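(* Let $k$ be an algebraically closed field of characteristic zero, $G$ a finite group, $a\in Z(G)$, $\chi:G\to k^{\times}$ a linear character with $q:=\chi(a)\neq1$ and $|q|=|\chi|=s$, and let $H=kG(\chi^{-1},a,0)$. Let $p,t\in\mathbb N^+$, $i,j\in I$ and $\alpha,\beta\in k^{\times}$. Then, as $H$-modules, $$V_p(i,\alpha)\otimes V_t(j,\beta)\cong\bigoplus_{l\in I}\bigoplus_{m=0}^{s-1}\bigoplus_{u=1}^{\min\{p,t\}}N_{i,j}^l\,V_{2u-1+|p-t|}(\sigma^m(l),\omega_j^s\alpha+\beta).$$ Moreover, $V_{2u-1+|p-t|}(\sigma^m(l),\omega_j^s\alpha+\beta)\cong V_{s(2u-1+|p-t|)}(\sigma^m(l))$ when $\omega_j^s\alpha+\beta=0$, and $V_{2u-1+|p-t|}(\sigma^m(l),\omega_j^s\alpha+\beta)\cong V_{2u-1+|p-t|}(l,\omega_j^s\alpha+\beta)$ when $\omega_j^s\alpha+\beta\neq0$.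
   Context: $k^{\times}=k\setminus\{0\}$; $\mathbb N^+$ is the set of positive integers; $\hat G$ is the group of linear characters $G\to k^{\times}$; $|\chi|$ is the order of $\chi$ in $\hat G$ and $|q|$ the order of $q$ in $k^{\times}$. For $n\in\mathbb N$ and a module $M$, $nM$ is the direct sum of $n$ copies of $M$ ($0M=0$). $H=kG(\chi^{-1},a,0)$ is the Hopf algebra generated as an algebra by $G$ and $x$ with relations $xg=\chi^{-1}(g)gx$ ($g\in G$) in addition to those of $kG$; it has $k$-basis $\{gx^i\mid g\in G, i\ge 0\}$, and $\Delta(x)=x\otimes a+1\otimes x$, $\varepsilon(x)=0$, $S(x)=-xa^{-1}$, $\Delta(g)=g\otimes g$, $\varepsilon(g)=1$, $S(g)=g^{-1}$. Tensor products of $H$-modules are over $k$, with action through $\Delta$. $\{V_i\mid i\in I\}$ is a complete set of representatives of isomorphism classes of simple $kG$-modules. For $\lambda\in\hat G$, $V_\lambda$ is the corresponding one-dimensional module. $\sigma$ is the permutation of $I$ with $V_\chi\otimes V_i\cong V_{\sigma(i)}$. $N_{i,j}^l$ is the multiplicity of $V_l$ in $V_i\otimes V_j$. For $i\in I$, $\omega_i\in k^{\times}$ is the scalar by which the central element $a$ acts on $V_i$. For $i\in I$ put $M(V_i)=H\otimes_{kG}V_i$. For $t\in\mathbb N^+$ put $V_t(i)=M(V_i)/x^tM(V_i)$ (where $x^tM(V_i)$ is the submodule generated by $x^t\otimes V_i$), and for $\beta\in k$ put $V_t(i,\beta)=M(V_i)/(x^s-\beta)^tM(V_i)$ (here $x^s$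 is central in $H$). *)

theory Defs
  imports
    "HOL-Algebra.Algebra"
    "HOL-Algebra.Free_Abelian_Groups"
    "HOL-Algebra.Product_Groups"
    "HOL-Computational_Algebra.Polynomial"
begin

section \<open>Modules over a ring that need not be commutative\<close>

text \<open>The record \<^typ>\<open>('a, 'b) module\<close> of \<^theory>\<open>HOL-Algebra.Module\<close> is reused, but the
  locale \<^locale>\<open>module\<close> found there demands a commutative ring. As usual for module records,
  the inherited fields \<open>mult\<close> and \<open>one\<close> carry no meaning.\<close>

locale left_module = R?: ring R + M?: abelian_group M
  for R :: "('a, 'r) ring_scheme" (structure) and M :: "('a, 'b, 'm) module_scheme" (structure) +
  assumes smult_closed:
      "\<lbrakk>a \<in> carrier R; x \<in> carrier M\<rbrakk> \<Longrightarrow> a \<odot>\<^bsub>M\<^esub> x \<in> carrier M"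
    and smult_l_distr:
      "\<lbrakk>a \<in> carrier R; b \<in> carrier R; x \<in> carrier M\<rbrakk> \<Longrightarrow>
        (a \<oplus> b) \<odot>\<^bsub>M\<^esub> x = a \<odot>\<^bsub>M\<^esub> x \<oplus>\<^bsub>M\<^esub> b \<odot>\<^bsub>M\<^esub> x"
    and smult_r_distr:
      "\<lbrakk>a \<in> carrier R; x \<in> carrier M; y \<in> carrier M\<rbrakk> \<Longrightarrow>
        a \<odot>\<^bsub>M\<^esub> (x \<oplus>\<^bsub>M\<^esub> y) = a \<odot>\<^bsub>M\<^esub> x \<oplus>\<^bsub>M\<^esub> a \<odot>\<^bsub>M\<^esub> y"
    and smult_assoc:
      "\<lbrakk>a \<in> carrier R; b \<in> carrier R; x \<in> carrier M\<rbrakk> \<Longrightarrow>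
        (a \<otimes> b) \<odot>\<^bsub>M\<^esub> x = a \<odot>\<^bsub>M\<^esub> (b \<odot>\<^bsub>M\<^esub> x)"
    and smult_one: "x \<in> carrier M \<Longrightarrow> \<one> \<odot>\<^bsub>M\<^esub> x = x"

definition module_hom :: "('a, 'r) ring_scheme \<Rightarrow> ('a, 'b) module \<Rightarrow> ('a, 'c) module \<Rightarrow> ('b \<Rightarrow> 'c) set"
  where "module_hom R M N =
    {f \<in> carrier M \<rightarrow> carrier N.
      (\<forall>x\<in>carrier M. \<forall>y\<in>carrier M. f (x \<oplus>\<^bsub>M\<^esub> y) = f x \<oplus>\<^bsub>N\<^esub> f y) \<and>
      (\<forall>r\<in>carrier R. \<forall>x\<in>carrier M. f (r \<odot>\<^bsub>M\<^esub> x) = r \<odot>\<^bsub>N\<^esub> f x)}"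

definition module_iso :: "('a, 'r) ring_scheme \<Rightarrow> ('a, 'b) module \<Rightarrow> ('a, 'c) module \<Rightarrow> bool"
  where "module_iso R M N \<longleftrightarrow> (\<exists>f\<in>module_hom R M N. bij_betw f (carrier M) (carrier N))"

definition simple_module :: "('a, 'r) ring_scheme \<Rightarrow> ('a, 'b) module \<Rightarrow> bool"
  where "simple_module R M \<longleftrightarrow> left_module R M \<and> carrier M \<noteq> {\<zero>\<^bsub>M\<^esub>} \<and>
    (\<forall>N. submodule N R M \<longrightarrow> N = {\<zero>\<^bsub>M\<^esub>} \<or> N = carrier M)"

definition span_module :: "('a, 'r) ring_scheme \<Rightarrow> ('a, 'b) module \<Rightarrow> 'b set \<Rightarrow> 'b set"
  where "span_module R M S = \<Inter>{N. submodule N R M \<and> S \<subseteq> N}"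

text \<open>For a coset \<open>A = N + m\<close> of a submodule, \<open>N + r A\<close> is the coset \<open>N + r m\<close>; adding \<open>N\<close> is
  needed because the set \<open>r A\<close> itself may be strictly smaller than a coset.\<close>

definition quot_module :: "('a, 'b) module \<Rightarrow> 'b set \<Rightarrow> ('a, 'b set) module"
  where "quot_module M N =
    \<lparr>carrier = a_rcosets\<^bsub>M\<^esub> N, monoid.mult = undefined, one = undefined, ring.zero = N,
     ring.add = (\<lambda>A B. A <+>\<^bsub>M\<^esub> B), module.smult = (\<lambda>r A. N <+>\<^bsub>M\<^esub> ((\<lambda>x. r \<odot>\<^bsub>M\<^esub> x) ` A))\<rparr>"

definition direct_sum :: "'i set \<Rightarrow> ('i \<Rightarrow> ('a, 'b) module) \<Rightarrow> ('a, 'i \<Rightarrow> 'b) module"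
  where "direct_sum I M =
    \<lparr>carrier = carrier (sum_group I (\<lambda>i. add_monoid (M i))), monoid.mult = undefined, one = undefined,
     ring.zero = (\<lambda>i\<in>I. \<zero>\<^bsub>M i\<^esub>), ring.add = (\<lambda>f g. \<lambda>i\<in>I. f i \<oplus>\<^bsub>M i\<^esub> g i),
     module.smult = (\<lambda>r f. \<lambda>i\<in>I. r \<odot>\<^bsub>M i\<^esub> f i)\<rparr>"

definition copies :: "nat \<Rightarrow> ('a, 'b) module \<Rightarrow> ('a, nat \<Rightarrow> 'b) module"
  where "copies n M = direct_sum {..<n} (\<lambda>_. M)"

text \<open>Every simple module is isomorphic to a quotient of \<open>R\<close> by a maximal left ideal. Its elements
  are then cosets, so modules with elements of type \<^typ>\<open>'a set\<close> exhaust all isomorphism classes.\<close>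

definition simple_representatives ::
    "('a, 'r) ring_scheme \<Rightarrow> 'i set \<Rightarrow> ('i \<Rightarrow> ('a, 'v) module) \<Rightarrow> bool"
  where "simple_representatives R I V \<longleftrightarrow>
    (\<forall>i\<in>I. simple_module R (V i)) \<and>
    (\<forall>i\<in>I. \<forall>j\<in>I. module_iso R (V i) (V j) \<longrightarrow> i = j) \<and>
    (\<forall>W :: ('a, 'a set) module. simple_module R W \<longrightarrow> (\<exists>i\<in>I. module_iso R W (V i)))"

text \<open>The multiplicity of a simple module \<open>S\<close> in a semisimple module \<open>W\<close> of finite length: the
  number of summands isomorphic to \<open>S\<close> in a decomposition of \<open>W\<close> into simple modules. By the
  Krull-Schmidt theorem it does not depend on the chosen decomposition.\<close>

definition simple_decomposition ::
    "('a, 'r) ring_scheme \<Rightarrow> ('a, 'w) module \<Rightarrow> nat \<times> (nat \<Rightarrow> ('a, 'w) module) \<Rightarrow> bool"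
  where "simple_decomposition R W = (\<lambda>(n, F).
    (\<forall>j<n. simple_module R (F j)) \<and> module_iso R W (direct_sum {..<n} F))"

definition simple_multiplicity :: "('a, 'r) ring_scheme \<Rightarrow> ('a, 'v) module \<Rightarrow> ('a, 'w) module \<Rightarrow> nat"
  where "simple_multiplicity R S W =
    (let (n, F) = (SOME D. simple_decomposition R W D) in card {j. j < n \<and> module_iso R (F j) S})"


section \<open>Tensor products\<close>

text \<open>The tensor product of a right module \<open>M\<close> and a left module \<open>N\<close> over a set \<open>S\<close> of scalars
  acting through \<open>ra\<close> and \<open>la\<close> is the free abelian group on \<open>M \<times> N\<close> modulo the balanced
  biadditive relations. A set of operators acts on it via \<open>\<phi>\<close>, where \<open>\<phi> h (x, v)\<close> is a
  representative of the image \<open>h \<cdot> (x \<otimes> v)\<close>.\<close>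

definition tensor_relations ::
    "'s set \<Rightarrow> ('m, 'x) ring_scheme \<Rightarrow> ('m \<Rightarrow> 's \<Rightarrow> 'm) \<Rightarrow> ('n, 'y) ring_scheme \<Rightarrow> ('s \<Rightarrow> 'n \<Rightarrow> 'n)
      \<Rightarrow> ('m \<times> 'n \<Rightarrow>\<^sub>0 int) set"
  where "tensor_relations S M ra N la =
    generate (free_Abelian_group (carrier M \<times> carrier N))
     ({frag_of (x \<oplus>\<^bsub>M\<^esub> y, v) - frag_of (x, v) - frag_of (y, v) | x y v.
         x \<in> carrier M \<and> y \<in> carrier M \<and> v \<in> carrier N} \<union>
      {frag_of (x, v \<oplus>\<^bsub>N\<^esub> w) - frag_of (x, v) - frag_of (x, w) | x v w.
         x \<in> carrier M \<and> v \<in> carrier N \<and> w \<in> carrier N} \<union>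
      {frag_of (ra x c, v) - frag_of (x, la c v) | x c v.
         x \<in> carrier M \<and> c \<in> S \<and> v \<in> carrier N})"

definition free_module ::
    "'b set \<Rightarrow> ('a \<Rightarrow> 'b \<Rightarrow> ('b \<Rightarrow>\<^sub>0 int)) \<Rightarrow> ('a, 'b \<Rightarrow>\<^sub>0 int) module"
  where "free_module B \<phi> =
    \<lparr>carrier = carrier (free_Abelian_group B), monoid.mult = undefined, one = undefined,
     ring.zero = 0, ring.add = (+), module.smult = (\<lambda>h. frag_extend (\<phi> h))\<rparr>"

definition balanced_tensor ::
    "'s set \<Rightarrow> ('m, 'x) ring_scheme \<Rightarrow> ('m \<Rightarrow> 's \<Rightarrow> 'm) \<Rightarrow> ('n, 'y) ring_scheme \<Rightarrow> ('s \<Rightarrow> 'n \<Rightarrow> 'n)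
      \<Rightarrow> ('a \<Rightarrow> 'm \<times> 'n \<Rightarrow> ('m \<times> 'n \<Rightarrow>\<^sub>0 int)) \<Rightarrow> ('a, ('m \<times> 'n \<Rightarrow>\<^sub>0 int) set) module"
  where "balanced_tensor S M ra N la \<phi> =
    quot_module (free_module (carrier M \<times> carrier N) \<phi>) (tensor_relations S M ra N la)"


section \<open>Algebras with a basis\<close>

text \<open>An algebra with basis \<open>B\<close> has the finitely supported functions on \<open>B\<close> as elements; the
  basis vector \<open>b\<close> is \<open>Poly_Mapping.single b 1\<close>.\<close>

definition scale :: "'k::field \<Rightarrow> ('b \<Rightarrow>\<^sub>0 'k) \<Rightarrow> ('b \<Rightarrow>\<^sub>0 'k)"
  where "scale c = Poly_Mapping.map ((*) c)"

definition lin_ext :: "('b \<Rightarrow> ('c \<Rightarrow>\<^sub>0 'k)) \<Rightarrow> ('b \<Rightarrow>\<^sub>0 'k::field) \<Rightarrow> ('c \<Rightarrow>\<^sub>0 'k)"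
  where "lin_ext f r = (\<Sum>b\<in>Poly_Mapping.keys r. scale (Poly_Mapping.lookup r b) (f b))"

definition bilin_ext ::
    "('b \<Rightarrow> 'c \<Rightarrow> ('d \<Rightarrow>\<^sub>0 'k)) \<Rightarrow> ('b \<Rightarrow>\<^sub>0 'k::field) \<Rightarrow> ('c \<Rightarrow>\<^sub>0 'k) \<Rightarrow> ('d \<Rightarrow>\<^sub>0 'k)"
  where "bilin_ext m r r' = lin_ext (\<lambda>b. lin_ext (m b) r') r"

definition based_algebra ::
    "'b set \<Rightarrow> ('b \<Rightarrow> 'b \<Rightarrow> ('b \<Rightarrow>\<^sub>0 'k::field)) \<Rightarrow> ('b \<Rightarrow>\<^sub>0 'k) \<Rightarrow> ('b \<Rightarrow>\<^sub>0 'k) ring"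
  where "based_algebra B m e =
    \<lparr>carrier = {r. Poly_Mapping.keys r \<subseteq> B}, monoid.mult = bilin_ext m, one = e,
     ring.zero = 0, ring.add = (+)\<rparr>"

definition elem_tensor :: "('b \<Rightarrow>\<^sub>0 'k::field) \<Rightarrow> ('c \<Rightarrow>\<^sub>0 'k) \<Rightarrow> ('b \<times> 'c \<Rightarrow>\<^sub>0 'k)"
  where "elem_tensor = bilin_ext (\<lambda>b c. Poly_Mapping.single (b, c) 1)"

text \<open>\<open>tensor_square B A\<close> is the algebra \<open>A \<otimes> A\<close> over \<open>k\<close>, for an algebra \<open>A\<close> with basis \<open>B\<close>.\<close>

definition tensor_square :: "'b set \<Rightarrow> ('b \<Rightarrow>\<^sub>0 'k::field) ring \<Rightarrow> ('b \<times> 'b \<Rightarrow>\<^sub>0 'k) ring"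
  where "tensor_square B A = based_algebra (B \<times> B)
    (\<lambda>(b, b') (c, c'). elem_tensor
       (Poly_Mapping.single b 1 \<otimes>\<^bsub>A\<^esub> Poly_Mapping.single c 1)
       (Poly_Mapping.single b' 1 \<otimes>\<^bsub>A\<^esub> Poly_Mapping.single c' 1))
    (elem_tensor \<one>\<^bsub>A\<^esub> \<one>\<^bsub>A\<^esub>)"

text \<open>The tensor product over \<open>k\<close> of two modules over a bialgebra \<open>A\<close> with comultiplication \<open>\<Delta>\<close>.
  The field acts on an \<open>A\<close>-module through \<open>c \<mapsto> c 1\<^sub>A\<close>.\<close>

definition module_tensor ::
    "('b \<Rightarrow>\<^sub>0 'k::field) ring \<Rightarrow> (('b \<Rightarrow>\<^sub>0 'k) \<Rightarrow> ('b \<times> 'b \<Rightarrow>\<^sub>0 'k))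
      \<Rightarrow> ('b \<Rightarrow>\<^sub>0 'k, 'v) module \<Rightarrow> ('b \<Rightarrow>\<^sub>0 'k, 'w) module
      \<Rightarrow> ('b \<Rightarrow>\<^sub>0 'k, ('v \<times> 'w \<Rightarrow>\<^sub>0 int) set) module"
  where "module_tensor A \<Delta> V W =
    balanced_tensor (UNIV :: 'k set)
      V (\<lambda>v c. scale c \<one>\<^bsub>A\<^esub> \<odot>\<^bsub>V\<^esub> v) W (\<lambda>c w. scale c \<one>\<^bsub>A\<^esub> \<odot>\<^bsub>W\<^esub> w)
      (\<lambda>h (v, w). \<Sum>(b, c)\<in>Poly_Mapping.keys (\<Delta> h).
         frag_of (Poly_Mapping.single b (Poly_Mapping.lookup (\<Delta> h) (b, c)) \<odot>\<^bsub>V\<^esub> v,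
                  Poly_Mapping.single c 1 \<odot>\<^bsub>W\<^esub> w))"


section \<open>The group algebra and linear characters\<close>

definition units_group :: "'k::field monoid"
  where "units_group = \<lparr>carrier = UNIV - {0}, monoid.mult = (*), one = 1\<rparr>"

definition dual_group :: "('g, 'm) monoid_scheme \<Rightarrow> ('g \<Rightarrow> 'k::field) monoid"
  where "dual_group G =
    \<lparr>carrier = hom G units_group \<inter> extensional (carrier G),
     monoid.mult = (\<lambda>\<phi> \<psi>. \<lambda>g\<in>carrier G. \<phi> g * \<psi> g), one = (\<lambda>g\<in>carrier G. 1)\<rparr>"

definition group_center :: "('g, 'm) monoid_scheme \<Rightarrow> 'g set"
  where "group_center G = {a \<in> carrier G. \<forall>g\<in>carrier G. a \<otimes>\<^bsub>G\<^esub> g = g \<otimes>\<^bsub>G\<^esub> a}"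

definition group_algebra :: "('g, 'm) monoid_scheme \<Rightarrow> ('g \<Rightarrow>\<^sub>0 'k::field) ring"
  where "group_algebra G = based_algebra (carrier G)
    (\<lambda>g h. Poly_Mapping.single (g \<otimes>\<^bsub>G\<^esub> h) 1) (Poly_Mapping.single \<one>\<^bsub>G\<^esub> 1)"

definition group_comult :: "('g \<Rightarrow>\<^sub>0 'k::field) \<Rightarrow> ('g \<times> 'g \<Rightarrow>\<^sub>0 'k)"
  where "group_comult = lin_ext (\<lambda>g. Poly_Mapping.single (g, g) 1)"

definition char_module :: "('g \<Rightarrow> 'k) \<Rightarrow> ('g \<Rightarrow>\<^sub>0 'k::field, 'k) module"
  where "char_module \<theta> =
    \<lparr>carrier = UNIV, monoid.mult = undefined, one = undefined, ring.zero = 0, ring.add = (+),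
     module.smult = (\<lambda>r v. (\<Sum>g\<in>Poly_Mapping.keys r. Poly_Mapping.lookup r g * \<theta> g) * v)\<rparr>"


section \<open>The Hopf algebra \<open>kG(\<tau>, a, 0)\<close>\<close>

text \<open>The basis vector \<open>(g, i)\<close> stands for \<open>g x\<^sup>i\<close>. The structure constants result from
  \<open>x g = \<tau>(g) g x\<close>, which gives \<open>(g x\<^sup>i) (h x\<^sup>j) = \<tau>(h)\<^sup>i g h x\<^sup>i\<^sup>+\<^sup>j\<close>.\<close>

definition ore_algebra ::
    "('g, 'm) monoid_scheme \<Rightarrow> ('g \<Rightarrow> 'k) \<Rightarrow> ('g \<times> nat \<Rightarrow>\<^sub>0 'k::field) ring"
  where "ore_algebra G \<tau> = based_algebra (carrier G \<times> UNIV)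
    (\<lambda>(g, i) (h, j). Poly_Mapping.single (g \<otimes>\<^bsub>G\<^esub> h, i + j) (\<tau> h ^ i))
    (Poly_Mapping.single (\<one>\<^bsub>G\<^esub>, 0) 1)"

definition ore_var :: "('g, 'm) monoid_scheme \<Rightarrow> ('g \<times> nat \<Rightarrow>\<^sub>0 'k::field)"
  where "ore_var G = Poly_Mapping.single (\<one>\<^bsub>G\<^esub>, 1) 1"

definition ore_grp :: "'g \<Rightarrow> ('g \<times> nat \<Rightarrow>\<^sub>0 'k::field)"
  where "ore_grp g = Poly_Mapping.single (g, 0) 1"

definition ore_embed :: "('g \<Rightarrow>\<^sub>0 'k::field) \<Rightarrow> ('g \<times> nat \<Rightarrow>\<^sub>0 'k)"
  where "ore_embed = lin_ext ore_grp"

text \<open>\<open>\<Delta>(g x\<^sup>i) = (g \<otimes> g) (x \<otimes> a + 1 \<otimes> x)\<^sup>i\<close>, extended linearly.\<close>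

definition ore_comult ::
    "('g, 'm) monoid_scheme \<Rightarrow> ('g \<Rightarrow> 'k) \<Rightarrow> 'g
      \<Rightarrow> ('g \<times> nat \<Rightarrow>\<^sub>0 'k::field) \<Rightarrow> (('g \<times> nat) \<times> ('g \<times> nat) \<Rightarrow>\<^sub>0 'k)"
  where "ore_comult G \<tau> a =
    (let H = ore_algebra G \<tau>;
         T = tensor_square (carrier G \<times> UNIV) H
     in lin_ext (\<lambda>(g, i). elem_tensor (ore_grp g) (ore_grp g) \<otimes>\<^bsub>T\<^esub>
          (elem_tensor (ore_var G) (ore_grp a) + elem_tensor \<one>\<^bsub>H\<^esub> (ore_var G)) [^]\<^bsub>T\<^esub> i))"

text \<open>\<open>M(V) = H \<otimes>\<^bsub>kG\<^esub> V\<close>, an \<open>H\<close>-module by left multiplication; \<open>ind_pure\<close> gives the pure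
  tensors \<open>h \<otimes> v\<close>.\<close>

definition ind_module ::
    "('g, 'm) monoid_scheme \<Rightarrow> ('g \<Rightarrow> 'k::field) \<Rightarrow> ('g \<Rightarrow>\<^sub>0 'k, 'v) module
      \<Rightarrow> ('g \<times> nat \<Rightarrow>\<^sub>0 'k, (('g \<times> nat \<Rightarrow>\<^sub>0 'k) \<times> 'v \<Rightarrow>\<^sub>0 int) set) module"
  where "ind_module G \<tau> V =
    (let H = ore_algebra G \<tau>
     in balanced_tensor (carrier (group_algebra G)) H (\<lambda>h r. h \<otimes>\<^bsub>H\<^esub> ore_embed r)
          V (\<lambda>r v. r \<odot>\<^bsub>V\<^esub> v) (\<lambda>h (y, v). frag_of (h \<otimes>\<^bsub>H\<^esub> y, v)))"

definition ind_pure ::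
    "('g, 'm) monoid_scheme \<Rightarrow> ('g \<Rightarrow> 'k::field) \<Rightarrow> ('g \<Rightarrow>\<^sub>0 'k, 'v) module
      \<Rightarrow> ('g \<times> nat \<Rightarrow>\<^sub>0 'k) \<Rightarrow> 'v \<Rightarrow> (('g \<times> nat \<Rightarrow>\<^sub>0 'k) \<times> 'v \<Rightarrow>\<^sub>0 int) set"
  where "ind_pure G \<tau> V h v =
    \<zero>\<^bsub>ind_module G \<tau> V\<^esub> #>\<^bsub>free_Abelian_group (carrier (ore_algebra G \<tau>) \<times> carrier V)\<^esub> frag_of (h, v)"

text \<open>\<open>V\<^sub>t(i) = M(V\<^sub>i) / x\<^sup>t M(V\<^sub>i)\<close> and \<open>V\<^sub>t(i, \<beta>) = M(V\<^sub>i) / (x\<^sup>s - \<beta>)\<^sup>t M(V\<^sub>i)\<close>, for \<open>V = V\<^sub>i\<close>.\<close>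

definition nil_module ::
    "('g, 'm) monoid_scheme \<Rightarrow> ('g \<Rightarrow> 'k::field) \<Rightarrow> nat \<Rightarrow> ('g \<Rightarrow>\<^sub>0 'k, 'v) module
      \<Rightarrow> ('g \<times> nat \<Rightarrow>\<^sub>0 'k, (('g \<times> nat \<Rightarrow>\<^sub>0 'k) \<times> 'v \<Rightarrow>\<^sub>0 int) set set) module"
  where "nil_module G \<tau> t V =
    (let H = ore_algebra G \<tau>; M = ind_module G \<tau> V
     in quot_module M
          (span_module H M {ind_pure G \<tau> V (ore_var G [^]\<^bsub>H\<^esub> t) v | v. v \<in> carrier V}))"

definition jordan_module ::
    "('g, 'm) monoid_scheme \<Rightarrow> ('g \<Rightarrow> 'k::field) \<Rightarrow> nat \<Rightarrow> nat \<Rightarrow> ('g \<Rightarrow>\<^sub>0 'k, 'v) module \<Rightarrow> 'k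
      \<Rightarrow> ('g \<times> nat \<Rightarrow>\<^sub>0 'k, (('g \<times> nat \<Rightarrow>\<^sub>0 'k) \<times> 'v \<Rightarrow>\<^sub>0 int) set set) module"
  where "jordan_module G \<tau> s t V \<beta> =
    (let H = ore_algebra G \<tau>; M = ind_module G \<tau> V;
         z = (ore_var G [^]\<^bsub>H\<^esub> s - scale \<beta> \<one>\<^bsub>H\<^esub>) [^]\<^bsub>H\<^esub> t
     in quot_module M ((\<lambda>m. z \<odot>\<^bsub>M\<^esub> m) ` carrier M))"

end

theory Submission
  imports Defs
begin

text \<open>In coordinates, a simple \<open>kG\<close>-module \<open>V\<close> and its Jordan modules are explicit: \<open>V\<^sub>t(V, \<beta>)\<close> is the
  tensor product of \<open>V\<close> with the Jordan block \<open>k[x]/(x\<^sup>s - \<beta>)\<^sup>t\<close>, on which \<open>g\<close> acts by \<open>x\<^sup>r \<mapsto> \<chi>(g)\<^sup>r x\<^sup>r\<close>.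
  Since \<open>a\<close> acts on \<open>V\<^sub>j\<close> by the scalar \<open>\<omega>\<^sub>j\<close>, the tensor product of two Jordan modules is
  \<open>V\<^sub>i \<otimes> V\<^sub>j\<close> tensored with the product of two Jordan blocks, on which \<open>x\<close> acts by \<open>y + z\<close> with
  \<open>y = x \<otimes> \<omega>\<^sub>j a\<close>, \<open>z = 1 \<otimes> x\<close> and \<open>y z = q z y\<close>. The \<open>q\<close>-binomial theorem at a root of unity of
  order \<open>s\<close> gives \<open>x\<^sup>s = y\<^sup>s + z\<^sup>s\<close>, so \<open>x\<^sup>s - (\<omega>\<^sub>j\<^sup>s \<alpha> + \<beta>)\<close> is a sum \<open>\<kappa> N \<otimes> 1 + 1 \<otimes> N\<close> of nilpotent
  Jordan blocks of sizes \<open>p\<close> and \<open>t\<close>. In characteristic zero its Jordan strings start at lowest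
  weight vectors of an \<open>sl\<^sub>2\<close>-action (Clebsch-Gordan). These, multiplied by \<open>z\<^sup>m\<close> for \<open>m < s\<close>,
  generate the summands; the degree shift by \<open>m\<close> turns \<open>V\<^sub>l\<close> into \<open>V\<^bsub>\<sigma>^m(l)\<^esub>\<close>.\<close>

section \<open>Linear algebra on finitely supported functions\<close>

text \<open>The modules of the statement are quotients of free abelian groups by generated relations
  and have no visible dimension, whereas the decomposition map is shown bijective by counting
  dimensions. Hence every module is first replaced by finitely supported functions on an explicit
  index set.

  The basis \<open>(x^s - \<gamma>)^k x^r\<close> makes a Jordan module transparent: dividing by
  \<open>(x^s - \<gamma>)^n\<close> becomes the truncation \<open>k < n\<close>, and
  \<open>G\<close> acts diagonally because \<open>x^s - \<gamma>\<close> has degree 0 modulo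
  \<open>s\<close>.

  Each summand needs a homogeneous generator. The nilpotent part of \<open>x^s\<close> preserves the
  corner of exponents (0,0), on which the grading is trivial, and the lowest weight vectors are
  taken there. Powers of \<open>x\<close> alone reach only one \<open>s\<close>-th of the space;
  powers of \<open>z\<close> supply the rest, and they carry strings to strings because
  \<open>z\<close> commutes with \<open>x^s\<close> when \<open>q^s = 1\<close>.

  For independence, \<open>x^r\<close> has a nonzero multiple of \<open>y^r\<close> as leading term,
  so a triangular matrix separates the monomials \<open>x^r z^m\<close> and only the independence of
  the \<open>sl_2\<close> strings remains.\<close>

abbreviation ev :: "'b \<Rightarrow> ('b \<Rightarrow>\<^sub>0 'k::field)" where "ev b \<equiv> Poly_Mapping.single b 1"

definition vecs :: "'b set \<Rightarrow> ('b \<Rightarrow>\<^sub>0 'k::field) set"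
  where "vecs B = {f. Poly_Mapping.keys f \<subseteq> B}"

text \<open>Linearity is asked on the whole type rather than on \<open>vecs B\<close>. Maps built
  from \<open>lin_ext\<close> have it, and an equation on \<open>vecs B\<close> then needs checking
  on the basis vectors of \<open>B\<close> only (\<open>lin_eqI\<close>).\<close>

definition lin :: "(('b \<Rightarrow>\<^sub>0 'k::field) \<Rightarrow> ('c \<Rightarrow>\<^sub>0 'k)) \<Rightarrow> bool"
  where "lin L \<longleftrightarrow> (\<forall>f g. L (f + g) = L f + L g) \<and> (\<forall>c f. L (scale c f) = scale c (L f))"

text \<open>Only the values of \<open>L\<close> and \<open>M\<close> on basis vectors enter. So
  \<open>tens L M\<close> is always linear, and it may be rewritten as soon as the factors agree on
  the relevant basis vectors (\<open>tens_cong\<close>); linearity of the factors is a matter of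
  evaluating it on general tensors.\<close>

definition tens :: "(('b \<Rightarrow>\<^sub>0 'k::field) \<Rightarrow> ('d \<Rightarrow>\<^sub>0 'k)) \<Rightarrow> (('c \<Rightarrow>\<^sub>0 'k) \<Rightarrow> ('e \<Rightarrow>\<^sub>0 'k))
    \<Rightarrow> ('b \<times> 'c \<Rightarrow>\<^sub>0 'k) \<Rightarrow> ('d \<times> 'e \<Rightarrow>\<^sub>0 'k)"
  where "tens L M = lin_ext (\<lambda>(b, c). elem_tensor (L (ev b)) (M (ev c)))"

lemma lookup_scale [simp]: "Poly_Mapping.lookup (scale c f) b = c * Poly_Mapping.lookup f b"
  unfolding scale_def by (simp add: Poly_Mapping.map.rep_eq when_def)

lemma scale_add_right: "scale c (f + g) = scale c f + scale c g"
  by (rule poly_mapping_eqI) (simp add: lookup_add algebra_simps)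

lemma scale_add_left: "scale (c + d) f = scale c f + scale d f"
  by (rule poly_mapping_eqI) (simp add: lookup_add algebra_simps)

lemma scale_diff_right: "scale c (f - g) = scale c f - scale c g"
  by (rule poly_mapping_eqI) (simp add: lookup_minus algebra_simps)

lemma scale_scale [simp]: "scale c (scale d f) = scale (c * d) f"
  by (rule poly_mapping_eqI) (simp add: algebra_simps)

lemma scale_simps [simp]: "scale c 0 = 0" "scale 0 f = 0" "scale 1 f = f" "scale (-1) f = - f"
  by (auto intro!: poly_mapping_eqI)

lemma scale_single [simp]: "scale c (Poly_Mapping.single b d) = Poly_Mapping.single b (c * d)"
  by (rule poly_mapping_eqI) (simp add: lookup_single when_def)

lemma scale_sum: "scale c (sum f A) = (\<Sum>a\<in>A. scale c (f a))"
  by (induction A rule: infinite_finite_induct) (simp_all add: scale_add_right)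

lemma scale_sum_left: "scale (sum h A) f = (\<Sum>a\<in>A. scale (h a) f)"
  by (induction A rule: infinite_finite_induct) (simp_all add: scale_add_left)

lemma keys_scale: "Poly_Mapping.keys (scale c f) \<subseteq> Poly_Mapping.keys f"
  by (auto simp: in_keys_iff)

lemma single_eq_scale: "Poly_Mapping.single b c = scale c (ev b)"
  by simp

lemma ev_inj [simp]: "(ev b :: 'b \<Rightarrow>\<^sub>0 'k::field) = ev c \<longleftrightarrow> b = c"
  by (metis lookup_single_eq lookup_single_not_eq zero_neq_one)

lemma vecsI: "(\<And>b. b \<notin> B \<Longrightarrow> Poly_Mapping.lookup f b = 0) \<Longrightarrow> f \<in> vecs B"
  by (auto simp: vecs_def in_keys_iff)

lemma vecsD: "f \<in> vecs B \<Longrightarrow> b \<notin> B \<Longrightarrow> Poly_Mapping.lookup f b = 0"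
  by (auto simp: vecs_def in_keys_iff)

lemma vecs_UNIV [simp]: "f \<in> vecs UNIV" by (simp add: vecs_def)

lemma vecs_0 [simp]: "0 \<in> vecs B" by (simp add: vecs_def)

lemma vecs_add: "f \<in> vecs B \<Longrightarrow> g \<in> vecs B \<Longrightarrow> f + g \<in> vecs B"
  using keys_add[of f g] by (auto simp: vecs_def)

lemma vecs_uminus: "f \<in> vecs B \<Longrightarrow> - f \<in> vecs B"
  by (simp add: vecs_def)

lemma vecs_diff: "f \<in> vecs B \<Longrightarrow> g \<in> vecs B \<Longrightarrow> f - g \<in> vecs B"
  using keys_diff[of f g] by (auto simp: vecs_def)

lemma vecs_scale: "f \<in> vecs B \<Longrightarrow> scale c f \<in> vecs B"
  using keys_scale[of c f] by (auto simp: vecs_def)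

lemma vecs_sum: "(\<And>a. a \<in> A \<Longrightarrow> f a \<in> vecs B) \<Longrightarrow> sum f A \<in> vecs B"
  by (induction A rule: infinite_finite_induct) (auto intro: vecs_add)

lemma vecs_single: "b \<in> B \<Longrightarrow> Poly_Mapping.single b c \<in> vecs B"
  by (simp add: vecs_def)

lemma vecs_mono: "f \<in> vecs A \<Longrightarrow> A \<subseteq> B \<Longrightarrow> f \<in> vecs B"
  by (auto simp: vecs_def)

lemmas vecs_intros = vecs_0 vecs_add vecs_uminus vecs_diff vecs_scale vecs_sum vecs_single

lemma poly_mapping_expand: "f = (\<Sum>b\<in>Poly_Mapping.keys f. Poly_Mapping.single b (Poly_Mapping.lookup f b))"
proof (rule poly_mapping_eqI)
  fix x
  have "(\<Sum>b\<in>Poly_Mapping.keys f. Poly_Mapping.lookup (Poly_Mapping.single b (Poly_Mapping.lookup f b)) x)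
      = (\<Sum>b\<in>Poly_Mapping.keys f. if b = x then Poly_Mapping.lookup f b else 0)"
    by (intro sum.cong) (auto simp: lookup_single when_def)
  also have "\<dots> = Poly_Mapping.lookup f x"
    by (simp add: sum.delta in_keys_iff)
  finally show "Poly_Mapping.lookup f x = Poly_Mapping.lookup (\<Sum>b\<in>Poly_Mapping.keys f.
      Poly_Mapping.single b (Poly_Mapping.lookup f b)) x"
    by (simp add: lookup_sum)
qed

lemma vecs_induct [consumes 1, case_names zero add single]:
  assumes "f \<in> vecs B" and "P 0" and "\<And>f g. f \<in> vecs B \<Longrightarrow> g \<in> vecs B \<Longrightarrow> P f \<Longrightarrow> P g \<Longrightarrow> P (f + g)"
    and "\<And>b c. b \<in> B \<Longrightarrow> P (Poly_Mapping.single b c)"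
  shows "P f"
proof -
  have "A \<subseteq> B \<Longrightarrow> finite A \<Longrightarrow> (\<Sum>b\<in>A. Poly_Mapping.single b (Poly_Mapping.lookup f b)) \<in> vecs B
      \<and> P (\<Sum>b\<in>A. Poly_Mapping.single b (Poly_Mapping.lookup f b))" for A
    by (rotate_tac, induction A rule: finite_induct)
      (auto intro!: assms(2-4) vecs_intros simp del: lookup_single)
  from this[of "Poly_Mapping.keys f"] assms(1) show ?thesis
    by (simp add: vecs_def flip: poly_mapping_expand)
qed

lemma vecs_lin_induct [consumes 1, case_names zero add scale ev]:
  assumes "f \<in> vecs B" and "P 0" and "\<And>f g. f \<in> vecs B \<Longrightarrow> g \<in> vecs B \<Longrightarrow> P f \<Longrightarrow> P g \<Longrightarrow> P (f + g)"
    and "\<And>f c. f \<in> vecs B \<Longrightarrow> P f \<Longrightarrow> P (scale c f)" and "\<And>b. b \<in> B \<Longrightarrow> P (ev b)"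
  shows "P f"
  using assms(1)
proof (induction rule: vecs_induct)
  case (single b c)
  have "P (scale c (ev b))" using single by (intro assms(4,5) vecs_single)
  then show ?case by simp
qed (use assms in auto)

lemma linI: "(\<And>f g. L (f + g) = L f + L g) \<Longrightarrow> (\<And>c f. L (scale c f) = scale c (L f)) \<Longrightarrow> lin L"
  by (simp add: lin_def)

lemma lin_add: "lin L \<Longrightarrow> L (f + g) = L f + L g" by (simp add: lin_def)

lemma lin_scale: "lin L \<Longrightarrow> L (scale c f) = scale c (L f)" by (simp add: lin_def)

lemma lin_0: "lin L \<Longrightarrow> L 0 = 0" by (metis lin_scale scale_simps(2))

lemma lin_uminus: "lin L \<Longrightarrow> L (- f) = - L f" by (metis lin_scale scale_simps(4))

lemma lin_diff: "lin L \<Longrightarrow> L (f - g) = L f - L g"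
  using lin_add[of L f "- g"] by (simp add: lin_uminus)

lemma lin_sum: "lin L \<Longrightarrow> L (sum f A) = (\<Sum>a\<in>A. L (f a))"
  by (induction A rule: infinite_finite_induct) (auto simp: lin_0 lin_add)

lemma lin_single: "lin L \<Longrightarrow> L (Poly_Mapping.single b c) = scale c (L (ev b))"
  by (metis lin_scale single_eq_scale)

lemma lin_id: "lin (\<lambda>x. x)" "lin id" by (simp_all add: lin_def)

lemma lin_comp: "lin L \<Longrightarrow> lin M \<Longrightarrow> lin (L \<circ> M)" "lin L \<Longrightarrow> lin M \<Longrightarrow> lin (\<lambda>f. L (M f))"
  by (simp_all add: lin_def)

lemma lin_funpow:
  fixes L :: "('b \<Rightarrow>\<^sub>0 'k::field) \<Rightarrow> ('b \<Rightarrow>\<^sub>0 'k)"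
  shows "lin L \<Longrightarrow> lin (L ^^ n)"

  unfolding lin_def by (induction n) auto

lemma lin_plus: "lin L \<Longrightarrow> lin M \<Longrightarrow> lin (\<lambda>f. L f + M f)"
  by (simp add: lin_def scale_add_right algebra_simps)

lemma lin_minus: "lin L \<Longrightarrow> lin M \<Longrightarrow> lin (\<lambda>f. L f - M f)"
  by (simp add: lin_def scale_diff_right algebra_simps)

lemma lin_scaleI: "lin L \<Longrightarrow> lin (\<lambda>f. scale c (L f))"
  by (simp add: lin_def scale_add_right algebra_simps)

lemma lin_zero: "lin (\<lambda>f. 0)" by (simp add: lin_def)

lemma lin_ext_superset:
  assumes "finite A" "Poly_Mapping.keys r \<subseteq> A"
  shows "lin_ext f r = (\<Sum>b\<in>A. scale (Poly_Mapping.lookup r b) (f b))"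
  unfolding lin_ext_def using assms by (intro sum.mono_neutral_left) (auto simp: in_keys_iff)

lemma lin_lin_ext:
  fixes f :: "'b \<Rightarrow> ('c \<Rightarrow>\<^sub>0 'k::field)"
  shows "lin (lin_ext f)"
proof (rule linI)
  fix g h :: "'b \<Rightarrow>\<^sub>0 'k" and c
  let ?A = "Poly_Mapping.keys g \<union> Poly_Mapping.keys h"
  show "lin_ext f (g + h) = lin_ext f g + lin_ext f h"
    using keys_add[of g h]
    by (simp add: lin_ext_superset[of ?A] lookup_add scale_add_left sum.distrib)
  show "lin_ext f (scale c g) = scale c (lin_ext f g)"
    using keys_scale[of c g] by (simp add: lin_ext_superset[of "Poly_Mapping.keys g"] scale_sum)
qed

lemma lin_ext_single [simp]: "lin_ext f (Poly_Mapping.single b c) = scale c (f b)"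
  by (simp add: lin_ext_def)

lemma lin_ext_cong: "(\<And>b. b \<in> Poly_Mapping.keys r \<Longrightarrow> f b = g b) \<Longrightarrow> lin_ext f r = lin_ext g r"
  by (simp add: lin_ext_def)

lemma lin_ext_vecs_cong: "r \<in> vecs B \<Longrightarrow> (\<And>b. b \<in> B \<Longrightarrow> f b = g b) \<Longrightarrow> lin_ext f r = lin_ext g r"
  by (rule lin_ext_cong) (auto simp: vecs_def)

lemma lin_ext_in_vecs: "r \<in> vecs A \<Longrightarrow> (\<And>b. b \<in> A \<Longrightarrow> f b \<in> vecs B) \<Longrightarrow> lin_ext f r \<in> vecs B"
  unfolding lin_ext_def by (intro vecs_sum vecs_scale) (auto simp: vecs_def)

lemma lin_comp_lin_ext: "lin L \<Longrightarrow> L (lin_ext f r) = lin_ext (\<lambda>b. L (f b)) r"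
  by (simp add: lin_ext_def lin_sum lin_scale)

lemma lin_ext_plus: "lin_ext (\<lambda>b. f b + g b) r = lin_ext f r + lin_ext g r"
  by (simp add: lin_ext_def scale_add_right sum.distrib)

lemma lin_ext_scale: "lin_ext (\<lambda>b. scale c (f b)) r = scale c (lin_ext f r)"
  by (simp add: lin_ext_def scale_sum algebra_simps)

lemma lin_ext_fun_lin: "(\<And>b. lin (f b)) \<Longrightarrow> lin (\<lambda>x. lin_ext (\<lambda>b. f b x) r)"
  by (simp add: lin_def lin_ext_plus lin_ext_scale)

lemma lin_ext_lin_ext: "lin_ext f (lin_ext g r) = lin_ext (\<lambda>b. lin_ext f (g b)) r"
  by (rule lin_comp_lin_ext[OF lin_lin_ext])

lemma lin_eqI:
  assumes "f \<in> vecs B" "lin L" "lin M" "\<And>b. b \<in> B \<Longrightarrow> L (ev b) = M (ev b)"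
  shows "L f = M f"
  using assms(1) by (induction rule: vecs_lin_induct)
    (auto simp: lin_0 lin_add lin_scale assms)

lemma lin_vecs_image:
  assumes "f \<in> vecs A" "lin L" "\<And>b. b \<in> A \<Longrightarrow> L (ev b) \<in> vecs B"
  shows "L f \<in> vecs B"
  using assms(1) by (induction rule: vecs_lin_induct)
    (auto simp: lin_0 lin_add lin_scale assms intro!: vecs_intros)

lemma lin_ext_ev: "lin L \<Longrightarrow> lin_ext (\<lambda>b. L (ev b)) f = L f"
  by (rule lin_eqI[of f UNIV]) (auto intro: lin_lin_ext)

lemma bilin_ext_lin_right: "lin (bilin_ext m r)"
  unfolding bilin_ext_def by (intro lin_ext_fun_lin lin_lin_ext)

lemma bilin_ext_lin_left: "lin (\<lambda>r. bilin_ext m r r')"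
  unfolding bilin_ext_def by (rule lin_lin_ext)

lemma bilin_ext_single [simp]:
  "bilin_ext m (Poly_Mapping.single b c) (Poly_Mapping.single d e) = scale (c * e) (m b d)"
  by (simp add: bilin_ext_def)

lemma bilin_eqI:
  assumes "f \<in> vecs B" "g \<in> vecs C" "\<And>g. lin (\<lambda>f. L f g)" "\<And>f. lin (L f)"
    "\<And>g. lin (\<lambda>f. M f g)" "\<And>f. lin (M f)"
    "\<And>b c. b \<in> B \<Longrightarrow> c \<in> C \<Longrightarrow> L (ev b) (ev c) = M (ev b) (ev c)"
  shows "L f g = M f g"
proof (rule lin_eqI[OF assms(1), where L = "\<lambda>f. L f g"])
  fix b assume "b \<in> B"
  then show "L (ev b) g = M (ev b) g"
    by (intro lin_eqI[OF assms(2), of "L (ev b)" "M (ev b)"] assms)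
qed (fact assms)+

lemma elem_tensor_lin: "lin (elem_tensor f)" "lin (\<lambda>f. elem_tensor f g)"
  unfolding elem_tensor_def by (rule bilin_ext_lin_right bilin_ext_lin_left)+

lemma elem_tensor_single [simp]:
  "elem_tensor (Poly_Mapping.single b c) (Poly_Mapping.single d e) = Poly_Mapping.single (b, d) (c * e)"
  by (simp add: elem_tensor_def)

lemma lookup_elem_tensor:
  "Poly_Mapping.lookup (elem_tensor f g) (b, c) = Poly_Mapping.lookup f b * Poly_Mapping.lookup g c"
proof -
  have "f \<in> vecs UNIV" "g \<in> vecs UNIV" by auto
  then show ?thesis
  proof (induction f rule: vecs_induct)
    case (single x d)
    from single(2) show ?case
      by (induction g rule: vecs_induct)
        (auto simp: lin_0[OF elem_tensor_lin(1)] lin_add[OF elem_tensor_lin(1)] lookup_add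
          algebra_simps lookup_single when_def)
  qed (auto simp: lin_0[OF elem_tensor_lin(2)] lin_add[OF elem_tensor_lin(2)] lookup_add algebra_simps)
qed

lemma elem_tensor_in_vecs: "f \<in> vecs A \<Longrightarrow> g \<in> vecs B \<Longrightarrow> elem_tensor f g \<in> vecs (A \<times> B)"
  by (rule vecsI) (auto simp: lookup_elem_tensor dest: vecsD)

lemma elem_tensor_scale:
  "elem_tensor (scale c f) g = scale c (elem_tensor f g)"
  "elem_tensor f (scale c g) = scale c (elem_tensor f g)"
  by (rule lin_scale[OF elem_tensor_lin(2)] lin_scale[OF elem_tensor_lin(1)])+

lemma elem_tensor_0 [simp]: "elem_tensor 0 g = 0" "elem_tensor f 0 = 0"
  by (rule lin_0[OF elem_tensor_lin(2)] lin_0[OF elem_tensor_lin(1)])+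

lemma elem_tensor_add:
  "elem_tensor (f + f') g = elem_tensor f g + elem_tensor f' g"
  "elem_tensor f (g + g') = elem_tensor f g + elem_tensor f g'"
  by (rule lin_add[OF elem_tensor_lin(2)] lin_add[OF elem_tensor_lin(1)])+

lemma lin_tens: "lin (tens L M)"
  unfolding tens_def by (rule lin_lin_ext)

lemma tens_ev [simp]: "tens L M (ev (b, c)) = elem_tensor (L (ev b)) (M (ev c))"
  by (simp add: tens_def)

lemma tens_elem_tensor:
  assumes "lin L" "lin M"
  shows "tens L M (elem_tensor f g) = elem_tensor (L f) (M g)"
proof (rule bilin_eqI[of f UNIV g UNIV])
  show "lin (\<lambda>f. tens L M (elem_tensor f g))" for g
    by (rule lin_comp(2)[OF lin_tens elem_tensor_lin(2)])
  show "lin (\<lambda>g. tens L M (elem_tensor f g))" for f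
    by (rule lin_comp(2)[OF lin_tens elem_tensor_lin(1)])
  show "lin (\<lambda>f. elem_tensor (L f) (M g))" for g
    by (rule lin_comp(2)[OF elem_tensor_lin(2) assms(1)])
  show "lin (\<lambda>g. elem_tensor (L f) (M g))" for f
    by (rule lin_comp(2)[OF elem_tensor_lin(1) assms(2)])
qed auto

lemma tens_eqI:
  assumes "f \<in> vecs (A \<times> B)" "lin P" "lin Q"
    "\<And>a b. a \<in> A \<Longrightarrow> b \<in> B \<Longrightarrow> P (elem_tensor (ev a) (ev b)) = Q (elem_tensor (ev a) (ev b))"
  shows "P f = Q f"
  by (rule lin_eqI[OF assms(1)]) (use assms in auto)

lemma tens_in_vecs:
  assumes "f \<in> vecs (A \<times> B)" "\<And>a. a \<in> A \<Longrightarrow> L (ev a) \<in> vecs A'" "\<And>b. b \<in> B \<Longrightarrow> M (ev b) \<in> vecs B'"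
  shows "tens L M f \<in> vecs (A' \<times> B')"
  using assms(1) by (rule lin_vecs_image[OF _ lin_tens])
    (auto intro!: elem_tensor_in_vecs assms)

lemma tens_comp:
  assumes "lin L" "lin M"
  shows "tens L M (tens L' M' f) = tens (L \<circ> L') (M \<circ> M') f"
proof (rule lin_eqI[of f UNIV])
  show "lin (\<lambda>f. tens L M (tens L' M' f))" by (rule lin_comp(2)[OF lin_tens lin_tens])
  show "tens L M (tens L' M' (ev b)) = tens (L \<circ> L') (M \<circ> M') (ev b)" for b
    by (cases b) (simp add: tens_elem_tensor assms)
qed (auto intro: lin_tens)

lemma tens_cong:
  assumes "f \<in> vecs (A \<times> B)" "\<And>a. a \<in> A \<Longrightarrow> L (ev a) = L' (ev a)" "\<And>b. b \<in> B \<Longrightarrow> M (ev b) = M' (ev b)"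
  shows "tens L M f = tens L' M' f"
  by (rule lin_eqI[OF assms(1) lin_tens lin_tens]) (auto simp: assms)

lemma tens_id: "tens (\<lambda>x. x) (\<lambda>x. x) f = f"
  by (rule lin_eqI[of f UNIV]) (auto intro: lin_tens lin_id)

text \<open>The inverse function is meaningful on \<open>vecs B\<close> only. Extending its values
  on basis vectors linearly gives a map that is linear on the whole type and still inverts
  \<open>L\<close> there.\<close>

lemma bij_betw_lin_inverse:
  assumes L: "lin L" and bij: "bij_betw L (vecs A) (vecs B)"
  obtains M where "lin M" "\<And>g. g \<in> vecs B \<Longrightarrow> M g \<in> vecs A" "\<And>f. f \<in> vecs A \<Longrightarrow> M (L f) = f"
    "\<And>g. g \<in> vecs B \<Longrightarrow> L (M g) = g"
proof -
  let ?i = "inv_into (vecs A) L"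
  define M where "M = lin_ext (\<lambda>b. ?i (ev b))"
  have M: "lin M" by (simp add: M_def lin_lin_ext)
  have inv: "?i g \<in> vecs A" "L (?i g) = g" if "g \<in> vecs B" for g
    using that bij by (auto simp: bij_betw_def intro: inv_into_into f_inv_into_f)
  have Min: "M g \<in> vecs A" if "g \<in> vecs B" for g
    unfolding M_def by (rule lin_ext_in_vecs[OF that]) (auto intro: inv vecs_intros)
  have LM: "L (M g) = g" if "g \<in> vecs B" for g
    by (rule lin_eqI[OF that, of "\<lambda>g. L (M g)" "\<lambda>g. g"])
      (use lin_comp(2)[OF L M] lin_id in \<open>auto simp: M_def inv vecs_intros\<close>)
  have "M (L f) = f" if "f \<in> vecs A" for f
  proof -
    have "L f \<in> vecs B" using that bij by (auto simp: bij_betw_def)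
    then have "L (M (L f)) = L f" "M (L f) \<in> vecs A" using LM Min by auto
    then show ?thesis using bij that by (auto simp: bij_betw_def inj_on_def)
  qed
  with M Min LM that show thesis by blast
qed

interpretation pmv: vector_space "scale :: 'k::field \<Rightarrow> ('b \<Rightarrow>\<^sub>0 'k) \<Rightarrow> _"
  by unfold_locales (auto simp: scale_add_right scale_add_left)

lemma vecs_eq_span: "(vecs B :: ('b \<Rightarrow>\<^sub>0 'k::field) set) = pmv.span (ev ` B)"
proof
  show "(vecs B :: ('b \<Rightarrow>\<^sub>0 'k) set) \<subseteq> pmv.span (ev ` B)"
  proof
    fix f :: "'b \<Rightarrow>\<^sub>0 'k" assume "f \<in> vecs B"
    then show "f \<in> pmv.span (ev ` B)"
      by (induction rule: vecs_lin_induct)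
        (auto simp: pmv.span_zero pmv.span_add intro!: pmv.span_scale intro: pmv.span_base)
  qed
  show "pmv.span (ev ` B) \<subseteq> (vecs B :: ('b \<Rightarrow>\<^sub>0 'k) set)"
    by (rule pmv.span_minimal) (auto simp: pmv.subspace_def intro: vecs_intros)
qed

text \<open>Dimension count: the images of the basis vectors form an independent set of size
  \<open>card B\<close>; a vector of \<open>vecs B\<close> outside their span would enlarge it to an
  independent set with more elements than the basis of \<open>vecs B\<close>.\<close>

lemma lin_inj_imp_bij:
  fixes L :: "('a \<Rightarrow>\<^sub>0 'k::field) \<Rightarrow> ('b \<Rightarrow>\<^sub>0 'k)"
  assumes L: "lin L" and fin: "finite A" "finite B" and card: "card A = card B"
    and into: "\<And>a. a \<in> A \<Longrightarrow> L (ev a) \<in> vecs B"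
    and inj: "\<And>f. f \<in> vecs A \<Longrightarrow> L f = 0 \<Longrightarrow> f = 0"
  shows "bij_betw L (vecs A) (vecs B)"
proof -
  have inj_on: "inj_on L (vecs A)"
    by (rule inj_onI) (metis L inj eq_iff_diff_eq_0 lin_diff vecs_diff)
  have maps: "L f \<in> vecs B" if "f \<in> vecs A" for f
    by (rule lin_vecs_image[OF that L into])
  let ?S = "(\<lambda>a. L (ev a)) ` A"
  have injS: "inj_on (\<lambda>a. L (ev a)) A"
    using inj_on unfolding inj_on_def by (metis ev_inj vecs_single)
  have span: "L ` vecs A = pmv.span ?S"
  proof
    show "L ` vecs A \<subseteq> pmv.span ?S"
    proof clarify
      fix f :: "'a \<Rightarrow>\<^sub>0 'k" assume "f \<in> vecs A"
      then show "L f \<in> pmv.span ?S"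
        by (induction rule: vecs_lin_induct)
          (auto simp: lin_0[OF L] lin_add[OF L] lin_scale[OF L] pmv.span_zero pmv.span_add
            intro!: pmv.span_scale intro: pmv.span_base)
    qed
    have "pmv.subspace (L ` vecs A)"
      unfolding pmv.subspace_def
    proof (intro conjI ballI allI)
      show "0 \<in> L ` vecs A" using lin_0[OF L] by (metis image_eqI vecs_0)
      show "x + y \<in> L ` vecs A" if "x \<in> L ` vecs A" "y \<in> L ` vecs A" for x y
      proof -
        from that obtain u v where "u \<in> vecs A" "x = L u" "v \<in> vecs A" "y = L v" by blast
        then have "x + y = L (u + v)" "u + v \<in> vecs A" by (simp_all add: lin_add[OF L] vecs_add)
        then show ?thesis by blast
      qed
      show "scale c x \<in> L ` vecs A" if "x \<in> L ` vecs A" for c x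
      proof -
        from that obtain u where "u \<in> vecs A" "x = L u" by blast
        then have "scale c x = L (scale c u)" "scale c u \<in> vecs A" by (simp_all add: lin_scale[OF L] vecs_scale)
        then show ?thesis by blast
      qed
    qed
    then show "pmv.span ?S \<subseteq> L ` vecs A"
      by (intro pmv.span_minimal) (auto intro!: imageI vecs_intros)
  qed
  have "pmv.independent ?S"
  proof (rule pmv.independent_if_scalars_zero)
    show "finite ?S" using fin by simp
    fix c x assume sum0: "(\<Sum>x\<in>?S. scale (c x) x) = 0" and x: "x \<in> ?S"
    then obtain a where a: "a \<in> A" "x = L (ev a)" by auto
    let ?f = "\<Sum>a\<in>A. Poly_Mapping.single a (c (L (ev a)))"
    have "L ?f = 0"
      using sum0 by (simp only: lin_sum[OF L] lin_single[OF L, of _ "c _"] sum.reindex[OF injS] o_def)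
    then have "?f = 0" by (intro inj) (auto intro!: vecs_intros)
    then have "Poly_Mapping.lookup ?f a = 0" by simp
    moreover have "Poly_Mapping.lookup ?f a = (\<Sum>b\<in>A. if b = a then c (L (ev a)) else 0)"
      unfolding lookup_sum by (intro sum.cong) (auto simp: lookup_single when_def)
    ultimately show "c x = 0" using a fin by simp
  qed
  moreover have "card ?S = card B" using injS card by (simp add: card_image)
  moreover have "y \<in> pmv.span ?S" if "y \<in> vecs B" for y
  proof (rule ccontr)
    assume y: "y \<notin> pmv.span ?S"
    then have "pmv.independent (insert y ?S)"
      using \<open>pmv.independent ?S\<close> by (rule pmv.independent_insertI)
    moreover have "insert y ?S \<subseteq> pmv.span (ev ` B)"
      using that into by (auto simp flip: vecs_eq_span)
    ultimately have "card (insert y ?S) \<le> card (ev ` B :: ('b \<Rightarrow>\<^sub>0 'k) set)"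
      using pmv.independent_span_bound fin by blast
    also have "\<dots> \<le> card B" by (rule card_image_le[OF fin(2)])
    finally have "card (insert y ?S) \<le> card B" .
    moreover have "y \<notin> ?S" using y pmv.span_base[of y ?S] by auto
    ultimately show False using \<open>card ?S = card B\<close> fin by (simp add: card_insert_if)
  qed
  ultimately show ?thesis
    using inj_on maps span unfolding bij_betw_def by blast
qed

section \<open>Modules and their isomorphisms\<close>

text \<open>The inverse of a homomorphism is a homomorphism only when the source is closed under its
  operations, so \<open>module_iso\<close> on bare records is not symmetric. With the module axioms
  of both sides included, isomorphisms can be inverted and chained freely.\<close>

definition miso :: "('a, 'r) ring_scheme \<Rightarrow> ('a, 'b) module \<Rightarrow> ('a, 'c) module \<Rightarrow> bool"
  where "miso R M N \<longleftrightarrow> left_module R M \<and> left_module R N \<and> module_iso R M N"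

lemma module_homI:
  assumes "\<And>x. x \<in> carrier M \<Longrightarrow> f x \<in> carrier N"
    and "\<And>x y. x \<in> carrier M \<Longrightarrow> y \<in> carrier M \<Longrightarrow> f (x \<oplus>\<^bsub>M\<^esub> y) = f x \<oplus>\<^bsub>N\<^esub> f y"
    and "\<And>r x. r \<in> carrier R \<Longrightarrow> x \<in> carrier M \<Longrightarrow> f (r \<odot>\<^bsub>M\<^esub> x) = r \<odot>\<^bsub>N\<^esub> f x"
  shows "f \<in> module_hom R M N"
  using assms by (auto simp: module_hom_def)

lemma module_homD:
  assumes "f \<in> module_hom R M N"
  shows "x \<in> carrier M \<Longrightarrow> f x \<in> carrier N"
    and "x \<in> carrier M \<Longrightarrow> y \<in> carrier M \<Longrightarrow> f (x \<oplus>\<^bsub>M\<^esub> y) = f x \<oplus>\<^bsub>N\<^esub> f y"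
    and "r \<in> carrier R \<Longrightarrow> x \<in> carrier M \<Longrightarrow> f (r \<odot>\<^bsub>M\<^esub> x) = r \<odot>\<^bsub>N\<^esub> f x"
  using assms by (auto simp: module_hom_def)

lemma module_hom_zero:
  assumes "f \<in> module_hom R M N" "abelian_group M" "abelian_group N"
  shows "f \<zero>\<^bsub>M\<^esub> = \<zero>\<^bsub>N\<^esub>"
proof -
  interpret M: abelian_group M by fact
  interpret N: abelian_group N by fact
  have "f \<zero>\<^bsub>M\<^esub> \<in> carrier N" using assms(1) by (auto intro: module_homD)
  moreover have "f \<zero>\<^bsub>M\<^esub> \<oplus>\<^bsub>N\<^esub> f \<zero>\<^bsub>M\<^esub> = f \<zero>\<^bsub>M\<^esub>"
    using module_homD(2)[OF assms(1), of "\<zero>\<^bsub>M\<^esub>" "\<zero>\<^bsub>M\<^esub>"] by simp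
  ultimately show ?thesis by (metis N.add.r_cancel_one')
qed

lemma module_hom_compose:
  "f \<in> module_hom R M N \<Longrightarrow> g \<in> module_hom R N P \<Longrightarrow> (\<lambda>x. g (f x)) \<in> module_hom R M P"
  by (rule module_homI) (simp_all add: module_homD)

lemma module_hom_inverse:
  assumes f: "f \<in> module_hom R M N" and bij: "bij_betw f (carrier M) (carrier N)" and M: "left_module R M"
  shows "inv_into (carrier M) f \<in> module_hom R N M"
proof -
  interpret M: left_module R M by fact
  let ?g = "inv_into (carrier M) f"
  have g: "?g y \<in> carrier M" "f (?g y) = y" if "y \<in> carrier N" for y
    using that bij by (auto simp: bij_betw_def inv_into_into f_inv_into_f)
  have gf: "?g (f x) = x" if "x \<in> carrier M" for x
    using that bij by (auto simp: bij_betw_def)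
  show ?thesis
  proof (rule module_homI)
    fix x y assume xy: "x \<in> carrier N" "y \<in> carrier N"
    then show "?g x \<in> carrier M" by (simp add: g)
    have "?g (f (?g x \<oplus>\<^bsub>M\<^esub> ?g y)) = ?g x \<oplus>\<^bsub>M\<^esub> ?g y" using xy by (intro gf) (simp add: g)
    then show "?g (x \<oplus>\<^bsub>N\<^esub> y) = ?g x \<oplus>\<^bsub>M\<^esub> ?g y" using xy by (simp add: module_homD[OF f] g)
  next
    fix r x assume rx: "r \<in> carrier R" "x \<in> carrier N"
    have "?g (f (r \<odot>\<^bsub>M\<^esub> ?g x)) = r \<odot>\<^bsub>M\<^esub> ?g x" using rx by (intro gf) (simp add: g M.smult_closed)
    then show "?g (r \<odot>\<^bsub>N\<^esub> x) = r \<odot>\<^bsub>M\<^esub> ?g x" using rx by (simp add: module_homD[OF f] g)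
  qed
qed

lemma misoI:
  assumes "left_module R M" "left_module R N" "f \<in> module_hom R M N" "bij_betw f (carrier M) (carrier N)"
  shows "miso R M N"
  using assms by (auto simp: miso_def module_iso_def)

lemma misoE:
  assumes "miso R M N"
  obtains f where "f \<in> module_hom R M N" "bij_betw f (carrier M) (carrier N)"
  using assms by (auto simp: miso_def module_iso_def)

lemma miso_iso: "miso R M N \<Longrightarrow> module_iso R M N"
  by (simp add: miso_def)

lemma miso_sym: "miso R M N \<Longrightarrow> miso R N M"
  unfolding miso_def module_iso_def by (meson bij_betw_inv_into module_hom_inverse)

lemma miso_trans [trans]:
  assumes "miso R M N" "miso R N P" shows "miso R M P"
proof -
  obtain f g where "f \<in> module_hom R M N" "bij_betw f (carrier M) (carrier N)"
    "g \<in> module_hom R N P" "bij_betw g (carrier N) (carrier P)"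
    using assms by (auto elim!: misoE)
  then show ?thesis
    using assms bij_betw_trans[of f _ _ g]
    by (intro misoI[of _ _ _ "\<lambda>x. g (f x)"]) (auto simp: miso_def o_def intro: module_hom_compose)
qed

text \<open>Identities are reflected by an injective map that respects the operations. This is how
  quotients and sums obtain their module axioms: from the module they are identified with.\<close>

lemma left_module_pullback:
  fixes M :: "('a, 'b) module" and N :: "('a, 'c) module"
  assumes N: "left_module R N" and f: "f \<in> module_hom R M N" and bij: "bij_betw f (carrier M) (carrier N)"
    and zero: "\<zero>\<^bsub>M\<^esub> \<in> carrier M" "f \<zero>\<^bsub>M\<^esub> = \<zero>\<^bsub>N\<^esub>"
    and add: "\<And>x y. x \<in> carrier M \<Longrightarrow> y \<in> carrier M \<Longrightarrow> x \<oplus>\<^bsub>M\<^esub> y \<in> carrier M"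
    and smult: "\<And>r x. r \<in> carrier R \<Longrightarrow> x \<in> carrier M \<Longrightarrow> r \<odot>\<^bsub>M\<^esub> x \<in> carrier M"
  shows "left_module R M"
proof -
  interpret N: left_module R N by fact
  have eqI: "x = y" if "x \<in> carrier M" "y \<in> carrier M" "f x = f y" for x y
    using that bij by (auto simp: bij_betw_def inj_on_def)
  note [simp] = module_homD[OF f] add smult zero N.smult_closed
  have ab: "abelian_group M"
  proof (rule abelian_groupI)
    fix x y z assume [simp]: "x \<in> carrier M" "y \<in> carrier M" "z \<in> carrier M"
    show "x \<oplus>\<^bsub>M\<^esub> y \<oplus>\<^bsub>M\<^esub> z = x \<oplus>\<^bsub>M\<^esub> (y \<oplus>\<^bsub>M\<^esub> z)" by (rule eqI) (simp_all add: N.M.add.m_assoc)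
    show "x \<oplus>\<^bsub>M\<^esub> y = y \<oplus>\<^bsub>M\<^esub> x" by (rule eqI) (simp_all add: N.M.add.m_comm)
    show "\<zero>\<^bsub>M\<^esub> \<oplus>\<^bsub>M\<^esub> x = x" by (rule eqI) simp_all
    \<comment> \<open>Negatives are the one axiom for which surjectivity matters.\<close>
    have "\<ominus>\<^bsub>N\<^esub> f x \<in> f ` carrier M" using bij by (simp add: bij_betw_def)
    then obtain y where "y \<in> carrier M" "f y = \<ominus>\<^bsub>N\<^esub> f x" by auto
    then show "\<exists>y\<in>carrier M. y \<oplus>\<^bsub>M\<^esub> x = \<zero>\<^bsub>M\<^esub>"
      by (intro bexI[of _ y] eqI) (simp_all add: N.M.l_neg)
  qed simp_all
  show ?thesis
    by (intro left_module.intro N.R.ring_axioms ab left_module_axioms.intro)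
      (auto intro!: eqI simp: N.smult_l_distr N.smult_r_distr N.smult_assoc N.smult_one)
qed

lemma smult_zero_right:
  assumes "left_module R M" "r \<in> carrier R" shows "r \<odot>\<^bsub>M\<^esub> \<zero>\<^bsub>M\<^esub> = \<zero>\<^bsub>M\<^esub>"
proof -
  interpret left_module R M by fact
  have "r \<odot>\<^bsub>M\<^esub> \<zero>\<^bsub>M\<^esub> \<oplus>\<^bsub>M\<^esub> r \<odot>\<^bsub>M\<^esub> \<zero>\<^bsub>M\<^esub> = r \<odot>\<^bsub>M\<^esub> \<zero>\<^bsub>M\<^esub>"
    using smult_r_distr[OF assms(2), of "\<zero>\<^bsub>M\<^esub>" "\<zero>\<^bsub>M\<^esub>"] by simp
  then show ?thesis using smult_closed[OF assms(2), of "\<zero>\<^bsub>M\<^esub>"] by (metis M.zero_closed M.add.r_cancel_one')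
qed

lemma kernel_coset:
  assumes M: "abelian_group M" and N: "abelian_group N"
    and into: "\<And>x. x \<in> carrier M \<Longrightarrow> F x \<in> carrier N"
    and F: "\<And>x y. x \<in> carrier M \<Longrightarrow> y \<in> carrier M \<Longrightarrow> F (x \<oplus>\<^bsub>M\<^esub> y) = F x \<oplus>\<^bsub>N\<^esub> F y"
    and K: "K = {x \<in> carrier M. F x = \<zero>\<^bsub>N\<^esub>}" and x: "x \<in> carrier M"
  shows "K +>\<^bsub>M\<^esub> x = {y \<in> carrier M. F y = F x}"
proof -
  interpret M: abelian_group M by fact
  interpret N: abelian_group N by fact
  have "y \<in> K +>\<^bsub>M\<^esub> x" if y: "y \<in> carrier M" "F y = F x" for y
  proof -
    have z: "y \<ominus>\<^bsub>M\<^esub> x \<in> carrier M" "(y \<ominus>\<^bsub>M\<^esub> x) \<oplus>\<^bsub>M\<^esub> x = y"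
      using x y by (auto simp: M.minus_eq M.add.m_assoc M.l_neg)
    then have "F (y \<ominus>\<^bsub>M\<^esub> x) \<oplus>\<^bsub>N\<^esub> F x = F x" using F[OF z(1) x] y by simp
    then have "F (y \<ominus>\<^bsub>M\<^esub> x) = \<zero>\<^bsub>N\<^esub>" using into[OF z(1)] into[OF x] by (simp add: N.add.l_cancel_one)
    then have "y \<ominus>\<^bsub>M\<^esub> x \<in> K" using z by (simp add: K)
    then show ?thesis using z by (force simp: a_r_coset_def r_coset_def)
  qed
  moreover have "y \<in> carrier M \<and> F y = F x" if "y \<in> K +>\<^bsub>M\<^esub> x" for y
    using that x into by (auto simp: a_r_coset_def r_coset_def K F)
  ultimately show ?thesis by auto
qed

text \<open>The first isomorphism theorem for a source that is merely an abelian group with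
  operators: the free abelian group beneath a tensor product is not a module before the relations
  are divided out. The quotient receives its module axioms from \<open>N\<close>.\<close>

lemma quot_module_miso:
  fixes M :: "('a, 'b) module" and N :: "('a, 'c) module"
  assumes M: "abelian_group M" and N: "left_module R N"
    and into: "\<And>x. x \<in> carrier M \<Longrightarrow> F x \<in> carrier N"
    and add: "\<And>x y. x \<in> carrier M \<Longrightarrow> y \<in> carrier M \<Longrightarrow> F (x \<oplus>\<^bsub>M\<^esub> y) = F x \<oplus>\<^bsub>N\<^esub> F y"
    and smult: "\<And>r x. r \<in> carrier R \<Longrightarrow> x \<in> carrier M \<Longrightarrow> r \<odot>\<^bsub>M\<^esub> x \<in> carrier M \<and> F (r \<odot>\<^bsub>M\<^esub> x) = r \<odot>\<^bsub>N\<^esub> F x"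
    and surj: "\<And>y. y \<in> carrier N \<Longrightarrow> \<exists>x\<in>carrier M. F x = y"
    and K: "K = {x \<in> carrier M. F x = \<zero>\<^bsub>N\<^esub>}"
  obtains f where "left_module R (quot_module M K)" "f \<in> module_hom R (quot_module M K) N"
    "bij_betw f (carrier (quot_module M K)) (carrier N)"
    "\<And>x. x \<in> carrier M \<Longrightarrow> f (K +>\<^bsub>M\<^esub> x) = F x"
proof -
  interpret M: abelian_group M by fact
  interpret N: left_module R N by fact
  let ?Q = "quot_module M K"
  \<comment> \<open>Cosets of the kernel are the fibres of \<open>F\<close>, and the operations on
    cosets are computed as operations on fibres.\<close>
  define fib where "fib x = {y \<in> carrier M. F y = F x}" for x
  have fib: "K +>\<^bsub>M\<^esub> x = fib x" if "x \<in> carrier M" for x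
    unfolding fib_def using that
    by (intro kernel_coset[OF M N.M.abelian_group_axioms into add K]) auto
  have F0: "F \<zero>\<^bsub>M\<^esub> = \<zero>\<^bsub>N\<^esub>"
    using add[of "\<zero>\<^bsub>M\<^esub>" "\<zero>\<^bsub>M\<^esub>"] into[of "\<zero>\<^bsub>M\<^esub>"] by (simp add: N.M.add.l_cancel_one')
  have Fneg: "F (y \<ominus>\<^bsub>M\<^esub> x) \<oplus>\<^bsub>N\<^esub> F x = F y" "(y \<ominus>\<^bsub>M\<^esub> x) \<oplus>\<^bsub>M\<^esub> x = y" "y \<ominus>\<^bsub>M\<^esub> x \<in> carrier M"
    if "x \<in> carrier M" "y \<in> carrier M" for x y
    using that add[of "y \<ominus>\<^bsub>M\<^esub> x" x] by (simp_all add: M.minus_eq M.add.m_assoc M.l_neg)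
  have carrier: "carrier ?Q = fib ` carrier M"
    using fib by (auto simp: quot_module_def A_RCOSETS_def RCOSETS_def a_r_coset_def)
  have K_fib: "K = fib \<zero>\<^bsub>M\<^esub>" by (simp add: fib_def F0 K)
  have plus: "fib x \<oplus>\<^bsub>?Q\<^esub> fib y = fib (x \<oplus>\<^bsub>M\<^esub> y)" if xy: "x \<in> carrier M" "y \<in> carrier M" for x y
  proof -
    have "z \<in> fib x <+>\<^bsub>M\<^esub> fib y" if z: "z \<in> carrier M" "F z = F x \<oplus>\<^bsub>N\<^esub> F y" for z
    proof -
      have "F (z \<ominus>\<^bsub>M\<^esub> y) \<oplus>\<^bsub>N\<^esub> F y = F x \<oplus>\<^bsub>N\<^esub> F y" using z xy Fneg[of y z] by simp
      then have "F (z \<ominus>\<^bsub>M\<^esub> y) = F x" using xy z Fneg(3)[of y z] by (simp add: into)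
      then have "z \<ominus>\<^bsub>M\<^esub> y \<in> fib x" "y \<in> fib y" using xy z Fneg(3)[of y z] by (simp_all add: fib_def)
      moreover have "z = (z \<ominus>\<^bsub>M\<^esub> y) \<oplus>\<^bsub>M\<^esub> y" using Fneg(2) xy z by simp
      ultimately show ?thesis unfolding set_add_def set_mult_def by (simp, metis)
    qed
    moreover have "z \<in> carrier M \<and> F z = F x \<oplus>\<^bsub>N\<^esub> F y" if "z \<in> fib x <+>\<^bsub>M\<^esub> fib y" for z
      using that xy by (auto simp: fib_def set_add_def set_mult_def add)
    moreover have "fib (x \<oplus>\<^bsub>M\<^esub> y) = {z \<in> carrier M. F z = F x \<oplus>\<^bsub>N\<^esub> F y}"
      using xy by (simp add: fib_def add)
    ultimately have "fib x <+>\<^bsub>M\<^esub> fib y = fib (x \<oplus>\<^bsub>M\<^esub> y)" by blast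
    then show ?thesis by (simp add: quot_module_def)
  qed
  have smul: "r \<odot>\<^bsub>?Q\<^esub> fib x = fib (r \<odot>\<^bsub>M\<^esub> x)" if rx: "r \<in> carrier R" "x \<in> carrier M" for r x
  proof -
    have "z \<in> K <+>\<^bsub>M\<^esub> ((\<lambda>x. r \<odot>\<^bsub>M\<^esub> x) ` fib x)" if z: "z \<in> carrier M" "F z = r \<odot>\<^bsub>N\<^esub> F x" for z
    proof -
      have r: "r \<odot>\<^bsub>M\<^esub> x \<in> carrier M" "F (r \<odot>\<^bsub>M\<^esub> x) = F z" using rx smult z by auto
      have "F (z \<ominus>\<^bsub>M\<^esub> (r \<odot>\<^bsub>M\<^esub> x)) = \<zero>\<^bsub>N\<^esub>"
        using Fneg(1,3)[OF r(1) z(1)] r(2) into[OF z(1)] into[OF Fneg(3)[OF r(1) z(1)]]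
        by (simp add: N.M.add.l_cancel_one)
      then have "z \<ominus>\<^bsub>M\<^esub> (r \<odot>\<^bsub>M\<^esub> x) \<in> K" using Fneg(3)[of "r \<odot>\<^bsub>M\<^esub> x" z] r z by (simp add: K)
      moreover have "x \<in> fib x" using rx by (simp add: fib_def)
      moreover have "z = (z \<ominus>\<^bsub>M\<^esub> (r \<odot>\<^bsub>M\<^esub> x)) \<oplus>\<^bsub>M\<^esub> (r \<odot>\<^bsub>M\<^esub> x)" using Fneg(2) r z by simp
      ultimately show ?thesis unfolding set_add_def set_mult_def by (simp, metis)
    qed
    moreover have "z \<in> carrier M \<and> F z = r \<odot>\<^bsub>N\<^esub> F x" if "z \<in> K <+>\<^bsub>M\<^esub> ((\<lambda>x. r \<odot>\<^bsub>M\<^esub> x) ` fib x)" for z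
      using that rx smult by (auto simp: fib_def set_add_def set_mult_def K add N.smult_closed into)
    moreover have "fib (r \<odot>\<^bsub>M\<^esub> x) = {z \<in> carrier M. F z = r \<odot>\<^bsub>N\<^esub> F x}"
      using rx smult by (simp add: fib_def)
    ultimately have "K <+>\<^bsub>M\<^esub> ((\<lambda>x. r \<odot>\<^bsub>M\<^esub> x) ` fib x) = fib (r \<odot>\<^bsub>M\<^esub> x)"
      by blast
    then show ?thesis by (simp add: quot_module_def)
  qed
  \<comment> \<open>Any representative serves, since \<open>F\<close> is constant on a
    fibre.\<close>
  define f where "f A = F (SOME x. x \<in> A)" for A
  have f: "f (fib x) = F x" if "x \<in> carrier M" for x
  proof -
    have "x \<in> fib x" using that by (simp add: fib_def)
    then have "(SOME y. y \<in> fib x) \<in> fib x" by (rule someI)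
    then show ?thesis by (simp add: f_def fib_def)
  qed
  have hom: "f \<in> module_hom R ?Q N"
  proof (rule module_homI)
    show "f x \<in> carrier N" if "x \<in> carrier ?Q" for x
      using that by (auto simp: carrier f into)
    show "f (x \<oplus>\<^bsub>?Q\<^esub> y) = f x \<oplus>\<^bsub>N\<^esub> f y" if "x \<in> carrier ?Q" "y \<in> carrier ?Q" for x y
      using that by (auto simp: carrier f plus add)
    show "f (r \<odot>\<^bsub>?Q\<^esub> x) = r \<odot>\<^bsub>N\<^esub> f x" if "r \<in> carrier R" "x \<in> carrier ?Q" for r x
      using that smult by (auto simp: carrier f smul)
  qed
  have bij: "bij_betw f (carrier ?Q) (carrier N)"
  proof (rule bij_betw_imageI)
    show "inj_on f (carrier ?Q)" by (auto simp: carrier inj_on_def f) (auto simp: fib_def)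
    have "f ` carrier ?Q = F ` carrier M" by (simp add: carrier image_image f)
    also have "\<dots> = carrier N" using surj into by (auto simp: image_iff)
    finally show "f ` carrier ?Q = carrier N" .
  qed
  have "left_module R ?Q"
  proof (rule left_module_pullback[OF N hom bij])
    have zero: "\<zero>\<^bsub>?Q\<^esub> = fib \<zero>\<^bsub>M\<^esub>" by (simp add: quot_module_def K_fib[symmetric])
    show "\<zero>\<^bsub>?Q\<^esub> \<in> carrier ?Q" "f \<zero>\<^bsub>?Q\<^esub> = \<zero>\<^bsub>N\<^esub>" by (simp_all add: zero carrier f F0)
    show "x \<oplus>\<^bsub>?Q\<^esub> y \<in> carrier ?Q" if "x \<in> carrier ?Q" "y \<in> carrier ?Q" for x y
      using that by (auto simp: carrier plus)
    show "r \<odot>\<^bsub>?Q\<^esub> x \<in> carrier ?Q" if "r \<in> carrier R" "x \<in> carrier ?Q" for r x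
      using that smult by (auto simp: carrier smul)
  qed
  from that[OF this hom bij] fib f show thesis by simp
qed

section \<open>Algebras and modules with a basis\<close>

text \<open>The action is given by one operator per basis vector of the algebra and extended
  linearly, so module axioms and intertwining relations are conditions on basis vectors of the
  algebra.\<close>

definition cmod :: "'b set \<Rightarrow> ('a \<Rightarrow> ('b \<Rightarrow>\<^sub>0 'k) \<Rightarrow> ('b \<Rightarrow>\<^sub>0 'k)) \<Rightarrow> ('a \<Rightarrow>\<^sub>0 'k::field, 'b \<Rightarrow>\<^sub>0 'k) module"
  where "cmod B op = \<lparr>carrier = vecs B, monoid.mult = undefined, one = undefined, ring.zero = 0,
    ring.add = (+), module.smult = (\<lambda>r f. lin_ext (\<lambda>a. op a f) r)\<rparr>"

lemma cmod_simps [simp]: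
  "carrier (cmod B op) = vecs B" "\<zero>\<^bsub>cmod B op\<^esub> = 0" "x \<oplus>\<^bsub>cmod B op\<^esub> y = x + y"
  "r \<odot>\<^bsub>cmod B op\<^esub> f = lin_ext (\<lambda>a. op a f) r"
  by (simp_all add: cmod_def)

lemma based_algebra_simps [simp]:
  "carrier (based_algebra B m e) = vecs B" "\<zero>\<^bsub>based_algebra B m e\<^esub> = 0"
  "\<one>\<^bsub>based_algebra B m e\<^esub> = e"
  "x \<oplus>\<^bsub>based_algebra B m e\<^esub> y = x + y" "x \<otimes>\<^bsub>based_algebra B m e\<^esub> y = bilin_ext m x y"
  by (simp_all add: based_algebra_def vecs_def)

lemma bilin_ext_in_vecs:
  assumes "f \<in> vecs A" "g \<in> vecs B" "\<And>a b. a \<in> A \<Longrightarrow> b \<in> B \<Longrightarrow> m a b \<in> vecs C"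
  shows "bilin_ext m f g \<in> vecs C"
  unfolding bilin_ext_def using assms by (intro lin_ext_in_vecs[of _ A] lin_ext_in_vecs[of _ B]) auto

lemma based_algebra_ring:
  fixes m :: "'b \<Rightarrow> 'b \<Rightarrow> ('b \<Rightarrow>\<^sub>0 'k::field)"
  assumes u: "u \<in> B" and m: "\<And>b c. b \<in> B \<Longrightarrow> c \<in> B \<Longrightarrow> m b c \<in> vecs B"
    and assoc: "\<And>b c d. b \<in> B \<Longrightarrow> c \<in> B \<Longrightarrow> d \<in> B \<Longrightarrow>
      bilin_ext m (m b c) (ev d) = bilin_ext m (ev b) (m c d)"
    and unit: "\<And>b. b \<in> B \<Longrightarrow> m u b = ev b" "\<And>b. b \<in> B \<Longrightarrow> m b u = ev b"
  shows "ring (based_algebra B m (ev u))"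
proof -
  let ?m = "bilin_ext m"
  note L = bilin_ext_lin_right[of m] bilin_ext_lin_left[of m]
  have closed: "?m f g \<in> vecs B" if "f \<in> vecs B" "g \<in> vecs B" for f g
    using that m by (intro bilin_ext_in_vecs)
  have assoc': "?m (?m f g) h = ?m f (?m g h)" if fgh: "f \<in> vecs B" "g \<in> vecs B" "h \<in> vecs B" for f g h
  proof (rule lin_eqI[OF fgh(1), where L = "\<lambda>f. ?m (?m f g) h" and M = "\<lambda>f. ?m f (?m g h)"])
    fix b assume b: "b \<in> B"
    show "?m (?m (ev b) g) h = ?m (ev b) (?m g h)"
    proof (rule bilin_eqI[OF fgh(2,3), where L = "\<lambda>g h. ?m (?m (ev b) g) h" and M = "\<lambda>g h. ?m (ev b) (?m g h)"])
      show "?m (?m (ev b) (ev c)) (ev d) = ?m (ev b) (?m (ev c) (ev d))" if "c \<in> B" "d \<in> B" for c d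
        using assoc[OF b that] by simp
    qed (rule L lin_comp(2)[OF L(1) L(1)] lin_comp(2)[OF L(1) L(2)] lin_comp(2)[OF L(2) L(1)])+
  qed (rule L lin_comp(2)[OF L(2) L(2)] )+
  have 1: "?m (ev u) f = f" "?m f (ev u) = f" if "f \<in> vecs B" for f
    using lin_eqI[OF that L(1) lin_id(1), of "ev u"] lin_eqI[OF that L(2) lin_id(1), of "ev u"]
    by (simp_all add: unit)
  show ?thesis
  proof (rule ringI)
    show "abelian_group (based_algebra B m (ev u))"
    proof (rule abelian_groupI)
      show "\<exists>y\<in>carrier (based_algebra B m (ev u)). y \<oplus>\<^bsub>based_algebra B m (ev u)\<^esub> x = \<zero>\<^bsub>based_algebra B m (ev u)\<^esub>"
        if "x \<in> carrier (based_algebra B m (ev u))" for x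
        by (rule bexI[of _ "- x"]) (use that in \<open>auto intro: vecs_uminus\<close>)
    qed (auto simp: algebra_simps intro: vecs_intros)
    show "monoid (based_algebra B m (ev u))"
      by (rule monoidI) (auto simp: assoc' 1 closed u intro: vecs_intros)
  qed (auto simp: lin_add[OF L(1)] lin_add[OF L(2)])
qed

lemma abelian_group_cmod: "abelian_group (cmod B op)"
proof (rule abelian_groupI)
  show "\<exists>y\<in>carrier (cmod B op). y \<oplus>\<^bsub>cmod B op\<^esub> x = \<zero>\<^bsub>cmod B op\<^esub>" if "x \<in> carrier (cmod B op)" for x
    by (rule bexI[of _ "- x"]) (use that in \<open>auto intro: vecs_uminus\<close>)
qed (auto simp: algebra_simps intro: vecs_intros)

lemma cmod_left_module:
  fixes m :: "'a \<Rightarrow> 'a \<Rightarrow> ('a \<Rightarrow>\<^sub>0 'k::field)" and op :: "'a \<Rightarrow> ('b \<Rightarrow>\<^sub>0 'k) \<Rightarrow> ('b \<Rightarrow>\<^sub>0 'k)"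
  assumes A: "ring (based_algebra A m (ev u))"
    and lin: "\<And>a. a \<in> A \<Longrightarrow> lin (op a)" and closed: "\<And>a f. a \<in> A \<Longrightarrow> f \<in> vecs B \<Longrightarrow> op a f \<in> vecs B"
    and mult: "\<And>a b f. a \<in> A \<Longrightarrow> b \<in> A \<Longrightarrow> f \<in> vecs B \<Longrightarrow> lin_ext (\<lambda>c. op c f) (m a b) = op a (op b f)"
    and unit: "\<And>f. f \<in> vecs B \<Longrightarrow> op u f = f"
  shows "left_module (based_algebra A m (ev u)) (cmod B op)"
proof (intro left_module.intro A abelian_group_cmod left_module_axioms.intro; simp)
  let ?act = "\<lambda>r f. lin_ext (\<lambda>a. op a f) r"
  show act_closed: "?act r f \<in> vecs B" if "r \<in> vecs A" "f \<in> vecs B" for r f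
    using that closed by (intro lin_ext_in_vecs)
  show "?act (r + r') f = ?act r f + ?act r' f" for r r' f
    by (rule lin_add[OF lin_lin_ext])
  show "?act r (f + g) = ?act r f + ?act r g" if "r \<in> vecs A" for r f g
    unfolding lin_ext_plus[symmetric]
    by (rule lin_ext_vecs_cong[OF that]) (rule lin_add[OF lin])
  show "?act (bilin_ext m r r') f = ?act r (?act r' f)"
    if r: "r \<in> vecs A" "r' \<in> vecs A" and f: "f \<in> vecs B" for r r' f
  proof (rule lin_eqI[OF r(1), where L = "\<lambda>r. ?act (bilin_ext m r r') f" and M = "\<lambda>r. ?act r (?act r' f)"])
    fix a assume a: "a \<in> A"
    have "?act (bilin_ext m (ev a) r') f = op a (?act r' f)"
    proof (rule lin_eqI[OF r(2), where L = "\<lambda>r'. ?act (bilin_ext m (ev a) r') f" and M = "\<lambda>r'. op a (?act r' f)"])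
      show "?act (bilin_ext m (ev a) (ev b)) f = op a (?act (ev b) f)" if "b \<in> A" for b
        using mult[OF a that f] by simp
    qed (rule lin_comp(2)[OF lin_lin_ext bilin_ext_lin_right] lin_comp(2)[OF lin[OF a] lin_lin_ext])+
    then show "?act (bilin_ext m (ev a) r') f = ?act (ev a) (?act r' f)" by simp
  qed (rule lin_comp(2)[OF lin_lin_ext bilin_ext_lin_left] lin_lin_ext)+
qed (simp add: unit)

section \<open>The group algebra and the Hopf algebra\<close>

definition grep :: "('g, 'm) monoid_scheme \<Rightarrow> 'b set \<Rightarrow> ('g \<Rightarrow> ('b \<Rightarrow>\<^sub>0 'k::field) \<Rightarrow> ('b \<Rightarrow>\<^sub>0 'k)) \<Rightarrow> bool"
  where "grep G B \<rho> \<longleftrightarrow> (\<forall>g\<in>carrier G. lin (\<rho> g)) \<and> (\<forall>g\<in>carrier G. \<forall>f\<in>vecs B. \<rho> g f \<in> vecs B) \<and>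
    (\<forall>g\<in>carrier G. \<forall>h\<in>carrier G. \<forall>f\<in>vecs B. \<rho> (g \<otimes>\<^bsub>G\<^esub> h) f = \<rho> g (\<rho> h f)) \<and>
    (\<forall>f\<in>vecs B. \<rho> \<one>\<^bsub>G\<^esub> f = f)"

definition hop :: "('g \<Rightarrow> ('b \<Rightarrow>\<^sub>0 'k::field) \<Rightarrow> ('b \<Rightarrow>\<^sub>0 'k)) \<Rightarrow> (('b \<Rightarrow>\<^sub>0 'k) \<Rightarrow> ('b \<Rightarrow>\<^sub>0 'k))
    \<Rightarrow> 'g \<times> nat \<Rightarrow> ('b \<Rightarrow>\<^sub>0 'k) \<Rightarrow> ('b \<Rightarrow>\<^sub>0 'k)"
  where "hop \<rho> Y = (\<lambda>(g, i) f. \<rho> g ((Y ^^ i) f))"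

text \<open>The last clause is the relation \<open>x g = \<tau>(g) g x\<close>. As it is the only
  relation involving \<open>x\<close>, such data are the same as a module over
  \<open>ore_algebra G \<tau>\<close>.\<close>

definition hrep :: "('g, 'm) monoid_scheme \<Rightarrow> ('g \<Rightarrow> 'k) \<Rightarrow> 'b set
    \<Rightarrow> ('g \<Rightarrow> ('b \<Rightarrow>\<^sub>0 'k::field) \<Rightarrow> ('b \<Rightarrow>\<^sub>0 'k)) \<Rightarrow> (('b \<Rightarrow>\<^sub>0 'k) \<Rightarrow> ('b \<Rightarrow>\<^sub>0 'k)) \<Rightarrow> bool"
  where "hrep G \<tau> B \<rho> Y \<longleftrightarrow> grep G B \<rho> \<and> lin Y \<and> (\<forall>f\<in>vecs B. Y f \<in> vecs B) \<and>
    (\<forall>g\<in>carrier G. \<forall>f\<in>vecs B. Y (\<rho> g f) = scale (\<tau> g) (\<rho> g (Y f)))"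

abbreviation hmod :: "'b set \<Rightarrow> ('g \<Rightarrow> ('b \<Rightarrow>\<^sub>0 'k::field) \<Rightarrow> ('b \<Rightarrow>\<^sub>0 'k)) \<Rightarrow> (('b \<Rightarrow>\<^sub>0 'k) \<Rightarrow> ('b \<Rightarrow>\<^sub>0 'k))
    \<Rightarrow> ('g \<times> nat \<Rightarrow>\<^sub>0 'k, 'b \<Rightarrow>\<^sub>0 'k) module"
  where "hmod B \<rho> Y \<equiv> cmod B (hop \<rho> Y)"

lemma hop_pair: "hop \<rho> Y (g, i) = (\<lambda>f. \<rho> g ((Y ^^ i) f))"
  by (simp add: hop_def)

lemma grepD:
  assumes "grep G B \<rho>"
  shows "g \<in> carrier G \<Longrightarrow> lin (\<rho> g)" "g \<in> carrier G \<Longrightarrow> f \<in> vecs B \<Longrightarrow> \<rho> g f \<in> vecs B"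
    "g \<in> carrier G \<Longrightarrow> h \<in> carrier G \<Longrightarrow> f \<in> vecs B \<Longrightarrow> \<rho> (g \<otimes>\<^bsub>G\<^esub> h) f = \<rho> g (\<rho> h f)"
    "f \<in> vecs B \<Longrightarrow> \<rho> \<one>\<^bsub>G\<^esub> f = f"
  using assms by (auto simp: grep_def)

lemma hrepD:
  assumes "hrep G \<tau> B \<rho> Y"
  shows "grep G B \<rho>" "lin Y" "f \<in> vecs B \<Longrightarrow> Y f \<in> vecs B"
    "g \<in> carrier G \<Longrightarrow> f \<in> vecs B \<Longrightarrow> Y (\<rho> g f) = scale (\<tau> g) (\<rho> g (Y f))"
  using assms by (auto simp: hrep_def)

lemma funpow_vecs:
  fixes Y :: "('b \<Rightarrow>\<^sub>0 'k::field) \<Rightarrow> ('b \<Rightarrow>\<^sub>0 'k)"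
  assumes "\<And>f. f \<in> vecs B \<Longrightarrow> Y f \<in> vecs B" "f \<in> vecs B"
  shows "(Y ^^ n) f \<in> vecs B"
  by (induction n) (auto simp: assms)

lemma hrep_pow:
  assumes "hrep G \<tau> B \<rho> Y" "g \<in> carrier G" "f \<in> vecs B"
  shows "(Y ^^ n) (\<rho> g f) = scale (\<tau> g ^ n) (\<rho> g ((Y ^^ n) f))"
proof (induction n)
  case (Suc n)
  have "(Y ^^ n) f \<in> vecs B" by (rule funpow_vecs[OF hrepD(3)[OF assms(1)] assms(3)])
  then show ?case
    using Suc hrepD(4)[OF assms(1,2), of "(Y ^^ n) f"] lin_scale[OF hrepD(2)[OF assms(1)]]
    by (simp add: mult.commute)
qed simp

lemma (in group) group_algebra_ring: "ring (group_algebra G :: ('a \<Rightarrow>\<^sub>0 'k::field) ring)"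
  unfolding group_algebra_def by (rule based_algebra_ring) (auto intro: vecs_single simp: m_assoc)

lemma (in group) grep_left_module:
  assumes "grep G B \<rho>"
  shows "left_module (group_algebra G) (cmod B \<rho>)"
  unfolding group_algebra_def
  by (rule cmod_left_module) (auto simp: grepD[OF assms] intro: group_algebra_ring[unfolded group_algebra_def])

lemma group_algebra_simps:
  "carrier (group_algebra G) = vecs (carrier G)" "\<one>\<^bsub>group_algebra G\<^esub> = ev \<one>\<^bsub>G\<^esub>"
  "x \<otimes>\<^bsub>group_algebra G\<^esub> y = bilin_ext (\<lambda>g h. ev (g \<otimes>\<^bsub>G\<^esub> h)) x y"
  by (simp_all add: group_algebra_def)

lemma ore_algebra_simps:
  "carrier (ore_algebra G \<tau>) = vecs (carrier G \<times> UNIV)" "\<one>\<^bsub>ore_algebra G \<tau>\<^esub> = ev (\<one>\<^bsub>G\<^esub>, 0)"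
  "x \<otimes>\<^bsub>ore_algebra G \<tau>\<^esub> y =
    bilin_ext (\<lambda>(g, i) (h, j). Poly_Mapping.single (g \<otimes>\<^bsub>G\<^esub> h, i + j) (\<tau> h ^ i)) x y"
  by (simp_all add: ore_algebra_def)

locale ore_setting = group G for G (structure) +
  fixes \<tau> :: "'a \<Rightarrow> 'k::field"
  assumes \<tau>_mult: "g \<in> carrier G \<Longrightarrow> h \<in> carrier G \<Longrightarrow> \<tau> (g \<otimes> h) = \<tau> g * \<tau> h"
    and \<tau>_one: "\<tau> \<one> = 1"
begin

abbreviation "H \<equiv> ore_algebra G \<tau>"
abbreviation "kG \<equiv> (group_algebra G :: ('a \<Rightarrow>\<^sub>0 'k) ring)"

lemma ring_H: "ring H"
  unfolding ore_algebra_def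
  by (rule based_algebra_ring)
    (auto intro: vecs_single simp: m_assoc \<tau>_mult \<tau>_one power_add power_mult_distrib algebra_simps split_beta)

lemma hrep_left_module:
  fixes B :: "'x set"
  assumes h: "hrep G \<tau> B \<rho> Y"
  shows "left_module H (hmod B \<rho> Y)"
  unfolding ore_algebra_def
proof (rule cmod_left_module)
  note g = grepD[OF hrepD(1)[OF h]]
  have Y: "(Y ^^ i) f \<in> vecs B" if "f \<in> vecs B" for f i
    by (rule funpow_vecs[OF hrepD(3)[OF h] that])
  show "ring (based_algebra (carrier G \<times> UNIV) (\<lambda>(g, i) (h, j). Poly_Mapping.single (g \<otimes> h, i + j) (\<tau> h ^ i)) (ev (\<one>, 0)))"
    using ring_H by (simp add: ore_algebra_def)
  show "lin (hop \<rho> Y a)" if "a \<in> carrier G \<times> UNIV" for a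
    using that lin_comp(2)[OF g(1) lin_funpow[OF hrepD(2)[OF h]]] by (auto simp: hop_pair)
  show "hop \<rho> Y a f \<in> vecs B" if "a \<in> carrier G \<times> UNIV" "f \<in> vecs B" for a f
    using that by (auto simp: hop_def intro: g Y)
  show "hop \<rho> Y (\<one>, 0) f = f" if "f \<in> vecs B" for f
    using that by (simp add: hop_def g)
  fix a b and f :: "'x \<Rightarrow>\<^sub>0 'k" assume ab: "a \<in> carrier G \<times> (UNIV :: nat set)" "b \<in> carrier G \<times> (UNIV :: nat set)" and f: "f \<in> vecs B"
  obtain g1 i g2 j where [simp]: "a = (g1, i)" "b = (g2, j)" by (metis surj_pair)
  have gs: "g1 \<in> carrier G" "g2 \<in> carrier G" using ab by auto
  show "lin_ext (\<lambda>c. hop \<rho> Y c f) ((\<lambda>(g, i) (h, j). Poly_Mapping.single (g \<otimes> h, i + j) (\<tau> h ^ i)) a b) =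
         hop \<rho> Y a (hop \<rho> Y b f)"
    using gs f by (simp add: hop_def hrep_pow[OF h] Y g funpow_add lin_scale[OF g(1)])
qed

end

section \<open>Tensor products by generators and relations\<close>

text \<open>The additive extension of \<open>F\<close> from generators to words of the free abelian
  group; integer coefficients act through the field.\<close>

definition fext :: "('x \<Rightarrow> ('b \<Rightarrow>\<^sub>0 'k::field)) \<Rightarrow> ('x \<Rightarrow>\<^sub>0 int) \<Rightarrow> ('b \<Rightarrow>\<^sub>0 'k)"
  where "fext F c = (\<Sum>x\<in>Poly_Mapping.keys c. scale (of_int (Poly_Mapping.lookup c x)) (F x))"

lemma fext_superset:
  assumes "finite A" "Poly_Mapping.keys c \<subseteq> A"
  shows "fext F c = (\<Sum>x\<in>A. scale (of_int (Poly_Mapping.lookup c x)) (F x))"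
  unfolding fext_def using assms by (intro sum.mono_neutral_left) (auto simp: in_keys_iff)

lemma fext_add: "fext F (c + d) = fext F c + fext F d"
  using keys_add[of c d]
  by (simp add: fext_superset[of "Poly_Mapping.keys c \<union> Poly_Mapping.keys d"] lookup_add
      scale_add_left sum.distrib)

lemma fext_0 [simp]: "fext F 0 = 0"
  by (simp add: fext_def)

lemma fext_diff: "fext F (c - d) = fext F c - fext F d"
  using fext_add[of F "c - d" d] by (simp add: algebra_simps)

lemma fext_sum: "fext F (sum c A) = (\<Sum>a\<in>A. fext F (c a))"
  by (induction A rule: infinite_finite_induct) (simp_all add: fext_add)

lemma fext_of [simp]: "fext F (frag_of x) = F x"
  by (simp add: fext_def)

lemma fext_in_vecs: "(\<And>x. x \<in> Poly_Mapping.keys c \<Longrightarrow> F x \<in> vecs B) \<Longrightarrow> fext F c \<in> vecs B"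
  unfolding fext_def by (auto intro!: vecs_sum vecs_scale)

locale frag_relations =
  fixes R :: "('x \<Rightarrow>\<^sub>0 int) set"
  assumes zero: "0 \<in> R" and add: "c \<in> R \<Longrightarrow> d \<in> R \<Longrightarrow> c + d \<in> R" and neg: "c \<in> R \<Longrightarrow> - c \<in> R"
begin

lemma diff: "c \<in> R \<Longrightarrow> d \<in> R \<Longrightarrow> c - d \<in> R"
  using add[of c "- d"] neg[of d] by simp

lemma sum: "(\<And>a. a \<in> A \<Longrightarrow> c a \<in> R) \<Longrightarrow> sum c A \<in> R"
  by (induction A rule: infinite_finite_induct) (auto intro: zero add)

end

definition nsum :: "('b \<Rightarrow> 'k \<Rightarrow> ('x \<Rightarrow>\<^sub>0 int)) \<Rightarrow> ('b \<Rightarrow>\<^sub>0 'k::field) \<Rightarrow> ('x \<Rightarrow>\<^sub>0 int)"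
  where "nsum n f = (\<Sum>b\<in>Poly_Mapping.keys f. n b (Poly_Mapping.lookup f b))"

text \<open>\<open>n b c\<close> is a word representing the vector with the single coordinate \<open>c\<close> at \<open>b\<close>.\<close>

locale frag_basis = frag_relations R for R :: "('x \<Rightarrow>\<^sub>0 int) set" +
  fixes B :: "'b set" and n :: "'b \<Rightarrow> 'k::field \<Rightarrow> ('x \<Rightarrow>\<^sub>0 int)"
  assumes n_add: "b \<in> B \<Longrightarrow> n b (c + d) - n b c - n b d \<in> R"
begin

text \<open>The words congruent modulo \<open>R\<close> to a normal form \<open>nsum n f\<close>.
  Once all generators are of this kind, a map that recovers \<open>f\<close> from
  \<open>nsum n f\<close> and kills \<open>R\<close> has kernel exactly \<open>R\<close>.\<close>

definition reach :: "('x \<Rightarrow>\<^sub>0 int) set"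
  where "reach = {c. \<exists>f\<in>vecs B. c - nsum n f \<in> R}"

lemma n_zero: "b \<in> B \<Longrightarrow> n b 0 \<in> R"
  using neg[OF n_add[of b 0 0]] by simp

lemma nsum_superset:
  assumes "finite A" "Poly_Mapping.keys f \<subseteq> A" "A \<subseteq> B"
  shows "(\<Sum>b\<in>A. n b (Poly_Mapping.lookup f b)) - nsum n f \<in> R"
proof -
  have "(\<Sum>b\<in>A. n b (Poly_Mapping.lookup f b)) - nsum n f =
      (\<Sum>b\<in>A - Poly_Mapping.keys f. n b (Poly_Mapping.lookup f b))"
    unfolding nsum_def using assms by (simp add: sum_diff)
  also have "\<dots> \<in> R" using assms by (intro sum) (auto simp: in_keys_iff intro!: n_zero)
  finally show ?thesis .
qed

lemma nsum_add:
  assumes "f \<in> vecs B" "g \<in> vecs B"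
  shows "nsum n (f + g) - nsum n f - nsum n g \<in> R"
proof -
  let ?A = "Poly_Mapping.keys f \<union> Poly_Mapping.keys g"
  let ?s = "\<lambda>f. \<Sum>b\<in>?A. n b (Poly_Mapping.lookup f b)"
  have A: "finite ?A" "?A \<subseteq> B" using assms by (auto simp: vecs_def)
  have "?s (f + g) - ?s f - ?s g =
      (\<Sum>b\<in>?A. n b (Poly_Mapping.lookup f b + Poly_Mapping.lookup g b) - n b (Poly_Mapping.lookup f b) - n b (Poly_Mapping.lookup g b))"
    by (simp add: lookup_add sum_subtractf)
  also have "\<dots> \<in> R" using A by (intro sum n_add) auto
  finally have 1: "?s (f + g) - ?s f - ?s g \<in> R" .
  have 2: "?s (f + g) - nsum n (f + g) \<in> R" "?s f - nsum n f \<in> R" "?s g - nsum n g \<in> R"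
    using A keys_add[of f g] by (auto intro!: nsum_superset)
  have "nsum n (f + g) - nsum n f - nsum n g =
      (?s (f + g) - ?s f - ?s g) - (?s (f + g) - nsum n (f + g)) + (?s f - nsum n f) + (?s g - nsum n g)"
    by (simp add: algebra_simps)
  also have "\<dots> \<in> R" by (intro add diff 1 2)
  finally show ?thesis .
qed

lemma reach_equiv: "d \<in> reach \<Longrightarrow> c - d \<in> R \<Longrightarrow> c \<in> reach"
  unfolding reach_def using add[of "c - d" "d - _"] by (fastforce simp: algebra_simps)

lemma reach_rel: "c \<in> R \<Longrightarrow> c \<in> reach"
  unfolding reach_def by (auto intro!: bexI[of _ 0] simp: nsum_def)

lemma reach_add:
  assumes "c \<in> reach" "d \<in> reach" shows "c + d \<in> reach"
proof -
  from assms obtain f g where fg: "f \<in> vecs B" "g \<in> vecs B" "c - nsum n f \<in> R" "d - nsum n g \<in> R"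
    by (auto simp: reach_def)
  have "c + d - nsum n (f + g) = (c - nsum n f) + (d - nsum n g) - (nsum n (f + g) - nsum n f - nsum n g)"
    by (simp add: algebra_simps)
  also have "\<dots> \<in> R" by (intro add diff fg nsum_add)
  finally show ?thesis using fg by (auto simp: reach_def intro!: bexI[of _ "f + g"] vecs_add)
qed

lemma reach_neg:
  assumes "c \<in> reach" shows "- c \<in> reach"
proof -
  from assms obtain f where f: "f \<in> vecs B" "c - nsum n f \<in> R" by (auto simp: reach_def)
  have "nsum n (f + - f) - nsum n f - nsum n (- f) \<in> R" by (intro nsum_add f vecs_uminus)
  then have "- (c - nsum n f) + (0 - nsum n f - nsum n (- f)) \<in> R"
    by (intro add neg f) (simp add: nsum_def)
  then show ?thesis using f by (auto simp: reach_def intro!: bexI[of _ "- f"] vecs_uminus)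
qed

lemma reach_diff: "c \<in> reach \<Longrightarrow> d \<in> reach \<Longrightarrow> c - d \<in> reach"
  using reach_add[of c "- d"] reach_neg[of d] by simp

lemma reach_basis: "b \<in> B \<Longrightarrow> n b c \<in> reach"
  unfolding reach_def
  by (cases "c = 0") (auto intro!: bexI[of _ "Poly_Mapping.single b c"] vecs_single simp: nsum_def zero n_zero)

end

lemma tensor_relations_intros:
  assumes "x \<in> carrier M" "v \<in> carrier N"
  shows "y \<in> carrier M \<Longrightarrow>
      frag_of (x \<oplus>\<^bsub>M\<^esub> y, v) - frag_of (x, v) - frag_of (y, v) \<in> tensor_relations S M ra N la"
    and "w \<in> carrier N \<Longrightarrow>
      frag_of (x, v \<oplus>\<^bsub>N\<^esub> w) - frag_of (x, v) - frag_of (x, w) \<in> tensor_relations S M ra N la"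
    and "c \<in> S \<Longrightarrow> frag_of (ra x c, v) - frag_of (x, la c v) \<in> tensor_relations S M ra N la"
  unfolding tensor_relations_def using assms by (auto intro!: generate.incl)

text \<open>Identifies a tensor product given by generators and relations with a space of
  coordinates. A balanced biadditive \<open>F\<close> kills the relations; conversely every word
  reduces to a normal form, on which \<open>F\<close> can be read off, so nothing else is killed.
  The premise \<open>gen\<close> is allowed to use the locale \<open>frag_basis\<close>, whose
  closure rules for \<open>reach\<close> carry out the reduction.\<close>

lemma balanced_tensor_miso:
  fixes M :: "('m, 'x) ring_scheme" and N :: "('n, 'y) ring_scheme" and B :: "'b set"
    and S :: "'s set" and ra :: "'m \<Rightarrow> 's \<Rightarrow> 'm" and la :: "'s \<Rightarrow> 'n \<Rightarrow> 'n"
    and n :: "'b \<Rightarrow> 'k::field \<Rightarrow> ('m \<times> 'n \<Rightarrow>\<^sub>0 int)" and \<phi> :: "'a \<Rightarrow> 'm \<times> 'n \<Rightarrow> ('m \<times> 'n \<Rightarrow>\<^sub>0 int)"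
    and P :: "('a, 'b \<Rightarrow>\<^sub>0 'k) module" and A :: "'a ring"
  defines "Rel \<equiv> tensor_relations S M ra N la"
  assumes P: "left_module A P" "carrier P = vecs B" "\<zero>\<^bsub>P\<^esub> = 0" "\<And>x y. x \<oplus>\<^bsub>P\<^esub> y = x + y"
    and closed: "\<And>x y. x \<in> carrier M \<Longrightarrow> y \<in> carrier M \<Longrightarrow> x \<oplus>\<^bsub>M\<^esub> y \<in> carrier M"
      "\<And>x y. x \<in> carrier N \<Longrightarrow> y \<in> carrier N \<Longrightarrow> x \<oplus>\<^bsub>N\<^esub> y \<in> carrier N"
      "\<And>x c. x \<in> carrier M \<Longrightarrow> c \<in> S \<Longrightarrow> ra x c \<in> carrier M"
      "\<And>x c. x \<in> carrier N \<Longrightarrow> c \<in> S \<Longrightarrow> la c x \<in> carrier N"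
    and into: "\<And>x v. x \<in> carrier M \<Longrightarrow> v \<in> carrier N \<Longrightarrow> F (x, v) \<in> vecs B"
    and biadd: "\<And>x y v. x \<in> carrier M \<Longrightarrow> y \<in> carrier M \<Longrightarrow> v \<in> carrier N \<Longrightarrow>
        F (x \<oplus>\<^bsub>M\<^esub> y, v) = F (x, v) + F (y, v)"
      "\<And>x v w. x \<in> carrier M \<Longrightarrow> v \<in> carrier N \<Longrightarrow> w \<in> carrier N \<Longrightarrow>
        F (x, v \<oplus>\<^bsub>N\<^esub> w) = F (x, v) + F (x, w)"
    and balanced: "\<And>x c v. x \<in> carrier M \<Longrightarrow> c \<in> S \<Longrightarrow> v \<in> carrier N \<Longrightarrow> F (ra x c, v) = F (x, la c v)"
    and \<phi>: "\<And>h x v. h \<in> carrier A \<Longrightarrow> x \<in> carrier M \<Longrightarrow> v \<in> carrier N \<Longrightarrow>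
        Poly_Mapping.keys (\<phi> h (x, v)) \<subseteq> carrier M \<times> carrier N \<and> fext F (\<phi> h (x, v)) = h \<odot>\<^bsub>P\<^esub> F (x, v)"
    and n: "\<And>b c d. b \<in> B \<Longrightarrow> n b (c + d) - n b c - n b d \<in> Rel"
      "\<And>b c. b \<in> B \<Longrightarrow> Poly_Mapping.keys (n b c) \<subseteq> carrier M \<times> carrier N"
      "\<And>b c. b \<in> B \<Longrightarrow> fext F (n b c) = Poly_Mapping.single b c"
    and gen: "\<And>x v. frag_basis Rel B n \<Longrightarrow> x \<in> carrier M \<Longrightarrow> v \<in> carrier N \<Longrightarrow>
        frag_of (x, v) \<in> frag_basis.reach Rel B n"
  obtains f where "left_module A (balanced_tensor S M ra N la \<phi>)"
    "f \<in> module_hom A (balanced_tensor S M ra N la \<phi>) P"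
    "bij_betw f (carrier (balanced_tensor S M ra N la \<phi>)) (carrier P)"
    "\<And>x v. x \<in> carrier M \<Longrightarrow> v \<in> carrier N \<Longrightarrow>
      f (Rel #>\<^bsub>free_Abelian_group (carrier M \<times> carrier N)\<^esub> frag_of (x, v)) = F (x, v)"
proof -
  let ?X = "carrier M \<times> carrier N"
  let ?G = "free_Abelian_group ?X"
  let ?M = "free_module ?X \<phi>"
  interpret G: group ?G by (rule group_free_Abelian_group)
  define Gens where "Gens = {frag_of (x \<oplus>\<^bsub>M\<^esub> y, v) - frag_of (x, v) - frag_of (y, v) | x y v.
         x \<in> carrier M \<and> y \<in> carrier M \<and> v \<in> carrier N} \<union>
      {frag_of (x, v \<oplus>\<^bsub>N\<^esub> w) - frag_of (x, v) - frag_of (x, w) | x v w.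
         x \<in> carrier M \<and> v \<in> carrier N \<and> w \<in> carrier N} \<union>
      {frag_of (ra x c, v) - frag_of (x, la c v) | x c v.
         x \<in> carrier M \<and> c \<in> S \<and> v \<in> carrier N}"
  have Rel: "Rel = generate ?G Gens"
    by (simp add: Rel_def tensor_relations_def Gens_def)
  have keys_intros: "Poly_Mapping.keys (frag_of x) \<subseteq> ?X" if "x \<in> ?X" for x
    using that by simp
  have keys_diffs: "Poly_Mapping.keys (c - d) \<subseteq> ?X" if "Poly_Mapping.keys c \<subseteq> ?X" "Poly_Mapping.keys d \<subseteq> ?X" for c d
    using that keys_diff[of c d] by blast
  have Gens: "Gens \<subseteq> carrier ?G"
  proof
    fix c assume "c \<in> Gens"
    then have "Poly_Mapping.keys c \<subseteq> ?X"
      unfolding Gens_def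
      by (elim UnE CollectE exE conjE; hypsubst; intro keys_diffs keys_intros; simp add: closed)
    then show "c \<in> carrier ?G" by simp
  qed
  have Rel_sub: "subgroup Rel ?G" unfolding Rel by (rule G.generate_is_subgroup[OF Gens])
  have Rel_keys: "Poly_Mapping.keys c \<subseteq> ?X" if "c \<in> Rel" for c
    using subgroup.mem_carrier[OF Rel_sub that] by simp
  have fr: "frag_relations Rel"
  proof
    show "0 \<in> Rel" using subgroup.one_closed[OF Rel_sub] by simp
    show "c + d \<in> Rel" if "c \<in> Rel" "d \<in> Rel" for c d
      using subgroup.m_closed[OF Rel_sub that] by simp
    show "- c \<in> Rel" if "c \<in> Rel" for c
      using subgroup.m_inv_closed[OF Rel_sub that] Rel_keys[OF that] by simp
  qed
  interpret fb: frag_basis Rel B n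
    by (intro frag_basis.intro fr frag_basis_axioms.intro n)
  have kill: "fext F c = 0" if "c \<in> Rel" for c
    using that unfolding Rel
  proof (induction rule: generate.induct)
    case (incl h)
    then show ?case by (auto simp: Gens_def fext_diff biadd balanced)
  next
    case (inv h)
    then have "fext F h = 0" by (auto simp: Gens_def fext_diff biadd balanced)
    moreover have "Poly_Mapping.keys h \<subseteq> ?X" using subsetD[OF Gens inv(1)] by simp
    ultimately show ?case using fext_diff[of F 0 h] by simp
  qed (simp_all add: fext_add)
  have reach: "c \<in> fb.reach" if "Poly_Mapping.keys c \<subseteq> ?X" for c
    using that
  proof (induction c rule: frag_induction)
    case (one x)
    then show ?case using gen[OF fb.frag_basis_axioms] by (cases x) auto
  qed (auto intro: fb.reach_rel fb.zero fb.reach_diff)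
  have nsum_F: "fext F (nsum n f) = f" if "f \<in> vecs B" for f
    unfolding nsum_def fext_sum using that
    by (subst (2) poly_mapping_expand) (intro sum.cong, auto simp: n vecs_def)
  have nsum_keys: "Poly_Mapping.keys (nsum n f) \<subseteq> ?X" if "f \<in> vecs B" for f
    unfolding nsum_def using that n(2) by (intro order_trans[OF keys_sum]) (auto simp: vecs_def)
  \<comment> \<open>If \<open>F\<close> kills a word congruent to \<open>nsum n f\<close>, then
    \<open>f = 0\<close>, and the normal form of 0 is the empty word.\<close>
  have kernel: "Rel = {c \<in> carrier ?M. fext F c = \<zero>\<^bsub>P\<^esub>}"
  proof -
    have "c \<in> Rel" if c: "Poly_Mapping.keys c \<subseteq> ?X" "fext F c = 0" for c
    proof -
      from reach[OF c(1)] obtain f where f: "f \<in> vecs B" "c - nsum n f \<in> Rel"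
        by (auto simp: fb.reach_def)
      have "fext F c - fext F (nsum n f) = 0" using kill[OF f(2)] by (simp add: fext_diff)
      then have "f = 0" using c f by (simp add: nsum_F)
      then show ?thesis using f by (simp add: nsum_def)
    qed
    then show ?thesis using kill Rel_keys P(3) by (auto simp: free_module_def)
  qed
  have ab: "abelian_group ?M"
  proof (rule abelian_groupI)
    show "\<exists>y\<in>carrier ?M. y \<oplus>\<^bsub>?M\<^esub> x = \<zero>\<^bsub>?M\<^esub>" if "x \<in> carrier ?M" for x
      by (rule bexI[of _ "- x"]) (use that in \<open>auto simp: free_module_def\<close>)
  qed (auto simp: free_module_def algebra_simps dest: subsetD[OF keys_add])
  interpret P: left_module A P by fact
  have smult: "Poly_Mapping.keys (frag_extend (\<phi> h) c) \<subseteq> ?X \<and> fext F (frag_extend (\<phi> h) c) = h \<odot>\<^bsub>P\<^esub> fext F c"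
    if h: "h \<in> carrier A" and c: "Poly_Mapping.keys c \<subseteq> ?X" for h c
  proof
    show "Poly_Mapping.keys (frag_extend (\<phi> h) c) \<subseteq> ?X"
      using \<phi>[OF h] c by (intro order_trans[OF keys_frag_extend]) auto
    have P_diff: "h \<odot>\<^bsub>P\<^esub> (x - y) = h \<odot>\<^bsub>P\<^esub> x - h \<odot>\<^bsub>P\<^esub> y" if "x \<in> vecs B" "y \<in> vecs B" for x y
      using P.smult_r_distr[OF h, of "x - y" y] that by (simp add: P vecs_diff)
    have "Poly_Mapping.keys c \<subseteq> ?X \<and> fext F (frag_extend (\<phi> h) c) = h \<odot>\<^bsub>P\<^esub> fext F c"
      using c
    proof (induction c rule: frag_induction)
      case zero
      then show ?case using P_diff[of 0 0] by simp
    next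
      case (one x)
      then show ?case using \<phi>[OF h] by (cases x) auto
    next
      case (diff a b)
      have "fext F a \<in> vecs B" "fext F b \<in> vecs B" using diff into by (auto intro!: fext_in_vecs)
      then show ?case using diff keys_diff[of a b] by (auto simp: frag_extend_diff fext_diff P_diff)
    qed
    then show "fext F (frag_extend (\<phi> h) c) = h \<odot>\<^bsub>P\<^esub> fext F c" by simp
  qed
  have into': "fext F x \<in> carrier P" if "x \<in> carrier ?M" for x
    using that into by (auto simp: free_module_def P intro!: fext_in_vecs)
  have add': "fext F (x \<oplus>\<^bsub>?M\<^esub> y) = fext F x \<oplus>\<^bsub>P\<^esub> fext F y" for x y
    by (simp add: free_module_def fext_add P)
  have smult': "r \<odot>\<^bsub>?M\<^esub> x \<in> carrier ?M \<and> fext F (r \<odot>\<^bsub>?M\<^esub> x) = r \<odot>\<^bsub>P\<^esub> fext F x"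
    if "r \<in> carrier A" "x \<in> carrier ?M" for r x
    using smult that by (simp add: free_module_def)
  have surj': "\<exists>x\<in>carrier ?M. fext F x = y" if "y \<in> carrier P" for y
    using that nsum_F nsum_keys by (intro bexI[of _ "nsum n y"]) (auto simp: free_module_def P)
  obtain f where f: "left_module A (quot_module ?M Rel)" "f \<in> module_hom A (quot_module ?M Rel) P"
    "bij_betw f (carrier (quot_module ?M Rel)) (carrier P)"
    "\<And>x. x \<in> carrier ?M \<Longrightarrow> f (Rel +>\<^bsub>?M\<^esub> x) = fext F x"
    by (rule quot_module_miso[OF ab P(1) into' add' smult' surj' kernel]) blast+
  show thesis
  proof (rule that)
    fix x v assume "x \<in> carrier M" "v \<in> carrier N"
    then have "f (Rel +>\<^bsub>?M\<^esub> frag_of (x, v)) = F (x, v)"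
      using f(4)[of "frag_of (x, v)"] by (simp add: free_module_def)
    then show "f (Rel #>\<^bsub>?G\<^esub> frag_of (x, v)) = F (x, v)"
      by (simp add: a_r_coset_def r_coset_def free_module_def)
  qed (use f in \<open>simp_all add: balanced_tensor_def Rel_def\<close>)
qed

definition basis_tensor_act :: "('a \<Rightarrow> ('b \<Rightarrow>\<^sub>0 'k::field) \<Rightarrow> ('b \<Rightarrow>\<^sub>0 'k)) \<Rightarrow> ('a \<Rightarrow> ('c \<Rightarrow>\<^sub>0 'k) \<Rightarrow> ('c \<Rightarrow>\<^sub>0 'k))
    \<Rightarrow> ('a \<times> 'a \<Rightarrow>\<^sub>0 'k) \<Rightarrow> ('b \<times> 'c \<Rightarrow>\<^sub>0 'k) \<Rightarrow> ('b \<times> 'c \<Rightarrow>\<^sub>0 'k)"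
  where "basis_tensor_act op op' t f = lin_ext (\<lambda>(a, b). tens (op a) (op' b) f) t"

lemma module_tensor_miso:
  fixes A :: "('a \<Rightarrow>\<^sub>0 'k::field) ring" and V :: "('a \<Rightarrow>\<^sub>0 'k, 'v) module" and W :: "('a \<Rightarrow>\<^sub>0 'k, 'w) module"
    and B :: "'b set" and B' :: "'c set"
    and op :: "'a \<Rightarrow> ('b \<Rightarrow>\<^sub>0 'k) \<Rightarrow> ('b \<Rightarrow>\<^sub>0 'k)" and op' :: "'a \<Rightarrow> ('c \<Rightarrow>\<^sub>0 'k) \<Rightarrow> ('c \<Rightarrow>\<^sub>0 'k)"
  assumes A: "carrier A = vecs Bas" "\<one>\<^bsub>A\<^esub> = ev u" "u \<in> Bas"
    and V: "miso A V (cmod B op)" and W: "miso A W (cmod B' op')"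
    and u: "\<And>f. f \<in> vecs B \<Longrightarrow> op u f = f" "\<And>f. f \<in> vecs B' \<Longrightarrow> op' u f = f"
    and lin: "\<And>a. a \<in> Bas \<Longrightarrow> lin (op a)" "\<And>a. a \<in> Bas \<Longrightarrow> lin (op' a)"
    and \<Delta>: "\<And>h. h \<in> vecs Bas \<Longrightarrow> \<Delta> h \<in> vecs (Bas \<times> Bas)"
    and P: "left_module A (cmod (B \<times> B') op2)"
    and op2: "\<And>h f. h \<in> vecs Bas \<Longrightarrow> f \<in> vecs (B \<times> B') \<Longrightarrow>
      lin_ext (\<lambda>a. op2 a f) h = basis_tensor_act op op' (\<Delta> h) f"
  shows "miso A (module_tensor A \<Delta> V W) (cmod (B \<times> B') op2)"
proof -
  interpret V: left_module A V using V by (simp add: miso_def)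
  interpret W: left_module A W using W by (simp add: miso_def)
  obtain e where e: "e \<in> module_hom A V (cmod B op)" "bij_betw e (carrier V) (vecs B)"
    using V by (auto elim!: misoE)
  obtain e' where e': "e' \<in> module_hom A W (cmod B' op')" "bij_betw e' (carrier W) (vecs B')"
    using W by (auto elim!: misoE)
  define i where "i = inv_into (carrier V) e"
  define i' where "i' = inv_into (carrier W) e'"
  have i: "i \<in> module_hom A (cmod B op) V" and i': "i' \<in> module_hom A (cmod B' op') W"
    unfolding i_def i'_def using e e' V.left_module_axioms W.left_module_axioms
    by (auto intro: module_hom_inverse)
  have ei: "e (i f) = f" if "f \<in> vecs B" for f
    using that e(2) by (auto simp: i_def bij_betw_def f_inv_into_f)
  have ei': "e' (i' f) = f" if "f \<in> vecs B'" for f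
    using that e'(2) by (auto simp: i'_def bij_betw_def f_inv_into_f)
  have ie: "i (e v) = v" if "v \<in> carrier V" for v
    using that e(2) by (auto simp: i_def bij_betw_def)
  have ie': "i' (e' v) = v" if "v \<in> carrier W" for v
    using that e'(2) by (auto simp: i'_def bij_betw_def)
  note eD = module_homD[OF e(1), simplified] module_homD[OF e'(1), simplified]
  note iD = module_homD[OF i, simplified] module_homD[OF i', simplified]
  have scA: "scale c \<one>\<^bsub>A\<^esub> \<in> carrier A" for c by (simp add: A vecs_single)
  have e_scale: "e (scale c \<one>\<^bsub>A\<^esub> \<odot>\<^bsub>V\<^esub> v) = scale c (e v)" if "v \<in> carrier V" for c v
    using that eD(3)[OF scA[of c] that] by (simp add: A u eD(1))
  have e_scale': "e' (scale c \<one>\<^bsub>A\<^esub> \<odot>\<^bsub>W\<^esub> v) = scale c (e' v)" if "v \<in> carrier W" for c v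
    using that eD(6)[OF scA[of c] that] by (simp add: A u eD(4))
  have i_scale: "scale c \<one>\<^bsub>A\<^esub> \<odot>\<^bsub>V\<^esub> i f = i (scale c f)" if "f \<in> vecs B" for c f
    using iD(3)[OF scA[of c] that] that by (simp add: A u)
  have i_scale': "scale c \<one>\<^bsub>A\<^esub> \<odot>\<^bsub>W\<^esub> i' f = i' (scale c f)" if "f \<in> vecs B'" for c f
    using iD(6)[OF scA[of c] that] that by (simp add: A u)
  let ?ra = "\<lambda>v c. scale c \<one>\<^bsub>A\<^esub> \<odot>\<^bsub>V\<^esub> v" and ?la = "\<lambda>c w. scale c \<one>\<^bsub>A\<^esub> \<odot>\<^bsub>W\<^esub> w"
  let ?\<phi> = "\<lambda>h (v, w). \<Sum>(b, c)\<in>Poly_Mapping.keys (\<Delta> h).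
         frag_of (Poly_Mapping.single b (Poly_Mapping.lookup (\<Delta> h) (b, c)) \<odot>\<^bsub>V\<^esub> v,
                  Poly_Mapping.single c 1 \<odot>\<^bsub>W\<^esub> w)"
  let ?F = "\<lambda>(v, w). elem_tensor (e v) (e' w)"
  let ?R = "tensor_relations (UNIV :: 'k set) V ?ra W ?la"
  \<comment> \<open>Normal forms keep the scalar in the left factor; the balancing relation moves it
    there.\<close>
  let ?n = "\<lambda>(b, b') c. frag_of (i (Poly_Mapping.single b c), i' (ev b'))"
  have MT: "module_tensor A \<Delta> V W = balanced_tensor UNIV V ?ra W ?la ?\<phi>"
    by (simp add: module_tensor_def)
  show ?thesis
    unfolding MT
  proof (rule balanced_tensor_miso[OF P, where F = ?F and n = ?n and S = UNIV and M = V and N = W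
        and ra = ?ra and la = ?la and \<phi> = ?\<phi>])
    show "carrier (cmod (B \<times> B') op2) = vecs (B \<times> B')" "\<zero>\<^bsub>cmod (B \<times> B') op2\<^esub> = 0"
      "x \<oplus>\<^bsub>cmod (B \<times> B') op2\<^esub> y = x + y" for x y
      by simp_all
    show "x \<oplus>\<^bsub>V\<^esub> y \<in> carrier V" if "x \<in> carrier V" "y \<in> carrier V" for x y using that by simp
    show "x \<oplus>\<^bsub>W\<^esub> y \<in> carrier W" if "x \<in> carrier W" "y \<in> carrier W" for x y using that by simp
    show "?ra x c \<in> carrier V" if "x \<in> carrier V" for x c using that scA by (simp add: V.smult_closed)
    show "?la c x \<in> carrier W" if "x \<in> carrier W" for x c using that scA by (simp add: W.smult_closed)
    show "?F (x, v) \<in> vecs (B \<times> B')" if "x \<in> carrier V" "v \<in> carrier W" for x v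
      using that by (auto intro: elem_tensor_in_vecs eD)
    show "?F (x \<oplus>\<^bsub>V\<^esub> y, v) = ?F (x, v) + ?F (y, v)" if "x \<in> carrier V" "y \<in> carrier V" for x y v
      using that by (simp add: eD elem_tensor_add)
    show "?F (x, v \<oplus>\<^bsub>W\<^esub> w) = ?F (x, v) + ?F (x, w)" if "v \<in> carrier W" "w \<in> carrier W" for x v w
      using that by (simp add: eD elem_tensor_add)
    show "?F (?ra x c, v) = ?F (x, ?la c v)" if "x \<in> carrier V" "v \<in> carrier W" for x c v
      using that by (simp add: e_scale e_scale' elem_tensor_scale)
    show "Poly_Mapping.keys (?\<phi> h (x, v)) \<subseteq> carrier V \<times> carrier W \<and>
        fext ?F (?\<phi> h (x, v)) = h \<odot>\<^bsub>cmod (B \<times> B') op2\<^esub> ?F (x, v)"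
      if h: "h \<in> carrier A" and x: "x \<in> carrier V" and v: "v \<in> carrier W" for h x v
    proof
      have Bas: "b \<in> Bas" "c \<in> Bas" if "(b, c) \<in> Poly_Mapping.keys (\<Delta> h)" for b c
        using \<Delta>[of h] h that by (auto simp: A vecs_def)
      have sV: "Poly_Mapping.single b c \<in> carrier A" if "b \<in> Bas" for b c
        using that by (simp add: A vecs_single)
      show "Poly_Mapping.keys (?\<phi> h (x, v)) \<subseteq> carrier V \<times> carrier W"
        unfolding case_prod_conv
        by (rule order_trans[OF keys_sum]) (use x v in \<open>auto intro!: V.smult_closed W.smult_closed sV intro: Bas\<close>)
      have "fext ?F (?\<phi> h (x, v)) = (\<Sum>(b, c)\<in>Poly_Mapping.keys (\<Delta> h).
          elem_tensor (e (Poly_Mapping.single b (Poly_Mapping.lookup (\<Delta> h) (b, c)) \<odot>\<^bsub>V\<^esub> x))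
            (e' (Poly_Mapping.single c 1 \<odot>\<^bsub>W\<^esub> v)))"
        unfolding case_prod_conv fext_sum by (intro sum.cong) auto
      also have "\<dots> = (\<Sum>(b, c)\<in>Poly_Mapping.keys (\<Delta> h).
          scale (Poly_Mapping.lookup (\<Delta> h) (b, c)) (tens (op b) (op' c) (elem_tensor (e x) (e' v))))"
      proof (intro sum.cong refl, clarify)
        fix b c assume bc: "(b, c) \<in> Poly_Mapping.keys (\<Delta> h)"
        note bc = Bas[OF bc]
        have "e (Poly_Mapping.single b d \<odot>\<^bsub>V\<^esub> x) = scale d (op b (e x))" for d
          using eD(3)[OF sV[OF bc(1)] x] by simp
        moreover have "e' (ev c \<odot>\<^bsub>W\<^esub> v) = op' c (e' v)"
          using eD(6)[OF sV[OF bc(2)] v] by simp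
        ultimately show "elem_tensor (e (Poly_Mapping.single b (Poly_Mapping.lookup (\<Delta> h) (b, c)) \<odot>\<^bsub>V\<^esub> x))
            (e' (Poly_Mapping.single c 1 \<odot>\<^bsub>W\<^esub> v)) =
          scale (Poly_Mapping.lookup (\<Delta> h) (b, c)) (tens (op b) (op' c) (elem_tensor (e x) (e' v)))"
          using bc by (simp add: tens_elem_tensor lin elem_tensor_scale)
      qed
      also have "\<dots> = basis_tensor_act op op' (\<Delta> h) (elem_tensor (e x) (e' v))"
        unfolding basis_tensor_act_def lin_ext_def by (intro sum.cong) auto
      also have "\<dots> = h \<odot>\<^bsub>cmod (B \<times> B') op2\<^esub> ?F (x, v)"
        using op2[of h "elem_tensor (e x) (e' v)"] h x v by (simp add: A elem_tensor_in_vecs eD)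
      finally show "fext ?F (?\<phi> h (x, v)) = h \<odot>\<^bsub>cmod (B \<times> B') op2\<^esub> ?F (x, v)" .
    qed
    show "?n b (c + d) - ?n b c - ?n b d \<in> ?R" if "b \<in> B \<times> B'" for b and c d :: 'k
      using that tensor_relations_intros(1)[where M = V and N = W and S = UNIV and ra = ?ra and la = ?la
          and x = "i (Poly_Mapping.single (fst b) c)" and y = "i (Poly_Mapping.single (fst b) d)" and v = "i' (ev (snd b))"]
      by (auto simp: single_add iD vecs_single)
    show "Poly_Mapping.keys (?n b c) \<subseteq> carrier V \<times> carrier W" if "b \<in> B \<times> B'" for b and c :: 'k
      using that by (auto simp: iD vecs_single)
    show "fext ?F (?n b c) = Poly_Mapping.single b c" if "b \<in> B \<times> B'" for b c
      using that by (auto simp: ei ei' vecs_single)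
    show "frag_of (x, v) \<in> frag_basis.reach ?R (B \<times> B') ?n"
      if fb: "frag_basis ?R (B \<times> B') ?n" and x: "x \<in> carrier V" and v: "v \<in> carrier W" for x v
    proof -
      interpret fb: frag_basis ?R "B \<times> B'" ?n by fact
      note rels = tensor_relations_intros[where M = V and N = W and S = UNIV and ra = ?ra and la = ?la]
      have sumI: "frag_of z \<in> fb.reach" if "frag_of z - frag_of z1 - frag_of z2 \<in> ?R"
        "frag_of z1 \<in> fb.reach" "frag_of z2 \<in> fb.reach" for z z1 z2
        by (rule fb.reach_equiv[OF fb.reach_add[OF that(2,3)]]) (use that in \<open>simp add: diff_diff_eq\<close>)
      \<comment> \<open>The biadditive relation for \<open>0 = 0 + 0\<close> has the shape
        \<open>z - z - z\<close>, so the generator \<open>z\<close> is itself a relation.\<close>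
      have zeroI: "frag_of z \<in> fb.reach" if "frag_of z - frag_of z - frag_of z \<in> ?R" for z
        using fb.neg[OF that] by (intro fb.reach_rel) simp
      have basis: "frag_of (i (Poly_Mapping.single b c), i' g) \<in> fb.reach" if b: "b \<in> B" and g: "g \<in> vecs B'" for b c g
        using g
      proof (induction g rule: vecs_induct)
        case zero
        show ?case using rels(2)[of "i (Poly_Mapping.single b c)" "i' 0" "i' 0"] b iD(5)[of 0 0]
          by (intro zeroI) (simp add: iD vecs_single)
      next
        case (add f g)
        show ?case using rels(2)[of "i (Poly_Mapping.single b c)" "i' f" "i' g"] b add
          by (intro sumI[OF _ add(3,4)]) (simp add: iD vecs_single)
      next
        case (single b' d)
        have "frag_of (i (Poly_Mapping.single b (d * c)), i' (ev b')) \<in> fb.reach"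
          using fb.reach_basis[of "(b, b')" "d * c"] b single by simp
        moreover have "frag_of (i (Poly_Mapping.single b (d * c)), i' (ev b'))
            - frag_of (i (Poly_Mapping.single b c), i' (Poly_Mapping.single b' d)) \<in> ?R"
          using rels(3)[of "i (Poly_Mapping.single b c)" "i' (ev b')" d] b single
          by (simp add: i_scale i_scale' vecs_single iD)
        ultimately show ?case
          using fb.neg by (intro fb.reach_equiv[of _ "frag_of (i (Poly_Mapping.single b c), i' (Poly_Mapping.single b' d))"]) force+
      qed
      have "frag_of (i f, i' g) \<in> fb.reach" if f: "f \<in> vecs B" and g: "g \<in> vecs B'" for f g
        using f
      proof (induction f rule: vecs_induct)
        case zero
        show ?case using rels(1)[of "i 0" "i' g" "i 0"] g iD(2)[of 0 0]
          by (intro zeroI) (simp add: iD)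
      next
        case (add f f')
        show ?case using rels(1)[of "i f" "i' g" "i f'"] g add
          by (intro sumI[OF _ add(3,4)]) (simp add: iD)
      qed (intro basis g)
      from this[of "e x" "e' v"] show ?thesis using x v by (simp add: ie ie' eD)
    qed
  qed (auto intro: misoI P)
qed

lemma lin_basis_tensor_act: "lin (\<lambda>t. basis_tensor_act op op' t f)"
  unfolding basis_tensor_act_def by (rule lin_lin_ext)

lemma lin_basis_tensor_act_right: "lin (basis_tensor_act op op' t)"
  unfolding basis_tensor_act_def by (intro lin_ext_fun_lin) (auto simp: split_beta lin_tens)

lemma basis_tensor_act_elem:
  "basis_tensor_act op op' (elem_tensor r r') f =
    lin_ext (\<lambda>a. lin_ext (\<lambda>b. tens (op a) (op' b) f) r') r"
proof (rule bilin_eqI[of r UNIV r' UNIV])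
  show "lin (\<lambda>r. basis_tensor_act op op' (elem_tensor r r') f)" for r'
    by (rule lin_comp(2)[OF lin_basis_tensor_act elem_tensor_lin(2)])
  show "lin (\<lambda>r'. basis_tensor_act op op' (elem_tensor r r') f)" for r
    by (rule lin_comp(2)[OF lin_basis_tensor_act elem_tensor_lin(1)])
  show "lin (\<lambda>r. lin_ext (\<lambda>a. lin_ext (\<lambda>b. tens (op a) (op' b) f) r') r)" for r'
    by (rule lin_lin_ext)
  show "lin (\<lambda>r'. lin_ext (\<lambda>a. lin_ext (\<lambda>b. tens (op a) (op' b) f) r') r)" for r
    by (intro lin_ext_fun_lin lin_lin_ext)
qed (auto simp: basis_tensor_act_def)

text \<open>The tensor product is a module over the tensor square; this is what turns powers of
  \<open>x \<otimes> a + 1 \<otimes> x\<close> into powers of a single operator. By bilinearity it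
  suffices to multiply pure tensors of basis elements, where both sides split into the two
  factors.\<close>

lemma basis_tensor_act_mult:
  fixes m :: "'a \<Rightarrow> 'a \<Rightarrow> ('a \<Rightarrow>\<^sub>0 'k::field)"
  defines "mT \<equiv> \<lambda>(b, b') (c, c'). elem_tensor (m b c) (m b' c')"
  assumes lin: "\<And>a. a \<in> A \<Longrightarrow> lin (op a)" "\<And>a. a \<in> A \<Longrightarrow> lin (op' a)"
    and closed: "\<And>a f. a \<in> A \<Longrightarrow> f \<in> vecs B \<Longrightarrow> op a f \<in> vecs B"
      "\<And>a f. a \<in> A \<Longrightarrow> f \<in> vecs B' \<Longrightarrow> op' a f \<in> vecs B'"
    and mult: "\<And>a b f. a \<in> A \<Longrightarrow> b \<in> A \<Longrightarrow> f \<in> vecs B \<Longrightarrow> lin_ext (\<lambda>c. op c f) (m a b) = op a (op b f)"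
      "\<And>a b f. a \<in> A \<Longrightarrow> b \<in> A \<Longrightarrow> f \<in> vecs B' \<Longrightarrow> lin_ext (\<lambda>c. op' c f) (m a b) = op' a (op' b f)"
    and t: "t \<in> vecs (A \<times> A)" "t' \<in> vecs (A \<times> A)" and f: "f \<in> vecs (B \<times> B')"
  shows "basis_tensor_act op op' (bilin_ext mT t t') f = basis_tensor_act op op' t (basis_tensor_act op op' t' f)"
proof (rule bilin_eqI[OF t])
  let ?act = "basis_tensor_act op op'"
  show "lin (\<lambda>t. ?act (bilin_ext mT t t') f)" for t'
    by (rule lin_comp(2)[OF lin_basis_tensor_act bilin_ext_lin_left])
  show "lin (\<lambda>t'. ?act (bilin_ext mT t t') f)" for t
    by (rule lin_comp(2)[OF lin_basis_tensor_act bilin_ext_lin_right])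
  show "lin (\<lambda>t. ?act t (?act t' f))" for t'
    by (rule lin_basis_tensor_act)
  show "lin (\<lambda>t'. ?act t (?act t' f))" for t
    by (rule lin_comp(2)[OF lin_basis_tensor_act_right lin_basis_tensor_act])
  fix x y assume "x \<in> A \<times> A" "y \<in> A \<times> A"
  then obtain b b' c c' where [simp]: "x = (b, b')" "y = (c, c')" and A: "b \<in> A" "b' \<in> A" "c \<in> A" "c' \<in> A" by auto
  have "?act (elem_tensor (m b c) (m b' c')) f = tens (op b) (op' b') (tens (op c) (op' c') f)"
  proof (rule tens_eqI[OF f lin_basis_tensor_act_right])
    show "lin (\<lambda>f. tens (op b) (op' b') (tens (op c) (op' c') f))"
      by (rule lin_comp(2)[OF lin_tens lin_tens])
    fix v w assume vw: "v \<in> B" "w \<in> B'"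
    define h where "h = (\<lambda>a. op a (ev v))"
    define h' where "h' = (\<lambda>a. op' a (ev w))"
    have "?act (elem_tensor (m b c) (m b' c')) (elem_tensor (ev v) (ev w)) =
        lin_ext (\<lambda>a. lin_ext (\<lambda>b. elem_tensor (h a) (h' b)) (m b' c')) (m b c)"
      by (simp add: basis_tensor_act_elem h_def h'_def)
    also have "\<dots> = lin_ext (\<lambda>a. elem_tensor (h a) (lin_ext h' (m b' c'))) (m b c)"
      by (simp add: lin_comp_lin_ext[OF elem_tensor_lin(1)])
    also have "\<dots> = elem_tensor (lin_ext h (m b c)) (lin_ext h' (m b' c'))"
      by (simp add: lin_comp_lin_ext[OF elem_tensor_lin(2)])
    also have "\<dots> = elem_tensor (op b (op c (ev v))) (op' b' (op' c' (ev w)))"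
      unfolding h_def h'_def using A vw by (simp add: mult vecs_single)
    also have "\<dots> = tens (op b) (op' b') (tens (op c) (op' c') (elem_tensor (ev v) (ev w)))"
      using A by (simp add: tens_elem_tensor lin)
    finally show "?act (elem_tensor (m b c) (m b' c')) (elem_tensor (ev v) (ev w)) =
        tens (op b) (op' b') (tens (op c) (op' c') (elem_tensor (ev v) (ev w)))" .
  qed
  then show "?act (bilin_ext mT (ev x) (ev y)) f = ?act (ev x) (?act (ev y) f)"
    by (simp add: mT_def basis_tensor_act_def)
qed

lemma (in group) grep_tens:
  assumes "grep G B \<rho>" "grep G B' \<rho>'"
  shows "grep G (B \<times> B') (\<lambda>g. tens (\<rho> g) (\<rho>' g))"
  unfolding grep_def
proof (intro conjI ballI)
  note r = grepD[OF assms(1)] and r' = grepD[OF assms(2)]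
  show "lin (tens (\<rho> g) (\<rho>' g))" for g by (rule lin_tens)
  show "tens (\<rho> g) (\<rho>' g) f \<in> vecs (B \<times> B')" if "g \<in> carrier G" "f \<in> vecs (B \<times> B')" for g f
    using that by (intro tens_in_vecs[OF that(2)] r r' vecs_single)
  show "tens (\<rho> (g \<otimes> h)) (\<rho>' (g \<otimes> h)) f = tens (\<rho> g) (\<rho>' g) (tens (\<rho> h) (\<rho>' h) f)"
    if "g \<in> carrier G" "h \<in> carrier G" "f \<in> vecs (B \<times> B')" for g h f
    unfolding tens_comp[OF r(1)[OF that(1)] r'(1)[OF that(1)]]
    using that by (intro tens_cong[OF that(3)]) (simp_all add: r r' vecs_single)
  show "tens (\<rho> \<one>) (\<rho>' \<one>) f = f" if "f \<in> vecs (B \<times> B')" for f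
  proof -
    have "tens (\<rho> \<one>) (\<rho>' \<one>) f = tens (\<lambda>x. x) (\<lambda>x. x) f"
      by (intro tens_cong[OF that]) (simp_all add: r r' vecs_single)
    then show ?thesis by (simp add: tens_id)
  qed
qed

lemma (in group) group_tensor_miso:
  fixes V :: "('a \<Rightarrow>\<^sub>0 'k::field, 'v) module" and W :: "('a \<Rightarrow>\<^sub>0 'k, 'w) module"
  assumes V: "miso (group_algebra G) V (cmod B \<rho>)" "grep G B \<rho>"
    and W: "miso (group_algebra G) W (cmod B' \<rho>')" "grep G B' \<rho>'"
  shows "miso (group_algebra G) (module_tensor (group_algebra G) group_comult V W)
    (cmod (B \<times> B') (\<lambda>g. tens (\<rho> g) (\<rho>' g)))"
proof (rule module_tensor_miso[OF _ _ _ V(1) W(1)])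
  show "carrier (group_algebra G) = vecs (carrier G)" "\<one>\<^bsub>group_algebra G\<^esub> = ev \<one>" "\<one> \<in> carrier G"
    by (simp_all add: group_algebra_simps)
  show "group_comult h \<in> vecs (carrier G \<times> carrier G)" if "h \<in> vecs (carrier G)" for h :: "'a \<Rightarrow>\<^sub>0 'k"
    unfolding group_comult_def using that by (rule lin_ext_in_vecs) (auto intro: vecs_single)
  show "left_module (group_algebra G) (cmod (B \<times> B') (\<lambda>g. tens (\<rho> g) (\<rho>' g)))"
    by (intro grep_left_module grep_tens V W)
  show "lin_ext (\<lambda>a. tens (\<rho> a) (\<rho>' a) f) h = basis_tensor_act \<rho> \<rho>' (group_comult h) f" for h f
    by (simp add: basis_tensor_act_def group_comult_def lin_ext_lin_ext)
qed (simp_all add: grepD[OF V(2)] grepD[OF W(2)])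

lemma cmod_intertwine:
  assumes "lin P" "r \<in> vecs A" "\<And>a. a \<in> A \<Longrightarrow> P (op a f) = op' a (P f)"
  shows "P (lin_ext (\<lambda>a. op a f) r) = lin_ext (\<lambda>a. op' a (P f)) r"
  unfolding lin_comp_lin_ext[OF assms(1)] by (rule lin_ext_vecs_cong[OF assms(2)]) (rule assms(3))

lemma hop_intertwine:
  fixes Y :: "('b \<Rightarrow>\<^sub>0 'k::field) \<Rightarrow> ('b \<Rightarrow>\<^sub>0 'k)"
  assumes "\<And>f. f \<in> vecs B \<Longrightarrow> Y f \<in> vecs B" "\<And>f. f \<in> vecs B \<Longrightarrow> P (Y f) = Y' (P f)"
    and "\<And>f. f \<in> vecs B \<Longrightarrow> P (\<rho> g f) = \<rho>' g (P f)" "f \<in> vecs B"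
  shows "P (hop \<rho> Y (g, i) f) = hop \<rho>' Y' (g, i) (P f)"
proof -
  have "P ((Y ^^ i) f) = (Y' ^^ i) (P f)"
    by (induction i) (simp_all add: assms funpow_vecs)
  then show ?thesis by (simp add: hop_pair assms funpow_vecs)
qed

lemma hmod_intertwine:
  fixes Y :: "('b \<Rightarrow>\<^sub>0 'k::field) \<Rightarrow> ('b \<Rightarrow>\<^sub>0 'k)" and Y' :: "('c \<Rightarrow>\<^sub>0 'k) \<Rightarrow> ('c \<Rightarrow>\<^sub>0 'k)"
  assumes "lin P" "r \<in> vecs (C \<times> UNIV)"
    "\<And>f. f \<in> vecs B \<Longrightarrow> Y f \<in> vecs B" "\<And>f. f \<in> vecs B \<Longrightarrow> P (Y f) = Y' (P f)"
    "\<And>g f. g \<in> C \<Longrightarrow> f \<in> vecs B \<Longrightarrow> P (\<rho> g f) = \<rho>' g (P f)" "f \<in> vecs B"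
  shows "P (lin_ext (\<lambda>b. hop \<rho> Y b f) r) = lin_ext (\<lambda>b. hop \<rho>' Y' b (P f)) r"
  by (rule cmod_intertwine[OF assms(1,2)]) (use assms in \<open>auto intro!: hop_intertwine[where B = B]\<close>)

section \<open>Tensor products of modules over the Hopf algebra\<close>

context ore_setting
begin

abbreviation "mH \<equiv> \<lambda>(g, i) (h, j). Poly_Mapping.single (g \<otimes> h, i + j) (\<tau> h ^ i)"
abbreviation "mT \<equiv> \<lambda>(b, b') (c, c'). elem_tensor (mH b c) (mH b' c')"

lemma tensor_square_H:
  "tensor_square (carrier G \<times> UNIV) H =
    based_algebra ((carrier G \<times> UNIV) \<times> (carrier G \<times> UNIV)) mT (elem_tensor (ev (\<one>, 0)) (ev (\<one>, 0)))"
proof -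
  have "(\<lambda>(b, b') (c, c'). elem_tensor (ev b \<otimes>\<^bsub>H\<^esub> ev c) (ev b' \<otimes>\<^bsub>H\<^esub> ev c')) = mT"
    by (auto simp: fun_eq_iff ore_algebra_simps)
  then show ?thesis by (simp add: tensor_square_def ore_algebra_simps)
qed

lemma mT_closed:
  "b \<in> (carrier G \<times> UNIV) \<times> (carrier G \<times> UNIV) \<Longrightarrow> c \<in> (carrier G \<times> UNIV) \<times> (carrier G \<times> UNIV) \<Longrightarrow>
    mT b c \<in> vecs ((carrier G \<times> UNIV) \<times> (carrier G \<times> UNIV))"
  by (auto intro!: elem_tensor_in_vecs vecs_single simp del: elem_tensor_single)

lemma hop_facts:
  assumes h: "hrep G \<tau> B \<rho> Y"
  shows "b \<in> carrier G \<times> UNIV \<Longrightarrow> lin (hop \<rho> Y b)"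
    and "b \<in> carrier G \<times> UNIV \<Longrightarrow> f \<in> vecs B \<Longrightarrow> hop \<rho> Y b f \<in> vecs B"
    and "b \<in> carrier G \<times> UNIV \<Longrightarrow> c \<in> carrier G \<times> UNIV \<Longrightarrow> f \<in> vecs B \<Longrightarrow>
      lin_ext (\<lambda>b. hop \<rho> Y b f) (mH b c) = hop \<rho> Y b (hop \<rho> Y c f)"
    and "f \<in> vecs B \<Longrightarrow> hop \<rho> Y (\<one>, i) f = (Y ^^ i) f"
proof -
  note g = grepD[OF hrepD(1)[OF h]]
  have X: "(Y ^^ i) f \<in> vecs B" if "f \<in> vecs B" for f i
    by (rule funpow_vecs[OF hrepD(3)[OF h] that])
  show "lin (hop \<rho> Y b)" if "b \<in> carrier G \<times> UNIV"
    using that lin_comp(2)[OF g(1) lin_funpow[OF hrepD(2)[OF h]]] by (auto simp: hop_pair)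
  show "hop \<rho> Y b f \<in> vecs B" if "b \<in> carrier G \<times> UNIV" "f \<in> vecs B"
    using that by (auto simp: hop_def intro: g X)
  show "lin_ext (\<lambda>b. hop \<rho> Y b f) (mH b c) = hop \<rho> Y b (hop \<rho> Y c f)"
    if "b \<in> carrier G \<times> UNIV" "c \<in> carrier G \<times> UNIV" "f \<in> vecs B"
    using that by (auto simp: hop_def hrep_pow[OF h] X g funpow_add lin_scale[OF g(1)])
  show "hop \<rho> Y (\<one>, i) f = (Y ^^ i) f" if "f \<in> vecs B"
    using that by (simp add: hop_pair g X)
qed

text \<open>The operator through which \<open>\<Delta>(x) = x \<otimes> a + 1 \<otimes> x\<close>
  acts.\<close>

definition tvar :: "'a \<Rightarrow> (('x \<Rightarrow>\<^sub>0 'k) \<Rightarrow> ('x \<Rightarrow>\<^sub>0 'k)) \<Rightarrow> ('a \<Rightarrow> ('y \<Rightarrow>\<^sub>0 'k) \<Rightarrow> ('y \<Rightarrow>\<^sub>0 'k)) \<Rightarrow> (('y \<Rightarrow>\<^sub>0 'k) \<Rightarrow> ('y \<Rightarrow>\<^sub>0 'k))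
    \<Rightarrow> ('x \<times> 'y \<Rightarrow>\<^sub>0 'k) \<Rightarrow> ('x \<times> 'y \<Rightarrow>\<^sub>0 'k)"
  where "tvar a Y \<rho>' Y' f = tens Y (\<rho>' a) f + tens (\<lambda>x. x) Y' f"

lemma hrep_tensor:
  fixes B :: "'x set" and B' :: "'y set"
  assumes h: "hrep G \<tau> B \<rho> Y" and h': "hrep G \<tau> B' \<rho>' Y'" and a: "a \<in> group_center G"
  shows "hrep G \<tau> (B \<times> B') (\<lambda>g. tens (\<rho> g) (\<rho>' g)) (tvar a Y \<rho>' Y')"
  unfolding hrep_def
proof (intro conjI ballI)
  note g = grepD[OF hrepD(1)[OF h]] and g' = grepD[OF hrepD(1)[OF h']]
  note y = hrepD[OF h] and y' = hrepD[OF h']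
  have aG: "a \<in> carrier G" and comm: "b \<in> carrier G \<Longrightarrow> a \<otimes> b = b \<otimes> a" for b
    using a by (auto simp: group_center_def)
  show "grep G (B \<times> B') (\<lambda>g. tens (\<rho> g) (\<rho>' g))" by (intro grep_tens y(1) y'(1))
  show "lin (tvar a Y \<rho>' Y')" unfolding tvar_def by (intro lin_plus lin_tens)
  show "tvar a Y \<rho>' Y' f \<in> vecs (B \<times> B')" if "f \<in> vecs (B \<times> B')" for f
    unfolding tvar_def using that aG
    by (intro vecs_add tens_in_vecs[OF that]) (auto intro: g' y y' vecs_single)
  fix b and f :: "'x \<times> 'y \<Rightarrow>\<^sub>0 'k" assume b: "b \<in> carrier G" and f: "f \<in> vecs (B \<times> B')"
  show "tvar a Y \<rho>' Y' (tens (\<rho> b) (\<rho>' b) f) = scale (\<tau> b) (tens (\<rho> b) (\<rho>' b) (tvar a Y \<rho>' Y' f))"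
  proof (rule tens_eqI[OF f])
    show "lin (\<lambda>f. tvar a Y \<rho>' Y' (tens (\<rho> b) (\<rho>' b) f))"
      unfolding tvar_def by (intro lin_plus lin_comp(2)[OF lin_tens lin_tens])
    show "lin (\<lambda>f. scale (\<tau> b) (tens (\<rho> b) (\<rho>' b) (tvar a Y \<rho>' Y' f)))"
      unfolding tvar_def by (intro lin_scaleI lin_comp(2)[OF lin_tens] lin_plus lin_tens)
    fix c d assume cd: "c \<in> B" "d \<in> B'"
    \<comment> \<open>Here the centrality of \<open>a\<close> enters: the summand
      \<open>x \<otimes> a\<close> commutes with \<open>b \<otimes> b\<close> up to the scalar
      \<open>\<tau> b\<close> because \<open>a\<close> commutes with \<open>b\<close>.\<close>
    have "\<rho>' a (\<rho>' b (ev d)) = \<rho>' b (\<rho>' a (ev d))"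
      using g'(3)[OF aG b, of "ev d"] g'(3)[OF b aG, of "ev d"] cd comm[OF b] by (simp add: vecs_single)
    then show "tvar a Y \<rho>' Y' (tens (\<rho> b) (\<rho>' b) (elem_tensor (ev c) (ev d))) =
        scale (\<tau> b) (tens (\<rho> b) (\<rho>' b) (tvar a Y \<rho>' Y' (elem_tensor (ev c) (ev d))))"
      using cd b aG
      by (simp add: tvar_def tens_elem_tensor g g' y(2,4) y'(2,4) lin_id vecs_single elem_tensor_scale
          scale_add_right lin_add[OF lin_tens])
  qed
qed

lemma ore_tensor_miso:
  fixes V :: "('a \<times> nat \<Rightarrow>\<^sub>0 'k, 'v) module" and W :: "('a \<times> nat \<Rightarrow>\<^sub>0 'k, 'w) module"
  assumes V: "miso H V (hmod B \<rho> Y)" and h: "hrep G \<tau> B \<rho> Y"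
    and W: "miso H W (hmod B' \<rho>' Y')" and h': "hrep G \<tau> B' \<rho>' Y'"
    and a: "a \<in> group_center G"
  shows "miso H (module_tensor H (ore_comult G \<tau> a) V W)
    (hmod (B \<times> B') (\<lambda>g. tens (\<rho> g) (\<rho>' g)) (tvar a Y \<rho>' Y'))"
proof -
  let ?A = "carrier G \<times> (UNIV :: nat set)"
  let ?T = "tensor_square ?A H"
  let ?act = "basis_tensor_act (hop \<rho> Y) (hop \<rho>' Y')"
  let ?\<rho> = "\<lambda>g. tens (\<rho> g) (\<rho>' g)" and ?Y = "tvar a Y \<rho>' Y'"
  note hf = hop_facts[OF h] and hf' = hop_facts[OF h']
  note h2 = hrep_tensor[OF h h' a]
  have aG: "a \<in> carrier G" using a by (auto simp: group_center_def)
  define D where "D = elem_tensor (ore_var G) (ore_grp a) + elem_tensor \<one>\<^bsub>H\<^esub> (ore_var G)"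
  define \<Delta> where "\<Delta> = (\<lambda>(g, i). elem_tensor (ore_grp g) (ore_grp g) \<otimes>\<^bsub>?T\<^esub> D [^]\<^bsub>?T\<^esub> (i::nat))"
  have comult: "ore_comult G \<tau> a = lin_ext \<Delta>"
    by (simp add: ore_comult_def \<Delta>_def D_def Let_def)
  have Tmult: "x \<otimes>\<^bsub>?T\<^esub> y = bilin_ext mT x y" for x y by (simp add: tensor_square_H)
  have Tone: "\<one>\<^bsub>?T\<^esub> = elem_tensor (ev (\<one>, 0)) (ev (\<one>, 0))" by (simp add: tensor_square_H)
  have Tclosed: "x \<otimes>\<^bsub>?T\<^esub> y \<in> vecs (?A \<times> ?A)" if "x \<in> vecs (?A \<times> ?A)" "y \<in> vecs (?A \<times> ?A)" for x y
    unfolding Tmult using that by (rule bilin_ext_in_vecs) (rule mT_closed)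
  have D: "D \<in> vecs (?A \<times> ?A)"
    unfolding D_def ore_var_def ore_grp_def ore_algebra_simps
    using aG by (intro vecs_add elem_tensor_in_vecs vecs_single) auto
  \<comment> \<open>The comultiplication is defined by powers in the tensor square; their recursion
    lets the action be computed one factor at a time.\<close>
  have Dpow_Suc: "D [^]\<^bsub>?T\<^esub> Suc i = D [^]\<^bsub>?T\<^esub> i \<otimes>\<^bsub>?T\<^esub> D" and Dpow_0: "D [^]\<^bsub>?T\<^esub> (0::nat) = \<one>\<^bsub>?T\<^esub>" for i
    by (simp_all add: nat_pow_def)
  have Dpow: "D [^]\<^bsub>?T\<^esub> i \<in> vecs (?A \<times> ?A)" for i :: nat
  proof (induction i)
    case 0
    show ?case unfolding Dpow_0 Tone by (intro elem_tensor_in_vecs vecs_single) auto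
  next
    case (Suc i)
    show ?case unfolding Dpow_Suc by (intro Tclosed Suc D)
  qed
  have grp: "elem_tensor (ore_grp g) (ore_grp g) \<in> vecs (?A \<times> ?A)" if "g \<in> carrier G" for g
    using that unfolding ore_grp_def by (intro elem_tensor_in_vecs vecs_single) auto
  have \<Delta>: "\<Delta> b \<in> vecs (?A \<times> ?A)" if "b \<in> ?A" for b
    using that by (auto simp: \<Delta>_def intro!: Tclosed grp Dpow)
  have act_mult: "?act (x \<otimes>\<^bsub>?T\<^esub> y) f = ?act x (?act y f)"
    if "x \<in> vecs (?A \<times> ?A)" "y \<in> vecs (?A \<times> ?A)" "f \<in> vecs (B \<times> B')" for x y f
    unfolding Tmult by (rule basis_tensor_act_mult[OF hf(1) hf'(1) hf(2) hf'(2) hf(3) hf'(3) that])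
  have act_D: "?act D f = ?Y f" if f: "f \<in> vecs (B \<times> B')" for f
  proof -
    have "?act D f = tens (hop \<rho> Y (\<one>, 1)) (hop \<rho>' Y' (a, 0)) f + tens (hop \<rho> Y (\<one>, 0)) (hop \<rho>' Y' (\<one>, 1)) f"
      unfolding D_def lin_add[OF lin_basis_tensor_act] ore_var_def ore_grp_def ore_algebra_simps
      by (simp add: basis_tensor_act_elem del: elem_tensor_single)
    also have "\<dots> = ?Y f"
      unfolding tvar_def
      by (intro arg_cong2[where f = "(+)"] tens_cong[OF f]) (simp_all add: hf(4) hf'(4) vecs_single hop_pair[of _ _ a])
    finally show ?thesis .
  qed
  have Y_closed: "?Y f \<in> vecs (B \<times> B')" if "f \<in> vecs (B \<times> B')" for f
    using hrepD(3)[OF h2 that] .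
  have act_Dpow: "?act (D [^]\<^bsub>?T\<^esub> i) f = (?Y ^^ i) f" if f: "f \<in> vecs (B \<times> B')" for f i
    using f
  proof (induction i arbitrary: f)
    case 0
    have "?act \<one>\<^bsub>?T\<^esub> f = tens (hop \<rho> Y (\<one>, 0)) (hop \<rho>' Y' (\<one>, 0)) f"
      unfolding Tone by (simp add: basis_tensor_act_elem del: elem_tensor_single)
    also have "\<dots> = tens (\<lambda>x. x) (\<lambda>x. x) f"
      by (intro tens_cong[OF 0]) (simp_all add: hf(4) hf'(4) vecs_single)
    finally show ?case by (simp add: Dpow_0 tens_id)
  next
    case (Suc i)
    show ?case unfolding Dpow_Suc act_mult[OF Dpow D Suc(2)] act_D[OF Suc(2)]
      using Suc(1)[OF Y_closed[OF Suc(2)]] by (simp only: funpow_Suc_right o_apply)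
  qed
  show ?thesis
  proof (rule module_tensor_miso[where Bas = ?A and u = "(\<one>, 0)", OF _ _ _ V W])
    show "ore_comult G \<tau> a x \<in> vecs (?A \<times> ?A)" if "x \<in> vecs ?A" for x
      unfolding comult using that \<Delta> by (rule lin_ext_in_vecs)
    show "left_module H (hmod (B \<times> B') ?\<rho> ?Y)" by (rule hrep_left_module[OF h2])
    show "lin_ext (\<lambda>b. hop ?\<rho> ?Y b f) x = ?act (ore_comult G \<tau> a x) f"
      if x: "x \<in> vecs ?A" and f: "f \<in> vecs (B \<times> B')" for x f
    proof (rule lin_eqI[OF x lin_lin_ext])
      show "lin (\<lambda>x. ?act (ore_comult G \<tau> a x) f)"
        unfolding comult by (rule lin_comp(2)[OF lin_basis_tensor_act lin_lin_ext])
      fix b assume b: "b \<in> ?A"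
      then obtain g i where [simp]: "b = (g, i)" and g: "g \<in> carrier G" by auto
      have Yf: "(?Y ^^ i) f \<in> vecs (B \<times> B')" by (rule funpow_vecs[OF Y_closed f])
      have "?act (\<Delta> b) f = ?act (elem_tensor (ore_grp g) (ore_grp g)) ((?Y ^^ i) f)"
        by (simp add: \<Delta>_def act_mult grp g Dpow f act_Dpow)
      also have "\<dots> = tens (hop \<rho> Y (g, 0)) (hop \<rho>' Y' (g, 0)) ((?Y ^^ i) f)"
        unfolding ore_grp_def by (simp add: basis_tensor_act_elem del: elem_tensor_single)
      also have "\<dots> = ?\<rho> g ((?Y ^^ i) f)"
        by (intro tens_cong[OF Yf]) (simp_all add: hop_pair)
      finally show "lin_ext (\<lambda>b. hop ?\<rho> ?Y b f) (ev b) = ?act (ore_comult G \<tau> a (ev b)) f"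
        by (simp add: comult hop_pair)
    qed
  qed (auto simp: ore_algebra_simps hf hf')
qed

end

section \<open>Graded modules over the polynomial ring\<close>

text \<open>A \<open>k[x]\<close>-module with basis \<open>S\<close> on which \<open>x\<close> acts by \<open>Y\<close>, graded by \<open>\<int>/s\<close>; the grading is
  encoded by the operators \<open>D c\<close> multiplying the component of degree \<open>r\<close> by \<open>c\<^sup>r\<close>, where \<open>c\<^sup>s = 1\<close>.\<close>

definition gdata :: "nat \<Rightarrow> 'j set \<Rightarrow> (('j \<Rightarrow>\<^sub>0 'k::field) \<Rightarrow> ('j \<Rightarrow>\<^sub>0 'k)) \<Rightarrow> ('k \<Rightarrow> ('j \<Rightarrow>\<^sub>0 'k) \<Rightarrow> ('j \<Rightarrow>\<^sub>0 'k)) \<Rightarrow> bool"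
  where "gdata s S Y D \<longleftrightarrow> lin Y \<and> (\<forall>f\<in>vecs S. Y f \<in> vecs S) \<and>
    (\<forall>c. lin (D c)) \<and> (\<forall>c. \<forall>f\<in>vecs S. D c f \<in> vecs S) \<and>
    (\<forall>c. c ^ s = 1 \<longrightarrow> (\<forall>f\<in>vecs S. D c (Y f) = scale c (Y (D c f)))) \<and>
    (\<forall>c d. \<forall>f\<in>vecs S. D (c * d) f = D c (D d f)) \<and> (\<forall>f\<in>vecs S. D 1 f = f)"

lemma gdataD:
  assumes "gdata s S Y D"
  shows "lin Y" "f \<in> vecs S \<Longrightarrow> Y f \<in> vecs S" "lin (D c)" "f \<in> vecs S \<Longrightarrow> D c f \<in> vecs S"
    "c ^ s = 1 \<Longrightarrow> f \<in> vecs S \<Longrightarrow> D c (Y f) = scale c (Y (D c f))"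
    "f \<in> vecs S \<Longrightarrow> D (c * d) f = D c (D d f)" "f \<in> vecs S \<Longrightarrow> D 1 f = f"
  using assms by (auto simp: gdata_def)

locale graded_setting = group G for G (structure) +
  fixes \<chi> :: "'a \<Rightarrow> 'k::field" and s :: nat
  assumes \<chi>_mult: "g \<in> carrier G \<Longrightarrow> h \<in> carrier G \<Longrightarrow> \<chi> (g \<otimes> h) = \<chi> g * \<chi> h"
    and \<chi>_one: "\<chi> \<one> = 1" and \<chi>_pow: "g \<in> carrier G \<Longrightarrow> \<chi> g ^ s = 1" and s_pos: "s > 0"
begin

sublocale ore_setting G "\<lambda>g. inverse (\<chi> g)"
  by unfold_locales (auto simp: \<chi>_mult \<chi>_one)

lemma \<chi>_nonzero: "g \<in> carrier G \<Longrightarrow> \<chi> g \<noteq> 0"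
  using \<chi>_pow[of g] s_pos by (auto simp: power_0_left)

text \<open>A vector of degree \<open>r\<close> plays the role of \<open>x^r\<close>. Since
  \<open>g x = \<chi>(g) x g\<close>, moving \<open>g\<close> past \<open>x^r\<close> costs the
  factor \<open>\<chi>(g)^r\<close>, which is \<open>D (\<chi> g)\<close>; then \<open>g\<close>
  acts on the representation.\<close>

abbreviation gact :: "('k \<Rightarrow> ('j \<Rightarrow>\<^sub>0 'k) \<Rightarrow> ('j \<Rightarrow>\<^sub>0 'k)) \<Rightarrow> ('a \<Rightarrow> ('u \<Rightarrow>\<^sub>0 'k) \<Rightarrow> ('u \<Rightarrow>\<^sub>0 'k))
    \<Rightarrow> 'a \<Rightarrow> ('j \<times> 'u \<Rightarrow>\<^sub>0 'k) \<Rightarrow> ('j \<times> 'u \<Rightarrow>\<^sub>0 'k)"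
  where "gact D \<rho> \<equiv> \<lambda>g. tens (D (\<chi> g)) (\<rho> g)"

abbreviation gvar :: "(('j \<Rightarrow>\<^sub>0 'k) \<Rightarrow> ('j \<Rightarrow>\<^sub>0 'k)) \<Rightarrow> ('j \<times> 'u \<Rightarrow>\<^sub>0 'k) \<Rightarrow> ('j \<times> 'u \<Rightarrow>\<^sub>0 'k)"
  where "gvar Y \<equiv> tens Y (\<lambda>x. x)"

abbreviation gmod :: "'j set \<Rightarrow> (('j \<Rightarrow>\<^sub>0 'k) \<Rightarrow> ('j \<Rightarrow>\<^sub>0 'k)) \<Rightarrow> ('k \<Rightarrow> ('j \<Rightarrow>\<^sub>0 'k) \<Rightarrow> ('j \<Rightarrow>\<^sub>0 'k))
    \<Rightarrow> 'u set \<Rightarrow> ('a \<Rightarrow> ('u \<Rightarrow>\<^sub>0 'k) \<Rightarrow> ('u \<Rightarrow>\<^sub>0 'k)) \<Rightarrow> ('a \<times> nat \<Rightarrow>\<^sub>0 'k, 'j \<times> 'u \<Rightarrow>\<^sub>0 'k) module"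
  where "gmod S Y D B \<rho> \<equiv> hmod (S \<times> B) (gact D \<rho>) (gvar Y)"

lemma hrep_gmod:
  fixes S :: "'j set" and B :: "'u set"
  assumes d: "gdata s S Y D" and r: "grep G B \<rho>"
  shows "hrep G (\<lambda>g. inverse (\<chi> g)) (S \<times> B) (gact D \<rho>) (gvar Y)"
  unfolding hrep_def
proof (intro conjI ballI)
  note d = gdataD[OF d] and r = grepD[OF r]
  show "grep G (S \<times> B) (gact D \<rho>)"
    unfolding grep_def
  proof (intro conjI ballI)
    show "lin (gact D \<rho> g)" for g by (rule lin_tens)
    show "gact D \<rho> g f \<in> vecs (S \<times> B)" if "g \<in> carrier G" "f \<in> vecs (S \<times> B)" for g f
      using that by (intro tens_in_vecs[OF that(2)] d r vecs_single)
    show "gact D \<rho> (g \<otimes> h) f = gact D \<rho> g (gact D \<rho> h f)"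
      if "g \<in> carrier G" "h \<in> carrier G" "f \<in> vecs (S \<times> B)" for g h f
      unfolding tens_comp[OF d(3) r(1)[OF that(1)]]
      using that by (intro tens_cong[OF that(3)]) (simp_all add: d r vecs_single \<chi>_mult)
    show "gact D \<rho> \<one> f = f" if "f \<in> vecs (S \<times> B)" for f
    proof -
      have "gact D \<rho> \<one> f = tens (\<lambda>x. x) (\<lambda>x. x) f"
        by (intro tens_cong[OF that]) (simp_all add: \<chi>_one d r vecs_single)
      then show ?thesis by (simp add: tens_id)
    qed
  qed
  show "lin (gvar Y)" by (rule lin_tens)
  show "gvar Y f \<in> vecs (S \<times> B)" if "f \<in> vecs (S \<times> B)" for f
    by (intro tens_in_vecs[OF that] d vecs_single)
  fix g and f :: "'j \<times> 'u \<Rightarrow>\<^sub>0 'k" assume g: "g \<in> carrier G" and f: "f \<in> vecs (S \<times> B)"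
  show "gvar Y (gact D \<rho> g f) = scale (inverse (\<chi> g)) (gact D \<rho> g (gvar Y f))"
  proof (rule tens_eqI[OF f])
    show "lin (\<lambda>f. gvar Y (gact D \<rho> g f))" by (rule lin_comp(2)[OF lin_tens lin_tens])
    show "lin (\<lambda>f. scale (inverse (\<chi> g)) (gact D \<rho> g (gvar Y f)))"
      by (intro lin_scaleI lin_comp(2)[OF lin_tens lin_tens])
    fix j b assume "j \<in> S" "b \<in> B"
    then show "gvar Y (gact D \<rho> g (elem_tensor (ev j) (ev b))) =
        scale (inverse (\<chi> g)) (gact D \<rho> g (gvar Y (elem_tensor (ev j) (ev b))))"
      using g by (simp add: tens_elem_tensor d(1-5) r(1) lin_id vecs_single elem_tensor_scale \<chi>_pow \<chi>_nonzero)
  qed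
qed

lemma gmod_left_module: "gdata s S Y D \<Longrightarrow> grep G B \<rho> \<Longrightarrow> left_module H (gmod S Y D B \<rho>)"
  by (rule hrep_left_module[OF hrep_gmod])

text \<open>The two tensor factors may be changed independently. The grading operators
  \<open>D c\<close> have to match for \<open>c^s = 1\<close> only, because \<open>c\<close> is
  always a value of \<open>\<chi>\<close>.\<close>

lemma gmod_cong:
  fixes S :: "'j set" and S' :: "'i set" and B :: "'u set" and B' :: "'w set"
  assumes d: "gdata s S Y D" "gdata s S' Y' D'" and r: "grep G B \<rho>" "grep G B' \<rho>'"
    and P: "lin P" "bij_betw P (vecs S) (vecs S')" "\<And>f. f \<in> vecs S \<Longrightarrow> P (Y f) = Y' (P f)"
      "\<And>c f. c ^ s = 1 \<Longrightarrow> f \<in> vecs S \<Longrightarrow> P (D c f) = D' c (P f)"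
    and Q: "lin Q" "bij_betw Q (vecs B) (vecs B')"
      "\<And>g f. g \<in> carrier G \<Longrightarrow> f \<in> vecs B \<Longrightarrow> Q (\<rho> g f) = \<rho>' g (Q f)"
  shows "miso H (gmod S Y D B \<rho>) (gmod S' Y' D' B' \<rho>')"
proof -
  obtain P' where P': "lin P'" "\<And>g. g \<in> vecs S' \<Longrightarrow> P' g \<in> vecs S" "\<And>f. f \<in> vecs S \<Longrightarrow> P' (P f) = f"
    "\<And>g. g \<in> vecs S' \<Longrightarrow> P (P' g) = g" using bij_betw_lin_inverse[OF P(1,2)] by blast
  obtain Q' where Q': "lin Q'" "\<And>g. g \<in> vecs B' \<Longrightarrow> Q' g \<in> vecs B" "\<And>f. f \<in> vecs B \<Longrightarrow> Q' (Q f) = f"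
    "\<And>g. g \<in> vecs B' \<Longrightarrow> Q (Q' g) = g" using bij_betw_lin_inverse[OF Q(1,2)] by blast
  have in': "P f \<in> vecs S'" if "f \<in> vecs S" for f using P(2) that by (auto simp: bij_betw_def)
  have in'': "Q f \<in> vecs B'" if "f \<in> vecs B" for f using Q(2) that by (auto simp: bij_betw_def)
  note dD' = gdataD[OF d(2)] and rD' = grepD[OF r(2)]
  have maps: "tens P Q f \<in> vecs (S' \<times> B')" if "f \<in> vecs (S \<times> B)" for f
    by (intro tens_in_vecs[OF that] in' in'' vecs_single)
  have maps': "tens P' Q' f \<in> vecs (S \<times> B)" if "f \<in> vecs (S' \<times> B')" for f
    by (intro tens_in_vecs[OF that] P' Q' vecs_single)
  have inv1: "tens P' Q' (tens P Q f) = f" if "f \<in> vecs (S \<times> B)" for f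
  proof -
    have "tens P' Q' (tens P Q f) = tens (\<lambda>x. x) (\<lambda>x. x) f"
      unfolding tens_comp[OF P'(1) Q'(1)] by (intro tens_cong[OF that]) (simp_all add: P' Q' vecs_single)
    then show ?thesis by (simp add: tens_id)
  qed
  have inv2: "tens P Q (tens P' Q' f) = f" if "f \<in> vecs (S' \<times> B')" for f
  proof -
    have "tens P Q (tens P' Q' f) = tens (\<lambda>x. x) (\<lambda>x. x) f"
      unfolding tens_comp[OF P(1) Q(1)] by (intro tens_cong[OF that]) (simp_all add: P' Q' vecs_single)
    then show ?thesis by (simp add: tens_id)
  qed
  have hom: "tens P Q \<in> module_hom H (gmod S Y D B \<rho>) (gmod S' Y' D' B' \<rho>')"
  proof (rule module_homI)
    show "tens P Q x \<in> carrier (gmod S' Y' D' B' \<rho>')" if "x \<in> carrier (gmod S Y D B \<rho>)" for x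
      using that maps by simp
    show "tens P Q (x \<oplus>\<^bsub>gmod S Y D B \<rho>\<^esub> y) = tens P Q x \<oplus>\<^bsub>gmod S' Y' D' B' \<rho>'\<^esub> tens P Q y" for x y
      by (simp add: lin_add[OF lin_tens])
    fix x and f :: "'j \<times> 'u \<Rightarrow>\<^sub>0 'k"
    assume x: "x \<in> carrier H" and "f \<in> carrier (gmod S Y D B \<rho>)"
    then have f: "f \<in> vecs (S \<times> B)" by simp
    have "tens P Q (lin_ext (\<lambda>b. hop (gact D \<rho>) (gvar Y) b f) x) =
        lin_ext (\<lambda>b. hop (gact D' \<rho>') (gvar Y') b (tens P Q f)) x"
    proof (rule hmod_intertwine[OF lin_tens _ _ _ _ f])
      show "x \<in> vecs (carrier G \<times> UNIV)" using x by (simp add: ore_algebra_simps)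
      show "gvar Y f \<in> vecs (S \<times> B)" if "f \<in> vecs (S \<times> B)" for f
        using hrepD(3)[OF hrep_gmod[OF d(1) r(1)] that] .
      show "tens P Q (gvar Y f) = gvar Y' (tens P Q f)" if "f \<in> vecs (S \<times> B)" for f
        unfolding tens_comp[OF P(1) Q(1)] tens_comp[OF dD'(1) lin_id(1)]
        by (intro tens_cong[OF that]) (simp_all add: P vecs_single)
      show "tens P Q (gact D \<rho> g f) = gact D' \<rho>' g (tens P Q f)" if "g \<in> carrier G" "f \<in> vecs (S \<times> B)" for g f
        unfolding tens_comp[OF P(1) Q(1)] tens_comp[OF dD'(3) rD'(1)[OF that(1)]]
        using that(1) by (intro tens_cong[OF that(2)]) (simp_all add: P(4) Q(3) vecs_single \<chi>_pow)
    qed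
    then show "tens P Q (x \<odot>\<^bsub>gmod S Y D B \<rho>\<^esub> f) = x \<odot>\<^bsub>gmod S' Y' D' B' \<rho>'\<^esub> tens P Q f"
      by simp
  qed
  have "bij_betw (tens P Q) (carrier (gmod S Y D B \<rho>)) (carrier (gmod S' Y' D' B' \<rho>'))"
    by (rule bij_betw_byWitness[of _ "tens P' Q'"]) (auto simp: inv1 inv2 maps maps')
  then show ?thesis
    by (rule misoI[OF gmod_left_module[OF d(1) r(1)] gmod_left_module[OF d(2) r(2)] hom])
qed

end

section \<open>The graded Jordan blocks\<close>

text \<open>The basis vector \<open>(k, r)\<close> stands for \<open>(x\<^sup>s - \<gamma>)\<^sup>k x\<^sup>r\<close>, with \<open>k \<in> K\<close> and \<open>r < s\<close>.\<close>

definition jx :: "nat set \<Rightarrow> nat \<Rightarrow> 'k \<Rightarrow> (nat \<times> nat \<Rightarrow>\<^sub>0 'k::field) \<Rightarrow> (nat \<times> nat \<Rightarrow>\<^sub>0 'k)"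
  where "jx K s \<gamma> = lin_ext (\<lambda>(k, r). if Suc r < s then ev (k, Suc r)
    else (if Suc k \<in> K then ev (Suc k, 0) else 0) + scale \<gamma> (ev (k, 0)))"

definition jd :: "'k \<Rightarrow> (nat \<times> nat \<Rightarrow>\<^sub>0 'k::field) \<Rightarrow> (nat \<times> nat \<Rightarrow>\<^sub>0 'k)"
  where "jd c = lin_ext (\<lambda>(k, r). scale (c ^ r) (ev (k, r)))"

lemma jx_lin: "lin (jx K s \<gamma>)" and jd_lin: "lin (jd c)"
  by (simp_all add: jx_def jd_def lin_lin_ext)

lemma jx_ev: "jx K s \<gamma> (ev (k, r)) = (if Suc r < s then ev (k, Suc r)
    else (if Suc k \<in> K then ev (Suc k, 0) else 0) + scale \<gamma> (ev (k, 0)))"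
  by (simp add: jx_def)

lemma jd_ev: "jd c (ev (k, r)) = scale (c ^ r) (ev (k, r))"
  by (simp add: jd_def)

lemma jx_in_vecs:
  assumes "s > 0" "f \<in> vecs (K \<times> {..<s})" shows "jx K s \<gamma> f \<in> vecs (K \<times> {..<s})"
  by (rule lin_vecs_image[OF assms(2) jx_lin])
    (use assms(1) in \<open>auto simp: jx_ev simp del: scale_single intro!: vecs_intros\<close>)

lemma gdata_jordan:
  assumes s: "s > 0" shows "gdata s (K \<times> {..<s}) (jx K s \<gamma>) jd"
  unfolding gdata_def
proof (intro conjI allI impI ballI)
  show "jd c f \<in> vecs (K \<times> {..<s})" if "f \<in> vecs (K \<times> {..<s})" for c f
    by (rule lin_vecs_image[OF that jd_lin]) (auto simp: jd_ev intro!: vecs_intros)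
  show "jd c (jx K s \<gamma> f) = scale c (jx K s \<gamma> (jd c f))" if c: "c ^ s = 1" and f: "f \<in> vecs (K \<times> {..<s})" for c f
  proof (rule lin_eqI[OF f])
    show "lin (\<lambda>f. jd c (jx K s \<gamma> f))" by (rule lin_comp(2)[OF jd_lin jx_lin])
    show "lin (\<lambda>f. scale c (jx K s \<gamma> (jd c f)))" by (intro lin_scaleI lin_comp(2)[OF jx_lin jd_lin])
    fix b assume "b \<in> K \<times> {..<s}"
    then obtain k r where [simp]: "b = (k, r)" and r: "r < s" by auto
    \<comment> \<open>The wrap-around \<open>x x^(s-1) = (x^s - \<gamma>) + \<gamma>\<close> drops
      the exponent from \<open>s - 1\<close> to 0; this is homogeneous because
      \<open>c^s = 1\<close>.\<close>
    have "Suc r = s" if "\<not> Suc r < s" using r that by simp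
    then have "c * c ^ r = 1" if "\<not> Suc r < s" using that c by (metis power_Suc)
    then show "jd c (jx K s \<gamma> (ev b)) = scale c (jx K s \<gamma> (jd c (ev b)))"
      by (auto simp: jx_ev jd_ev lin_add[OF jd_lin] lin_scale[OF jd_lin] lin_scale[OF jx_lin] lin_0[OF jd_lin]
          scale_add_right mult.commute simp del: scale_single)
  qed
  show "jd (c * d) f = jd c (jd d f)" if "f \<in> vecs (K \<times> {..<s})" for c d f
    by (rule lin_eqI[OF that jd_lin lin_comp(2)[OF jd_lin jd_lin]])
      (auto simp: jd_ev lin_scale[OF jd_lin] power_mult_distrib simp del: scale_single; simp)
  show "jd 1 f = f" if "f \<in> vecs (K \<times> {..<s})" for f
    by (rule lin_eqI[OF that jd_lin lin_id(1)]) (auto simp: jd_ev)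
qed (auto simp: jx_lin jd_lin intro: jx_in_vecs s)

lemma jx_pow_less: "j + r < s \<Longrightarrow> (jx K s \<gamma> ^^ j) (ev (k, r)) = ev (k, r + j)"
  by (induction j) (auto simp: jx_ev)

lemma jx_pow_s:
  assumes "r < s"
  shows "(jx K s \<gamma> ^^ s) (ev (k, r)) = (if Suc k \<in> K then ev (Suc k, r) else 0) + scale \<gamma> (ev (k, r))"
proof -
  have pow: "lin (jx K s \<gamma> ^^ r)" by (rule lin_funpow[OF jx_lin])
  \<comment> \<open>Split \<open>x^s = x^r x^(s-r)\<close>: the first \<open>s - r\<close> steps
    wrap around exactly once, and the remaining \<open>r\<close> restore the exponent.\<close>
  have "(jx K s \<gamma> ^^ (s - r)) (ev (k, r)) = jx K s \<gamma> ((jx K s \<gamma> ^^ (s - r - 1)) (ev (k, r)))"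
    using assms by (cases "s - r") auto
  also have "\<dots> = jx K s \<gamma> (ev (k, s - 1))" using assms by (subst jx_pow_less) auto
  also have "\<dots> = (if Suc k \<in> K then ev (Suc k, 0) else 0) + scale \<gamma> (ev (k, 0))"
    using assms by (simp add: jx_ev)
  finally have 1: "(jx K s \<gamma> ^^ (s - r)) (ev (k, r)) = \<dots>" .
  have "(jx K s \<gamma> ^^ s) (ev (k, r)) = (jx K s \<gamma> ^^ r) ((jx K s \<gamma> ^^ (s - r)) (ev (k, r)))"
    using assms funpow_add[of r "s - r" "jx K s \<gamma>"] by simp
  then show ?thesis
    using assms jx_pow_less[of r 0 s K \<gamma>]
    unfolding 1 by (simp add: lin_add[OF pow] lin_scale[OF pow] lin_0[OF pow] del: scale_single)
qed

section \<open>Monomials adapted to \<open>x^s - \<gamma>\<close> in the Hopf algebra\<close>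

context graded_setting
begin

definition zH :: "'k \<Rightarrow> ('a \<times> nat \<Rightarrow>\<^sub>0 'k)"
  where "zH \<gamma> = ore_var G [^]\<^bsub>H\<^esub> s - scale \<gamma> \<one>\<^bsub>H\<^esub>"

lemma H_mult_lin: "lin (\<lambda>y. x \<otimes>\<^bsub>H\<^esub> y)" "lin (\<lambda>x. x \<otimes>\<^bsub>H\<^esub> y)"
  unfolding ore_algebra_simps by (rule bilin_ext_lin_right bilin_ext_lin_left)+

lemma H_carrier: "carrier H = vecs (carrier G \<times> UNIV)"
  by (simp add: ore_algebra_simps)

lemma var_closed: "ore_var G \<in> carrier H"
  by (simp add: ore_var_def H_carrier vecs_single)

lemma var_pow_closed: "ore_var G [^]\<^bsub>H\<^esub> (n::nat) \<in> carrier H"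
proof -
  interpret Hr: ring H by (rule ring_H)
  show ?thesis by (simp add: var_closed)
qed

lemma zH_closed: "zH \<gamma> \<in> carrier H"
  using var_pow_closed[of s] unfolding zH_def H_carrier ore_algebra_simps
  by (auto intro!: vecs_diff vecs_single simp del: scale_single intro: vecs_scale)

lemma zH_pow_closed: "zH \<gamma> [^]\<^bsub>H\<^esub> (n::nat) \<in> carrier H"
proof -
  interpret Hr: ring H by (rule ring_H)
  show ?thesis by (simp add: zH_closed)
qed

lemma var_zH_comm: "ore_var G \<otimes>\<^bsub>H\<^esub> zH \<gamma> = zH \<gamma> \<otimes>\<^bsub>H\<^esub> ore_var G"
proof -
  interpret Hr: ring H by (rule ring_H)
  have "ore_var G \<otimes>\<^bsub>H\<^esub> ore_var G [^]\<^bsub>H\<^esub> s = ore_var G [^]\<^bsub>H\<^esub> s \<otimes>\<^bsub>H\<^esub> ore_var G"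
    by (metis Hr.nat_pow_Suc Hr.nat_pow_Suc2 var_closed)
  then show ?thesis
    unfolding zH_def using var_closed
    by (simp only: lin_diff[OF H_mult_lin(1)] lin_diff[OF H_mult_lin(2)] lin_scale[OF H_mult_lin(1)]
        lin_scale[OF H_mult_lin(2)] Hr.r_one Hr.l_one)
qed

text \<open>The elements \<open>(x^s - \<gamma>)^k x^r\<close>. With \<open>r < s\<close> they form
  a basis of \<open>k[x]\<close>, and hence of \<open>H\<close> as a right module over
  \<open>kG\<close>.\<close>

definition wH :: "'k \<Rightarrow> nat \<times> nat \<Rightarrow> ('a \<times> nat \<Rightarrow>\<^sub>0 'k)"
  where "wH \<gamma> = (\<lambda>(k, r). zH \<gamma> [^]\<^bsub>H\<^esub> k \<otimes>\<^bsub>H\<^esub> ore_var G [^]\<^bsub>H\<^esub> r)"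

lemma wH_closed: "wH \<gamma> b \<in> carrier H"
proof -
  interpret Hr: ring H by (rule ring_H)
  show ?thesis by (cases b) (simp add: wH_def zH_pow_closed var_pow_closed)
qed

lemma var_wH:
  assumes "r < s"
  shows "ore_var G \<otimes>\<^bsub>H\<^esub> wH \<gamma> (k, r) = lin_ext (wH \<gamma>) (jx UNIV s \<gamma> (ev (k, r)))"
proof -
  interpret Hr: ring H by (rule ring_H)
  let ?x = "ore_var G" and ?z = "zH \<gamma>"
  have comm: "?x \<otimes>\<^bsub>H\<^esub> ?z [^]\<^bsub>H\<^esub> k = ?z [^]\<^bsub>H\<^esub> k \<otimes>\<^bsub>H\<^esub> ?x"
    by (rule Hr.group_commutes_pow[symmetric]) (simp_all add: var_zH_comm zH_closed var_closed)
  have "?x \<otimes>\<^bsub>H\<^esub> wH \<gamma> (k, r) = ?x \<otimes>\<^bsub>H\<^esub> ?z [^]\<^bsub>H\<^esub> k \<otimes>\<^bsub>H\<^esub> ?x [^]\<^bsub>H\<^esub> r"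
    by (simp add: wH_def Hr.m_assoc zH_closed var_closed)
  also have "\<dots> = ?z [^]\<^bsub>H\<^esub> k \<otimes>\<^bsub>H\<^esub> ?x [^]\<^bsub>H\<^esub> Suc r"
    unfolding comm by (simp only: Hr.nat_pow_Suc2 Hr.m_assoc zH_closed var_closed Hr.nat_pow_closed)
  finally have 1: "?x \<otimes>\<^bsub>H\<^esub> wH \<gamma> (k, r) = ?z [^]\<^bsub>H\<^esub> k \<otimes>\<^bsub>H\<^esub> ?x [^]\<^bsub>H\<^esub> Suc r" .
  show ?thesis
  proof (cases "Suc r < s")
    case True
    then show ?thesis unfolding 1 by (simp add: jx_ev wH_def)
  next
    case False
    then have "Suc r = s" using assms by simp
    have "?x [^]\<^bsub>H\<^esub> s = ?z + scale \<gamma> \<one>\<^bsub>H\<^esub>" by (simp add: zH_def)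
    then have "?z [^]\<^bsub>H\<^esub> k \<otimes>\<^bsub>H\<^esub> ?x [^]\<^bsub>H\<^esub> s = ?z [^]\<^bsub>H\<^esub> Suc k + scale \<gamma> (?z [^]\<^bsub>H\<^esub> k)"
      using zH_pow_closed[of \<gamma> k]
      by (simp only: lin_add[OF H_mult_lin(1)] lin_scale[OF H_mult_lin(1)] Hr.nat_pow_Suc Hr.r_one)
    also have "\<dots> = lin_ext (wH \<gamma>) (jx UNIV s \<gamma> (ev (k, r)))"
      using False zH_pow_closed[of \<gamma> k] zH_pow_closed[of \<gamma> "Suc k"]
      by (simp add: jx_ev lin_add[OF lin_lin_ext] wH_def del: Hr.nat_pow_Suc nat_pow_Suc)
    finally show ?thesis unfolding 1 \<open>Suc r = s\<close> .
  qed
qed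

text \<open>Left multiplication by \<open>x\<close> preserves the span of the
  \<open>wH \<gamma> (k, r)\<close> with \<open>r < s\<close>. The existence of coordinates is what
  reduces words to normal forms; their uniqueness then comes out of
  \<open>ind_module_miso\<close>.\<close>

lemma var_pow_wH: "\<exists>p\<in>vecs (UNIV \<times> {..<s}). ore_var G [^]\<^bsub>H\<^esub> (n::nat) = lin_ext (wH \<gamma>) p"
proof (induction n)
  case 0
  interpret Hr: ring H by (rule ring_H)
  show ?case using s_pos by (intro bexI[of _ "ev (0, 0)"]) (auto simp: wH_def vecs_single)
next
  case (Suc n)
  interpret Hr: ring H by (rule ring_H)
  from Suc obtain p where p: "p \<in> vecs (UNIV \<times> {..<s})" "ore_var G [^]\<^bsub>H\<^esub> n = lin_ext (wH \<gamma>) p" by blast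
  have "ore_var G [^]\<^bsub>H\<^esub> Suc n = ore_var G \<otimes>\<^bsub>H\<^esub> lin_ext (wH \<gamma>) p"
    unfolding p(2)[symmetric] by (rule Hr.nat_pow_Suc2[OF var_closed])
  also have "\<dots> = lin_ext (wH \<gamma>) (jx UNIV s \<gamma> p)"
    by (rule lin_eqI[OF p(1) lin_comp(2)[OF H_mult_lin(1) lin_lin_ext] lin_comp(2)[OF lin_lin_ext jx_lin]])
      (auto simp: var_wH)
  finally show ?case using jx_in_vecs[OF s_pos p(1)] by blast
qed

lemma var_pow: "ore_var G [^]\<^bsub>H\<^esub> (n::nat) = ev (\<one>, n)"
proof (induction n)
  case (Suc n)
  then show ?case by (simp add: nat_pow_Suc) (simp add: ore_algebra_simps ore_var_def \<chi>_one)
qed (simp add: nat_pow_0 ore_algebra_simps)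

section \<open>The action on graded modules\<close>

lemma act_var_pow:
  assumes h: "hrep G (\<lambda>g. inverse (\<chi> g)) B \<rho> Y" and f: "f \<in> vecs B"
  shows "ore_var G [^]\<^bsub>H\<^esub> (n::nat) \<odot>\<^bsub>hmod B \<rho> Y\<^esub> f = (Y ^^ n) f"
  unfolding var_pow using hop_facts(4)[OF h f] by simp

lemma act_zH_pow:
  assumes h: "hrep G (\<lambda>g. inverse (\<chi> g)) B \<rho> Y" and f: "f \<in> vecs B"
  shows "zH \<gamma> [^]\<^bsub>H\<^esub> (n::nat) \<odot>\<^bsub>hmod B \<rho> Y\<^esub> f = ((\<lambda>f. (Y ^^ s) f - scale \<gamma> f) ^^ n) f"
  using f
proof (induction n arbitrary: f)
  case 0
  then show ?case using hop_facts(4)[OF h, of f 0] by (simp add: nat_pow_0 ore_algebra_simps)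
next
  case (Suc n)
  interpret M: left_module H "hmod B \<rho> Y" by (rule hrep_left_module[OF h])
  have z: "zH \<gamma> \<odot>\<^bsub>hmod B \<rho> Y\<^esub> f = (Y ^^ s) f - scale \<gamma> f"
    using act_var_pow[OF h Suc(2), of s] hop_facts(4)[OF h Suc(2), of 0]
    by (simp add: zH_def lin_diff[OF lin_lin_ext] lin_scale[OF lin_lin_ext] ore_algebra_simps)
  have in_B: "(Y ^^ s) f - scale \<gamma> f \<in> vecs B"
    using Suc(2) funpow_vecs[OF hrepD(3)[OF h] Suc(2)] by (intro vecs_diff vecs_scale)
  have "zH \<gamma> [^]\<^bsub>H\<^esub> Suc n \<odot>\<^bsub>hmod B \<rho> Y\<^esub> f = zH \<gamma> [^]\<^bsub>H\<^esub> n \<odot>\<^bsub>hmod B \<rho> Y\<^esub> (zH \<gamma> \<odot>\<^bsub>hmod B \<rho> Y\<^esub> f)"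
    unfolding Group.nat_pow_Suc by (rule M.smult_assoc) (simp_all add: zH_pow_closed zH_closed Suc(2))
  also have "\<dots> = ((\<lambda>f. (Y ^^ s) f - scale \<gamma> f) ^^ n) ((Y ^^ s) f - scale \<gamma> f)"
    unfolding z by (rule Suc(1)[OF in_B])
  finally show ?case by (simp only: funpow_Suc_right o_apply)
qed

lemma gvar_pow: "lin Y \<Longrightarrow> (gvar Y ^^ n) (elem_tensor p q) = elem_tensor ((Y ^^ n) p) q"
  by (induction n) (simp_all add: tens_elem_tensor lin_id)

definition sh :: "nat \<Rightarrow> (nat \<times> nat \<Rightarrow>\<^sub>0 'k) \<Rightarrow> (nat \<times> nat \<Rightarrow>\<^sub>0 'k)"
  where "sh n = lin_ext (\<lambda>(k, r). ev (k + n, r))"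

lemma sh_ev [simp]: "sh n (ev (k, r)) = ev (k + n, r)"
  by (simp add: sh_def)

text \<open>On the infinite block \<open>x^s - \<gamma>\<close> just increments \<open>k\<close>, by
  \<open>jx_pow_s\<close> with \<open>K = UNIV\<close>, where no truncation occurs.\<close>

lemma act_zH_pow_jordan:
  assumes f: "f \<in> vecs ((UNIV \<times> {..<s}) \<times> B)" and r: "grep G B \<rho>"
  shows "zH \<gamma> [^]\<^bsub>H\<^esub> (n::nat) \<odot>\<^bsub>gmod (UNIV \<times> {..<s}) (jx UNIV s \<gamma>) jd B \<rho>\<^esub> f = tens (sh n) (\<lambda>x. x) f"
  unfolding act_zH_pow[OF hrep_gmod[OF gdata_jordan[OF s_pos] r] f]
proof (rule tens_eqI[OF f])
  let ?Z = "\<lambda>f. (gvar (jx UNIV s \<gamma>) ^^ s) f - scale \<gamma> f"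
  have "lin ?Z" by (intro lin_minus lin_funpow lin_tens lin_scaleI lin_id)
  then show "lin (?Z ^^ n)" by (rule lin_funpow)
  show "lin (tens (sh n) (\<lambda>x. x))" by (rule lin_tens)
  fix j b assume "j \<in> (UNIV :: nat set) \<times> {..<s}"
  then obtain k r where [simp]: "j = (k, r)" and r: "r < s" by auto
  have Z: "?Z (elem_tensor (ev (k, r)) q) = elem_tensor (ev (Suc k, r)) q" for k and q :: "'j \<Rightarrow>\<^sub>0 'k"
    by (simp add: gvar_pow jx_lin jx_pow_s[OF r] elem_tensor_add elem_tensor_scale del: scale_single)
  have "(?Z ^^ n) (elem_tensor (ev (k, r)) (ev b)) = elem_tensor (ev (k + n, r)) (ev b)"
    by (induction n) (simp_all only: funpow.simps Z o_apply add_Suc_right id_apply add_0_right)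
  then show "(?Z ^^ n) (elem_tensor (ev j) (ev b)) = tens (sh n) (\<lambda>x. x) (elem_tensor (ev j) (ev b))"
    by simp
qed

end

section \<open>The induced module\<close>

context graded_setting
begin

abbreviation "imod \<equiv> ind_module G (\<lambda>g. inverse (\<chi> g))"
abbreviation "ipure \<equiv> ind_pure G (\<lambda>g. inverse (\<chi> g))"

lemma embed_in: "r \<in> carrier kG \<Longrightarrow> ore_embed r \<in> carrier H"
  unfolding ore_embed_def H_carrier group_algebra_simps
  by (rule lin_ext_in_vecs) (auto simp: ore_grp_def vecs_single)

text \<open>Since \<open>H\<close> is free over \<open>kG\<close> on the monomials
  \<open>wH \<gamma> j\<close>, the induced module is \<open>k[x]\<close> tensored with
  \<open>V\<close>. The parameter \<open>\<gamma>\<close> selects the basis of \<open>k[x]\<close>;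
  the induced module itself is the same for all \<open>\<gamma>\<close>. The images of pure tensors
  are recorded because they generate the submodule in \<open>nil_module\<close>.\<close>

lemma ind_module_miso:
  fixes V :: "('a \<Rightarrow>\<^sub>0 'k, 'v) module" and B :: "'u set" and \<gamma> :: 'k
  assumes V: "miso kG V (cmod B \<rho>)" and r: "grep G B \<rho>"
  defines "P \<equiv> gmod (UNIV \<times> {..<s}) (jx UNIV s \<gamma>) jd B \<rho>"
  obtains e \<theta> where "e \<in> module_hom kG V (cmod B \<rho>)" "bij_betw e (carrier V) (vecs B)"
    "left_module H (imod V)" "\<theta> \<in> module_hom H (imod V) P" "bij_betw \<theta> (carrier (imod V)) (carrier P)"
    "\<And>h v. h \<in> carrier H \<Longrightarrow> v \<in> carrier V \<Longrightarrow> \<theta> (ipure V h v) = h \<odot>\<^bsub>P\<^esub> elem_tensor (ev (0, 0)) (e v)"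
proof -
  let ?S = "(UNIV :: nat set) \<times> {..<s}"
  have d: "gdata s ?S (jx UNIV s \<gamma>) jd" by (rule gdata_jordan[OF s_pos])
  note hr = hrep_gmod[OF d r]
  interpret V: left_module kG V using V by (simp add: miso_def)
  interpret Hr: ring H by (rule ring_H)
  have PL: "left_module H P" unfolding P_def by (rule gmod_left_module[OF d r])
  interpret P: left_module H P by (rule PL)
  have Pc: "carrier P = vecs (?S \<times> B)" "\<zero>\<^bsub>P\<^esub> = 0" "x \<oplus>\<^bsub>P\<^esub> y = x + y" for x y
    by (simp_all add: P_def)
  obtain e where e: "e \<in> module_hom kG V (cmod B \<rho>)" "bij_betw e (carrier V) (vecs B)"
    using V by (auto elim!: misoE)
  define i where "i = inv_into (carrier V) e"
  have i: "i \<in> module_hom kG (cmod B \<rho>) V"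
    unfolding i_def using e V.left_module_axioms by (auto intro: module_hom_inverse)
  have ei: "e (i f) = f" if "f \<in> vecs B" for f
    using that e(2) by (auto simp: i_def bij_betw_def f_inv_into_f)
  have ie: "i (e v) = v" if "v \<in> carrier V" for v
    using that e(2) by (auto simp: i_def bij_betw_def)
  note eD = module_homD[OF e(1), simplified]
  note iD = module_homD[OF i, simplified]
  define \<iota> :: "('u \<Rightarrow>\<^sub>0 'k) \<Rightarrow> _" where "\<iota> = elem_tensor (ev (0 :: nat, 0 :: nat))"
  have \<iota>_in: "\<iota> f \<in> carrier P" if "f \<in> vecs B" for f
    unfolding \<iota>_def Pc using s_pos by (intro elem_tensor_in_vecs[OF _ that] vecs_single) auto
  let ?ra = "\<lambda>h r. h \<otimes>\<^bsub>H\<^esub> ore_embed r" and ?la = "\<lambda>r v. r \<odot>\<^bsub>V\<^esub> v"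
  let ?\<phi> = "\<lambda>h (y, v). frag_of (h \<otimes>\<^bsub>H\<^esub> y, v)"
  let ?F = "\<lambda>(h, v). h \<odot>\<^bsub>P\<^esub> \<iota> (e v)"
  let ?R = "tensor_relations (carrier kG) H ?ra V ?la"
  let ?n = "\<lambda>(j, b) c. frag_of (scale c (wH \<gamma> j), i (ev b))"
  have ind: "imod V = balanced_tensor (carrier kG) H ?ra V ?la ?\<phi>"
    by (simp add: ind_module_def Let_def)
  have embed_ev: "ore_embed (Poly_Mapping.single g c) = Poly_Mapping.single (g, 0) c" for g :: 'a and c :: 'k
    by (simp add: ore_embed_def ore_grp_def)
  have sc_closed: "scale c x \<in> carrier H" if "x \<in> carrier H" for c x
    using that by (simp add: H_carrier vecs_scale)
  have act_scale: "scale c x \<odot>\<^bsub>P\<^esub> f = scale c (x \<odot>\<^bsub>P\<^esub> f)" for c x f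
    by (simp add: P_def lin_scale[OF lin_lin_ext])
  \<comment> \<open>On exponent 0 the grading is trivial, so \<open>kG\<close> acts on the copy of
    \<open>V\<close> inside the induced module as it does on \<open>V\<close>; this is the balancing
    condition.\<close>
  have embed_act: "ore_embed r \<odot>\<^bsub>P\<^esub> \<iota> f = \<iota> (lin_ext (\<lambda>g. \<rho> g f) r)"
    if rr: "r \<in> carrier kG" and f: "f \<in> vecs B" for r f
  proof (rule lin_eqI[where L = "\<lambda>r. ore_embed r \<odot>\<^bsub>P\<^esub> \<iota> f" and M = "\<lambda>r. \<iota> (lin_ext (\<lambda>g. \<rho> g f) r)"])
    show "r \<in> vecs (carrier G)" using rr by (simp add: group_algebra_simps)
    show "lin (\<lambda>r. ore_embed r \<odot>\<^bsub>P\<^esub> \<iota> f)"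
      unfolding P_def cmod_simps ore_embed_def by (rule lin_comp(2)[OF lin_lin_ext lin_lin_ext])
    show "lin (\<lambda>r. \<iota> (lin_ext (\<lambda>g. \<rho> g f) r))"
      unfolding \<iota>_def by (rule lin_comp(2)[OF elem_tensor_lin(1) lin_lin_ext])
    fix g assume "g \<in> carrier G"
    then show "ore_embed (ev g) \<odot>\<^bsub>P\<^esub> \<iota> f = \<iota> (lin_ext (\<lambda>g. \<rho> g f) (ev g))"
      by (simp add: embed_ev P_def hop_pair \<iota>_def tens_elem_tensor jd_lin grepD[OF r] jd_ev)
  qed
  \<comment> \<open>The monomial \<open>wH \<gamma> (k, r)\<close> carries the corner (0,0) to the
    basis vector \<open>(k, r)\<close>, so \<open>F\<close> reads the coordinates off a normal
    form.\<close>
  have w_act: "wH \<gamma> (k, r) \<odot>\<^bsub>P\<^esub> \<iota> f = elem_tensor (ev (k, r)) f" if "r < s" "f \<in> vecs B" for k r f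
  proof -
    have \<iota>: "\<iota> f \<in> vecs (?S \<times> B)" using \<iota>_in[OF that(2)] by (simp add: Pc)
    have in_P: "elem_tensor (ev (0, r)) f \<in> vecs (?S \<times> B)"
      using that by (intro elem_tensor_in_vecs vecs_single) auto
    have "ore_var G [^]\<^bsub>H\<^esub> r \<odot>\<^bsub>P\<^esub> \<iota> f = elem_tensor (ev (0, r)) f"
      using act_var_pow[OF hr \<iota>, of r] that jx_pow_less[of r 0 s UNIV \<gamma> 0]
      by (simp add: P_def \<iota>_def gvar_pow jx_lin)
    moreover have "zH \<gamma> [^]\<^bsub>H\<^esub> k \<odot>\<^bsub>P\<^esub> elem_tensor (ev (0, r)) f = elem_tensor (ev (k, r)) f"
      using act_zH_pow_jordan[OF in_P r, of \<gamma> k] by (simp add: P_def tens_elem_tensor sh_def lin_lin_ext lin_id)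
    ultimately show ?thesis
      using P.smult_assoc[OF zH_pow_closed var_pow_closed \<iota>_in[OF that(2)], of \<gamma> k r] by (simp add: wH_def)
  qed
  obtain f where f: "left_module H (imod V)" "f \<in> module_hom H (imod V) P"
    "bij_betw f (carrier (imod V)) (carrier P)"
    "\<And>h v. h \<in> carrier H \<Longrightarrow> v \<in> carrier V \<Longrightarrow>
      f (?R #>\<^bsub>free_Abelian_group (carrier H \<times> carrier V)\<^esub> frag_of (h, v)) = ?F (h, v)"
    unfolding ind
  proof (rule balanced_tensor_miso[OF PL, where F = ?F and n = ?n and S = "carrier kG" and M = H and N = V
        and ra = ?ra and la = ?la and \<phi> = ?\<phi> and B = "?S \<times> B"])
    show "carrier P = vecs (?S \<times> B)" "\<zero>\<^bsub>P\<^esub> = 0" "x \<oplus>\<^bsub>P\<^esub> y = x + y" for x y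
      by (simp_all add: Pc)
    show "x \<oplus>\<^bsub>H\<^esub> y \<in> carrier H" if "x \<in> carrier H" "y \<in> carrier H" for x y using that by simp
    show "x \<oplus>\<^bsub>V\<^esub> y \<in> carrier V" if "x \<in> carrier V" "y \<in> carrier V" for x y using that by simp
    show "?ra x c \<in> carrier H" if "x \<in> carrier H" "c \<in> carrier kG" for x c
      using that embed_in by simp
    show "?la c x \<in> carrier V" if "x \<in> carrier V" "c \<in> carrier kG" for x c
      using that by (simp add: V.smult_closed)
    show F_in: "?F (h, v) \<in> vecs (?S \<times> B)" if "h \<in> carrier H" "v \<in> carrier V" for h v
      using that P.smult_closed[OF that(1) \<iota>_in[OF eD(1)[OF that(2)]]] by (simp add: Pc)
    show "?F (x \<oplus>\<^bsub>H\<^esub> y, v) = ?F (x, v) + ?F (y, v)" if "x \<in> carrier H" "y \<in> carrier H" "v \<in> carrier V" for x y v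
      using P.smult_l_distr[OF that(1,2) \<iota>_in[OF eD(1)[OF that(3)]]] by (simp add: Pc)
    show "?F (x, v \<oplus>\<^bsub>V\<^esub> w) = ?F (x, v) + ?F (x, w)" if "x \<in> carrier H" "v \<in> carrier V" "w \<in> carrier V" for x v w
      using P.smult_r_distr[OF that(1) \<iota>_in[OF eD(1)[OF that(2)]] \<iota>_in[OF eD(1)[OF that(3)]]] that
      by (simp add: Pc eD) (simp add: \<iota>_def elem_tensor_add)
    show "?F (?ra x c, v) = ?F (x, ?la c v)" if "x \<in> carrier H" "c \<in> carrier kG" "v \<in> carrier V" for x c v
      using P.smult_assoc[OF that(1) embed_in[OF that(2)] \<iota>_in[OF eD(1)[OF that(3)]]] that
      by (simp add: eD embed_act)
    show "Poly_Mapping.keys (?\<phi> h (x, v)) \<subseteq> carrier H \<times> carrier V \<and> fext ?F (?\<phi> h (x, v)) = h \<odot>\<^bsub>P\<^esub> ?F (x, v)"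
      if "h \<in> carrier H" "x \<in> carrier H" "v \<in> carrier V" for h x v
      using P.smult_assoc[OF that(1,2) \<iota>_in[OF eD(1)[OF that(3)]]] that by simp
    note rels = tensor_relations_intros[where M = H and N = V and S = "carrier kG" and ra = ?ra and la = ?la]
    have iev: "i (ev b) \<in> carrier V" if "b \<in> B" for b using that by (simp add: iD vecs_single)
    have Hadd: "x \<oplus>\<^bsub>H\<^esub> y = x + y" for x y by (simp add: ore_algebra_def)
    show "?n b (c + d) - ?n b c - ?n b d \<in> ?R" if "b \<in> ?S \<times> B" for b c d
      using that rels(1)[of "scale c (wH \<gamma> (fst b))" "i (ev (snd b))" "scale d (wH \<gamma> (fst b))"]
      by (auto simp: sc_closed wH_closed iev Hadd scale_add_left)
    show "Poly_Mapping.keys (?n b c) \<subseteq> carrier H \<times> carrier V" if "b \<in> ?S \<times> B" for b c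
      using that by (auto simp: sc_closed wH_closed iev)
    show "fext ?F (?n b c) = Poly_Mapping.single b c" if "b \<in> ?S \<times> B" for b c
      using that by (auto simp: ei vecs_single act_scale w_act)
    show "frag_of (h, v) \<in> frag_basis.reach ?R (?S \<times> B) ?n"
      if fb: "frag_basis ?R (?S \<times> B) ?n" and h: "h \<in> carrier H" and v: "v \<in> carrier V" for h v
    proof -
      interpret fb: frag_basis ?R "?S \<times> B" ?n by fact
      have sumI: "frag_of z \<in> fb.reach" if "frag_of z - frag_of z1 - frag_of z2 \<in> ?R"
        "frag_of z1 \<in> fb.reach" "frag_of z2 \<in> fb.reach" for z z1 z2
        by (rule fb.reach_equiv[OF fb.reach_add[OF that(2,3)]]) (use that in \<open>simp add: diff_diff_eq\<close>)
      have zeroI: "frag_of z \<in> fb.reach" if "frag_of z - frag_of z - frag_of z \<in> ?R" for z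
        using fb.neg[OF that] by (intro fb.reach_rel) simp
      have symI: "frag_of z \<in> fb.reach" if "frag_of z' - frag_of z \<in> ?R" "frag_of z' \<in> fb.reach" for z z'
        using fb.neg[OF that(1)] by (intro fb.reach_equiv[OF that(2)]) simp
      have scale_one: "x \<otimes>\<^bsub>H\<^esub> ore_embed (Poly_Mapping.single \<one> c) = scale c x" if "x \<in> carrier H" for c x
      proof -
        have "ore_embed (Poly_Mapping.single \<one> c) = scale c \<one>\<^bsub>H\<^esub>"
          by (simp add: embed_ev ore_algebra_simps)
        then show ?thesis using that by (simp only: lin_scale[OF H_mult_lin(1)] Hr.r_one)
      qed
      have 1: "frag_of (scale c (wH \<gamma> j), i g) \<in> fb.reach" if j: "j \<in> ?S" and g: "g \<in> vecs B" for c j g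
        using g
      proof (induction g rule: vecs_induct)
        case zero
        show ?case using rels(2)[of "scale c (wH \<gamma> j)" "i 0" "i 0"] iD(2)[of 0 0]
          by (intro zeroI) (simp add: iD sc_closed wH_closed)
      next
        case (add f g)
        show ?case using rels(2)[of "scale c (wH \<gamma> j)" "i f" "i g"] add
          by (intro sumI[OF _ add(3,4)]) (simp add: iD sc_closed wH_closed)
      next
        case (single b d)
        have "i (Poly_Mapping.single b d) = Poly_Mapping.single \<one> d \<odot>\<^bsub>V\<^esub> i (ev b)"
          using iD(3)[of "Poly_Mapping.single \<one> d" "ev b"] single
          by (simp add: group_algebra_simps vecs_single grepD[OF r])
        moreover have "scale c (wH \<gamma> j) \<otimes>\<^bsub>H\<^esub> ore_embed (Poly_Mapping.single \<one> d) = scale (d * c) (wH \<gamma> j)"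
          unfolding scale_one[OF sc_closed[OF wH_closed]] by simp
        moreover have "frag_of (?ra (scale c (wH \<gamma> j)) (Poly_Mapping.single \<one> d), i (ev b)) -
            frag_of (scale c (wH \<gamma> j), ?la (Poly_Mapping.single \<one> d) (i (ev b))) \<in> ?R"
          by (rule rels(3)) (simp_all add: sc_closed wH_closed iev single group_algebra_simps vecs_single)
        ultimately have rel: "frag_of (scale (d * c) (wH \<gamma> j), i (ev b)) -
            frag_of (scale c (wH \<gamma> j), i (Poly_Mapping.single b d)) \<in> ?R"
          by simp
        have "frag_of (scale (d * c) (wH \<gamma> j), i (ev b)) \<in> fb.reach"
          using fb.reach_basis[of "(j, b)" "d * c"] j single by simp
        then show ?case by (rule symI[OF rel])
      qed
      have 2: "frag_of (lin_ext (wH \<gamma>) p, v) \<in> fb.reach" if p: "p \<in> vecs ?S" and v: "v \<in> carrier V" for p v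
        using p
      proof (induction p rule: vecs_induct)
        case zero
        show ?case using rels(1)[of 0 v 0] v
          by (intro zeroI) (simp add: Hadd H_carrier lin_0[OF lin_lin_ext])
      next
        case (add f g)
        have "lin_ext (wH \<gamma>) f \<in> carrier H" for f
          unfolding H_carrier
          by (rule lin_ext_in_vecs[of _ UNIV]) (use wH_closed in \<open>simp_all add: H_carrier\<close>)
        then show ?case using rels(1)[of "lin_ext (wH \<gamma>) f" v "lin_ext (wH \<gamma>) g"] v
          by (intro sumI[OF _ add(3,4)]) (simp add: Hadd lin_add[OF lin_lin_ext])
      next
        case (single j c)
        then show ?case using 1[of j "e v" c] v by (simp add: ie eD)
      qed
      have 3: "frag_of (Poly_Mapping.single (\<one>, n) c, v) \<in> fb.reach" if v: "v \<in> carrier V" for n c v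
      proof -
        obtain p where p: "p \<in> vecs ?S" "ore_var G [^]\<^bsub>H\<^esub> n = lin_ext (wH \<gamma>) p"
          using var_pow_wH by blast
        have "Poly_Mapping.single (\<one>, n) c = scale c (ore_var G [^]\<^bsub>H\<^esub> n)" by (simp add: var_pow)
        also have "\<dots> = lin_ext (wH \<gamma>) (scale c p)" by (simp only: p lin_scale[OF lin_lin_ext])
        finally show ?thesis using 2[OF vecs_scale[OF p(1)] v] by simp
      qed
      have "h \<in> vecs (carrier G \<times> UNIV)" using h by (simp add: H_carrier)
      then show ?thesis
      proof (induction h rule: vecs_induct)
        case zero
        show ?case using rels(1)[of 0 v 0] v
          by (intro zeroI) (simp add: Hadd H_carrier)
      next
        case (add f g)
        then show ?case using rels(1)[of f v g] v
          by (intro sumI[OF _ add(3,4)]) (simp add: Hadd H_carrier)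
      next
        case (single b c)
        then obtain g n where [simp]: "b = (g, n)" and g: "g \<in> carrier G" by auto
        \<comment> \<open>From \<open>x^n g = \<chi>(g)^(-n) g x^n\<close>: with the factor
          \<open>\<chi>(g)^n\<close> the group element stands on the right and can cross the tensor
          sign.\<close>
        define x where "x = Poly_Mapping.single (\<one>, n) (c * \<chi> g ^ n)"
        have x: "x \<in> carrier H" by (simp add: x_def H_carrier vecs_single)
        have eg: "ev g \<in> carrier kG" using g by (simp add: group_algebra_simps vecs_single)
        have xg: "x \<otimes>\<^bsub>H\<^esub> ore_embed (ev g) = Poly_Mapping.single b c"
        proof -
          have "\<chi> g ^ n * inverse (\<chi> g) ^ n = 1"
            using \<chi>_nonzero[OF g] by (simp flip: power_mult_distrib)
          then have c: "c * \<chi> g ^ n * inverse (\<chi> g) ^ n = c" by (simp only: mult.assoc mult_1_right)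
          show ?thesis using g by (simp add: x_def embed_ev ore_algebra_simps c)
        qed
        have "frag_of (x, ev g \<odot>\<^bsub>V\<^esub> v) \<in> fb.reach"
          unfolding x_def by (rule 3) (rule V.smult_closed[OF eg v])
        moreover have "frag_of (Poly_Mapping.single b c, v) - frag_of (x, ev g \<odot>\<^bsub>V\<^esub> v) \<in> ?R"
          using rels(3)[OF x v eg] unfolding xg .
        ultimately show ?case by (rule fb.reach_equiv)
      qed
    qed
  qed blast+
  show thesis
  proof (rule that[OF e f(1,2,3)])
    fix h v assume hv: "h \<in> carrier H" "v \<in> carrier V"
    have "\<zero>\<^bsub>imod V\<^esub> = ?R" by (simp add: ind balanced_tensor_def quot_module_def)
    then show "f (ipure V h v) = h \<odot>\<^bsub>P\<^esub> elem_tensor (ev (0, 0)) (e v)"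
      using f(4)[OF hv] by (simp add: ind_pure_def \<iota>_def)
  qed
qed

end

section \<open>Jordan modules as truncations of the induced module\<close>

context graded_setting
begin

definition trunc :: "nat \<Rightarrow> (nat \<times> nat \<Rightarrow>\<^sub>0 'k) \<Rightarrow> (nat \<times> nat \<Rightarrow>\<^sub>0 'k)"
  where "trunc n = lin_ext (\<lambda>(k, r). if k < n then ev (k, r) else 0)"

definition unsh :: "nat \<Rightarrow> (nat \<times> nat \<Rightarrow>\<^sub>0 'k) \<Rightarrow> (nat \<times> nat \<Rightarrow>\<^sub>0 'k)"
  where "unsh n = lin_ext (\<lambda>(k, r). ev (k - n, r))"

abbreviation "jordan n \<gamma> B \<rho> \<equiv> gmod ({..<n} \<times> {..<s}) (jx {..<n} s \<gamma>) jd B \<rho>"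

lemma trunc_lin: "lin (trunc n)" and sh_lin: "lin (sh n)" and unsh_lin: "lin (unsh n)"
  by (simp_all add: trunc_def sh_def unsh_def lin_lin_ext)

lemma trunc_ev [simp]: "trunc n (ev (k, r)) = (if k < n then ev (k, r) else 0)"
  and unsh_ev [simp]: "unsh n (ev (k, r)) = ev (k - n, r)"
  by (simp_all add: trunc_def unsh_def)

lemma lookup_trunc:
  fixes f :: "(nat \<times> nat) \<times> 'u \<Rightarrow>\<^sub>0 'k"
  shows "Poly_Mapping.lookup (tens (trunc n) (\<lambda>x. x) f) ((k, r), b) =
    (if k < n then Poly_Mapping.lookup f ((k, r), b) else 0)"
proof -
  have "f \<in> vecs UNIV" by simp
  then show ?thesis
  proof (induction rule: vecs_lin_induct)
    case (ev x)
    obtain k' r' b' where [simp]: "x = ((k', r'), b')" by (metis surj_pair)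
    show ?case by (simp add: lookup_single when_def)
  qed (simp_all add: lin_0[OF lin_tens] lin_add[OF lin_tens] lin_scale[OF lin_tens] lookup_add)
qed

text \<open>Truncation \<open>k < n\<close> of the basis \<open>(x\<^sup>s - \<gamma>)\<^sup>k x\<^sup>r \<otimes> b\<close> of the induced module is the quotient
  by the multiples of \<open>(x\<^sup>s - \<gamma>)\<^sup>n\<close>.\<close>

lemma jordan_module_miso:
  fixes V :: "('a \<Rightarrow>\<^sub>0 'k, 'v) module" and B :: "'u set" and \<gamma> :: 'k
  assumes V: "miso kG V (cmod B \<rho>)" and r: "grep G B \<rho>"
  shows "miso H (jordan_module G (\<lambda>g. inverse (\<chi> g)) s n V \<gamma>) (jordan n \<gamma> B \<rho>)"
    and "\<gamma> = 0 \<Longrightarrow> jordan_module G (\<lambda>g. inverse (\<chi> g)) s n V \<gamma> = nil_module G (\<lambda>g. inverse (\<chi> g)) (s * n) V"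
proof -
  let ?S = "(UNIV :: nat set) \<times> {..<s}"
  let ?S' = "{..<n} \<times> {..<s}"
  let ?P = "gmod ?S (jx UNIV s \<gamma>) jd B \<rho>"
  let ?N = "jordan n \<gamma> B \<rho>"
  obtain e \<theta> where e: "e \<in> module_hom kG V (cmod B \<rho>)" "bij_betw e (carrier V) (vecs B)"
    and \<theta>: "left_module H (imod V)" "\<theta> \<in> module_hom H (imod V) ?P" "bij_betw \<theta> (carrier (imod V)) (carrier ?P)"
    and pure: "\<And>h v. h \<in> carrier H \<Longrightarrow> v \<in> carrier V \<Longrightarrow> \<theta> (ipure V h v) = h \<odot>\<^bsub>?P\<^esub> elem_tensor (ev (0, 0)) (e v)"
    by (rule ind_module_miso[OF V r, where \<gamma> = \<gamma>]) blast
  interpret M: left_module H "imod V" by fact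
  have d: "gdata s ?S (jx UNIV s \<gamma>) jd" and d': "gdata s ?S' (jx {..<n} s \<gamma>) jd"
    by (rule gdata_jordan[OF s_pos])+
  have PL: "left_module H ?P" and NL: "left_module H ?N"
    by (rule gmod_left_module[OF d r] gmod_left_module[OF d' r])+
  interpret P: left_module H ?P by (rule PL)
  interpret N: left_module H ?N by (rule NL)
  note \<theta>D = module_homD[OF \<theta>(2)]
  have \<theta>_in: "\<theta> m \<in> vecs (?S \<times> B)" if "m \<in> carrier (imod V)" for m
    using \<theta>D(1)[OF that] by simp
  have \<theta>_surj: "\<exists>m\<in>carrier (imod V). \<theta> m = f" if "f \<in> vecs (?S \<times> B)" for f
  proof -
    have "f \<in> \<theta> ` carrier (imod V)" using that \<theta>(3) by (simp add: bij_betw_def)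
    then show ?thesis by blast
  qed
  have \<theta>_inj: "m = m'" if "m \<in> carrier (imod V)" "m' \<in> carrier (imod V)" "\<theta> m = \<theta> m'" for m m'
    using that \<theta>(3) by (auto simp: bij_betw_def inj_on_def)
  let ?tr = "tens (trunc n) (\<lambda>x. x)"
  have tr_in: "?tr f \<in> vecs (?S' \<times> B)" if "f \<in> vecs (?S \<times> B)" for f
    by (rule tens_in_vecs[OF that]) (auto intro: vecs_single)
  have tr_id: "?tr f = f" if "f \<in> vecs (?S' \<times> B)" for f
  proof -
    have "?tr f = tens (\<lambda>x. x) (\<lambda>x. x) f" by (intro tens_cong[OF that]) auto
    then show ?thesis by (simp add: tens_id)
  qed
  have tr_hom: "?tr (x \<odot>\<^bsub>?P\<^esub> f) = x \<odot>\<^bsub>?N\<^esub> ?tr f" if x: "x \<in> carrier H" and f: "f \<in> vecs (?S \<times> B)" for x f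
    unfolding cmod_simps
  proof (rule hmod_intertwine[OF lin_tens _ _ _ _ f])
    show "x \<in> vecs (carrier G \<times> UNIV)" using x by (simp add: H_carrier)
    show "gvar (jx UNIV s \<gamma>) f \<in> vecs (?S \<times> B)" if "f \<in> vecs (?S \<times> B)" for f
      using hrepD(3)[OF hrep_gmod[OF d r] that] .
    show "?tr (gvar (jx UNIV s \<gamma>) f) = gvar (jx {..<n} s \<gamma>) (?tr f)" if "f \<in> vecs (?S \<times> B)" for f
      unfolding tens_comp[OF trunc_lin lin_id(1)] tens_comp[OF jx_lin lin_id(1)]
      by (intro tens_cong[OF that])
        (auto simp: jx_ev lin_add[OF trunc_lin] lin_scale[OF trunc_lin] lin_0[OF jx_lin] simp del: scale_single)
    show "?tr (gact jd \<rho> g f) = gact jd \<rho> g (?tr f)" if "g \<in> carrier G" "f \<in> vecs (?S \<times> B)" for g f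
      unfolding tens_comp[OF trunc_lin lin_id(1)] tens_comp[OF jd_lin grepD(1)[OF r that(1)]]
      by (intro tens_cong[OF that(2)])
        (auto simp: jd_ev lin_scale[OF trunc_lin] lin_0[OF jd_lin] simp del: scale_single)
  qed
  \<comment> \<open>The kernel of truncation. It is identified with the image of
    \<open>(x^s - \<gamma>)^n\<close> and, for \<open>\<gamma> = 0\<close>, also with the submodule
    generated by \<open>x^(s n)\<close>; both quotients of the statement then coincide.\<close>
  define K where "K = {m \<in> carrier (imod V). ?tr (\<theta> m) = 0}"
  have K_lookup: "Poly_Mapping.lookup (\<theta> m) ((k, q), b) = 0" if "m \<in> K" "k < n" for m k q b
    using that lookup_trunc[of n "\<theta> m" k q b] by (simp add: K_def)
  have K_vecs: "\<theta> m \<in> vecs (({n..} \<times> {..<s}) \<times> B)" if "m \<in> K" for m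
  proof (rule vecsI)
    fix x assume x: "x \<notin> ({n..} \<times> {..<s}) \<times> B"
    obtain k q b where [simp]: "x = ((k, q), b)" by (metis surj_pair)
    show "Poly_Mapping.lookup (\<theta> m) x = 0"
      using K_lookup[OF that, of k q b] vecsD[OF \<theta>_in[of m], of x] x that by (cases "k < n") (auto simp: K_def)
  qed
  have z_act: "zH \<gamma> [^]\<^bsub>H\<^esub> n \<odot>\<^bsub>?P\<^esub> f = tens (sh n) (\<lambda>x. x) f" if "f \<in> vecs (?S \<times> B)" for f
    by (rule act_zH_pow_jordan[OF that r])
  have z_tr: "?tr (zH \<gamma> [^]\<^bsub>H\<^esub> n \<odot>\<^bsub>?P\<^esub> f) = 0" if "f \<in> vecs (?S \<times> B)" for f
    unfolding z_act[OF that] tens_comp[OF trunc_lin lin_id(1)]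
    by (rule lin_eqI[OF that lin_tens lin_zero]) auto
  have K_image: "K = (\<lambda>m. zH \<gamma> [^]\<^bsub>H\<^esub> n \<odot>\<^bsub>imod V\<^esub> m) ` carrier (imod V)"
  proof
    show "(\<lambda>m. zH \<gamma> [^]\<^bsub>H\<^esub> n \<odot>\<^bsub>imod V\<^esub> m) ` carrier (imod V) \<subseteq> K"
    proof clarify
      fix m assume m: "m \<in> carrier (imod V)"
      have "?tr (\<theta> (zH \<gamma> [^]\<^bsub>H\<^esub> n \<odot>\<^bsub>imod V\<^esub> m)) = 0"
        unfolding \<theta>D(3)[OF zH_pow_closed m] by (rule z_tr[OF \<theta>_in[OF m]])
      then show "zH \<gamma> [^]\<^bsub>H\<^esub> n \<odot>\<^bsub>imod V\<^esub> m \<in> K"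
        using M.smult_closed[OF zH_pow_closed m] by (simp add: K_def)
    qed
    show "K \<subseteq> (\<lambda>m. zH \<gamma> [^]\<^bsub>H\<^esub> n \<odot>\<^bsub>imod V\<^esub> m) ` carrier (imod V)"
    proof
      fix m assume m: "m \<in> K"
      \<comment> \<open>Division by \<open>(x^s - \<gamma>)^n\<close>: elements of \<open>K\<close>
        have \<open>k \<ge> n\<close> throughout, so the truncated subtraction in
        \<open>unsh\<close> loses nothing.\<close>
      let ?f = "tens (unsh n) (\<lambda>x. x) (\<theta> m)"
      have f: "?f \<in> vecs (?S \<times> B)"
        by (rule tens_in_vecs[OF K_vecs[OF m]]) (auto intro!: vecs_single)
      obtain m' where m': "m' \<in> carrier (imod V)" "\<theta> m' = ?f" using \<theta>_surj[OF f] by blast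
      have "tens (sh n) (\<lambda>x. x) ?f = tens (\<lambda>x. x) (\<lambda>x. x) (\<theta> m)"
        unfolding tens_comp[OF sh_lin lin_id(1)] by (intro tens_cong[OF K_vecs[OF m]]) auto
      then have "\<theta> (zH \<gamma> [^]\<^bsub>H\<^esub> n \<odot>\<^bsub>imod V\<^esub> m') = \<theta> m"
        unfolding \<theta>D(3)[OF zH_pow_closed m'(1)] m'(2) z_act[OF f] tens_id .
      then have "zH \<gamma> [^]\<^bsub>H\<^esub> n \<odot>\<^bsub>imod V\<^esub> m' = m"
        using m m' M.smult_closed[OF zH_pow_closed m'(1)] by (intro \<theta>_inj) (auto simp: K_def)
      then show "m \<in> (\<lambda>m. zH \<gamma> [^]\<^bsub>H\<^esub> n \<odot>\<^bsub>imod V\<^esub> m) ` carrier (imod V)" using m' by blast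
    qed
  qed
  have jordan_eq: "jordan_module G (\<lambda>g. inverse (\<chi> g)) s n V \<gamma> = quot_module (imod V) K"
    by (simp add: jordan_module_def Let_def K_image zH_def)
  have add': "?tr (\<theta> (x \<oplus>\<^bsub>imod V\<^esub> y)) = ?tr (\<theta> x) \<oplus>\<^bsub>?N\<^esub> ?tr (\<theta> y)"
    if "x \<in> carrier (imod V)" "y \<in> carrier (imod V)" for x y
    using that by (simp add: \<theta>D lin_add[OF lin_tens])
  have smult': "x \<odot>\<^bsub>imod V\<^esub> m \<in> carrier (imod V) \<and> ?tr (\<theta> (x \<odot>\<^bsub>imod V\<^esub> m)) = x \<odot>\<^bsub>?N\<^esub> ?tr (\<theta> m)"
    if "x \<in> carrier H" "m \<in> carrier (imod V)" for x m
    using that M.smult_closed[OF that] by (simp only: \<theta>D tr_hom \<theta>_in simp_thms)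
  have surj': "\<exists>m\<in>carrier (imod V). ?tr (\<theta> m) = y" if "y \<in> carrier ?N" for y
  proof -
    have y: "y \<in> vecs (?S' \<times> B)" using that by simp
    then have "y \<in> vecs (?S \<times> B)" by (rule vecs_mono) auto
    then obtain m where "m \<in> carrier (imod V)" "\<theta> m = y" using \<theta>_surj by blast
    then show ?thesis using tr_id[OF y] by blast
  qed
  have into': "?tr (\<theta> m) \<in> carrier ?N" if "m \<in> carrier (imod V)" for m
    using tr_in[OF \<theta>_in[OF that]] by simp
  have K': "K = {m \<in> carrier (imod V). ?tr (\<theta> m) = \<zero>\<^bsub>?N\<^esub>}" by (simp add: K_def)
  obtain f where "left_module H (quot_module (imod V) K)" "f \<in> module_hom H (quot_module (imod V) K) ?N"
    "bij_betw f (carrier (quot_module (imod V) K)) (carrier ?N)"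
    by (rule quot_module_miso[OF M.M.abelian_group_axioms NL into' add' smult' surj' K']) blast+
  then show "miso H (jordan_module G (\<lambda>g. inverse (\<chi> g)) s n V \<gamma>) ?N"
    unfolding jordan_eq using NL by (blast intro: misoI)
  assume \<gamma>: "\<gamma> = 0"
  let ?x = "ore_var G [^]\<^bsub>H\<^esub> (s * n)"
  interpret Hr: ring H by (rule ring_H)
  have z: "zH \<gamma> [^]\<^bsub>H\<^esub> n = ?x"
    by (simp add: zH_def \<gamma> monoid.nat_pow_pow[OF ring.is_monoid[OF ring_H] var_closed])
  have \<theta>_pure: "\<theta> (ipure V ?x v) = elem_tensor (ev (n, 0)) (e v)" if "v \<in> carrier V" for v
  proof -
    have "elem_tensor (ev (0, 0)) (e v) \<in> vecs (?S \<times> B)"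
      using s_pos module_homD(1)[OF e(1) that] by (intro elem_tensor_in_vecs vecs_single) auto
    from z_act[OF this] show ?thesis
      using pure[OF zH_pow_closed that, of \<gamma> n] unfolding z
      by (simp add: tens_elem_tensor sh_lin lin_id)
  qed
  have pure_in: "ipure V h v \<in> carrier (imod V)" if "h \<in> carrier H" "v \<in> carrier V" for h v
    using that unfolding ind_pure_def ind_module_def Let_def balanced_tensor_def quot_module_def
    by (auto simp: A_RCOSETS_def RCOSETS_def free_module_def r_coset_def intro!: bexI[of _ "frag_of (h, v)"])
  let ?U = "{ipure V ?x v | v. v \<in> carrier V}"
  have "span_module H (imod V) ?U = K"
  proof
    have "submodule K H (imod V)"
    proof (intro submodule.intro submodule_axioms.intro)
      have K0: "\<zero>\<^bsub>imod V\<^esub> \<in> K"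
        using module_hom_zero[OF \<theta>(2) M.M.abelian_group_axioms P.M.abelian_group_axioms]
        by (simp add: K_def lin_0[OF lin_tens])
      show "subgroup K (add_monoid (imod V))"
      proof (rule group.subgroupI[OF M.M.a_group])
        show "K \<subseteq> carrier (add_monoid (imod V))" by (auto simp: K_def)
        show "K \<noteq> {}" using K0 by blast
        show "x \<otimes>\<^bsub>add_monoid (imod V)\<^esub> y \<in> K" if "x \<in> K" "y \<in> K" for x y
          using that add' by (auto simp: K_def)
        show "inv\<^bsub>add_monoid (imod V)\<^esub> x \<in> K" if x: "x \<in> K" for x
        proof -
          have xc: "x \<in> carrier (imod V)" using x by (simp add: K_def)
          then have "?tr (\<theta> (\<ominus>\<^bsub>imod V\<^esub> x)) + ?tr (\<theta> x) = ?tr (\<theta> \<zero>\<^bsub>imod V\<^esub>)"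
            using add'[of "\<ominus>\<^bsub>imod V\<^esub> x" x] by (simp add: M.M.l_neg)
          then show ?thesis using x K0 xc by (simp add: K_def flip: a_inv_def)
        qed
      qed
      show "x \<odot>\<^bsub>imod V\<^esub> m \<in> K" if "x \<in> carrier H" "m \<in> K" for x m
        using smult'[of x m] that smult_zero_right[OF NL that(1)] by (simp add: K_def)
    qed
    moreover have "?U \<subseteq> K"
    proof clarify
      fix v assume v: "v \<in> carrier V"
      then have "?tr (\<theta> (ipure V ?x v)) = 0"
        by (simp add: \<theta>_pure tens_elem_tensor trunc_lin lin_id)
      then show "ipure V ?x v \<in> K" using v by (simp add: K_def pure_in var_pow_closed)
    qed
    ultimately show "span_module H (imod V) ?U \<subseteq> K" unfolding span_module_def by blast
    show "K \<subseteq> span_module H (imod V) ?U"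
      unfolding span_module_def
    proof (intro Inter_greatest subsetI; clarify)
      fix L m assume L: "submodule L H (imod V)" and U: "?U \<subseteq> L" and m: "m \<in> K"
      interpret L: submodule L H "imod V" by fact
      have Lc: "x \<in> carrier (imod V)" if "x \<in> L" for x using L.mem_carrier[OF that] by simp
      \<comment> \<open>Every basis vector with \<open>k \<ge> n\<close> is reached inside
        \<open>L\<close>: the one at \<open>(k, q)\<close> and \<open>b\<close> is
        \<open>(x^s)^(k-n) x^q\<close> applied to a generator, which sits at
        \<open>(n, 0)\<close>.\<close>
      have "\<exists>x\<in>L. \<theta> x = f" if "f \<in> vecs (({n..} \<times> {..<s}) \<times> B)" for f
        using that
      proof (induction f rule: vecs_induct)
        case zero
        have "\<zero>\<^bsub>imod V\<^esub> \<in> L" using L.one_closed by simp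
        then show ?case
          using module_hom_zero[OF \<theta>(2) M.M.abelian_group_axioms P.M.abelian_group_axioms] by force
      next
        case (add f g)
        then obtain x y where "x \<in> L" "y \<in> L" "\<theta> x = f" "\<theta> y = g" by blast
        then show ?case using L.m_closed[of x y] Lc
          by (intro bexI[of _ "x \<oplus>\<^bsub>imod V\<^esub> y"]) (auto simp: \<theta>D)
      next
        case (single j c)
        then obtain k q b where [simp]: "j = ((k, q), b)" and k: "n \<le> k" and q: "q < s" and b: "b \<in> B" by auto
        obtain v where v: "v \<in> carrier V" "e v = Poly_Mapping.single b c"
        proof -
          have "Poly_Mapping.single b c \<in> e ` carrier V"
            using e(2) b by (simp add: bij_betw_def vecs_single)
          then show thesis using that by auto
        qed
        let ?h = "zH \<gamma> [^]\<^bsub>H\<^esub> (k - n) \<otimes>\<^bsub>H\<^esub> ore_var G [^]\<^bsub>H\<^esub> q"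
        have h: "?h \<in> carrier H" by (simp add: zH_pow_closed var_pow_closed)
        have p: "ipure V ?x v \<in> L" using U v by blast
        then have pc: "ipure V ?x v \<in> carrier (imod V)" by (rule Lc)
        have in1: "Poly_Mapping.single ((n, 0), b) c \<in> vecs (?S \<times> B)"
          and in2: "Poly_Mapping.single ((n, q), b) c \<in> vecs (?S \<times> B)"
          using b q s_pos by (auto intro: vecs_single)
        have t: "elem_tensor (ev (n, q)) (Poly_Mapping.single b c) = Poly_Mapping.single ((n, q), b) c" for q :: nat
          by simp
        have "\<theta> (?h \<odot>\<^bsub>imod V\<^esub> ipure V ?x v) = ?h \<odot>\<^bsub>?P\<^esub> Poly_Mapping.single ((n, 0), b) c"
          unfolding \<theta>D(3)[OF h pc] \<theta>_pure[OF v(1)] v(2) t ..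
        also have "\<dots> = zH \<gamma> [^]\<^bsub>H\<^esub> (k - n) \<odot>\<^bsub>?P\<^esub> (ore_var G [^]\<^bsub>H\<^esub> q \<odot>\<^bsub>?P\<^esub> Poly_Mapping.single ((n, 0), b) c)"
          using in1 by (intro P.smult_assoc) (simp_all add: zH_pow_closed var_pow_closed)
        also have "ore_var G [^]\<^bsub>H\<^esub> q \<odot>\<^bsub>?P\<^esub> Poly_Mapping.single ((n, 0), b) c = Poly_Mapping.single ((n, q), b) c"
          using act_var_pow[OF hrep_gmod[OF d r] in1, of q] q
            gvar_pow[OF jx_lin, of q UNIV s \<gamma> "ev (n, 0)" "Poly_Mapping.single b c"]
          by (simp only: t jx_pow_less add_0_right add_0_left)
        also have "zH \<gamma> [^]\<^bsub>H\<^esub> (k - n) \<odot>\<^bsub>?P\<^esub> Poly_Mapping.single ((n, q), b) c = Poly_Mapping.single j c"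
          using act_zH_pow_jordan[OF in2 r, of \<gamma> "k - n"] k
            tens_elem_tensor[OF sh_lin[of "k - n"] lin_id(1), of "ev (n, q)" "Poly_Mapping.single b c"]
          by (simp del: cmod_simps)
        finally show ?case using L.smult_closed[OF h p] by blast
      qed
      then obtain x where "x \<in> L" "\<theta> x = \<theta> m" using K_vecs[OF m] by blast
      then show "m \<in> L" using \<theta>_inj[of x m] Lc m by (auto simp: K_def)
    qed
  qed
  then show "jordan_module G (\<lambda>g. inverse (\<chi> g)) s n V \<gamma> = nil_module G (\<lambda>g. inverse (\<chi> g)) (s * n) V"
    unfolding jordan_eq by (simp add: nil_module_def Let_def)
qed

end

section \<open>Direct sums\<close>

lemma direct_sum_carrier:
  assumes "\<And>i. i \<in> I \<Longrightarrow> abelian_group (M i)"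
  shows "carrier (direct_sum I M) = {x \<in> \<Pi>\<^sub>E i\<in>I. carrier (M i). finite {i \<in> I. x i \<noteq> \<zero>\<^bsub>M i\<^esub>}}"
  unfolding direct_sum_def using assms
  by (simp add: carrier_sum_group abelian_group.a_group)

lemma direct_sum_simps [simp]:
  "\<zero>\<^bsub>direct_sum I M\<^esub> = (\<lambda>i\<in>I. \<zero>\<^bsub>M i\<^esub>)"
  "x \<oplus>\<^bsub>direct_sum I M\<^esub> y = (\<lambda>i\<in>I. x i \<oplus>\<^bsub>M i\<^esub> y i)"
  "r \<odot>\<^bsub>direct_sum I M\<^esub> x = (\<lambda>i\<in>I. r \<odot>\<^bsub>M i\<^esub> x i)"
  by (simp_all add: direct_sum_def)

lemma direct_sum_left_module:
  fixes M :: "'i \<Rightarrow> ('a, 'b) module"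
  assumes M: "\<And>i. i \<in> I \<Longrightarrow> left_module R (M i)" and R: "ring R"
  shows "left_module R (direct_sum I M)"
proof -
  have ab: "abelian_group (M i)" if "i \<in> I" for i
    using M[OF that] by (simp add: left_module_def)
  note car = direct_sum_carrier[of I M, OF ab]
  let ?G = "sum_group I (\<lambda>i. add_monoid (M i))"
  have G: "group ?G" by (rule sum_group) (simp add: ab abelian_group.a_group)
  interpret G: group ?G by (rule G)
  have carG: "carrier (direct_sum I M) = carrier ?G" by (simp add: direct_sum_def)
  have add_closed: "x \<oplus>\<^bsub>direct_sum I M\<^esub> y \<in> carrier (direct_sum I M)"
    if "x \<in> carrier (direct_sum I M)" "y \<in> carrier (direct_sum I M)" for x y
    using G.m_closed[of x y] that by (simp add: carG)
  have zero_closed: "\<zero>\<^bsub>direct_sum I M\<^esub> \<in> carrier (direct_sum I M)"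
    using G.one_closed by (simp add: carG)
  have comp: "x i \<in> carrier (M i)" if "x \<in> carrier (direct_sum I M)" "i \<in> I" for x i
    using that by (auto simp: car)
  have ext: "x = y" if "x \<in> carrier (direct_sum I M)" "y \<in> carrier (direct_sum I M)" "\<And>i. i \<in> I \<Longrightarrow> x i = y i" for x y
    using that by (auto simp: car intro: PiE_ext)
  have smult_closed: "r \<odot>\<^bsub>direct_sum I M\<^esub> x \<in> carrier (direct_sum I M)"
    if "r \<in> carrier R" "x \<in> carrier (direct_sum I M)" for r x
  proof -
    have "finite {i \<in> I. r \<odot>\<^bsub>M i\<^esub> x i \<noteq> \<zero>\<^bsub>M i\<^esub>}"
      by (rule finite_subset[of _ "{i \<in> I. x i \<noteq> \<zero>\<^bsub>M i\<^esub>}"])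
        (use that in \<open>auto simp: car smult_zero_right[OF M]\<close>)
    then show ?thesis
      using that left_module.smult_closed[OF M] comp[OF that(2)] by (auto simp: car cong: conj_cong)
  qed
  have "abelian_group (direct_sum I M)"
  proof (rule abelian_groupI)
    fix x y z assume c: "x \<in> carrier (direct_sum I M)" "y \<in> carrier (direct_sum I M)" "z \<in> carrier (direct_sum I M)"
    show "x \<oplus>\<^bsub>direct_sum I M\<^esub> y \<in> carrier (direct_sum I M)" using add_closed c by blast
    show "x \<oplus>\<^bsub>direct_sum I M\<^esub> y \<oplus>\<^bsub>direct_sum I M\<^esub> z = x \<oplus>\<^bsub>direct_sum I M\<^esub> (y \<oplus>\<^bsub>direct_sum I M\<^esub> z)"
    proof (rule ext)
      fix i assume i: "i \<in> I"
      interpret abelian_group "M i" by (rule ab[OF i])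
      show "(x \<oplus>\<^bsub>direct_sum I M\<^esub> y \<oplus>\<^bsub>direct_sum I M\<^esub> z) i = (x \<oplus>\<^bsub>direct_sum I M\<^esub> (y \<oplus>\<^bsub>direct_sum I M\<^esub> z)) i"
        using i c by (simp add: comp add.m_assoc)
    qed (intro add_closed c)+
    show "x \<oplus>\<^bsub>direct_sum I M\<^esub> y = y \<oplus>\<^bsub>direct_sum I M\<^esub> x"
    proof (rule ext)
      fix i assume i: "i \<in> I"
      interpret abelian_group "M i" by (rule ab[OF i])
      show "(x \<oplus>\<^bsub>direct_sum I M\<^esub> y) i = (y \<oplus>\<^bsub>direct_sum I M\<^esub> x) i"
        using i c by (simp add: comp add.m_comm)
    qed (intro add_closed c)+
    show "\<zero>\<^bsub>direct_sum I M\<^esub> \<oplus>\<^bsub>direct_sum I M\<^esub> x = x"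
    proof (rule ext)
      fix i assume i: "i \<in> I"
      interpret abelian_group "M i" by (rule ab[OF i])
      show "(\<zero>\<^bsub>direct_sum I M\<^esub> \<oplus>\<^bsub>direct_sum I M\<^esub> x) i = x i"
        using i c by (simp add: comp)
    qed (intro add_closed zero_closed c)+
    show "\<exists>y\<in>carrier (direct_sum I M). y \<oplus>\<^bsub>direct_sum I M\<^esub> x = \<zero>\<^bsub>direct_sum I M\<^esub>"
      using G.l_inv_ex[of x] c by (simp add: carG)
  qed (rule zero_closed)
  then show ?thesis
  proof (rule left_module.intro[OF R _ left_module_axioms.intro])
    interpret R: ring R by (rule R)
    note comp' = comp left_module.smult_l_distr[OF M] left_module.smult_r_distr[OF M]
      left_module.smult_assoc[OF M] left_module.smult_one[OF M]
    show "(a \<oplus>\<^bsub>R\<^esub> b) \<odot>\<^bsub>direct_sum I M\<^esub> x = a \<odot>\<^bsub>direct_sum I M\<^esub> x \<oplus>\<^bsub>direct_sum I M\<^esub> b \<odot>\<^bsub>direct_sum I M\<^esub> x"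
      if "a \<in> carrier R" "b \<in> carrier R" "x \<in> carrier (direct_sum I M)" for a b x
      using that comp' by (intro ext add_closed smult_closed R.add.m_closed) auto
    show "a \<odot>\<^bsub>direct_sum I M\<^esub> (x \<oplus>\<^bsub>direct_sum I M\<^esub> y) = a \<odot>\<^bsub>direct_sum I M\<^esub> x \<oplus>\<^bsub>direct_sum I M\<^esub> a \<odot>\<^bsub>direct_sum I M\<^esub> y"
      if "a \<in> carrier R" "x \<in> carrier (direct_sum I M)" "y \<in> carrier (direct_sum I M)" for a x y
      using that comp' by (intro ext add_closed smult_closed) auto
    show "(a \<otimes>\<^bsub>R\<^esub> b) \<odot>\<^bsub>direct_sum I M\<^esub> x = a \<odot>\<^bsub>direct_sum I M\<^esub> (b \<odot>\<^bsub>direct_sum I M\<^esub> x)"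
      if "a \<in> carrier R" "b \<in> carrier R" "x \<in> carrier (direct_sum I M)" for a b x
      using that comp' by (intro ext smult_closed R.m_closed) auto
    show "\<one>\<^bsub>R\<^esub> \<odot>\<^bsub>direct_sum I M\<^esub> x = x" if "x \<in> carrier (direct_sum I M)" for x
      using that comp' by (intro ext smult_closed R.one_closed) auto
  qed (rule smult_closed)
qed

definition sumop :: "('i \<Rightarrow> 'a \<Rightarrow> ('b \<Rightarrow>\<^sub>0 'k::field) \<Rightarrow> ('b \<Rightarrow>\<^sub>0 'k)) \<Rightarrow> 'a \<Rightarrow> ('i \<times> 'b \<Rightarrow>\<^sub>0 'k) \<Rightarrow> ('i \<times> 'b \<Rightarrow>\<^sub>0 'k)"
  where "sumop op a = lin_ext (\<lambda>(i, b). elem_tensor (ev i) (op i a (ev b)))"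

definition coord :: "'i \<Rightarrow> ('i \<times> 'b \<Rightarrow>\<^sub>0 'k::field) \<Rightarrow> ('b \<Rightarrow>\<^sub>0 'k)"
  where "coord i = lin_ext (\<lambda>(i', b). if i' = i then ev b else 0)"

lemma sumop_ev [simp]: "sumop op a (ev (i, b)) = elem_tensor (ev i) (op i a (ev b))"
  by (simp add: sumop_def)

lemma sumop_lin: "lin (sumop op a)" and coord_lin: "lin (coord i)"
  by (simp_all add: sumop_def coord_def lin_lin_ext)

lemma coord_ev: "coord i (ev (i', b)) = (if i' = i then ev b else 0)"
  by (simp add: coord_def)

lemma lookup_coord: "Poly_Mapping.lookup (coord i f) b = Poly_Mapping.lookup f (i, b)"
proof -
  have "f \<in> vecs UNIV" by simp
  then show ?thesis
    by (induction rule: vecs_lin_induct)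
      (auto simp: lin_0[OF coord_lin] lin_add[OF coord_lin] lin_scale[OF coord_lin] lookup_add
        coord_ev lookup_single when_def split: if_splits)
qed

lemma coord_elem_tensor: "coord i (elem_tensor (ev j) f) = (if i = j then f else 0)"
  by (rule poly_mapping_eqI) (auto simp: lookup_coord lookup_elem_tensor lookup_single when_def)

lemma coord_in_vecs: "f \<in> vecs (Sigma I B) \<Longrightarrow> coord i f \<in> vecs (B i)"
  by (rule vecsI) (auto simp: lookup_coord dest: vecsD)

lemma elem_tensor_Sigma: "i \<in> I \<Longrightarrow> f \<in> vecs (B i) \<Longrightarrow> elem_tensor (ev i) f \<in> vecs (Sigma I B)"
  by (rule vecsI) (auto simp: lookup_elem_tensor lookup_single when_def dest: vecsD split: if_splits)

lemma sumop_in_vecs: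
  assumes "f \<in> vecs (Sigma I B)" "\<And>i f. i \<in> I \<Longrightarrow> f \<in> vecs (B i) \<Longrightarrow> op i a f \<in> vecs (B i)"
  shows "sumop op a f \<in> vecs (Sigma I B)"
  using assms(1) by (rule lin_vecs_image[OF _ sumop_lin])
    (auto intro!: elem_tensor_Sigma assms(2) vecs_single)

lemma direct_sum_miso:
  fixes A :: "('a \<Rightarrow>\<^sub>0 'k::field) ring" and M :: "'i \<Rightarrow> ('a \<Rightarrow>\<^sub>0 'k, 'v) module" and B :: "'i \<Rightarrow> 'b set"
  assumes A: "ring A" "carrier A = vecs Bas"
    and M: "\<And>i. i \<in> I \<Longrightarrow> miso A (M i) (cmod (B i) (op i))"
    and lin: "\<And>i a. i \<in> I \<Longrightarrow> a \<in> Bas \<Longrightarrow> lin (op i a)"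
    and closed: "\<And>i a f. i \<in> I \<Longrightarrow> a \<in> Bas \<Longrightarrow> f \<in> vecs (B i) \<Longrightarrow> op i a f \<in> vecs (B i)"
  shows "miso A (direct_sum I M) (cmod (Sigma I B) (sumop op))"
proof -
  \<comment> \<open>The isomorphisms run from coordinates to modules, so that composing them with
    the projections \<open>coord i\<close> gives the components of the map to the direct
    sum.\<close>
  have "\<exists>e. e \<in> module_hom A (cmod (B i) (op i)) (M i) \<and> bij_betw e (vecs (B i)) (carrier (M i))" if "i \<in> I" for i
    using miso_sym[OF M[OF that]] by (auto elim!: misoE)
  then obtain e where e: "\<And>i. i \<in> I \<Longrightarrow> e i \<in> module_hom A (cmod (B i) (op i)) (M i)"
      "\<And>i. i \<in> I \<Longrightarrow> bij_betw (e i) (vecs (B i)) (carrier (M i))"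
    by metis
  have LM: "left_module A (M i)" if "i \<in> I" for i using M[OF that] by (simp add: miso_def)
  have DL: "left_module A (direct_sum I M)" by (rule direct_sum_left_module[OF LM A(1)])
  have ab: "abelian_group (M i)" if "i \<in> I" for i using LM[OF that] by (simp add: left_module_def)
  note car = direct_sum_carrier[of I M, OF ab]
  have e0: "e i 0 = \<zero>\<^bsub>M i\<^esub>" if "i \<in> I" for i
    using module_hom_zero[OF e(1)[OF that] abelian_group_cmod ab[OF that]] by simp
  note eD = module_homD[OF e(1), simplified]
  let ?C = "cmod (Sigma I B) (sumop op)"
  define F where "F f = (\<lambda>i\<in>I. e i (coord i f))" for f
  have F_in: "F f \<in> carrier (direct_sum I M)" if f: "f \<in> vecs (Sigma I B)" for f
  proof -
    have "{i \<in> I. F f i \<noteq> \<zero>\<^bsub>M i\<^esub>} \<subseteq> fst ` Poly_Mapping.keys f"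
    proof clarify
      fix i assume i: "i \<in> I" "F f i \<noteq> \<zero>\<^bsub>M i\<^esub>"
      then have "coord i f \<noteq> 0" using e0 by (auto simp: F_def)
      then obtain b where "Poly_Mapping.lookup (coord i f) b \<noteq> 0"
        by (metis lookup_zero poly_mapping_eqI)
      then show "i \<in> fst ` Poly_Mapping.keys f" by (force simp: lookup_coord in_keys_iff)
    qed
    then have "finite {i \<in> I. F f i \<noteq> \<zero>\<^bsub>M i\<^esub>}" by (rule finite_subset) simp
    then show ?thesis using eD(1) coord_in_vecs[OF f] by (auto simp: car F_def)
  qed
  have hom: "F \<in> module_hom A ?C (direct_sum I M)"
  proof (rule module_homI)
    show "F x \<in> carrier (direct_sum I M)" if "x \<in> carrier ?C" for x using F_in that by simp
    show "F (x \<oplus>\<^bsub>?C\<^esub> y) = F x \<oplus>\<^bsub>direct_sum I M\<^esub> F y" if "x \<in> carrier ?C" "y \<in> carrier ?C" for x y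
      using that coord_in_vecs[of x I B] coord_in_vecs[of y I B]
      by (auto simp: F_def lin_add[OF coord_lin] eD intro!: restrict_ext)
    fix x f assume x: "x \<in> carrier A" and "f \<in> carrier ?C"
    then have f: "f \<in> vecs (Sigma I B)" by simp
    have "coord i (lin_ext (\<lambda>a. sumop op a f) x) = lin_ext (\<lambda>a. op i a (coord i f)) x" if i: "i \<in> I" for i
    proof (rule cmod_intertwine[OF coord_lin])
      show "x \<in> vecs Bas" using x A by simp
      fix a assume a: "a \<in> Bas"
      show "coord i (sumop op a f) = op i a (coord i f)"
        by (rule lin_eqI[OF f lin_comp(2)[OF coord_lin sumop_lin] lin_comp(2)[OF lin[OF i a] coord_lin]])
          (auto simp: coord_elem_tensor lin_0[OF lin[OF i a]] coord_ev)
    qed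
    then show "F (x \<odot>\<^bsub>?C\<^esub> f) = x \<odot>\<^bsub>direct_sum I M\<^esub> F f"
      using x coord_in_vecs[OF f] by (auto simp: F_def eD(3)[symmetric] intro!: restrict_ext)
  qed
  have inj: "inj_on F (vecs (Sigma I B))"
  proof (rule inj_onI)
    fix f g assume fg: "f \<in> vecs (Sigma I B)" "g \<in> vecs (Sigma I B)" "F f = F g"
    show "f = g"
    proof (rule poly_mapping_eqI)
      fix x :: "'i \<times> 'b" obtain i b where [simp]: "x = (i, b)" by (metis surj_pair)
      show "Poly_Mapping.lookup f x = Poly_Mapping.lookup g x"
      proof (cases "i \<in> I")
        case True
        then have "e i (coord i f) = e i (coord i g)" using fg(3) by (auto simp: F_def dest: fun_cong[of _ _ i])
        then have "coord i f = coord i g"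
          using e(2)[OF True] coord_in_vecs[OF fg(1), of i] coord_in_vecs[OF fg(2), of i]
          unfolding bij_betw_def inj_on_def by blast
        then show ?thesis using lookup_coord[of i f b] lookup_coord[of i g b] by simp
      next
        case False
        then have "x \<notin> Sigma I B" by simp
        then show ?thesis using vecsD fg by metis
      qed
    qed
  qed
  have surj: "\<exists>f\<in>vecs (Sigma I B). F f = x" if x: "x \<in> carrier (direct_sum I M)" for x
  proof -
    let ?S = "{i \<in> I. x i \<noteq> \<zero>\<^bsub>M i\<^esub>}"
    define d where "d i = inv_into (vecs (B i)) (e i) (x i)" for i
    have d: "d i \<in> vecs (B i)" "e i (d i) = x i" if "i \<in> I" for i
    proof -
      have "x i \<in> e i ` vecs (B i)" using x that e(2)[OF that] by (auto simp: car bij_betw_def)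
      then show "d i \<in> vecs (B i)" "e i (d i) = x i" by (auto simp: d_def inv_into_into f_inv_into_f)
    qed
    define f where "f = (\<Sum>i\<in>?S. elem_tensor (ev i) (d i))"
    have S: "finite ?S" using x by (simp add: car)
    have f: "f \<in> vecs (Sigma I B)" unfolding f_def by (intro vecs_sum elem_tensor_Sigma d) auto
    have "e i (coord i f) = x i" if i: "i \<in> I" for i
    proof -
      have "coord i f = (\<Sum>j\<in>?S. if i = j then d j else 0)"
        unfolding f_def lin_sum[OF coord_lin] by (intro sum.cong refl coord_elem_tensor)
      also have "\<dots> = (if i \<in> ?S then d i else 0)" using S by simp
      finally show ?thesis using d i e0 by auto
    qed
    then have "F f = x" using x by (auto simp: F_def car PiE_def extensional_def fun_eq_iff)
    then show ?thesis using f by blast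
  qed
  have bij: "bij_betw F (carrier ?C) (carrier (direct_sum I M))"
    using inj F_in surj by (auto simp: bij_betw_def)
  have "left_module A ?C"
  proof (rule left_module_pullback[OF DL hom bij])
    show "F \<zero>\<^bsub>?C\<^esub> = \<zero>\<^bsub>direct_sum I M\<^esub>"
      by (auto simp: F_def lin_0[OF coord_lin] e0 intro!: restrict_ext)
    show "x \<odot>\<^bsub>?C\<^esub> f \<in> carrier ?C" if "x \<in> carrier A" "f \<in> carrier ?C" for x f
      using that A closed by (auto intro!: lin_ext_in_vecs[of _ Bas] sumop_in_vecs)
  qed (auto intro: vecs_intros)
  then show ?thesis using misoI[OF _ DL hom bij] miso_sym by blast
qed

lemma cmod_reindex:
  fixes op :: "'a \<Rightarrow> ('b \<Rightarrow>\<^sub>0 'k::field) \<Rightarrow> ('b \<Rightarrow>\<^sub>0 'k)" and op' :: "'a \<Rightarrow> ('c \<Rightarrow>\<^sub>0 'k) \<Rightarrow> ('c \<Rightarrow>\<^sub>0 'k)"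
  assumes A: "carrier A = vecs Bas" and L: "left_module A (cmod B op)" "left_module A (cmod C op')"
    and h: "bij_betw h B C"
    and lin: "\<And>a. a \<in> Bas \<Longrightarrow> lin (op a)" "\<And>a. a \<in> Bas \<Longrightarrow> lin (op' a)"
    and op: "\<And>a b. a \<in> Bas \<Longrightarrow> b \<in> B \<Longrightarrow> op' a (ev (h b)) = lin_ext (\<lambda>b. ev (h b)) (op a (ev b))"
  shows "miso A (cmod B op) (cmod C op')"
proof -
  let ?P = "lin_ext (\<lambda>b. ev (h b))" and ?Q = "lin_ext (\<lambda>c. ev (inv_into B h c))"
  have hB: "h b \<in> C" if "b \<in> B" for b using h that by (auto simp: bij_betw_def)
  have ih: "inv_into B h (h b) = b" if "b \<in> B" for b using h that by (auto simp: bij_betw_def)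
  have hi: "h (inv_into B h c) = c" "inv_into B h c \<in> B" if "c \<in> C" for c
    using h that by (auto simp: bij_betw_def f_inv_into_f inv_into_into)
  have P_in: "?P f \<in> vecs C" if "f \<in> vecs B" for f
    by (rule lin_ext_in_vecs[OF that]) (auto intro: vecs_single hB)
  have Q_in: "?Q f \<in> vecs B" if "f \<in> vecs C" for f
    by (rule lin_ext_in_vecs[OF that]) (auto intro: vecs_single hi)
  have QP: "?Q (?P f) = f" if "f \<in> vecs B" for f
    by (rule lin_eqI[OF that lin_comp(2)[OF lin_lin_ext lin_lin_ext] lin_id(1)]) (simp add: ih)
  have PQ: "?P (?Q f) = f" if "f \<in> vecs C" for f
    by (rule lin_eqI[OF that lin_comp(2)[OF lin_lin_ext lin_lin_ext] lin_id(1)]) (simp add: hi)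
  have bij: "bij_betw ?P (vecs B) (vecs C)"
    by (rule bij_betw_byWitness[of _ ?Q]) (auto simp: QP PQ P_in Q_in)
  have "?P \<in> module_hom A (cmod B op) (cmod C op')"
  proof (rule module_homI)
    fix x f assume x: "x \<in> carrier A" and "f \<in> carrier (cmod B op)"
    then have f: "f \<in> vecs B" by simp
    have "?P (lin_ext (\<lambda>a. op a f) x) = lin_ext (\<lambda>a. op' a (?P f)) x"
    proof (rule cmod_intertwine[OF lin_lin_ext])
      show "x \<in> vecs Bas" using x A by simp
      fix a assume a: "a \<in> Bas"
      show "?P (op a f) = op' a (?P f)"
        by (rule lin_eqI[OF f lin_comp(2)[OF lin_lin_ext lin(1)[OF a]] lin_comp(2)[OF lin(2)[OF a] lin_lin_ext]])
          (simp add: op a)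
    qed
    then show "?P (x \<odot>\<^bsub>cmod B op\<^esub> f) = x \<odot>\<^bsub>cmod C op'\<^esub> ?P f" by simp
  qed (simp_all add: P_in lin_add[OF lin_lin_ext])
  then show ?thesis by (rule misoI[OF L]) (simp add: bij)
qed

section \<open>Modules over the group algebra\<close>

lemma simple_module_miso:
  assumes iso: "miso R M N" and N: "simple_module R N"
  shows "simple_module R M"
proof -
  obtain f where f: "f \<in> module_hom R M N" "bij_betw f (carrier M) (carrier N)"
    using iso by (auto elim!: misoE)
  interpret M: left_module R M using iso by (simp add: miso_def)
  interpret N: left_module R N using iso by (simp add: miso_def)
  note fD = module_homD[OF f(1)]
  have f0: "f \<zero>\<^bsub>M\<^esub> = \<zero>\<^bsub>N\<^esub>"
    by (rule module_hom_zero[OF f(1) M.M.abelian_group_axioms N.M.abelian_group_axioms])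
  have inj: "x = y" if "x \<in> carrier M" "y \<in> carrier M" "f x = f y" for x y
    using f(2) that by (auto simp: bij_betw_def inj_on_def)
  have surj: "f ` carrier M = carrier N" using f(2) by (simp add: bij_betw_def)
  have "L = {\<zero>\<^bsub>M\<^esub>} \<or> L = carrier M" if "submodule L R M" for L
  proof -
    interpret L: submodule L R M by fact
    have Lc: "x \<in> carrier M" if "x \<in> L" for x using L.mem_carrier[OF that] by simp
    have "submodule (f ` L) R N"
    proof (intro submodule.intro submodule_axioms.intro)
      show "subgroup (f ` L) (add_monoid N)"
      proof (rule group.subgroupI[OF N.M.a_group])
        show "f ` L \<subseteq> carrier (add_monoid N)" using Lc fD(1) by auto
        show "f ` L \<noteq> {}" using L.one_closed by auto
        show "x \<otimes>\<^bsub>add_monoid N\<^esub> y \<in> f ` L" if "x \<in> f ` L" "y \<in> f ` L" for x y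
        proof -
          from that obtain u v where uv: "u \<in> L" "v \<in> L" "x = f u" "y = f v" by blast
          then have "x \<oplus>\<^bsub>N\<^esub> y = f (u \<oplus>\<^bsub>M\<^esub> v)" "u \<oplus>\<^bsub>M\<^esub> v \<in> L"
            using fD(2) Lc L.m_closed[of u v] by auto
          then show ?thesis by simp
        qed
        show "inv\<^bsub>add_monoid N\<^esub> x \<in> f ` L" if "x \<in> f ` L" for x
        proof -
          from that obtain u where u: "u \<in> L" "x = f u" by blast
          have nu: "\<ominus>\<^bsub>M\<^esub> u \<in> L" using L.m_inv_closed[OF u(1)] by (simp add: a_inv_def)
          have "f (\<ominus>\<^bsub>M\<^esub> u) \<oplus>\<^bsub>N\<^esub> f u = \<zero>\<^bsub>N\<^esub>"
            using fD(2)[OF Lc[OF nu] Lc[OF u(1)]] Lc[OF u(1)] f0 by (simp add: M.M.l_neg)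
          then have "\<ominus>\<^bsub>N\<^esub> x = f (\<ominus>\<^bsub>M\<^esub> u)"
            using u fD(1) Lc nu by (simp add: N.M.minus_equality)
          then show ?thesis using nu by (simp add: a_inv_def)
        qed
      qed
      show "r \<odot>\<^bsub>N\<^esub> x \<in> f ` L" if "r \<in> carrier R" "x \<in> f ` L" for r x
      proof -
        from that(2) obtain u where u: "u \<in> L" "x = f u" by blast
        then have "r \<odot>\<^bsub>N\<^esub> x = f (r \<odot>\<^bsub>M\<^esub> u)" using fD(3)[OF that(1) Lc[OF u(1)]] by simp
        then show ?thesis using L.smult_closed[OF that(1) u(1)] by blast
      qed
    qed
    then consider "f ` L = {\<zero>\<^bsub>N\<^esub>}" | "f ` L = carrier N"
      using N by (auto simp: simple_module_def)
    then show ?thesis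
    proof cases
      case 1
      have "\<zero>\<^bsub>M\<^esub> \<in> L" using L.one_closed by simp
      moreover have "x = \<zero>\<^bsub>M\<^esub>" if "x \<in> L" for x
      proof (rule inj[OF Lc[OF that] M.M.zero_closed])
        show "f x = f \<zero>\<^bsub>M\<^esub>" using 1 that f0 by auto
      qed
      ultimately have "L = {\<zero>\<^bsub>M\<^esub>}" by blast
      then show ?thesis ..
    next
      case 2
      have "x \<in> L" if "x \<in> carrier M" for x
      proof -
        have "f x \<in> f ` L" using 2 fD(1)[OF that] by simp
        then obtain y where "y \<in> L" "f x = f y" by blast
        then show ?thesis using inj[OF that Lc] by blast
      qed
      then have "L = carrier M" using Lc by blast
      then show ?thesis ..
    qed
  qed
  moreover have "carrier M \<noteq> {\<zero>\<^bsub>M\<^esub>}"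
    using N f0 surj by (auto simp: simple_module_def)
  ultimately show ?thesis
    using M.left_module_axioms by (simp add: simple_module_def)
qed

context group
begin

abbreviation "gA \<equiv> (group_algebra G :: ('a \<Rightarrow>\<^sub>0 'k::field) ring)"

lemma gA_closed [simp]: "g \<in> carrier G \<Longrightarrow> Poly_Mapping.single g c \<in> carrier (gA :: ('a \<Rightarrow>\<^sub>0 'k::field) ring)"
  by (simp add: group_algebra_simps vecs_single)

lemma gA_single_mult:
  "Poly_Mapping.single \<one> c \<otimes>\<^bsub>gA\<^esub> r = scale c r" if "r \<in> carrier gA" for c :: "'k::field"
  unfolding group_algebra_simps
proof (rule lin_eqI[OF _ bilin_ext_lin_right lin_scaleI[OF lin_id(1)]])
  show "r \<in> vecs (carrier G)" using that by (simp add: group_algebra_simps)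
qed simp

lemma gA_ev_mult:
  "g \<in> carrier G \<Longrightarrow> h \<in> carrier G \<Longrightarrow>
    Poly_Mapping.single g c \<otimes>\<^bsub>gA\<^esub> Poly_Mapping.single h d = Poly_Mapping.single (g \<otimes> h) (c * d :: 'k::field)"
  unfolding group_algebra_simps by simp

lemma gA_add: "x \<oplus>\<^bsub>gA\<^esub> y = x + y"
  by (simp add: group_algebra_def)

text \<open>The field acts on \<open>V\<close> through the multiples of \<open>\<one>\<close> in
  \<open>kG\<close>, so compatibility with these makes the coordinate map linear. The action of a
  group element is transported on basis vectors and extended.\<close>

lemma group_module_coordinates:
  fixes V :: "('a \<Rightarrow>\<^sub>0 'k::field, 'v) module" and B :: "'u set"
  assumes V: "left_module gA V" and bij: "bij_betw \<phi> (vecs B) (carrier V)"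
    and add: "\<And>f g. f \<in> vecs B \<Longrightarrow> g \<in> vecs B \<Longrightarrow> \<phi> (f + g) = \<phi> f \<oplus>\<^bsub>V\<^esub> \<phi> g"
    and sc: "\<And>f c. f \<in> vecs B \<Longrightarrow> \<phi> (scale c f) = Poly_Mapping.single \<one> c \<odot>\<^bsub>V\<^esub> \<phi> f"
  shows "\<exists>\<rho>. grep G B \<rho> \<and> miso gA V (cmod B \<rho>)"
proof -
  interpret V: left_module gA V by fact
  define \<psi> where "\<psi> = inv_into (vecs B) \<phi>"
  have \<phi>_in: "\<phi> f \<in> carrier V" if "f \<in> vecs B" for f using bij that by (auto simp: bij_betw_def)
  have \<psi>: "\<psi> v \<in> vecs B" "\<phi> (\<psi> v) = v" if "v \<in> carrier V" for v
    using bij that by (auto simp: \<psi>_def bij_betw_def inv_into_into f_inv_into_f)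
  have inj: "f = g" if "f \<in> vecs B" "g \<in> vecs B" "\<phi> f = \<phi> g" for f g
    using bij that by (auto simp: bij_betw_def inj_on_def)
  have \<phi>0: "\<phi> 0 = \<zero>\<^bsub>V\<^esub>"
    using add[of 0 0] \<phi>_in[of 0] by (simp add: V.M.add.l_cancel_one')
  have zero_act: "0 \<odot>\<^bsub>V\<^esub> v = \<zero>\<^bsub>V\<^esub>" if "v \<in> carrier V" for v
  proof -
    have z: "0 \<in> carrier gA" by (simp add: group_algebra_simps)
    show ?thesis
      using V.smult_l_distr[OF z z that] V.smult_closed[OF z that]
      by (simp add: gA_add V.M.add.l_cancel_one')
  qed
  define \<rho> where "\<rho> h = lin_ext (\<lambda>b. \<psi> (ev h \<odot>\<^bsub>V\<^esub> \<phi> (ev b)))" for h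
  have \<rho>_in: "\<rho> h f \<in> vecs B" if "h \<in> carrier G" "f \<in> vecs B" for h f
    unfolding \<rho>_def using that
    by (intro lin_ext_in_vecs[OF that(2)] \<psi> V.smult_closed \<phi>_in vecs_single gA_closed)
  have \<rho>: "\<phi> (\<rho> h f) = ev h \<odot>\<^bsub>V\<^esub> \<phi> f" if h: "h \<in> carrier G" and f: "f \<in> vecs B" for h f
    using f
  proof (induction f rule: vecs_lin_induct)
    case zero
    then show ?case using h smult_zero_right[OF V] by (simp add: \<phi>0 \<rho>_def lin_0[OF lin_lin_ext])
  next
    case (add f g)
    then show ?case
      using \<rho>_in[OF h] h by (simp add: assms(3) V.smult_r_distr \<phi>_in) (simp add: \<rho>_def lin_add[OF lin_lin_ext] assms(3))
  next
    case (scale f c)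
    have "\<phi> (\<rho> h (scale c f)) = Poly_Mapping.single \<one> c \<odot>\<^bsub>V\<^esub> (ev h \<odot>\<^bsub>V\<^esub> \<phi> f)"
      using \<rho>_in[OF h scale(1)] scale(2) sc by (simp add: \<rho>_def lin_scale[OF lin_lin_ext])
    also have "\<dots> = ev h \<odot>\<^bsub>V\<^esub> (Poly_Mapping.single \<one> c \<odot>\<^bsub>V\<^esub> \<phi> f)"
      using h scale(1) by (simp add: V.smult_assoc[symmetric] \<phi>_in gA_ev_mult)
    finally show ?case using sc scale by simp
  next
    case (ev b)
    then show ?case using h by (simp add: \<rho>_def \<psi> V.smult_closed \<phi>_in vecs_single)
  qed
  have "grep G B \<rho>"
    unfolding grep_def
  proof (intro conjI ballI)
    show "lin (\<rho> g)" for g by (simp add: \<rho>_def lin_lin_ext)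
    show "\<rho> (g \<otimes> h) f = \<rho> g (\<rho> h f)" if "g \<in> carrier G" "h \<in> carrier G" "f \<in> vecs B" for g h f
    proof (rule inj)
      show "\<phi> (\<rho> (g \<otimes> h) f) = \<phi> (\<rho> g (\<rho> h f))"
        using that V.smult_assoc[of "ev g" "ev h" "\<phi> f"] by (simp add: \<rho> \<rho>_in gA_ev_mult \<phi>_in)
    qed (use that \<rho>_in in auto)
    show "\<rho> \<one> f = f" if "f \<in> vecs B" for f
      using that V.smult_one[OF \<phi>_in[OF that]]
      by (intro inj) (simp_all add: \<rho> \<rho>_in group_algebra_simps)
  qed (rule \<rho>_in)
  moreover have "miso gA (cmod B \<rho>) V"
  proof (rule misoI)
    show "left_module gA (cmod B \<rho>)" using \<open>grep G B \<rho>\<close> by (rule grep_left_module)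
    show "\<phi> \<in> module_hom gA (cmod B \<rho>) V"
    proof (rule module_homI)
      fix r :: "'a \<Rightarrow>\<^sub>0 'k" and f assume r: "r \<in> carrier gA" and "f \<in> carrier (cmod B \<rho>)"
      then have f: "f \<in> vecs B" by simp
      have "r \<in> vecs (carrier G)" using r by (simp add: group_algebra_simps)
      then have "lin_ext (\<lambda>g. \<rho> g f) r \<in> vecs B \<and> \<phi> (lin_ext (\<lambda>g. \<rho> g f) r) = r \<odot>\<^bsub>V\<^esub> \<phi> f"
      proof (induction r rule: vecs_induct)
        case zero
        then show ?case using f by (simp add: lin_0[OF lin_lin_ext] \<phi>0 zero_act \<phi>_in)
      next
        case (add r r')
        then show ?case
          using V.smult_l_distr[of r r' "\<phi> f"] f
          by (simp add: lin_add[OF lin_lin_ext] assms(3) \<phi>_in group_algebra_simps gA_add vecs_add)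
      next
        case (single g c)
        have "Poly_Mapping.single \<one> c \<otimes>\<^bsub>gA\<^esub> ev g = Poly_Mapping.single g c"
          using single by (simp add: gA_ev_mult)
        then show ?case
          using single f V.smult_assoc[of "Poly_Mapping.single \<one> c" "ev g" "\<phi> f"]
          by (simp add: sc \<rho> \<rho>_in vecs_scale \<phi>_in)
      qed
      then show "\<phi> (r \<odot>\<^bsub>cmod B \<rho>\<^esub> f) = r \<odot>\<^bsub>V\<^esub> \<phi> f" by simp
    qed (use \<phi>_in add in auto)
  qed (use V bij in auto)
  ultimately show ?thesis by (auto intro: miso_sym)
qed

lemma scalar_act:
  assumes V: "left_module gA V" and r: "r \<in> carrier gA" and v: "v \<in> carrier V"
  shows "scale c r \<odot>\<^bsub>V\<^esub> v = Poly_Mapping.single \<one> c \<odot>\<^bsub>V\<^esub> (r \<odot>\<^bsub>V\<^esub> v)"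
proof -
  interpret V: left_module gA V by fact
  show ?thesis using V.smult_assoc[of "Poly_Mapping.single \<one> c" r v] r v by (simp add: gA_single_mult)
qed

lemma simple_module_cyclic:
  fixes V :: "('a \<Rightarrow>\<^sub>0 'k::field, 'v) module"
  assumes V: "simple_module gA V"
  obtains v where "v \<in> carrier V" "\<And>w. w \<in> carrier V \<Longrightarrow> \<exists>r\<in>carrier gA. w = r \<odot>\<^bsub>V\<^esub> v"
proof -
  interpret V: left_module gA V using V by (simp add: simple_module_def)
  have "carrier V \<noteq> {\<zero>\<^bsub>V\<^esub>}" using V by (simp add: simple_module_def)
  then obtain v where v: "v \<in> carrier V" "v \<noteq> \<zero>\<^bsub>V\<^esub>" using V.M.zero_closed by blast
  let ?L = "(\<lambda>r. r \<odot>\<^bsub>V\<^esub> v) ` carrier gA"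
  have "submodule ?L gA V"
  proof (intro submodule.intro submodule_axioms.intro)
    show "subgroup ?L (add_monoid V)"
    proof (rule group.subgroupI[OF V.M.a_group])
      show "?L \<subseteq> carrier (add_monoid V)" using v V.smult_closed by auto
      show "?L \<noteq> {}" using V.R.one_closed by blast
      show "x \<otimes>\<^bsub>add_monoid V\<^esub> y \<in> ?L" if xy: "x \<in> ?L" "y \<in> ?L" for x y
      proof -
        from xy obtain r r' where r: "r \<in> carrier gA" "r' \<in> carrier gA" "x = r \<odot>\<^bsub>V\<^esub> v" "y = r' \<odot>\<^bsub>V\<^esub> v" by blast
        then have "x \<oplus>\<^bsub>V\<^esub> y = (r \<oplus>\<^bsub>gA\<^esub> r') \<odot>\<^bsub>V\<^esub> v" using v by (simp add: V.smult_l_distr)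
        then show ?thesis using r V.R.add.m_closed by auto
      qed
      show "inv\<^bsub>add_monoid V\<^esub> x \<in> ?L" if x: "x \<in> ?L" for x
      proof -
        from x obtain r where r: "r \<in> carrier gA" "x = r \<odot>\<^bsub>V\<^esub> v" by blast
        have "(\<ominus>\<^bsub>gA\<^esub> r) \<odot>\<^bsub>V\<^esub> v \<oplus>\<^bsub>V\<^esub> x = (\<zero>\<^bsub>gA\<^esub>) \<odot>\<^bsub>V\<^esub> v"
          using r v by (simp add: V.smult_l_distr[symmetric] V.R.l_neg)
        also have "\<dots> = \<zero>\<^bsub>V\<^esub>"
          using V.smult_l_distr[OF V.R.zero_closed V.R.zero_closed v(1)] V.smult_closed[OF V.R.zero_closed v(1)]
          by (simp add: V.M.add.l_cancel_one')
        finally have "\<ominus>\<^bsub>V\<^esub> x = (\<ominus>\<^bsub>gA\<^esub> r) \<odot>\<^bsub>V\<^esub> v"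
          using r v V.smult_closed by (intro V.M.minus_equality) auto
        then show ?thesis using r V.R.a_inv_closed by (auto simp flip: a_inv_def)
      qed
    qed
    show "a \<odot>\<^bsub>V\<^esub> x \<in> ?L" if "a \<in> carrier gA" "x \<in> ?L" for a x
    proof -
      from that obtain r where r: "r \<in> carrier gA" "x = r \<odot>\<^bsub>V\<^esub> v" by blast
      then have "a \<odot>\<^bsub>V\<^esub> x = (a \<otimes>\<^bsub>gA\<^esub> r) \<odot>\<^bsub>V\<^esub> v" using that v by (simp add: V.smult_assoc)
      then show ?thesis using V.R.m_closed[OF that(1) r(1)] by blast
    qed
  qed
  then have "?L = {\<zero>\<^bsub>V\<^esub>} \<or> ?L = carrier V" using V by (simp add: simple_module_def)
  moreover have "v \<in> ?L" using V.smult_one[OF v(1)] V.R.one_closed by (metis image_eqI)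
  ultimately have "?L = carrier V" using v by auto
  then show thesis using that[OF v(1)] by blast
qed

text \<open>A simple module is spanned by the orbit of a vector, so some subset of \<open>G\<close> labels a basis.\<close>

lemma simple_module_coordinates:
  fixes V :: "('a \<Rightarrow>\<^sub>0 'k::field, 'v) module"
  assumes fin: "finite (carrier G)" and V: "simple_module gA V"
  obtains B \<rho> where "B \<subseteq> carrier G" "grep G B \<rho>" "miso gA V (cmod B \<rho>)"
proof -
  have VL: "left_module gA V" using V by (simp add: simple_module_def)
  interpret V: left_module gA V by (rule VL)
  obtain v where v: "v \<in> carrier V" and gen: "\<And>w. w \<in> carrier V \<Longrightarrow> \<exists>r\<in>carrier gA. w = r \<odot>\<^bsub>V\<^esub> v"
    by (rule simple_module_cyclic[OF V]) blast
  let ?\<phi> = "\<lambda>f. f \<odot>\<^bsub>V\<^esub> v"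
  \<comment> \<open>A set \<open>B\<close> of group elements counts as independent when the vectors
    \<open>g v\<close> with \<open>g\<close> in \<open>B\<close> are; a maximal such set exists
    because \<open>G\<close> is finite.\<close>
  define indep where "indep B \<longleftrightarrow> (\<forall>f\<in>vecs B. ?\<phi> f = \<zero>\<^bsub>V\<^esub> \<longrightarrow> f = 0)" for B
  have "{} \<in> {B. B \<subseteq> carrier G \<and> indep B}" by (simp add: indep_def vecs_def)
  moreover have "finite {B. B \<subseteq> carrier G \<and> indep B}"
    by (rule finite_subset[of _ "Pow (carrier G)"]) (auto simp: fin)
  ultimately have "\<exists>B\<in>{B. B \<subseteq> carrier G \<and> indep B}. \<forall>C\<in>{B. B \<subseteq> carrier G \<and> indep B}. B \<subseteq> C \<longrightarrow> B = C"
    by (intro finite_has_maximal) auto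
  then obtain B where "B \<in> {B. B \<subseteq> carrier G \<and> indep B}"
    and max: "\<forall>C\<in>{B. B \<subseteq> carrier G \<and> indep B}. B \<subseteq> C \<longrightarrow> B = C"
    by (rule bexE)
  then have B: "B \<subseteq> carrier G" "indep B" by simp_all
  have inA: "f \<in> carrier gA" if "f \<in> vecs C" "C \<subseteq> carrier G" for f C
    using vecs_mono[OF that] by (simp add: group_algebra_simps)
  have \<phi>_add: "?\<phi> (f + g) = ?\<phi> f \<oplus>\<^bsub>V\<^esub> ?\<phi> g" if "f \<in> carrier gA" "g \<in> carrier gA" for f g
    using V.smult_l_distr[OF that v] by (simp add: gA_add)
  have \<phi>_scale: "?\<phi> (scale c f) = Poly_Mapping.single \<one> c \<odot>\<^bsub>V\<^esub> ?\<phi> f" if "f \<in> carrier gA" for f c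
    by (rule scalar_act[OF VL that v])
  have inj: "inj_on ?\<phi> (vecs B)"
  proof (rule inj_onI)
    fix f g assume fg: "f \<in> vecs B" "g \<in> vecs B" "?\<phi> f = ?\<phi> g"
    have c: "f - g \<in> carrier gA" "g \<in> carrier gA" using fg B by (auto intro: inA vecs_diff)
    have "?\<phi> (f - g) \<oplus>\<^bsub>V\<^esub> ?\<phi> g = ?\<phi> g" using \<phi>_add[OF c] fg by simp
    then have "?\<phi> (f - g) = \<zero>\<^bsub>V\<^esub>" using c v by (simp add: V.smult_closed V.M.add.l_cancel_one)
    then show "f = g" using B(2) vecs_diff[OF fg(1,2)] by (auto simp: indep_def)
  qed
  have ev_reach: "\<exists>f\<in>vecs B. ?\<phi> (ev g) = ?\<phi> f" if g: "g \<in> carrier G" for g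
  proof (cases "g \<in> B")
    case True
    then show ?thesis by (intro bexI[of _ "ev g"]) (auto intro: vecs_single)
  next
    case False
    \<comment> \<open>Maximality yields a linear relation on \<open>insert g B\<close>; its
      coefficient at \<open>g\<close> cannot vanish, and solving for \<open>g\<close> expresses
      \<open>g v\<close> through \<open>B\<close>.\<close>
    have "insert g B \<notin> {B. B \<subseteq> carrier G \<and> indep B}"
      using bspec[OF max, of "insert g B"] False by auto
    then have "\<not> indep (insert g B)" using g B by simp
    then obtain f where f: "f \<in> vecs (insert g B)" "?\<phi> f = \<zero>\<^bsub>V\<^esub>" "f \<noteq> 0" by (auto simp: indep_def)
    define c where "c = Poly_Mapping.lookup f g"
    have rest: "f - Poly_Mapping.single g c \<in> vecs B"
      by (rule vecsI) (use vecsD[OF f(1)] in \<open>auto simp: lookup_minus lookup_single when_def c_def\<close>)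
    have c: "c \<noteq> 0"
      using rest f B(2) by (auto simp: indep_def)
    define f' where "f' = scale (- inverse c) (f - Poly_Mapping.single g c)"
    have eq: "ev g = scale (inverse c) f + f'"
      using c unfolding f'_def
      by (intro poly_mapping_eqI) (simp add: lookup_add lookup_minus lookup_single when_def algebra_simps)
    have f': "f' \<in> vecs B" unfolding f'_def by (rule vecs_scale[OF rest])
    have fA: "f \<in> carrier gA" using inA[OF f(1)] g B by simp
    have A: "f' \<in> carrier gA" "scale (inverse c) f \<in> carrier gA"
      using inA[OF f' B(1)] fA by (auto simp: group_algebra_simps vecs_scale)
    have "?\<phi> (ev g) = ?\<phi> f'"
      unfolding eq using A v by (simp add: \<phi>_add \<phi>_scale[OF fA] f(2) smult_zero_right[OF VL] V.smult_closed)
    then show ?thesis using f' by blast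
  qed
  have reach: "\<exists>f\<in>vecs B. ?\<phi> r = ?\<phi> f" if "r \<in> carrier gA" for r
  proof -
    have "r \<in> vecs (carrier G)" using that by (simp add: group_algebra_simps)
    then show ?thesis
    proof (induction r rule: vecs_lin_induct)
      case (add r r')
      then obtain f g where fg: "f \<in> vecs B" "g \<in> vecs B" "?\<phi> r = ?\<phi> f" "?\<phi> r' = ?\<phi> g" by blast
      have "r \<in> carrier gA" "r' \<in> carrier gA" using add by (simp_all add: group_algebra_simps)
      then have "?\<phi> (r + r') = ?\<phi> (f + g)"
        using inA[OF fg(1) B(1)] inA[OF fg(2) B(1)] by (simp only: \<phi>_add fg(3,4))
      then show ?case using vecs_add[OF fg(1,2)] by blast
    next
      case (scale r c)
      then obtain f where f: "f \<in> vecs B" "?\<phi> r = ?\<phi> f" by blast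
      have "r \<in> carrier gA" using scale by (simp add: group_algebra_simps)
      then have "?\<phi> (scale c r) = ?\<phi> (scale c f)"
        using inA[OF f(1) B(1)] by (simp only: \<phi>_scale f(2))
      then show ?case using vecs_scale[OF f(1)] by blast
    qed (auto intro: ev_reach bexI[of _ 0])
  qed
  have bij: "bij_betw ?\<phi> (vecs B) (carrier V)"
  proof (rule bij_betw_imageI[OF inj])
    have "w \<in> ?\<phi> ` vecs B" if w: "w \<in> carrier V" for w
    proof -
      obtain r where r: "r \<in> carrier gA" "w = ?\<phi> r" using gen[OF w] by blast
      then show ?thesis using reach[OF r(1)] by auto
    qed
    moreover have "?\<phi> f \<in> carrier V" if "f \<in> vecs B" for f
      by (rule V.smult_closed[OF inA[OF that B(1)] v])
    ultimately show "?\<phi> ` vecs B = carrier V" by blast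
  qed
  have "\<exists>\<rho>. grep G B \<rho> \<and> miso gA V (cmod B \<rho>)"
    by (rule group_module_coordinates[OF VL bij]) (simp_all add: \<phi>_add \<phi>_scale inA[OF _ B(1)])
  then show thesis using that[OF B(1)] by blast
qed

text \<open>\<open>simple_representatives\<close> speaks only about modules whose elements are sets
  of algebra elements, while \<open>F\<close> may have any element type. So \<open>F\<close> is
  first replaced by the regular module modulo the annihilator of a generator, whose elements are
  cosets of the right type.\<close>

lemma simple_module_representative:
  fixes V :: "'i \<Rightarrow> ('a \<Rightarrow>\<^sub>0 'k::field, 'v) module" and F :: "('a \<Rightarrow>\<^sub>0 'k, 'w) module"
  assumes reps: "simple_representatives gA I V" and F: "simple_module gA F"
  obtains i where "i \<in> I" "miso gA F (V i)"
proof -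
  have FL: "left_module gA F" using F by (simp add: simple_module_def)
  interpret F: left_module gA F by (rule FL)
  obtain v where v: "v \<in> carrier F" and gen: "\<And>w. w \<in> carrier F \<Longrightarrow> \<exists>r\<in>carrier gA. w = r \<odot>\<^bsub>F\<^esub> v"
    by (rule simple_module_cyclic[OF F]) blast
  let ?reg = "cmod (carrier G) (\<lambda>g. bilin_ext (\<lambda>g h. ev (g \<otimes> h)) (ev g)) :: ('a \<Rightarrow>\<^sub>0 'k, 'a \<Rightarrow>\<^sub>0 'k) module"
  have reg_smult: "r \<odot>\<^bsub>?reg\<^esub> f = r \<otimes>\<^bsub>gA\<^esub> f" for r f
    using lin_ext_ev[OF bilin_ext_lin_left, of "\<lambda>g h. ev (g \<otimes> h)" f r] by (simp add: group_algebra_simps)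
  have reg: "carrier ?reg = carrier gA" "x \<oplus>\<^bsub>?reg\<^esub> y = x \<oplus>\<^bsub>gA\<^esub> y" for x y
    by (simp_all add: group_algebra_simps gA_add)
  \<comment> \<open>The annihilator of the generator \<open>v\<close>, that is, the kernel of
    \<open>r \<mapsto> r v\<close>.\<close>
  let ?K = "{r \<in> carrier ?reg. r \<odot>\<^bsub>F\<^esub> v = \<zero>\<^bsub>F\<^esub>}"
  have into: "x \<odot>\<^bsub>F\<^esub> v \<in> carrier F" if "x \<in> carrier ?reg" for x
    using that v F.smult_closed by (simp only: reg)
  have add: "(x \<oplus>\<^bsub>?reg\<^esub> y) \<odot>\<^bsub>F\<^esub> v = x \<odot>\<^bsub>F\<^esub> v \<oplus>\<^bsub>F\<^esub> y \<odot>\<^bsub>F\<^esub> v" if "x \<in> carrier ?reg" "y \<in> carrier ?reg" for x y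
    using that v F.smult_l_distr unfolding reg by blast
  have smult: "r \<odot>\<^bsub>?reg\<^esub> x \<in> carrier ?reg \<and> (r \<odot>\<^bsub>?reg\<^esub> x) \<odot>\<^bsub>F\<^esub> v = r \<odot>\<^bsub>F\<^esub> (x \<odot>\<^bsub>F\<^esub> v)"
    if "r \<in> carrier gA" "x \<in> carrier ?reg" for r x
    using that v F.smult_assoc F.R.m_closed unfolding reg reg_smult by blast
  have surj: "\<exists>x\<in>carrier ?reg. x \<odot>\<^bsub>F\<^esub> v = w" if "w \<in> carrier F" for w
    using gen[OF that] unfolding reg by blast
  obtain f where f: "left_module gA (quot_module ?reg ?K)" "f \<in> module_hom gA (quot_module ?reg ?K) F"
    "bij_betw f (carrier (quot_module ?reg ?K)) (carrier F)"
    by (rule quot_module_miso[OF abelian_group_cmod FL into add smult surj refl]) blast+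
  have iso: "miso gA (quot_module ?reg ?K) F" by (rule misoI[OF f(1) FL f(2,3)])
  have simple: "simple_module gA (quot_module ?reg ?K)" by (rule simple_module_miso[OF iso F])
  then obtain i where i: "i \<in> I" "module_iso gA (quot_module ?reg ?K) (V i)"
    using reps unfolding simple_representatives_def by blast
  have "left_module gA (V i)" using reps i by (auto simp: simple_representatives_def simple_module_def)
  then have "miso gA (quot_module ?reg ?K) (V i)" using f(1) i(2) by (simp add: miso_def)
  then show thesis using that[OF i(1)] miso_trans[OF miso_sym[OF iso]] by blast
qed

end

section \<open>Complete reducibility and multiplicities\<close>

lemma dim_strict_mono:
  fixes U :: "('b \<Rightarrow>\<^sub>0 'k::field) set"
  assumes fin: "finite B" and U': "pmv.subspace U'" and sub: "U' \<subset> U" "U \<subseteq> vecs B"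
  shows "pmv.dim U' < pmv.dim U"
proof -
  obtain b where b: "b \<subseteq> U'" "pmv.independent b" "U' \<subseteq> pmv.span b" "card b = pmv.dim U'"
    using pmv.basis_exists[of U'] by metis
  obtain u where u: "u \<in> U" "u \<notin> U'" using sub by blast
  have "u \<notin> pmv.span b" using pmv.span_minimal[OF b(1) U'] u by blast
  then have ind: "pmv.independent (insert u b)" and ub: "u \<notin> b"
    using pmv.independent_insertI[OF _ b(2)] pmv.span_base by blast+
  have "insert u b \<subseteq> U" using u b sub by blast
  from pmv.maximal_independent_subset_extend[OF this ind]
  obtain b2 where b2: "insert u b \<subseteq> b2" "b2 \<subseteq> U" "pmv.independent b2" "U \<subseteq> pmv.span b2" by metis
  have "b2 \<subseteq> pmv.span (ev ` B)" using b2(2) sub(2) by (simp flip: vecs_eq_span)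
  then have "finite b2" using pmv.independent_span_bound[OF _ b2(3)] fin by blast
  then have "card (insert u b) \<le> card b2" "finite b" using b2(1) by (auto intro: card_mono finite_subset)
  moreover have "pmv.dim U = card b2" using pmv.basis_card_eq_dim[OF b2(2,4,3)] by simp
  ultimately show ?thesis using ub b(4) by simp
qed

lemma linear_projection:
  fixes N :: "('b \<Rightarrow>\<^sub>0 'k::field) set"
  assumes "pmv.subspace N"
  obtains P where "lin P" "\<And>f. P f \<in> N" "\<And>f. f \<in> N \<Longrightarrow> P f = f"
proof -
  interpret pair: vector_space_pair "scale :: 'k \<Rightarrow> ('b \<Rightarrow>\<^sub>0 'k) \<Rightarrow> _" "scale :: 'k \<Rightarrow> ('b \<Rightarrow>\<^sub>0 'k) \<Rightarrow> _"
    by unfold_locales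
  have "Vector_Spaces.linear scale scale (\<lambda>f :: 'b \<Rightarrow>\<^sub>0 'k. f)"
    by (simp add: Vector_Spaces.linear_iff pmv.vector_space_axioms)
  then obtain P where P: "P \<in> UNIV \<rightarrow> N" "Vector_Spaces.linear scale scale P" "\<forall>v\<in>N. P v = v"
    using pair.linear_exists_left_inverse_on[of "\<lambda>f. f" N] assms by (auto simp: image_subset_iff_funcset)
  then have "lin P" by (simp add: Vector_Spaces.linear_iff lin_def)
  then show thesis using that P by blast
qed

lemma direct_sum_cong:
  fixes M :: "'i \<Rightarrow> ('a, 'b) module" and N :: "'i \<Rightarrow> ('a, 'c) module"
  assumes MN: "\<And>i. i \<in> I \<Longrightarrow> miso R (M i) (N i)" and R: "ring R"
  shows "miso R (direct_sum I M) (direct_sum I N)"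
proof -
  have "\<exists>f. f \<in> module_hom R (M i) (N i) \<and> bij_betw f (carrier (M i)) (carrier (N i))" if "i \<in> I" for i
    using MN[OF that] by (auto elim!: misoE)
  then obtain f where f: "\<And>i. i \<in> I \<Longrightarrow> f i \<in> module_hom R (M i) (N i)"
      "\<And>i. i \<in> I \<Longrightarrow> bij_betw (f i) (carrier (M i)) (carrier (N i))"
    by metis
  have L: "left_module R (M i)" "left_module R (N i)" if "i \<in> I" for i using MN[OF that] by (simp_all add: miso_def)
  have ab: "abelian_group (M i)" "abelian_group (N i)" if "i \<in> I" for i
    using L[OF that] by (simp_all add: left_module_def)
  note carM = direct_sum_carrier[of I M, OF ab(1)] and carN = direct_sum_carrier[of I N, OF ab(2)]
  note fD = module_homD[OF f(1)]
  have f0: "f i \<zero>\<^bsub>M i\<^esub> = \<zero>\<^bsub>N i\<^esub>" if "i \<in> I" for i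
    by (rule module_hom_zero[OF f(1) ab]) fact+
  have f_inj: "x = y" if "i \<in> I" "x \<in> carrier (M i)" "y \<in> carrier (M i)" "f i x = f i y" for i x y
    using f(2)[OF that(1)] that by (auto simp: bij_betw_def inj_on_def)
  define F where "F x = (\<lambda>i\<in>I. f i (x i))" for x
  have F_in: "F x \<in> carrier (direct_sum I N)" if x: "x \<in> carrier (direct_sum I M)" for x
  proof -
    have "finite {i \<in> I. F x i \<noteq> \<zero>\<^bsub>N i\<^esub>}"
      by (rule finite_subset[of _ "{i \<in> I. x i \<noteq> \<zero>\<^bsub>M i\<^esub>}"]) (use x f0 in \<open>auto simp: carM F_def\<close>)
    then show ?thesis using x fD(1) by (auto simp: carM carN F_def)
  qed
  have hom: "F \<in> module_hom R (direct_sum I M) (direct_sum I N)"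
  proof -
    have comp: "x i \<in> carrier (M i)" if "x \<in> carrier (direct_sum I M)" "i \<in> I" for x i
      using that by (auto simp: carM)
    show ?thesis
      by (rule module_homI[OF F_in]) (auto simp: F_def fD comp intro!: restrict_ext)
  qed
  have inj: "inj_on F (carrier (direct_sum I M))"
  proof (rule inj_onI)
    fix x y assume xy: "x \<in> carrier (direct_sum I M)" "y \<in> carrier (direct_sum I M)" "F x = F y"
    have "x i = y i" if i: "i \<in> I" for i
    proof (rule f_inj[OF i])
      show "f i (x i) = f i (y i)" using fun_cong[OF xy(3), of i] i by (simp add: F_def)
    qed (use xy i in \<open>auto simp: carM\<close>)
    then show "x = y" using xy by (auto simp: carM intro: PiE_ext)
  qed
  have "y \<in> F ` carrier (direct_sum I M)" if y: "y \<in> carrier (direct_sum I N)" for y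
  proof -
    define x where "x = (\<lambda>i\<in>I. inv_into (carrier (M i)) (f i) (y i))"
    have x: "x i \<in> carrier (M i)" "f i (x i) = y i" if i: "i \<in> I" for i
    proof -
      have "y i \<in> f i ` carrier (M i)" using y i f(2)[OF i] by (auto simp: carN bij_betw_def)
      then show "x i \<in> carrier (M i)" "f i (x i) = y i"
        using i by (auto simp: x_def inv_into_into f_inv_into_f)
    qed
    have "x i = \<zero>\<^bsub>M i\<^esub>" if i: "i \<in> I" and "y i = \<zero>\<^bsub>N i\<^esub>" for i
    proof (rule f_inj[OF i x(1)[OF i]])
      show "\<zero>\<^bsub>M i\<^esub> \<in> carrier (M i)" by (rule abelian_monoid.zero_closed[OF abelian_group.axioms(1)[OF ab(1)[OF i]]])
      show "f i (x i) = f i \<zero>\<^bsub>M i\<^esub>" using x(2)[OF i] f0[OF i] that by simp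
    qed
    then have "{i \<in> I. x i \<noteq> \<zero>\<^bsub>M i\<^esub>} \<subseteq> {i \<in> I. y i \<noteq> \<zero>\<^bsub>N i\<^esub>}" by blast
    moreover have "finite {i \<in> I. y i \<noteq> \<zero>\<^bsub>N i\<^esub>}" using y by (simp add: carN)
    ultimately have "finite {i \<in> I. x i \<noteq> \<zero>\<^bsub>M i\<^esub>}" by (rule finite_subset)
    moreover have "x \<in> extensional I" by (simp add: x_def)
    ultimately have "x \<in> carrier (direct_sum I M)" using x(1) by (auto simp: carM PiE_def)
    moreover have "F x = y" using y x(2) by (auto simp: F_def carN PiE_def extensional_def fun_eq_iff)
    ultimately show ?thesis by blast
  qed
  then have bij: "bij_betw F (carrier (direct_sum I M)) (carrier (direct_sum I N))"
    using inj F_in by (auto simp: bij_betw_def)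
  have "left_module R (direct_sum I M)" "left_module R (direct_sum I N)"
    by (rule direct_sum_left_module[OF _ R], erule L)+
  then show ?thesis using hom bij by (rule misoI)
qed

context group
begin

definition inv_sub :: "'u set \<Rightarrow> ('a \<Rightarrow> ('u \<Rightarrow>\<^sub>0 'k::field) \<Rightarrow> ('u \<Rightarrow>\<^sub>0 'k)) \<Rightarrow> ('u \<Rightarrow>\<^sub>0 'k) set \<Rightarrow> bool"
  where "inv_sub B \<rho> U \<longleftrightarrow> pmv.subspace U \<and> U \<subseteq> vecs B \<and> (\<forall>g\<in>carrier G. \<forall>f\<in>U. \<rho> g f \<in> U)"

text \<open>Maschke's averaging: a linear projection onto \<open>N\<close> is conjugated by each
  group element and the conjugates are averaged, which is possible because
  \<open>card (carrier G)\<close> is invertible in characteristic zero.\<close>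

lemma equivariant_projection:
  fixes \<rho> :: "'a \<Rightarrow> ('u \<Rightarrow>\<^sub>0 'k::field_char_0) \<Rightarrow> ('u \<Rightarrow>\<^sub>0 'k)"
  assumes fin: "finite (carrier G)" and r: "grep G B \<rho>" and N: "inv_sub B \<rho> N"
  obtains \<pi> where "lin \<pi>" "\<And>f. f \<in> vecs B \<Longrightarrow> \<pi> f \<in> N" "\<And>f. f \<in> N \<Longrightarrow> \<pi> f = f"
    "\<And>g f. g \<in> carrier G \<Longrightarrow> f \<in> vecs B \<Longrightarrow> \<pi> (\<rho> g f) = \<rho> g (\<pi> f)"
proof -
  note rD = grepD[OF r]
  have Nsub: "pmv.subspace N" and NB: "\<And>f. f \<in> N \<Longrightarrow> f \<in> vecs B" and Ninv: "\<And>g f. g \<in> carrier G \<Longrightarrow> f \<in> N \<Longrightarrow> \<rho> g f \<in> N"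
    using N by (auto simp: inv_sub_def)
  obtain P where P: "lin P" "\<And>f. P f \<in> N" "\<And>f. f \<in> N \<Longrightarrow> P f = f"
    using linear_projection[OF Nsub] by blast
  define T where "T g f = \<rho> g (P (\<rho> (inv g) f))" for g f
  define \<pi> where "\<pi> f = scale (1 / of_nat (card (carrier G))) (\<Sum>g\<in>carrier G. T g f)" for f
  have T_lin: "lin (T g)" if "g \<in> carrier G" for g
    unfolding T_def using that by (intro lin_comp(2)[OF rD(1)] lin_comp(2)[OF P(1)] rD(1)) auto
  show thesis
  proof (rule that)
    show "lin \<pi>"
      by (rule linI)
        (simp_all add: \<pi>_def lin_add[OF T_lin] lin_scale[OF T_lin] sum.distrib scale_add_right scale_sum mult.commute)
    show "\<pi> f \<in> N" if "f \<in> vecs B" for f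
      unfolding \<pi>_def T_def
      by (intro pmv.subspace_scale[OF Nsub] pmv.subspace_sum[OF Nsub] Ninv P)
    show "\<pi> f = f" if f: "f \<in> N" for f
    proof -
      have "T g f = f" if g: "g \<in> carrier G" for g
        using rD(3)[OF g inv_closed[OF g] NB[OF f]] rD(4)[OF NB[OF f]] g
        by (simp add: T_def P(3)[OF Ninv[OF inv_closed[OF g] f]])
      moreover have "card (carrier G) \<noteq> 0" using fin one_closed by (auto simp: card_eq_0_iff)
      ultimately show ?thesis
        by (simp add: \<pi>_def flip: scale_sum_left[of "\<lambda>_. 1", simplified])
    qed
    fix h and f :: "'u \<Rightarrow>\<^sub>0 'k" assume h: "h \<in> carrier G" and f: "f \<in> vecs B"
    \<comment> \<open>Substituting \<open>h g\<close> for \<open>g\<close> in the average lets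
      \<open>h\<close> pass through it.\<close>
    have bij: "bij_betw (\<lambda>g. h \<otimes> g) (carrier G) (carrier G)"
      by (rule bij_betw_byWitness[of _ "\<lambda>g. inv h \<otimes> g"]) (use h in \<open>auto simp: m_assoc[symmetric]\<close>)
    have "(\<Sum>g\<in>carrier G. T g (\<rho> h f)) = (\<Sum>g\<in>carrier G. T (h \<otimes> g) (\<rho> h f))"
      by (rule sum.reindex_bij_betw[OF bij, symmetric])
    also have "\<dots> = (\<Sum>g\<in>carrier G. \<rho> h (T g f))"
    proof (intro sum.cong refl)
      fix g assume g: "g \<in> carrier G"
      have "\<rho> (inv (h \<otimes> g)) (\<rho> h f) = \<rho> (inv g) f"
        using rD(3)[of "inv (h \<otimes> g)" h f] g h f by (simp add: inv_mult_group m_assoc)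
      then show "T (h \<otimes> g) (\<rho> h f) = \<rho> h (T g f)"
        using g h rD(3)[OF h g NB[OF P(2)]] by (simp add: T_def)
    qed
    finally show "\<pi> (\<rho> h f) = \<rho> h (\<pi> f)"
      by (simp add: \<pi>_def lin_scale[OF rD(1)[OF h]] lin_sum[OF rD(1)[OF h]])
  qed
qed

text \<open>\<open>U\<close> is the internal direct sum of the minimal invariant subspaces \<open>N 0, \<dots>, N (n - 1)\<close>.\<close>

definition decomposes :: "'u set \<Rightarrow> ('a \<Rightarrow> ('u \<Rightarrow>\<^sub>0 'k::field) \<Rightarrow> ('u \<Rightarrow>\<^sub>0 'k)) \<Rightarrow> ('u \<Rightarrow>\<^sub>0 'k) set \<Rightarrow> nat
    \<Rightarrow> (nat \<Rightarrow> ('u \<Rightarrow>\<^sub>0 'k) set) \<Rightarrow> bool"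
  where "decomposes B \<rho> U n N \<longleftrightarrow>
    (\<forall>j<n. inv_sub B \<rho> (N j) \<and> N j \<noteq> {0} \<and> N j \<subseteq> U \<and>
      (\<forall>L. inv_sub B \<rho> L \<longrightarrow> L \<subseteq> N j \<longrightarrow> L = {0} \<or> L = N j)) \<and>
    (\<forall>u\<in>U. \<exists>x. (\<forall>j<n. x j \<in> N j) \<and> u = (\<Sum>j<n. x j)) \<and>
    (\<forall>x. (\<forall>j<n. x j \<in> N j) \<longrightarrow> (\<Sum>j<n. x j) = 0 \<longrightarrow> (\<forall>j<n. x j = 0))"

text \<open>Split off a nonzero invariant subspace of least dimension, which is minimal, and
  continue with the kernel inside \<open>U\<close> of an equivariant projection onto it, whose
  dimension is smaller.\<close>

lemma exists_decomposition:
  fixes \<rho> :: "'a \<Rightarrow> ('u \<Rightarrow>\<^sub>0 'k::field_char_0) \<Rightarrow> ('u \<Rightarrow>\<^sub>0 'k)"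
  assumes fin: "finite (carrier G)" "finite B" and r: "grep G B \<rho>" and U: "inv_sub B \<rho> U"
  shows "\<exists>n N. decomposes B \<rho> U n N"
  using U
proof (induction "pmv.dim U" arbitrary: U rule: less_induct)
  case less
  note rD = grepD[OF r]
  have Usub: "pmv.subspace U" and UB: "U \<subseteq> vecs B" and Uinv: "\<And>g f. g \<in> carrier G \<Longrightarrow> f \<in> U \<Longrightarrow> \<rho> g f \<in> U"
    using less(2) by (auto simp: inv_sub_def)
  show ?case
  proof (cases "U = {0}")
    case True
    then have "decomposes B \<rho> U 0 (\<lambda>_. {})" by (auto simp: decomposes_def)
    then show ?thesis by blast
  next
    case False
    let ?P = "\<lambda>N. inv_sub B \<rho> N \<and> N \<subseteq> U \<and> N \<noteq> {0}"
    have "?P U" using less(2) False by simp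
    then obtain N0 where N0: "?P N0" and min: "\<And>L. ?P L \<Longrightarrow> pmv.dim N0 \<le> pmv.dim L"
      using ex_has_least_nat[of ?P U pmv.dim] by blast
    have N0_min: "L = {0} \<or> L = N0" if L: "inv_sub B \<rho> L" "L \<subseteq> N0" for L
    proof (rule ccontr)
      assume c: "\<not> (L = {0} \<or> L = N0)"
      then have "pmv.dim N0 \<le> pmv.dim L" using L N0 by (intro min) auto
      moreover have "pmv.dim L < pmv.dim N0"
        using L c N0 by (intro dim_strict_mono[OF fin(2)]) (auto simp: inv_sub_def)
      ultimately show False by simp
    qed
    have N0i: "inv_sub B \<rho> N0" using N0 by blast
    obtain \<pi> where \<pi>: "lin \<pi>" "\<And>f. f \<in> vecs B \<Longrightarrow> \<pi> f \<in> N0" "\<And>f. f \<in> N0 \<Longrightarrow> \<pi> f = f"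
      "\<And>g f. g \<in> carrier G \<Longrightarrow> f \<in> vecs B \<Longrightarrow> \<pi> (\<rho> g f) = \<rho> g (\<pi> f)"
      by (rule equivariant_projection[OF fin(1) r N0i]) blast
    define U' where "U' = {u \<in> U. \<pi> u = 0}"
    have U': "inv_sub B \<rho> U'"
      unfolding inv_sub_def pmv.subspace_def
    proof (intro conjI ballI allI)
      show "0 \<in> U'" using pmv.subspace_0[OF Usub] by (simp add: U'_def lin_0[OF \<pi>(1)])
      show "x + y \<in> U'" if "x \<in> U'" "y \<in> U'" for x y
        using that pmv.subspace_add[OF Usub] by (simp add: U'_def lin_add[OF \<pi>(1)])
      show "scale c x \<in> U'" if "x \<in> U'" for c x
        using that pmv.subspace_scale[OF Usub] by (simp add: U'_def lin_scale[OF \<pi>(1)])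
      show "U' \<subseteq> vecs B" using UB by (auto simp: U'_def)
      show "\<rho> g f \<in> U'" if "g \<in> carrier G" "f \<in> U'" for g f
        using that Uinv UB \<pi>(4) lin_0[OF rD(1)[OF that(1)]] by (auto simp: U'_def)
    qed
    have "U' \<noteq> U"
    proof
      assume "U' = U"
      have "f = 0" if "f \<in> N0" for f
      proof -
        have "f \<in> U'" using \<open>U' = U\<close> that N0 by blast
        then show ?thesis using \<pi>(3)[OF that] by (simp add: U'_def)
      qed
      moreover have "0 \<in> N0" using N0i pmv.subspace_0 by (auto simp: inv_sub_def)
      ultimately have "N0 = {0}" by blast
      then show False using N0 by simp
    qed
    then have "pmv.dim U' < pmv.dim U"
      using U' UB by (intro dim_strict_mono[OF fin(2)]) (auto simp: inv_sub_def U'_def)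
    from less(1)[OF this U'] obtain n N where dec: "decomposes B \<rho> U' n N" by blast
    have N_props: "inv_sub B \<rho> (N j)" "N j \<noteq> {0}" "N j \<subseteq> U'"
      "\<And>L. inv_sub B \<rho> L \<Longrightarrow> L \<subseteq> N j \<Longrightarrow> L = {0} \<or> L = N j" if "j < n" for j
      using dec that by (auto simp: decomposes_def)
    have dec_ex: "\<exists>x. (\<forall>j<n. x j \<in> N j) \<and> u = (\<Sum>j<n. x j)" if "u \<in> U'" for u
      using dec that by (simp add: decomposes_def)
    have dec_uniq: "\<forall>j<n. x j = 0" if "\<forall>j<n. x j \<in> N j" "(\<Sum>j<n. x j) = 0" for x
      using dec that by (simp add: decomposes_def)
    define N' where "N' j = (if j < n then N j else N0)" for j
    have sum_U': "(\<Sum>j<n. x j) \<in> U'" if "\<And>j. j < n \<Longrightarrow> x j \<in> N j" for x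
      using that N_props(3) U' by (intro pmv.subspace_sum) (auto simp: inv_sub_def)
    have "decomposes B \<rho> U (Suc n) N'"
      unfolding decomposes_def
    proof (intro conjI allI impI ballI)
      fix j assume "j < Suc n"
      show "inv_sub B \<rho> (N' j)" "N' j \<noteq> {0}" "N' j \<subseteq> U"
        using N_props[of j] N0 by (auto simp: N'_def U'_def)
      show "L = {0} \<or> L = N' j" if "inv_sub B \<rho> L" "L \<subseteq> N' j" for L
        using N_props(4)[of j L] N0_min[of L] that by (auto simp: N'_def split: if_splits)
    next
      fix u assume u: "u \<in> U"
      have pu: "\<pi> u \<in> N0" using u UB \<pi>(2) by blast
      have "u - \<pi> u \<in> U'"
        using u pu N0 pmv.subspace_diff[OF Usub] by (auto simp: U'_def lin_diff[OF \<pi>(1)] \<pi>(3))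
      then obtain x where x: "\<forall>j<n. x j \<in> N j" "u - \<pi> u = (\<Sum>j<n. x j)"
        using dec_ex by blast
      have "u = (\<Sum>j<Suc n. (x(n := \<pi> u)) j)"
        using x(2) by (simp add: algebra_simps)
      moreover have "\<forall>j<Suc n. (x(n := \<pi> u)) j \<in> N' j" using x(1) pu by (auto simp: N'_def)
      ultimately show "\<exists>x. (\<forall>j<Suc n. x j \<in> N' j) \<and> u = (\<Sum>j<Suc n. x j)" by blast
    next
      fix x j assume x: "\<forall>j<Suc n. x j \<in> N' j" "(\<Sum>j<Suc n. x j) = 0" and j: "j < Suc n"
      have xj: "x j \<in> N j" if "j < n" for j using x(1)[rule_format, of j] that by (simp add: N'_def)
      have xn: "x n \<in> N0" using x(1) by (auto simp: N'_def)
      have "\<pi> (\<Sum>j<n. x j) = 0" using sum_U'[of x] xj by (simp add: U'_def)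
      then have "\<pi> (x n) = 0"
        using arg_cong[OF x(2), of \<pi>] by (simp add: lin_add[OF \<pi>(1)] lin_0[OF \<pi>(1)])
      then have xn0: "x n = 0" using \<pi>(3)[OF xn] by simp
      then have "(\<Sum>j<n. x j) = 0" using x(2) by simp
      then have "\<forall>j<n. x j = 0" using dec_uniq xj by blast
      then show "x j = 0" using xn0 j by (cases "j = n") auto
    qed
    then show ?thesis by blast
  qed
qed

text \<open>\<open>simple_multiplicity\<close> selects a decomposition by choice, so its value is
  informative only once one is known to exist.\<close>

lemma exists_simple_decomposition:
  fixes W :: "('a \<Rightarrow>\<^sub>0 'k::field_char_0, 'w) module" and B :: "'u set"
  assumes fin: "finite (carrier G)" "finite B" and r: "grep G B \<rho>" and W: "miso gA W (cmod B \<rho>)"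
  shows "\<exists>D. simple_decomposition gA W D"
proof -
  note rD = grepD[OF r]
  have WL: "left_module gA W" using W by (simp add: miso_def)
  interpret W: left_module gA W by (rule WL)
  obtain e where e: "e \<in> module_hom gA (cmod B \<rho>) W" "bij_betw e (vecs B) (carrier W)"
    using miso_sym[OF W] by (auto elim!: misoE)
  note eD = module_homD[OF e(1), simplified]
  have e0: "e 0 = \<zero>\<^bsub>W\<^esub>"
    using module_hom_zero[OF e(1) abelian_group_cmod W.M.abelian_group_axioms] by simp
  have e_inj: "f = g" if "f \<in> vecs B" "g \<in> vecs B" "e f = e g" for f g
    using e(2) that by (auto simp: bij_betw_def inj_on_def)
  have "inv_sub B \<rho> (vecs B)"
    by (auto simp: inv_sub_def pmv.subspace_def rD intro: vecs_intros)
  from exists_decomposition[OF fin r this] obtain n N where dec: "decomposes B \<rho> (vecs B) n N" by blast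
  have N: "inv_sub B \<rho> (N j)" "N j \<noteq> {0}"
    "\<And>L. inv_sub B \<rho> L \<Longrightarrow> L \<subseteq> N j \<Longrightarrow> L = {0} \<or> L = N j" if "j < n" for j
    using dec that by (auto simp: decomposes_def)
  have dec_ex: "\<exists>x. (\<forall>j<n. x j \<in> N j) \<and> u = (\<Sum>j<n. x j)" if "u \<in> vecs B" for u
    using dec that by (simp add: decomposes_def)
  have dec_uniq: "\<forall>j<n. x j = 0" if "\<forall>j<n. x j \<in> N j" "(\<Sum>j<n. x j) = 0" for x
    using dec that by (simp add: decomposes_def)
  have Nsub: "pmv.subspace (N j)" and NB: "N j \<subseteq> vecs B" if "j < n" for j
    using N(1)[OF that] by (auto simp: inv_sub_def)
  have NBD: "f \<in> vecs B" if "f \<in> N j" "j < n" for f j using NB that by blast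
  have N_act: "lin_ext (\<lambda>g. \<rho> g f) x \<in> N j" if j: "j < n" and f: "f \<in> N j" and x: "x \<in> carrier gA" for j f x
    unfolding lin_ext_def using x f N(1)[OF j]
    by (intro pmv.subspace_sum[OF Nsub[OF j]] pmv.subspace_scale[OF Nsub[OF j]])
      (auto simp: inv_sub_def group_algebra_simps vecs_def)
  \<comment> \<open>\<open>simple_decomposition\<close> wants summands with the element type of
    \<open>W\<close>, so the minimal invariant subspaces are carried back to submodules of
    \<open>W\<close> itself.\<close>
  define F where "F j = W\<lparr>carrier := e ` N j\<rparr>" for j
  have F_simps [simp]: "carrier (F j) = e ` N j" "\<zero>\<^bsub>F j\<^esub> = \<zero>\<^bsub>W\<^esub>" "x \<oplus>\<^bsub>F j\<^esub> y = x \<oplus>\<^bsub>W\<^esub> y"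
    "r \<odot>\<^bsub>F j\<^esub> x = r \<odot>\<^bsub>W\<^esub> x" for j x y r
    by (simp_all add: F_def)
  have FL: "left_module gA (F j)" if j: "j < n" for j
  proof (intro left_module.intro W.R.ring_axioms left_module_axioms.intro)
    have eN: "e f \<in> carrier W" if "f \<in> N j" for f using eD(1) NB[OF j] that by blast
    show "abelian_group (F j)"
    proof (rule abelian_groupI)
      show "\<zero>\<^bsub>F j\<^esub> \<in> carrier (F j)" using pmv.subspace_0[OF Nsub[OF j]] e0 by force
      show "x \<oplus>\<^bsub>F j\<^esub> y \<in> carrier (F j)" if "x \<in> carrier (F j)" "y \<in> carrier (F j)" for x y
      proof -
        from that obtain f g where fg: "f \<in> N j" "g \<in> N j" "x = e f" "y = e g" by auto
        then have "x \<oplus>\<^bsub>F j\<^esub> y = e (f + g)" by (simp add: eD(2) NBD[OF _ j])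
        then show ?thesis using pmv.subspace_add[OF Nsub[OF j] fg(1,2)] by simp
      qed
      show "\<exists>y\<in>carrier (F j). y \<oplus>\<^bsub>F j\<^esub> x = \<zero>\<^bsub>F j\<^esub>" if "x \<in> carrier (F j)" for x
      proof -
        from that obtain f where f: "f \<in> N j" "x = e f" by auto
        have "- f \<in> N j" by (rule pmv.subspace_neg[OF Nsub[OF j] f(1)])
        moreover have "e (- f) \<oplus>\<^bsub>W\<^esub> x = \<zero>\<^bsub>W\<^esub>"
          using eD(2)[OF vecs_uminus[OF NBD[OF f(1) j]] NBD[OF f(1) j]] f e0 by simp
        ultimately show ?thesis by auto
      qed
    qed (use eN in \<open>auto simp: W.M.a_ac\<close>)
    show "r \<odot>\<^bsub>F j\<^esub> x \<in> carrier (F j)" if r: "r \<in> carrier gA" and x: "x \<in> carrier (F j)" for r x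
    proof -
      from x obtain f where f: "f \<in> N j" "x = e f" by auto
      then show ?thesis using eD(3)[OF r, of f] NB[OF j] N_act[OF j f(1) r] by (auto simp flip: eD(3)[OF r])
    qed
  qed (use eD(1) NB[OF j] in \<open>auto simp: W.smult_l_distr W.smult_r_distr W.smult_assoc W.smult_one subset_iff\<close>)
  have simple: "simple_module gA (F j)" if j: "j < n" for j
    unfolding simple_module_def
  proof (intro conjI allI impI)
    show "left_module gA (F j)" by (rule FL[OF j])
    show "carrier (F j) \<noteq> {\<zero>\<^bsub>F j\<^esub>}"
    proof
      assume c: "carrier (F j) = {\<zero>\<^bsub>F j\<^esub>}"
      have "f = 0" if "f \<in> N j" for f
        using c that e0 NB[OF j] by (intro e_inj) auto
      then show False using N(2)[OF j] pmv.subspace_0[OF Nsub[OF j]] by blast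
    qed
    fix L assume "submodule L gA (F j)"
    then interpret L: submodule L gA "F j" .
    have Lc: "L \<subseteq> e ` N j" using L.subset by simp
    define L' where "L' = {f \<in> N j. e f \<in> L}"
    have eL': "e ` L' = L" using Lc by (auto simp: L'_def)
    have act: "r \<odot>\<^bsub>W\<^esub> x \<in> L" if "r \<in> carrier gA" "x \<in> L" for r x
      using L.smult_closed[OF that] by simp
    have "inv_sub B \<rho> L'"
      unfolding inv_sub_def pmv.subspace_def
    proof (intro conjI ballI allI)
      show "0 \<in> L'" using L.one_closed pmv.subspace_0[OF Nsub[OF j]] e0 by (simp add: L'_def)
      show "x + y \<in> L'" if "x \<in> L'" "y \<in> L'" for x y
        using that L.m_closed[of "e x" "e y"] pmv.subspace_add[OF Nsub[OF j]] j
        by (simp add: L'_def eD(2) NBD[OF _ j])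
      show "scale c x \<in> L'" if x: "x \<in> L'" for c x
      proof -
        have xB: "x \<in> vecs B" using x NB[OF j] by (auto simp: L'_def)
        have "e (scale c x) = Poly_Mapping.single \<one> c \<odot>\<^bsub>W\<^esub> e x"
          using eD(3)[of "Poly_Mapping.single \<one> c" x] xB by (simp add: rD)
        then show ?thesis using x act[of "Poly_Mapping.single \<one> c" "e x"] pmv.subspace_scale[OF Nsub[OF j]]
          by (simp add: L'_def)
      qed
      show "L' \<subseteq> vecs B" using NB[OF j] by (auto simp: L'_def)
      show "\<rho> g x \<in> L'" if g: "g \<in> carrier G" and x: "x \<in> L'" for g x
      proof -
        have xB: "x \<in> vecs B" using x NB[OF j] by (auto simp: L'_def)
        have "e (\<rho> g x) = ev g \<odot>\<^bsub>W\<^esub> e x" using eD(3)[of "ev g" x] xB g by simp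
        then show ?thesis using x g act[of "ev g" "e x"] N(1)[OF j] by (simp add: L'_def inv_sub_def)
      qed
    qed
    then have "L' = {0} \<or> L' = N j" by (rule N(3)[OF j]) (auto simp: L'_def)
    then show "L = {\<zero>\<^bsub>F j\<^esub>} \<or> L = carrier (F j)" using eL' e0 by auto
  qed
  define D where "D = direct_sum {..<n} F"
  have DL: "left_module gA D"
    unfolding D_def by (rule direct_sum_left_module[OF FL W.R.ring_axioms]) simp
  have Dcar: "carrier D = (\<Pi>\<^sub>E j\<in>{..<n}. e ` N j)"
    unfolding D_def by (subst direct_sum_carrier) (use FL in \<open>auto simp: left_module_def\<close>)
  define i where "i = inv_into (vecs B) e"
  have ie: "i (e f) = f" if "f \<in> vecs B" for f using e(2) that by (auto simp: i_def bij_betw_def)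
  have i_hom: "i \<in> module_hom gA W (cmod B \<rho>)"
    unfolding i_def using module_hom_inverse[OF e(1)] e(2) grep_left_module[OF r] by auto
  note iD = module_homD[OF i_hom, simplified]
  have iN: "i x \<in> N j" "x \<in> carrier W" if "j < n" "x \<in> e ` N j" for j x
    using that NB[OF that(1)] ie eD(1) by auto
  define S where "S x = e (\<Sum>j<n. i (x j))" for x
  have ei: "e (i w) = w" if "w \<in> carrier W" for w
    using e(2) that by (auto simp: i_def bij_betw_def f_inv_into_f)
  have xD: "i (x j) \<in> N j" "x j \<in> carrier W" "e (i (x j)) = x j" if "x \<in> carrier D" "j < n" for x j
  proof -
    have xj: "x j \<in> e ` N j" using that by (auto simp: Dcar)
    show "i (x j) \<in> N j" "x j \<in> carrier W" "e (i (x j)) = x j"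
      using iN[OF that(2) xj] ei by auto
  qed
  have sumB: "(\<Sum>j<n. i (x j)) \<in> vecs B" if "x \<in> carrier D" for x
    by (rule vecs_sum) (use xD(1)[OF that] NB in blast)
  have hom: "S \<in> module_hom gA D W"
  proof (rule module_homI)
    show "S x \<in> carrier W" if "x \<in> carrier D" for x unfolding S_def by (rule eD(1)[OF sumB[OF that]])
    show "S (x \<oplus>\<^bsub>D\<^esub> y) = S x \<oplus>\<^bsub>W\<^esub> S y" if x: "x \<in> carrier D" and y: "y \<in> carrier D" for x y
    proof -
      have "(\<Sum>j<n. i ((x \<oplus>\<^bsub>D\<^esub> y) j)) = (\<Sum>j<n. i (x j) + i (y j))"
        by (intro sum.cong refl) (use xD[OF x] xD[OF y] in \<open>simp add: D_def iD\<close>)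
      then show ?thesis using sumB[OF x] sumB[OF y] by (simp add: S_def sum.distrib eD)
    qed
    show "S (r \<odot>\<^bsub>D\<^esub> x) = r \<odot>\<^bsub>W\<^esub> S x" if r: "r \<in> carrier gA" and x: "x \<in> carrier D" for r x
    proof -
      have "(\<Sum>j<n. i ((r \<odot>\<^bsub>D\<^esub> x) j)) = (\<Sum>j<n. lin_ext (\<lambda>a. \<rho> a (i (x j))) r)"
        by (intro sum.cong refl) (use xD[OF x] r in \<open>simp add: D_def iD\<close>)
      also have "\<dots> = lin_ext (\<lambda>a. \<rho> a (\<Sum>j<n. i (x j))) r"
      proof -
        have "(\<Sum>j<n. lin_ext (\<lambda>a. \<rho> a (i (x j))) r) = lin_ext (\<lambda>a. \<Sum>j<n. \<rho> a (i (x j))) r"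
          unfolding lin_ext_def by (simp add: scale_sum) (rule sum.swap)
        also have "\<dots> = lin_ext (\<lambda>a. \<rho> a (\<Sum>j<n. i (x j))) r"
          by (rule lin_ext_vecs_cong[of r "carrier G"]) (use r in \<open>auto simp: group_algebra_simps lin_sum[OF rD(1)]\<close>)
        finally show ?thesis .
      qed
      finally show ?thesis using eD(3)[OF r sumB[OF x]] by (simp add: S_def)
    qed
  qed
  have bij: "bij_betw S (carrier D) (carrier W)"
  proof (rule bij_betw_imageI)
    show "inj_on S (carrier D)"
    proof (rule inj_onI)
      fix x y assume x: "x \<in> carrier D" and y: "y \<in> carrier D" and eq: "S x = S y"
      have "(\<Sum>j<n. i (x j) - i (y j)) = 0"
        using e_inj[OF sumB[OF x] sumB[OF y]] eq by (simp add: S_def sum_subtractf)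
      moreover have "\<forall>j<n. i (x j) - i (y j) \<in> N j"
        using xD(1)[OF x] xD(1)[OF y] pmv.subspace_diff[OF Nsub] by blast
      ultimately have z: "\<forall>j<n. i (x j) - i (y j) = 0"
        by (intro dec_uniq)
      have "x j = y j" if "j < n" for j
        using z that xD(3)[OF x that] xD(3)[OF y that] by (metis eq_iff_diff_eq_0)
      then show "x = y" using x y unfolding Dcar by (intro PiE_ext) auto
    qed
    have "w \<in> S ` carrier D" if w: "w \<in> carrier W" for w
    proof -
      have "i w \<in> vecs B" using iD(1)[OF w] .
      then obtain x where x: "\<forall>j<n. x j \<in> N j" "i w = (\<Sum>j<n. x j)"
        using dec_ex by blast
      let ?x = "\<lambda>j\<in>{..<n}. e (x j)"
      have "?x \<in> carrier D" using x(1) by (auto simp: Dcar)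
      moreover have "(\<Sum>j<n. i (?x j)) = (\<Sum>j<n. x j)"
        by (intro sum.cong refl) (use x(1) NB ie in \<open>auto simp: subset_iff\<close>)
      then have "S ?x = w" using ei[OF w] x(2) by (simp add: S_def)
      ultimately show ?thesis by blast
    qed
    then show "S ` carrier D = carrier W" using module_homD(1)[OF hom] by blast
  qed
  have "miso gA D W" by (rule misoI[OF DL WL hom bij])
  then have "module_iso gA W D" using miso_sym by (auto simp: miso_def)
  then have "simple_decomposition gA W (n, F)"
    by (simp add: simple_decomposition_def simple D_def)
  then show ?thesis by blast
qed

lemma multiplicity_decomposition:
  fixes V :: "'i \<Rightarrow> ('a \<Rightarrow>\<^sub>0 'k::field_char_0, 'v) module" and W :: "('a \<Rightarrow>\<^sub>0 'k, 'w) module" and B :: "'u set"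
  assumes fin: "finite (carrier G)" "finite B" and r: "grep G B \<rho>" and W: "miso gA W (cmod B \<rho>)"
    and reps: "simple_representatives gA I V"
  obtains n :: nat and l where "\<And>c. c < n \<Longrightarrow> l c \<in> I" "\<And>i. i \<in> I \<Longrightarrow> simple_multiplicity gA (V i) W = card {c. c < n \<and> l c = i}"
    "miso gA W (direct_sum {..<n} (\<lambda>c. V (l c)))"
proof -
  \<comment> \<open>This is the very decomposition chosen inside \<open>simple_multiplicity\<close>,
    so the summands counted there are the ones used here.\<close>
  obtain n F where D: "(SOME D. simple_decomposition gA W D) = (n, F)" by (metis surj_pair)
  have "simple_decomposition gA W (n, F)"
    using someI_ex[OF exists_simple_decomposition[OF fin r W]] unfolding D .
  then have F: "\<And>c. c < n \<Longrightarrow> simple_module gA (F c)" "module_iso gA W (direct_sum {..<n} F)"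
    by (auto simp: simple_decomposition_def)
  have "\<exists>i. i \<in> I \<and> miso gA (F c) (V i)" if c: "c < n" for c
    by (rule simple_module_representative[OF reps F(1)[OF c]]) blast
  then obtain l where l: "\<And>c. c < n \<Longrightarrow> l c \<in> I" "\<And>c. c < n \<Longrightarrow> miso gA (F c) (V (l c))"
    by metis
  have VL: "left_module gA (V i)" if "i \<in> I" for i
    using reps that by (auto simp: simple_representatives_def simple_module_def)
  \<comment> \<open>Since the representatives are pairwise non-isomorphic, counting the summands
    isomorphic to \<open>V i\<close> amounts to counting the indices \<open>c\<close> with label
    \<open>i\<close>.\<close>
  have iff: "module_iso gA (F c) (V i) \<longleftrightarrow> l c = i" if c: "c < n" and i: "i \<in> I" for c i
  proof
    assume "module_iso gA (F c) (V i)"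
    then have "miso gA (F c) (V i)" using F(1)[OF c] VL[OF i] by (simp add: miso_def simple_module_def)
    then have "module_iso gA (V (l c)) (V i)"
      by (intro miso_iso miso_trans[OF miso_sym[OF l(2)[OF c]]])
    then show "l c = i" using reps l(1)[OF c] i by (auto simp: simple_representatives_def)
  qed (use l(2)[OF c] in \<open>auto intro: miso_iso\<close>)
  show thesis
  proof (rule that[of n l])
    show "l c \<in> I" if "c < n" for c using l(1) that .
    show "simple_multiplicity gA (V i) W = card {c. c < n \<and> l c = i}" if "i \<in> I" for i
    proof -
      have "{c. c < n \<and> module_iso gA (F c) (V i)} = {c. c < n \<and> l c = i}"
        using iff that by blast
      then show ?thesis by (simp add: simple_multiplicity_def D)
    qed
    have DL: "left_module gA (direct_sum {..<n} F)"
      using F(1) by (intro direct_sum_left_module group_algebra_ring) (auto simp: simple_module_def)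
    have "left_module gA W" using W by (simp add: miso_def)
    then have "miso gA W (direct_sum {..<n} F)" using F(2) DL by (simp add: miso_def)
    also have "miso gA (direct_sum {..<n} F) (direct_sum {..<n} (\<lambda>c. V (l c)))"
      by (rule direct_sum_cong[OF _ group_algebra_ring]) (simp add: l)
    finally show "miso gA W (direct_sum {..<n} (\<lambda>c. V (l c)))" .
  qed
qed

end

section \<open>The \<open>q\<close>-binomial theorem\<close>

text \<open>The Gaussian binomial coefficients. The recursion is the Pascal rule obtained by
  multiplying by \<open>y + z\<close> from the left and moving \<open>y\<close> past
  \<open>z^i\<close> at the cost of \<open>q^i\<close>.\<close>

primrec gbin :: "'k::field \<Rightarrow> nat \<Rightarrow> nat \<Rightarrow> 'k"
  where "gbin q 0 i = (if i = 0 then 1 else 0)"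
  | "gbin q (Suc n) i = q ^ i * gbin q n i + (if i = 0 then 0 else gbin q n (i - 1))"

lemma gbin_0 [simp]: "gbin q n 0 = 1"
  by (induction n) auto

lemma gbin_gt: "i > n \<Longrightarrow> gbin q n i = 0"
  by (induction n arbitrary: i) auto

lemma gbin_same [simp]: "gbin q n n = 1"
  by (induction n) (auto simp: gbin_gt)

text \<open>The quotient of neighbouring Gaussian binomials with the denominator cleared, so that it
  also makes sense where \<open>1 - q ^ Suc i\<close> vanishes.\<close>

lemma gbin_step:
  "i \<le> n \<Longrightarrow> (1 - q ^ Suc i) * gbin q n (Suc i) = (1 - q ^ (n - i)) * gbin q n i"
proof (induction n arbitrary: i)
  case (Suc n)
  show ?case
  proof (cases i)
    case 0
    have IH: "(1 - q) * gbin q n (Suc 0) = 1 - q ^ n" using Suc.IH[of 0] by simp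
    have "(1 - q) * (q * gbin q n (Suc 0) + 1) = q * ((1 - q) * gbin q n (Suc 0)) + (1 - q)"
      by (simp add: algebra_simps)
    also have "\<dots> = 1 - q ^ Suc n" unfolding IH by (simp add: algebra_simps)
    finally show ?thesis unfolding 0 by simp
  next
    case (Suc j)
    show ?thesis
    proof (cases "i \<le> n")
      case True
      have nj: "n - j = Suc (n - i)" using True Suc by simp
      have 1: "(1 - q ^ Suc i) * gbin q n (Suc i) = (1 - q ^ (n - i)) * gbin q n i"
        by (rule Suc.IH[OF True])
      have 2: "(1 - q ^ i) * gbin q n i = (1 - q ^ (n - j)) * gbin q n j"
        using Suc.IH[of j] True Suc by simp
      have p: "q ^ Suc i * q ^ (n - i) = q ^ Suc n" "q ^ i * q ^ Suc (n - i) = q ^ Suc n"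
        using True by (simp_all flip: power_add)
      have "(1 - q ^ Suc i) * gbin q (Suc n) (Suc i) = q ^ Suc i * ((1 - q ^ Suc i) * gbin q n (Suc i)) + (1 - q ^ Suc i) * gbin q n i"
        by (simp add: algebra_simps)
      also have "\<dots> = (1 - q ^ Suc i * q ^ (n - i)) * gbin q n i"
        unfolding 1 by (simp add: algebra_simps)
      also have "\<dots> = (1 - q ^ i * q ^ Suc (n - i)) * gbin q n i" unfolding p ..
      also have "\<dots> = (1 - q ^ Suc (n - i)) * (q ^ i * gbin q n i) + (1 - q ^ i) * gbin q n i"
        by (simp add: algebra_simps)
      also have "\<dots> = (1 - q ^ Suc (n - i)) * gbin q (Suc n) i"
        unfolding 2 nj using Suc by (simp add: algebra_simps)
      finally show ?thesis using True by (simp add: Suc_diff_le)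
    next
      case False
      then have "i = Suc n" using Suc.prems by simp
      then show ?thesis by (simp add: gbin_gt)
    qed
  qed
qed (simp add: gbin_gt)

text \<open>In row \<open>s\<close> the step from \<open>i = 0\<close> has the factor
  \<open>1 - q^s = 0\<close>; the zero then propagates, because the left factors
  \<open>1 - q ^ Suc i\<close> are nonzero below \<open>s\<close>.\<close>

lemma gbin_root_of_unity:
  assumes q: "q ^ s = 1" "\<And>i. 0 < i \<Longrightarrow> i < s \<Longrightarrow> q ^ i \<noteq> 1" and i: "0 < i" "i < s"
  shows "gbin q s i = 0"
  using i
proof (induction i)
  case (Suc i)
  have "(1 - q ^ Suc i) * gbin q s (Suc i) = (1 - q ^ (s - i)) * gbin q s i"
    using Suc by (intro gbin_step) simp
  also have "\<dots> = 0" using Suc q(1) by (cases "i = 0") auto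
  finally show ?case using q(2)[of "Suc i"] Suc by simp
qed simp

lemma q_commute_pow:
  fixes y z :: "('b \<Rightarrow>\<^sub>0 'k::field) \<Rightarrow> ('b \<Rightarrow>\<^sub>0 'k)"
  assumes y: "lin y" and z: "lin z" "\<And>f. f \<in> vecs S \<Longrightarrow> z f \<in> vecs S"
    and comm: "\<And>f. f \<in> vecs S \<Longrightarrow> y (z f) = scale q (z (y f))" and f: "f \<in> vecs S"
  shows "y ((z ^^ i) f) = scale (q ^ i) ((z ^^ i) (y f))"
proof (induction i)
  case (Suc i)
  have "(z ^^ i) f \<in> vecs S" by (rule funpow_vecs[OF z(2) f])
  then show ?case using comm Suc by (simp add: lin_scale[OF z(1)])
qed simp

lemma q_binomial:
  fixes y z :: "('b \<Rightarrow>\<^sub>0 'k::field) \<Rightarrow> ('b \<Rightarrow>\<^sub>0 'k)"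
  assumes y: "lin y" "\<And>f. f \<in> vecs S \<Longrightarrow> y f \<in> vecs S" and z: "lin z" "\<And>f. f \<in> vecs S \<Longrightarrow> z f \<in> vecs S"
    and comm: "\<And>f. f \<in> vecs S \<Longrightarrow> y (z f) = scale q (z (y f))" and f: "f \<in> vecs S"
  shows "((\<lambda>f. y f + z f) ^^ n) f = (\<Sum>i\<le>n. scale (gbin q n i) ((z ^^ i) ((y ^^ (n - i)) f)))"
proof (induction n)
  case (Suc n)
  let ?T = "\<lambda>n i. (z ^^ i) ((y ^^ (n - i)) f)"
  have yT: "y (?T n i) = scale (q ^ i) (?T (Suc n) i)" if "i \<le> n" for i
    using that q_commute_pow[OF y(1) z comm funpow_vecs[OF y(2) f, where n = "n - i"], where i = i] by (simp add: Suc_diff_le)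
  have zT: "z (?T n i) = ?T (Suc n) (Suc i)" for i by simp
  have "((\<lambda>f. y f + z f) ^^ Suc n) f = (\<Sum>i\<le>n. scale (gbin q n i) (y (?T n i))) + (\<Sum>i\<le>n. scale (gbin q n i) (z (?T n i)))"
    using Suc by (simp add: lin_sum[OF y(1)] lin_sum[OF z(1)] lin_scale[OF y(1)] lin_scale[OF z(1)])
  also have "(\<Sum>i\<le>n. scale (gbin q n i) (y (?T n i))) = (\<Sum>i\<le>n. scale (q ^ i * gbin q n i) (?T (Suc n) i))"
    by (intro sum.cong refl) (simp add: yT mult.commute)
  also have "\<dots> = (\<Sum>i\<le>Suc n. scale (q ^ i * gbin q n i) (?T (Suc n) i))"
    by (simp add: gbin_gt)
  also have "(\<Sum>i\<le>n. scale (gbin q n i) (z (?T n i))) =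
      (\<Sum>i\<le>Suc n. scale (if i = 0 then 0 else gbin q n (i - 1)) (?T (Suc n) i))"
    unfolding sum.atMost_Suc_shift zT by simp
  finally show ?case by (simp add: sum.distrib[symmetric] scale_add_left[symmetric] del: sum.atMost_Suc)
qed simp

lemma q_binomial_root_of_unity:
  fixes y z :: "('b \<Rightarrow>\<^sub>0 'k::field) \<Rightarrow> ('b \<Rightarrow>\<^sub>0 'k)"
  assumes y: "lin y" "\<And>f. f \<in> vecs S \<Longrightarrow> y f \<in> vecs S" and z: "lin z" "\<And>f. f \<in> vecs S \<Longrightarrow> z f \<in> vecs S"
    and comm: "\<And>f. f \<in> vecs S \<Longrightarrow> y (z f) = scale q (z (y f))" and f: "f \<in> vecs S"
    and q: "q ^ s = 1" "\<And>i. 0 < i \<Longrightarrow> i < s \<Longrightarrow> q ^ i \<noteq> 1" and s: "s > 0"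
  shows "((\<lambda>f. y f + z f) ^^ s) f = (y ^^ s) f + (z ^^ s) f"
proof -
  have "((\<lambda>f. y f + z f) ^^ s) f = (\<Sum>i\<le>s. scale (gbin q s i) ((z ^^ i) ((y ^^ (s - i)) f)))"
    by (rule q_binomial[OF y z comm f])
  also have "\<dots> = (\<Sum>i\<in>{0, s}. scale (gbin q s i) ((z ^^ i) ((y ^^ (s - i)) f)))"
    by (rule sum.mono_neutral_right) (auto simp: gbin_root_of_unity[OF q])
  finally show ?thesis using s by simp
qed

section \<open>Tensor products of nilpotent Jordan blocks\<close>

text \<open>Multiplication by \<open>E = \<kappa> N \<otimes> 1 + 1 \<otimes> N\<close> on \<open>k[N]/(N\<^sup>p) \<otimes> k[N]/(N\<^sup>t)\<close> is part of an
  action of \<open>sl\<^sub>2\<close>; \<open>F\<close> is the lowering operator and \<open>prim\<close> gives its lowest weight vectors.\<close>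

locale sl2_tensor =
  fixes p t :: nat and \<kappa> :: "'k::field_char_0"
  assumes \<kappa>: "\<kappa> \<noteq> 0"
begin

definition up :: "nat \<Rightarrow> 'k \<Rightarrow> (nat \<Rightarrow>\<^sub>0 'k) \<Rightarrow> (nat \<Rightarrow>\<^sub>0 'k)"
  where "up n c = lin_ext (\<lambda>i. if Suc i < n then scale c (ev (Suc i)) else 0)"

text \<open>The weights \<open>i (n - i)\<close> are those of the lowering operator on the
  \<open>n\<close>-dimensional irreducible \<open>sl_2\<close>-module whose raising operator is a
  plain shift. Dividing by \<open>c\<close> compensates the factor \<open>c\<close> in
  \<open>up\<close>, so the commutator does not depend on \<open>c\<close>.\<close>

definition down :: "nat \<Rightarrow> 'k \<Rightarrow> (nat \<Rightarrow>\<^sub>0 'k) \<Rightarrow> (nat \<Rightarrow>\<^sub>0 'k)"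
  where "down n c = lin_ext (\<lambda>i. scale (of_nat (i * (n - i)) / c) (ev (i - 1)))"

definition E :: "(nat \<times> nat \<Rightarrow>\<^sub>0 'k) \<Rightarrow> (nat \<times> nat \<Rightarrow>\<^sub>0 'k)"
  where "E f = tens (up p \<kappa>) (\<lambda>x. x) f + tens (\<lambda>x. x) (up t 1) f"

definition F :: "(nat \<times> nat \<Rightarrow>\<^sub>0 'k) \<Rightarrow> (nat \<times> nat \<Rightarrow>\<^sub>0 'k)"
  where "F f = tens (down p \<kappa>) (\<lambda>x. x) f + tens (\<lambda>x. x) (down t 1) f"

definition wt :: "nat \<Rightarrow> (nat \<times> nat) set"
  where "wt d = {(i, j). i < p \<and> j < t \<and> i + j = d}"

lemma up_lin: "lin (up n c)" and down_lin: "lin (down n c)"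
  by (simp_all add: up_def down_def lin_lin_ext)

lemma up_ev: "up n c (ev i) = (if Suc i < n then scale c (ev (Suc i)) else 0)"
  and down_ev: "down n c (ev i) = scale (of_nat (i * (n - i)) / c) (ev (i - 1))"
  by (simp_all add: up_def down_def)

lemma E_lin: "lin E" and F_lin: "lin F"
  unfolding E_def F_def by (intro lin_plus lin_tens)+

lemma commutator_1:
  assumes "c \<noteq> 0" "i < n"
  shows "down n c (up n c (ev i)) = up n c (down n c (ev i)) + scale (of_nat n - 1 - 2 * of_nat i) (ev i)"
proof -
  have n: "(of_nat (n - Suc i) :: 'k) = of_nat n - 1 - of_nat i" "(of_nat (n - i) :: 'k) = of_nat n - of_nat i"
    using assms(2) by (simp_all add: of_nat_diff)
  \<comment> \<open>For \<open>i = n - 1\<close> the raised vector is 0, in agreement with the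
    factor \<open>n - Suc i = 0\<close>.\<close>
  have 1: "down n c (up n c (ev i)) = scale (of_nat (Suc i * (n - Suc i))) (ev i)"
    using assms by (cases "Suc i < n") (auto simp: up_ev down_ev lin_scale[OF down_lin] lin_0[OF down_lin] simp del: scale_single of_nat_Suc single_one)
  have 2: "up n c (down n c (ev i)) = scale (of_nat (i * (n - i))) (ev i)"
    using assms by (cases i) (auto simp: up_ev down_ev lin_scale[OF up_lin] lin_0[OF up_lin] simp del: scale_single of_nat_Suc single_one)
  have "(of_nat (Suc i * (n - Suc i)) :: 'k) = of_nat (i * (n - i)) + (of_nat n - 1 - 2 * of_nat i)"
    unfolding of_nat_mult n by (simp add: algebra_simps)
  then show ?thesis unfolding 1 2 by (simp only: scale_add_left)
qed

lemma commutator: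
  assumes "f \<in> vecs (wt d)"
  shows "F (E f) = E (F f) + scale (of_nat p + of_nat t - 2 - 2 * of_nat d) f"
proof (rule lin_eqI[OF assms])
  show "lin (\<lambda>f. F (E f))" by (rule lin_comp(2)[OF F_lin E_lin])
  show "lin (\<lambda>f. E (F f) + scale (of_nat p + of_nat t - 2 - 2 * of_nat d) f)"
    by (intro lin_plus lin_comp(2)[OF E_lin F_lin] lin_scaleI lin_id)
  fix b assume "b \<in> wt d"
  then obtain i j where b: "b = (i, j)" and ij: "i < p" "j < t" "i + j = d" by (auto simp: wt_def)
  note L = tens_elem_tensor[OF up_lin lin_id(1)] tens_elem_tensor[OF lin_id(1) up_lin]
    tens_elem_tensor[OF down_lin lin_id(1)] tens_elem_tensor[OF lin_id(1) down_lin]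
  have ev: "ev b = elem_tensor (ev i) (ev j)" by (simp add: b)
  show "F (E (ev b)) = E (F (ev b)) + scale (of_nat p + of_nat t - 2 - 2 * of_nat d) (ev b)"
    unfolding ev E_def F_def lin_add[OF lin_tens] L commutator_1[OF \<kappa> ij(1)] commutator_1[OF one_neq_zero ij(2)]
      elem_tensor_add elem_tensor_scale
    by (rule poly_mapping_eqI) (simp add: lookup_add lookup_single when_def algebra_simps flip: ij(3))
qed

lemma E_wt: "f \<in> vecs (wt d) \<Longrightarrow> E f \<in> vecs (wt (Suc d))"
  by (erule lin_vecs_image[OF _ E_lin])
    (auto simp: E_def wt_def up_ev elem_tensor_scale simp del: scale_single intro!: vecs_intros)

lemma E_pow_wt: "f \<in> vecs (wt d) \<Longrightarrow> (E ^^ k) f \<in> vecs (wt (d + k))"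
  by (induction k) (auto intro: E_wt)

text \<open>The recursion solves \<open>F (prim d) = 0\<close> coefficient by coefficient: at
  \<open>(i, d - i - 1)\<close> the equation links the coefficients with indices \<open>i\<close>
  and \<open>Suc i\<close>. For \<open>d < p\<close> the denominators occurring in
  \<open>prim d\<close> are nonzero.\<close>

primrec prim_coeff :: "nat \<Rightarrow> nat \<Rightarrow> 'k"
  where "prim_coeff d 0 = 1"
  | "prim_coeff d (Suc i) = - \<kappa> * prim_coeff d i * of_nat ((d - i) * (t - (d - i))) / of_nat (Suc i * (p - Suc i))"

definition prim :: "nat \<Rightarrow> (nat \<times> nat \<Rightarrow>\<^sub>0 'k)"
  where "prim d = (\<Sum>i\<le>d. Poly_Mapping.single (i, d - i) (prim_coeff d i))"

lemma prim_wt: "d < p \<Longrightarrow> d < t \<Longrightarrow> prim d \<in> vecs (wt d)"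
  unfolding prim_def by (intro vecs_sum vecs_single) (auto simp: wt_def)

text \<open>Leading coefficient 1 at first index 0: this single row of coordinates tells the
  primitive vectors of different degrees apart, and so gives their independence.\<close>

lemma lookup_prim: "d < p \<Longrightarrow> d < t \<Longrightarrow> Poly_Mapping.lookup (prim d) (0, d') = (if d = d' then 1 else 0)"
proof -
  have "Poly_Mapping.lookup (prim d) (0, d') = (\<Sum>i\<le>d. if i = 0 then if d = d' then 1 else 0 else 0)"
    unfolding prim_def lookup_sum by (intro sum.cong) (auto simp: lookup_single when_def)
  then show ?thesis by simp
qed

lemma F_prim:
  assumes d: "d < p" "d < t"
  shows "F (prim d) = 0"
proof -
  let ?c = "prim_coeff d"
  have F_ev: "F (ev (i, j)) = scale (of_nat (i * (p - i)) / \<kappa>) (ev (i - 1, j)) + scale (of_nat (j * (t - j))) (ev (i, j - 1))" for i j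
    by (simp add: F_def down_ev elem_tensor_scale)
  let ?a = "\<lambda>i. scale (?c i * (of_nat (i * (p - i)) / \<kappa>)) (ev (i - 1, d - i))"
  let ?b = "\<lambda>i. scale (?c i * of_nat ((d - i) * (t - (d - i)))) (ev (i, d - i - 1))"
  have "F (prim d) = (\<Sum>i\<le>d. scale (?c i) (F (ev (i, d - i))))"
    unfolding prim_def lin_sum[OF F_lin] by (intro sum.cong refl lin_single[OF F_lin])
  also have "\<dots> = (\<Sum>i\<le>d. ?a i) + (\<Sum>i\<le>d. ?b i)"
    unfolding F_ev scale_add_right sum.distrib scale_scale ..
  \<comment> \<open>The term \<open>i = 0\<close> of this sum and the term \<open>i = d\<close> of
    the other vanish; after the shift both contribute to the same basis vectors and cancel
    pairwise.\<close>
  also have "(\<Sum>i\<le>d. ?a i) = (\<Sum>i<d. ?a (Suc i))"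
    unfolding lessThan_Suc_atMost[symmetric] sum.lessThan_Suc_shift by simp
  also have "(\<Sum>i\<le>d. ?b i) = (\<Sum>i<d. ?b i)"
    unfolding lessThan_Suc_atMost[symmetric] sum.lessThan_Suc by simp
  also have "(\<Sum>i<d. ?a (Suc i)) + (\<Sum>i<d. ?b i) = (\<Sum>i<d. ?a (Suc i) + ?b i)"
    by (simp add: sum.distrib)
  also have "\<dots> = 0"
  proof (rule sum.neutral, rule ballI)
    fix i assume "i \<in> {..<d}"
    then have i: "i < d" by simp
    have nz: "(of_nat (Suc i * (p - Suc i)) :: 'k) \<noteq> 0"
      using i d by (subst of_nat_eq_0_iff) simp
    have "?c (Suc i) * (of_nat (Suc i * (p - Suc i)) / \<kappa>) = - (?c i * of_nat ((d - i) * (t - (d - i))))"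
      using nz \<kappa> by (simp del: of_nat_mult of_nat_Suc mult_Suc)
    moreover have "d - Suc i = d - i - 1" by simp
    ultimately show "?a (Suc i) + ?b i = 0"
      unfolding diff_Suc_1 by (simp add: scale_add_left[symmetric] del: scale_single prim_coeff.simps of_nat_mult of_nat_Suc)
  qed
  finally show ?thesis .
qed

text \<open>The length of the string that starts in degree \<open>d\<close>: the commutator acts
  there by \<open>p + t - 2 - 2 d\<close>, and an \<open>sl_2\<close>-string has one vector more
  than this weight.\<close>

definition blk :: "nat \<Rightarrow> nat" where "blk d = p + t - 1 - 2 * d"

lemma F_E_pow_prim:
  assumes d: "d < p" "d < t"
  shows "F ((E ^^ Suc k) (prim d)) = scale (of_nat (Suc k) * (of_nat (blk d) - of_nat (Suc k))) ((E ^^ k) (prim d))"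
proof (induction k)
  have blk: "(of_nat (blk d) :: 'k) = of_nat p + of_nat t - 1 - 2 * of_nat d"
    using d by (simp add: blk_def of_nat_diff)
  {
    case 0
    have c0: "(of_nat (Suc 0) * (of_nat (blk d) - of_nat (Suc 0)) :: 'k) = of_nat p + of_nat t - 2 - 2 * of_nat d"
      by (simp add: blk)
    show ?case unfolding c0 using commutator[OF prim_wt[OF d]] by (simp add: F_prim[OF d] lin_0[OF E_lin])
  next
    case (Suc k)
    have "F ((E ^^ Suc (Suc k)) (prim d)) = E (F ((E ^^ Suc k) (prim d))) +
        scale (of_nat p + of_nat t - 2 - 2 * of_nat (d + Suc k)) ((E ^^ Suc k) (prim d))"
      using commutator[OF E_pow_wt[OF prim_wt[OF d], of "Suc k"]] by simp
    also have "\<dots> = scale (of_nat (Suc (Suc k)) * (of_nat (blk d) - of_nat (Suc (Suc k)))) ((E ^^ Suc k) (prim d))"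
    proof -
      have e: "E ((E ^^ k) (prim d)) = (E ^^ Suc k) (prim d)" by simp
      show ?thesis
        unfolding Suc lin_scale[OF E_lin] e scale_add_left[symmetric]
        by (rule arg_cong2[where f = scale]) (simp_all add: blk algebra_simps)
    qed
    finally show ?case .
  }
qed

text \<open>Degrees are bounded, so the string breaks off at some first \<open>K\<close>. Applying
  \<open>F\<close> at the break gives \<open>K (blk d - K) = 0\<close> in the field, and
  characteristic zero forces \<open>K = blk d\<close>.\<close>

lemma E_pow_prim_eq_0:
  assumes d: "d < p" "d < t"
  shows "(E ^^ blk d) (prim d) = 0"
proof -
  let ?v = "\<lambda>k. (E ^^ k) (prim d)"
  have "wt (d + (p + t)) = {}" by (auto simp: wt_def)
  then have "?v (p + t) = 0"
    using E_pow_wt[OF prim_wt[OF d], of "p + t"] by (auto simp: vecs_def)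
  then have ex: "\<exists>k. ?v k = 0" by blast
  define K where "K = (LEAST k. ?v k = 0)"
  have K: "?v K = 0" unfolding K_def by (rule LeastI_ex[OF ex])
  have "?v 0 \<noteq> 0"
  proof
    assume "?v 0 = 0"
    then have "Poly_Mapping.lookup (prim d) (0, d) = 0" by simp
    then show False using lookup_prim[OF d, of d] by simp
  qed
  then obtain k where k: "K = Suc k" using K by (cases K) auto
  have vk: "?v k \<noteq> 0" using not_less_Least[of k "\<lambda>k. ?v k = 0"] k by (simp add: K_def)
  have "scale (of_nat (Suc k) * (of_nat (blk d) - of_nat (Suc k))) (?v k) = 0"
    using F_E_pow_prim[OF d, of k] K k by (simp add: lin_0[OF F_lin])
  then have "(of_nat (Suc k) :: 'k) * (of_nat (blk d) - of_nat (Suc k)) = 0"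
    using vk by (simp only: pmv.scale_eq_0_iff) simp
  then have "(of_nat (blk d) :: 'k) = of_nat (Suc k)"
    by (simp only: mult_eq_0_iff of_nat_eq_0_iff) simp
  then show ?thesis using K k by (simp only: of_nat_eq_iff)
qed

text \<open>The kernel of the map \<open>(u, k) \<mapsto> E\<^sup>k (prim (min p t - u))\<close> is stable under the locally nilpotent
  operator \<open>lower\<close>, whose own kernel is spanned by the pairs \<open>(u, 0)\<close>.\<close>

definition blkset :: "(nat \<times> nat) set"
  where "blkset = {(u, k). u \<in> {1..min p t} \<and> k < blk (min p t - u)}"

definition chain :: "(nat \<times> nat \<Rightarrow>\<^sub>0 'k) \<Rightarrow> (nat \<times> nat \<Rightarrow>\<^sub>0 'k)"
  where "chain = lin_ext (\<lambda>(u, k). (E ^^ k) (prim (min p t - u)))"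

definition lower :: "(nat \<times> nat \<Rightarrow>\<^sub>0 'k) \<Rightarrow> (nat \<times> nat \<Rightarrow>\<^sub>0 'k)"
  where "lower = lin_ext (\<lambda>(u, k). case k of 0 \<Rightarrow> 0
    | Suc k' \<Rightarrow> scale (of_nat k * (of_nat (blk (min p t - u)) - of_nat k)) (ev (u, k')))"

lemma chain_lin: "lin chain" and lower_lin: "lin lower"
  by (simp_all add: chain_def lower_def lin_lin_ext)

lemma chain_ev: "chain (ev (u, k)) = (E ^^ k) (prim (min p t - u))"
  and lower_ev: "lower (ev (u, 0)) = 0"
  "lower (ev (u, Suc k)) = scale (of_nat (Suc k) * (of_nat (blk (min p t - u)) - of_nat (Suc k))) (ev (u, k))"
  by (simp_all add: chain_def lower_def del: of_nat_Suc)

lemma deg_less: "u \<in> {1..min p t} \<Longrightarrow> min p t - u < p \<and> min p t - u < t"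
  by auto

lemma chain_lower:
  assumes "f \<in> vecs blkset" shows "F (chain f) = chain (lower f)"
proof (rule lin_eqI[OF assms lin_comp(2)[OF F_lin chain_lin] lin_comp(2)[OF chain_lin lower_lin]])
  fix b assume "b \<in> blkset"
  then obtain u k where [simp]: "b = (u, k)" and u: "u \<in> {1..min p t}" by (auto simp: blkset_def)
  note d = conjunct1[OF deg_less[OF u]] conjunct2[OF deg_less[OF u]]
  show "F (chain (ev b)) = chain (lower (ev b))"
  proof (cases k)
    case 0
    then show ?thesis by (simp add: chain_ev lower_ev F_prim[OF d] lin_0[OF chain_lin])
  next
    case (Suc k')
    show ?thesis using F_E_pow_prim[OF d, of k']
      by (simp add: Suc chain_ev lower_ev lin_scale[OF chain_lin] del: scale_single of_nat_Suc funpow.simps)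
  qed
qed

lemma lookup_lower:
  "Poly_Mapping.lookup (lower f) (u, k) =
    of_nat (Suc k) * (of_nat (blk (min p t - u)) - of_nat (Suc k)) * Poly_Mapping.lookup f (u, Suc k)"
proof -
  have "f \<in> vecs UNIV" by simp
  then show ?thesis
  proof (induction rule: vecs_lin_induct)
    case (ev b)
    obtain u' k' where [simp]: "b = (u', k')" by (metis surj_pair)
    show ?case
      by (cases k') (auto simp: lower_ev lookup_single when_def simp del: of_nat_Suc)
  qed (simp_all add: lin_0[OF lower_lin] lin_add[OF lower_lin] lin_scale[OF lower_lin] lookup_add
    distrib_left mult.left_commute del: of_nat_Suc)
qed

lemma lookup_chain_bottom:
  assumes "f \<in> vecs {(u, k). u \<in> {1..min p t} \<and> k = 0}" "u \<in> {1..min p t}"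
  shows "Poly_Mapping.lookup (chain f) (0, min p t - u) = Poly_Mapping.lookup f (u, 0)"
  using assms(1)
proof (induction rule: vecs_lin_induct)
  case (ev b)
  then obtain u' where [simp]: "b = (u', 0)" and u': "u' \<in> {1..min p t}" by auto
  have "min p t - u' = min p t - u \<longleftrightarrow> u' = u" using u' assms(2) by auto
  then show ?case using u' deg_less[OF u'] by (simp add: chain_ev lookup_prim lookup_single when_def)
qed (simp_all add: lin_0[OF chain_lin] lin_add[OF chain_lin] lin_scale[OF chain_lin] lookup_add)

lemma chain_inj:
  assumes "f \<in> vecs blkset" "chain f = 0"
  shows "f = 0"
proof -
  have "f \<in> vecs (blkset \<inter> {(u, k). k < K}) \<Longrightarrow> chain f = 0 \<Longrightarrow> f = 0" for K f
  proof (induction K arbitrary: f)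
    case 0
    then show ?case by (simp add: vecs_def)
  next
    case (Suc K)
    have fB: "f \<in> vecs blkset" using Suc(2) by (rule vecs_mono) auto
    \<comment> \<open>\<open>lower\<close> shortens the strings and, intertwining with
      \<open>F\<close>, stays in the kernel of \<open>chain\<close>; the induction hypothesis thus
      gives \<open>lower f = 0\<close>.\<close>
    have "lower f \<in> vecs (blkset \<inter> {(u, k). k < K})"
      by (rule lin_vecs_image[OF Suc(2) lower_lin])
        (auto simp: blkset_def lower_def simp del: scale_single of_nat_Suc intro!: vecs_intros split: nat.splits)
    moreover have "chain (lower f) = 0" using chain_lower[OF fB] Suc(3) by (simp add: lin_0[OF F_lin])
    ultimately have l0: "lower f = 0" by (rule Suc(1))
    \<comment> \<open>Inside \<open>blkset\<close> the coefficients of \<open>lower\<close> are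
      nonzero in characteristic zero, so \<open>f\<close> lives on the starting vectors of the
      strings.\<close>
    have nz: "Poly_Mapping.lookup f (u, Suc k) = 0" for u k
    proof (cases "(u, Suc k) \<in> blkset")
      case True
      then have "(of_nat (Suc k) :: 'k) * (of_nat (blk (min p t - u)) - of_nat (Suc k)) \<noteq> 0"
        by (auto simp: blkset_def simp del: of_nat_Suc)
      then show ?thesis using lookup_lower[of f u k] l0 by (simp del: of_nat_Suc)
    qed (rule vecsD[OF fB])
    have f0: "f \<in> vecs {(u, k). u \<in> {1..min p t} \<and> k = 0}"
    proof (rule vecsI)
      fix b :: "nat \<times> nat" assume b: "b \<notin> {(u, k). u \<in> {1..min p t} \<and> k = 0}"
      obtain u k where [simp]: "b = (u, k)" by (metis surj_pair)
      show "Poly_Mapping.lookup f b = 0"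
      proof (cases k)
        case 0
        then show ?thesis using b by (intro vecsD[OF fB]) (auto simp: blkset_def)
      qed (simp add: nz)
    qed
    show ?case
    proof (rule poly_mapping_eqI)
      fix b :: "nat \<times> nat" obtain u k where [simp]: "b = (u, k)" by (metis surj_pair)
      show "Poly_Mapping.lookup f b = Poly_Mapping.lookup 0 b"
      proof (cases "u \<in> {1..min p t} \<and> k = 0")
        case True
        then show ?thesis using lookup_chain_bottom[OF f0, of u] Suc(3) by simp
      next
        case False
        then show ?thesis using vecsD[OF f0, of b] by simp
      qed
    qed
  qed
  moreover have "f \<in> vecs (blkset \<inter> {(u, k). k < Suc (Max (snd ` Poly_Mapping.keys f))})"
  proof -
    have "k \<le> Max (snd ` Poly_Mapping.keys f)" if "(u, k) \<in> Poly_Mapping.keys f" for u k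
      using that by (intro Max_ge) force+
    then show ?thesis using assms(1) by (auto simp: vecs_def less_Suc_eq_le)
  qed
  ultimately show ?thesis using assms(2) by blast
qed

end

section \<open>Graded data: shifts, direct sums and twisted tensor products\<close>

definition suml :: "('i \<Rightarrow> ('b \<Rightarrow>\<^sub>0 'k::field) \<Rightarrow> ('b \<Rightarrow>\<^sub>0 'k)) \<Rightarrow> ('i \<times> 'b \<Rightarrow>\<^sub>0 'k) \<Rightarrow> ('i \<times> 'b \<Rightarrow>\<^sub>0 'k)"
  where "suml L = lin_ext (\<lambda>(i, b). elem_tensor (ev i) (L i (ev b)))"

lemma suml_ev [simp]: "suml L (ev (i, b)) = elem_tensor (ev i) (L i (ev b))"
  by (simp add: suml_def)

lemma suml_lin: "lin (suml L)"
  by (simp add: suml_def lin_lin_ext)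

lemma suml_elem_tensor: "lin (L i) \<Longrightarrow> suml L (elem_tensor (ev i) f) = elem_tensor (ev i) (L i f)"
  by (rule lin_eqI[of f UNIV, OF _ lin_comp(2)[OF suml_lin elem_tensor_lin(1)] lin_comp(2)[OF elem_tensor_lin(1)]])
    auto

lemma suml_in_vecs:
  "f \<in> vecs (Sigma I S) \<Longrightarrow> (\<And>i f. i \<in> I \<Longrightarrow> f \<in> vecs (S i) \<Longrightarrow> L i f \<in> vecs (S i)) \<Longrightarrow> suml L f \<in> vecs (Sigma I S)"
  by (rule lin_vecs_image[OF _ suml_lin], assumption) (clarsimp intro!: elem_tensor_Sigma, simp add: vecs_single)

lemma gdata_sum:
  assumes d: "\<And>i. i \<in> I \<Longrightarrow> gdata s (S i) (Y i) (D i)"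
  shows "gdata s (Sigma I S) (suml Y) (\<lambda>c. suml (\<lambda>i. D i c))"
  unfolding gdata_def
proof (intro conjI allI impI ballI)
  note g = gdataD[OF d]
  show "suml Y f \<in> vecs (Sigma I S)" if "f \<in> vecs (Sigma I S)" for f
    using that by (rule suml_in_vecs) (rule g(2))
  show "suml (\<lambda>i. D i c) f \<in> vecs (Sigma I S)" if "f \<in> vecs (Sigma I S)" for c f
    using that by (rule suml_in_vecs) (rule g(4))
  show "suml (\<lambda>i. D i c) (suml Y f) = scale c (suml Y (suml (\<lambda>i. D i c) f))"
    if c: "c ^ s = 1" and f: "f \<in> vecs (Sigma I S)" for c f
    by (rule lin_eqI[OF f lin_comp(2)[OF suml_lin suml_lin] lin_scaleI[OF lin_comp(2)[OF suml_lin suml_lin]]])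
      (auto simp: suml_elem_tensor g(1) g(3) g(5)[OF _ c] vecs_single elem_tensor_scale)
  show "suml (\<lambda>i. D i (c * d)) f = suml (\<lambda>i. D i c) (suml (\<lambda>i. D i d) f)"
    if f: "f \<in> vecs (Sigma I S)" for c d f
    by (rule lin_eqI[OF f suml_lin lin_comp(2)[OF suml_lin suml_lin]])
      (auto simp: suml_elem_tensor g(3) g(6) vecs_single)
  show "suml (\<lambda>i. D i 1) f = f" if f: "f \<in> vecs (Sigma I S)" for f
    by (rule lin_eqI[OF f suml_lin lin_id(1)]) (auto simp: g(7) vecs_single)
qed (rule suml_lin)+

lemma gdata_shift:
  assumes d: "gdata s S Y D"
  shows "gdata s S Y (\<lambda>c f. scale (c ^ m) (D c f))"
  unfolding gdata_def using gdataD[OF d]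
  by (auto simp: lin_scale[OF gdataD(1)[OF d]] lin_scale[OF gdataD(3)[OF d]] power_mult_distrib mult.commute
      intro: lin_scaleI vecs_scale)

text \<open>The action of \<open>x \<otimes> a + 1 \<otimes> x\<close> on the graded parts:
  \<open>a\<close> acts on the second factor by the scalar \<open>w\<close> of its representation
  and by \<open>q^r\<close>, with \<open>q = \<chi>(a)\<close>, in degree \<open>r\<close>.\<close>

definition qsum :: "'k \<Rightarrow> 'k \<Rightarrow> (('i \<Rightarrow>\<^sub>0 'k::field) \<Rightarrow> ('i \<Rightarrow>\<^sub>0 'k)) \<Rightarrow> ('k \<Rightarrow> ('j \<Rightarrow>\<^sub>0 'k) \<Rightarrow> ('j \<Rightarrow>\<^sub>0 'k))
    \<Rightarrow> (('j \<Rightarrow>\<^sub>0 'k) \<Rightarrow> ('j \<Rightarrow>\<^sub>0 'k)) \<Rightarrow> ('i \<times> 'j \<Rightarrow>\<^sub>0 'k) \<Rightarrow> ('i \<times> 'j \<Rightarrow>\<^sub>0 'k)"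
  where "qsum w q Y D' Y' f = tens Y (\<lambda>f. scale w (D' q f)) f + tens (\<lambda>x. x) Y' f"

lemma gdata_tensor:
  assumes d: "gdata s S Y D" and d': "gdata s S' Y' D'" and q: "q ^ s = 1"
  shows "gdata s (S \<times> S') (qsum w q Y D' Y') (\<lambda>c. tens (D c) (D' c))"
  unfolding gdata_def
proof (intro conjI allI impI ballI)
  note g = gdataD[OF d] and g' = gdataD[OF d']
  have w: "lin (\<lambda>f. scale w (D' q f))" by (rule lin_scaleI[OF g'(3)])
  show Q: "lin (qsum w q Y D' Y')" unfolding qsum_def by (intro lin_plus lin_tens)
  show "qsum w q Y D' Y' f \<in> vecs (S \<times> S')" if "f \<in> vecs (S \<times> S')" for f
    unfolding qsum_def by (intro vecs_add tens_in_vecs[OF that] vecs_scale g g' vecs_single)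
  show "tens (D c) (D' c) f \<in> vecs (S \<times> S')" if "f \<in> vecs (S \<times> S')" for c f
    by (intro tens_in_vecs[OF that] g g' vecs_single)
  show "tens (D c) (D' c) (qsum w q Y D' Y' f) = scale c (qsum w q Y D' Y' (tens (D c) (D' c) f))"
    if c: "c ^ s = 1" and f: "f \<in> vecs (S \<times> S')" for c f
  proof (rule tens_eqI[OF f lin_comp(2)[OF lin_tens Q] lin_scaleI[OF lin_comp(2)[OF Q lin_tens]]])
    fix i j assume ij: "i \<in> S" "j \<in> S'"
    have "D' c (D' q (ev j)) = D' q (D' c (ev j))"
      using g'(6)[of "ev j" c q] g'(6)[of "ev j" q c] ij by (simp add: vecs_single mult.commute)
    then show "tens (D c) (D' c) (qsum w q Y D' Y' (elem_tensor (ev i) (ev j))) =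
        scale c (qsum w q Y D' Y' (tens (D c) (D' c) (elem_tensor (ev i) (ev j))))"
      unfolding qsum_def using ij
      by (simp add: tens_elem_tensor g(1,3) g'(1,3) w lin_id lin_add[OF lin_tens] g(5)[OF c] g'(5)[OF c] vecs_single
          elem_tensor_scale lin_scale[OF g'(3)] lin_scale[OF lin_tens] scale_add_right mult.commute del: elem_tensor_single)
  qed
  show "tens (D (c * e)) (D' (c * e)) f = tens (D c) (D' c) (tens (D e) (D' e) f)" if f: "f \<in> vecs (S \<times> S')" for c e f
    unfolding tens_comp[OF g(3) g'(3)] by (rule tens_cong[OF f]) (simp_all add: g(6) g'(6) vecs_single)
  show "tens (D 1) (D' 1) f = f" if f: "f \<in> vecs (S \<times> S')" for f
  proof -
    have "tens (D 1) (D' 1) f = tens (\<lambda>x. x) (\<lambda>x. x) f"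
      by (rule tens_cong[OF f]) (simp_all add: g(7) g'(7) vecs_single)
    then show ?thesis by (simp add: tens_id)
  qed
qed (rule lin_tens)

section \<open>Decomposition of the twisted tensor product of two graded Jordan blocks\<close>

text \<open>The parameter \<open>\<kappa>\<close> becomes \<open>w^s\<close>: applying
  \<open>y\<close> \<open>s\<close> times acts as \<open>x^s\<close> on the first block and
  multiplies degree \<open>r\<close> of the second by \<open>(w q^r)^s = w^s\<close>.\<close>

locale jordan_tensor = sl2_tensor p t "w ^ s" for p t s :: nat and w :: "'k::field_char_0" +
  fixes q \<alpha> \<beta> :: 'k
  assumes q: "q ^ s = 1" "\<And>i. 0 < i \<Longrightarrow> i < s \<Longrightarrow> q ^ i \<noteq> 1" and s: "s > 0" and w: "w \<noteq> 0"
begin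

definition "SA = ({..<p} \<times> {..<s}) \<times> ({..<t} \<times> {..<s})"
definition "yA = tens (jx {..<p} s \<alpha>) (\<lambda>f. scale w (jd q f))"
definition "zA = tens (\<lambda>x. x) (jx {..<t} s \<beta>)"
definition "xA = qsum w q (jx {..<p} s \<alpha>) jd (jx {..<t} s \<beta>)"
definition "DA = (\<lambda>c. tens (jd c) (jd c))"
definition "\<gamma> = w ^ s * \<alpha> + \<beta>"
definition "EA f = (xA ^^ s) f - scale \<gamma> f"
text \<open>Embeds the product of the two nilpotent blocks as the corner where both exponents of
  \<open>x\<close> are 0. All operators \<open>DA c\<close> fix this corner.\<close>

definition "\<iota> = lin_ext (\<lambda>(i :: nat, j :: nat). (ev ((i, 0 :: nat), (j, 0 :: nat))) :: (nat \<times> nat) \<times> (nat \<times> nat) \<Rightarrow>\<^sub>0 'k)"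

lemma xA_eq: "xA f = yA f + zA f"
  by (simp add: xA_def yA_def zA_def qsum_def)

lemma wq_lin: "lin (\<lambda>f. scale w (jd q f))"
  by (rule lin_scaleI[OF jd_lin])

lemma yA_lin: "lin yA" and zA_lin: "lin zA" and xA_lin: "lin xA" and \<iota>_lin: "lin \<iota>" and EA_lin: "lin EA"
proof -
  show "lin yA" "lin zA" "lin \<iota>" by (simp_all add: yA_def zA_def \<iota>_def lin_tens lin_lin_ext)
  then show "lin xA" unfolding xA_eq[abs_def] by (intro lin_plus)
  then show "lin EA" unfolding EA_def[abs_def] by (intro lin_minus lin_funpow lin_scaleI lin_id)
qed

lemma gdata_A: "gdata s SA xA DA"
  unfolding SA_def xA_def DA_def by (intro gdata_tensor gdata_jordan s q)

lemma jd_vecs: "f \<in> vecs (K \<times> {..<s}) \<Longrightarrow> jd c f \<in> vecs (K \<times> {..<s})"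
  using gdataD(4)[OF gdata_jordan[OF s]] .

lemma yA_vecs: "f \<in> vecs SA \<Longrightarrow> yA f \<in> vecs SA" and zA_vecs: "f \<in> vecs SA \<Longrightarrow> zA f \<in> vecs SA"
  unfolding SA_def yA_def zA_def
  by (erule tens_in_vecs; (intro vecs_scale jd_vecs jx_in_vecs[OF s] vecs_single; assumption))+

lemma xA_vecs: "f \<in> vecs SA \<Longrightarrow> xA f \<in> vecs SA"
  by (rule gdataD(2)[OF gdata_A])

lemma yz_comm:
  assumes f: "f \<in> vecs SA" shows "yA (zA f) = scale q (zA (yA f))"
  unfolding yA_def zA_def
proof (rule tens_eqI[OF f[unfolded SA_def] lin_comp(2)[OF lin_tens lin_tens] lin_scaleI[OF lin_comp(2)[OF lin_tens lin_tens]]])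
  fix i j assume "i \<in> {..<p} \<times> {..<s}" and j: "j \<in> {..<t} \<times> {..<s}"
  have "jd q (jx {..<t} s \<beta> (ev j)) = scale q (jx {..<t} s \<beta> (jd q (ev j)))"
    by (rule gdataD(5)[OF gdata_jordan[OF s] q(1)]) (rule vecs_single[OF j])
  then show "tens (jx {..<p} s \<alpha>) (\<lambda>f. scale w (jd q f)) (tens (\<lambda>x. x) (jx {..<t} s \<beta>) (elem_tensor (ev i) (ev j))) =
      scale q (tens (\<lambda>x. x) (jx {..<t} s \<beta>) (tens (jx {..<p} s \<alpha>) (\<lambda>f. scale w (jd q f)) (elem_tensor (ev i) (ev j))))"
    by (simp add: tens_elem_tensor jx_lin wq_lin lin_id elem_tensor_scale lin_scale[OF jx_lin] lin_scale[OF lin_tens] mult.commute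
        del: elem_tensor_single)
qed

lemma tens_pow:
  fixes L :: "('i \<Rightarrow>\<^sub>0 'k) \<Rightarrow> ('i \<Rightarrow>\<^sub>0 'k)" and M :: "('j \<Rightarrow>\<^sub>0 'k) \<Rightarrow> ('j \<Rightarrow>\<^sub>0 'k)"
  assumes "lin L" "lin M" shows "(tens L M ^^ n) (elem_tensor f g) = elem_tensor ((L ^^ n) f) ((M ^^ n) g)"
  by (induction n) (simp_all add: tens_elem_tensor assms)

lemma id_pow: "((\<lambda>x. x) ^^ n) f = f"
  by (induction n) auto

lemma wjd_pow:
  "((\<lambda>f. scale w (jd q f)) ^^ n) (ev (j, r)) = scale (w ^ n * q ^ (n * r)) (ev (j, r))"
proof (induction n)
  case (Suc n)
  then show ?case
    by (simp add: lin_scale[OF jd_lin] jd_ev power_add mult_ac del: scale_single)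
qed simp

definition "delta c n i r = (if Suc i < n then scale c (ev (Suc i :: nat, r :: nat)) else 0)"

text \<open>In \<open>x^s = y^s + z^s\<close> the two blocks contribute the scalars
  \<open>w^s \<alpha>\<close> and \<open>\<beta>\<close>, which add up to \<open>\<gamma>\<close>;
  what \<open>EA\<close> leaves are the two nilpotent shifts.\<close>

lemma EA_ev:
  assumes "i < p" "r < s" "j < t" "r' < s"
  shows "EA (ev ((i, r), (j, r'))) = elem_tensor (delta (w ^ s) p i r) (ev (j, r')) + elem_tensor (ev (i, r)) (delta 1 t j r')"
proof -
  let ?v = "elem_tensor (ev (i, r)) (ev (j, r')) :: (nat \<times> nat) \<times> (nat \<times> nat) \<Rightarrow>\<^sub>0 'k"
  have v: "?v \<in> vecs SA" unfolding SA_def using assms by (intro elem_tensor_in_vecs vecs_single) auto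
  have "(xA ^^ s) ?v = (yA ^^ s) ?v + (zA ^^ s) ?v"
    unfolding xA_eq[abs_def]
    by (rule q_binomial_root_of_unity[where S = SA and q = q, OF yA_lin yA_vecs zA_lin zA_vecs yz_comm v q s])
  also have "(yA ^^ s) ?v = elem_tensor ((jx {..<p} s \<alpha> ^^ s) (ev (i, r))) (scale (w ^ s) (ev (j, r')))"
    unfolding yA_def tens_pow[OF jx_lin wq_lin] wjd_pow using q(1) by (simp add: power_mult)
  also have "(zA ^^ s) ?v = elem_tensor (ev (i, r)) ((jx {..<t} s \<beta> ^^ s) (ev (j, r')))"
    unfolding zA_def tens_pow[OF lin_id(1) jx_lin] id_pow ..
  finally have "(xA ^^ s) ?v = elem_tensor (delta (w ^ s) p i r) (ev (j, r')) + elem_tensor (ev (i, r)) (delta 1 t j r') + scale \<gamma> ?v"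
    unfolding jx_pow_s[OF assms(2)] jx_pow_s[OF assms(4)]
    by (cases "Suc i < p"; cases "Suc j < t")
      (simp_all add: delta_def \<gamma>_def elem_tensor_add elem_tensor_scale scale_add_left algebra_simps
        del: scale_single elem_tensor_single)
  then show ?thesis by (simp add: EA_def)
qed

text \<open>Moving \<open>z\<close> past \<open>y^s\<close> costs \<open>q^s = 1\<close>. Hence
  multiplication by \<open>z\<close> carries Jordan strings of \<open>x^s - \<gamma>\<close> to
  Jordan strings.\<close>

lemma EA_z:
  assumes f: "f \<in> vecs SA" shows "EA (zA f) = zA (EA f)"
proof -
  have x_s: "(xA ^^ s) f = (yA ^^ s) f + (zA ^^ s) f" if "f \<in> vecs SA" for f
    unfolding xA_eq[abs_def]
    by (rule q_binomial_root_of_unity[where S = SA and q = q, OF yA_lin yA_vecs zA_lin zA_vecs yz_comm that q s])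
  have "(yA ^^ s) (zA f) = scale (q ^ s) (zA ((yA ^^ s) f))"
  proof -
    have "(yA ^^ n) (zA f) = scale (q ^ n) (zA ((yA ^^ n) f))" for n
    proof (induction n)
      case (Suc n)
      then show ?case
        using yz_comm[OF funpow_vecs[OF yA_vecs f, where n = n]] by (simp add: lin_scale[OF yA_lin] mult.commute)
    qed simp
    then show ?thesis .
  qed
  then have "(xA ^^ s) (zA f) = zA ((xA ^^ s) f)"
    using f zA_vecs by (simp add: x_s q(1) lin_add[OF zA_lin] funpow_swap1)
  then show ?thesis by (simp add: EA_def lin_diff[OF zA_lin] lin_scale[OF zA_lin])
qed

lemma \<iota>_ev [simp]: "\<iota> (ev (i, j)) = ev ((i, 0), (j, 0))"
  by (simp add: \<iota>_def)

definition "RA = {..<p} \<times> {..<t}"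

lemma \<iota>_vecs: "f \<in> vecs RA \<Longrightarrow> \<iota> f \<in> vecs SA"
  by (erule lin_vecs_image[OF _ \<iota>_lin]) (auto simp: RA_def SA_def s intro!: vecs_single)

lemma E_RA: "f \<in> vecs RA \<Longrightarrow> E f \<in> vecs RA"
  by (erule lin_vecs_image[OF _ E_lin])
    (auto simp: E_def RA_def up_ev elem_tensor_scale simp del: scale_single intro!: vecs_intros)

lemma EA_\<iota>:
  assumes f: "f \<in> vecs RA" shows "EA (\<iota> f) = \<iota> (E f)"
proof (rule lin_eqI[OF f lin_comp(2)[OF EA_lin \<iota>_lin] lin_comp(2)[OF \<iota>_lin E_lin]])
  fix b assume "b \<in> RA"
  then obtain i j where [simp]: "b = (i, j)" and ij: "i < p" "j < t" by (auto simp: RA_def)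
  show "EA (\<iota> (ev b)) = \<iota> (E (ev b))"
    using EA_ev[OF ij(1) s ij(2) s]
    by (simp add: E_def up_ev delta_def elem_tensor_scale lin_add[OF \<iota>_lin] lin_scale[OF \<iota>_lin] lin_0[OF \<iota>_lin]
        del: scale_single)
qed

lemma prim_RA: "u \<in> {1..min p t} \<Longrightarrow> prim (min p t - u) \<in> vecs RA"
  using deg_less[of u] by (intro vecs_mono[OF prim_wt]) (auto simp: wt_def RA_def)

lemma DA_\<iota>: "DA c (\<iota> f) = \<iota> f"
  by (rule lin_eqI[of f UNIV "\<lambda>f. DA c (\<iota> f)" \<iota>, OF _ lin_comp(2)[OF _ \<iota>_lin] \<iota>_lin])
    (auto simp: DA_def lin_tens jd_ev)

lemma DA_z: "c ^ s = 1 \<Longrightarrow> f \<in> vecs SA \<Longrightarrow> DA c (zA f) = scale c (zA (DA c f))"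
  unfolding DA_def zA_def SA_def
  by (rule tens_eqI[OF _ lin_comp(2)[OF lin_tens lin_tens] lin_scaleI[OF lin_comp(2)[OF lin_tens lin_tens]]], assumption)
    (simp add: tens_elem_tensor jx_lin jd_lin lin_id gdataD(5)[OF gdata_jordan[OF s]] vecs_single elem_tensor_scale
      del: elem_tensor_single)

text \<open>The corner has degree 0, and \<open>x\<close> and \<open>z\<close> each raise the degree
  by one.\<close>

lemma DA_pow:
  assumes c: "c ^ s = 1" and f: "f \<in> vecs RA"
  shows "DA c ((xA ^^ r) ((zA ^^ m) (\<iota> f))) = scale (c ^ (r + m)) ((xA ^^ r) ((zA ^^ m) (\<iota> f)))"
proof -
  have z: "(zA ^^ m) (\<iota> f) \<in> vecs SA" for m by (intro funpow_vecs[OF zA_vecs] \<iota>_vecs f)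
  have x: "(xA ^^ r) ((zA ^^ m) (\<iota> f)) \<in> vecs SA" for r by (intro funpow_vecs[OF xA_vecs] z)
  have 1: "DA c ((zA ^^ m) (\<iota> f)) = scale (c ^ m) ((zA ^^ m) (\<iota> f))" for m
    by (induction m) (simp_all add: DA_\<iota> DA_z[OF c z] lin_scale[OF zA_lin])
  show ?thesis
    by (induction r) (simp_all add: 1 gdataD(5)[OF gdata_A c x] lin_scale[OF xA_lin])
qed

end

section \<open>The comparison map and its bijectivity\<close>

context jordan_tensor
begin

text \<open>The string length \<open>blk\<close> in the numbering of the statement: \<open>u\<close>
  counts down from the top degree, \<open>d = min p t - u\<close>.\<close>

definition "nblk u = 2 * u - 1 + nat \<bar>int p - int t\<bar>"
definition "SC = Sigma {..<s} (\<lambda>m. Sigma {1..min p t} (\<lambda>u. {..<nblk u} \<times> {..<s}))"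
definition "YC = suml (\<lambda>m :: nat. suml (\<lambda>u :: nat. jx {..<nblk u} s \<gamma>))"
definition "DC c = suml (\<lambda>m f. scale (c ^ m) (suml (\<lambda>u :: nat. jd c) f))"
text \<open>The summand with label \<open>(m, u)\<close> is generated by \<open>z^m\<close> times a
  lowest weight vector in the corner; its basis vector \<open>(k, r)\<close> goes to
  \<open>x^r (x^s - \<gamma>)^k\<close> of that generator, written with \<open>E^k\<close> inside
  the corner. The generator has degree \<open>m\<close>, whence the shift \<open>c^m\<close> in
  \<open>DC\<close>.\<close>

definition "P = lin_ext (\<lambda>(m, (u, (k, r))). (xA ^^ r) ((zA ^^ m) (\<iota> ((E ^^ k) (prim (min p t - u))))))"

lemma nblk: "u \<in> {1..min p t} \<Longrightarrow> nblk u = blk (min p t - u)"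
  by (auto simp: nblk_def blk_def min_def)

lemma gdata_C: "gdata s SC YC DC"
  unfolding SC_def YC_def DC_def by (intro gdata_sum gdata_shift gdata_jordan s)

lemma P_lin: "lin P"
  by (simp add: P_def lin_lin_ext)

lemma P_ev: "P (ev (m, (u, (k, r)))) = (xA ^^ r) ((zA ^^ m) (\<iota> ((E ^^ k) (prim (min p t - u)))))"
  by (simp add: P_def)

lemma chain_RA: "u \<in> {1..min p t} \<Longrightarrow> (E ^^ k) (prim (min p t - u)) \<in> vecs RA"
  by (intro funpow_vecs[OF E_RA] prim_RA)

lemma P_var:
  assumes f: "f \<in> vecs SC" shows "P (YC f) = xA (P f)"
proof (rule lin_eqI[OF f lin_comp(2)[OF P_lin] lin_comp(2)[OF xA_lin P_lin]])
  show "lin YC" by (simp add: YC_def suml_lin)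
  fix b assume "b \<in> SC"
  then obtain m u k r where [simp]: "b = (m, (u, (k, r)))" and u: "u \<in> {1..min p t}" and k: "k < nblk u" and r: "r < s"
    by (auto simp: SC_def)
  define v where "v k = (zA ^^ m) (\<iota> ((E ^^ k) (prim (min p t - u))))" for k
  have EAv: "EA (v k) = v (Suc k)" for k
  proof -
    have "EA ((zA ^^ m) f) = (zA ^^ m) (EA f)" if "f \<in> vecs SA" for f
      by (induction m) (simp_all add: EA_z funpow_vecs[OF zA_vecs that])
    then show ?thesis unfolding v_def using EA_\<iota>[OF chain_RA[OF u]] \<iota>_vecs[OF chain_RA[OF u]] by simp
  qed
  have xs: "(xA ^^ s) (v k) = v (Suc k) + scale \<gamma> (v k)"
    using EAv[of k] by (simp add: EA_def algebra_simps)
  \<comment> \<open>The string ends exactly where the block of size \<open>nblk u\<close> is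
    truncated, so both sides lose the same term at the wrap-around.\<close>
  have top: "v (nblk u) = 0"
    using E_pow_prim_eq_0[OF conjunct1[OF deg_less[OF u]] conjunct2[OF deg_less[OF u]]]
    by (simp add: v_def nblk[OF u] lin_0[OF \<iota>_lin] lin_0[OF lin_funpow[OF zA_lin]])
  show "P (YC (ev b)) = xA (P (ev b))"
  proof (cases "Suc r < s")
    case True
    then show ?thesis by (simp add: YC_def jx_ev P_ev)
  next
    case False
    then have sr: "Suc r = s" using r by simp
    have "xA (P (ev b)) = (xA ^^ Suc r) (v k)" by (simp add: P_ev v_def)
    then have "xA (P (ev b)) = v (Suc k) + scale \<gamma> (v k)" unfolding sr xs .
    moreover have "P (YC (ev b)) = (if Suc k < nblk u then v (Suc k) else 0) + scale \<gamma> (v k)"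
      using False by (simp add: YC_def jx_ev P_ev v_def elem_tensor_add elem_tensor_scale lin_add[OF P_lin]
          lin_scale[OF P_lin] lin_0[OF P_lin] del: scale_single)
    moreover have "v (Suc k) = 0" if "\<not> Suc k < nblk u"
      using that k top by (metis Suc_lessI)
    ultimately show ?thesis by simp
  qed
qed

lemma P_grading:
  assumes c: "c ^ s = 1" and f: "f \<in> vecs SC" shows "P (DC c f) = DA c (P f)"
proof (rule lin_eqI[OF f lin_comp(2)[OF P_lin] lin_comp(2)[OF gdataD(3)[OF gdata_A] P_lin]])
  show "lin (DC c)" by (simp add: DC_def suml_lin)
  fix b assume "b \<in> SC"
  then obtain m u k r where [simp]: "b = (m, (u, (k, r)))" and u: "u \<in> {1..min p t}" by (auto simp: SC_def)
  show "P (DC c (ev b)) = DA c (P (ev b))"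
    using DA_pow[OF c chain_RA[OF u], of r m k]
    by (simp add: DC_def jd_ev P_ev elem_tensor_scale lin_scale[OF P_lin] power_add mult.commute del: scale_single)
qed

text \<open>\<open>P\<close> factors through the passage from the monomials \<open>x\<^sup>r z\<^sup>m\<close> to \<open>y\<^sup>r z\<^sup>m\<close>, which is triangular.\<close>

definition "P1 = lin_ext (\<lambda>((m, r), (i, j)). (xA ^^ r) ((zA ^^ m) (ev ((i, 0 :: nat), (j, 0 :: nat)))))"
definition "Q = lin_ext (\<lambda>(m :: nat, (u, (k, r :: nat))). elem_tensor (ev (m, r)) (chain (ev (u, k))))"
definition "slice m r = lin_ext (\<lambda>(m' :: nat, (u :: nat, (k :: nat, r' :: nat))). if m' = m \<and> r' = r then ev (u, k) else 0)"
definition "S1 = ({..<s} \<times> {..<s}) \<times> RA"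

lemma P1_lin: "lin P1" and Q_lin: "lin Q" and slice_lin: "lin (slice m r)"
  by (simp_all add: P1_def Q_def slice_def lin_lin_ext)

lemma P_factor: "P f = P1 (Q f)"
proof (rule lin_eqI[of f UNIV, OF _ P_lin lin_comp(2)[OF P1_lin Q_lin]])
  fix b :: "nat \<times> nat \<times> nat \<times> nat"
  obtain m u k r where [simp]: "b = (m, (u, (k, r)))" by (metis surj_pair)
  have "P1 (elem_tensor (ev (m, r)) g) = (xA ^^ r) ((zA ^^ m) (\<iota> g))" for g
    by (rule lin_eqI[of g UNIV, OF _ lin_comp(2)[OF P1_lin elem_tensor_lin(1)]
        lin_comp(2)[OF lin_funpow[OF xA_lin] lin_comp(2)[OF lin_funpow[OF zA_lin] \<iota>_lin]]])
      (auto simp: P1_def)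
  then show "P (ev b) = P1 (Q (ev b))"
    by (simp add: P_ev Q_def chain_ev)
qed simp

lemma lookup_slice: "Poly_Mapping.lookup (slice m r f) (u, k) = Poly_Mapping.lookup f (m, (u, (k, r)))"
proof -
  have "f \<in> vecs UNIV" by simp
  then show ?thesis
  proof (induction rule: vecs_lin_induct)
    case (ev b)
    obtain m' u' k' r' where [simp]: "b = (m', (u', (k', r')))" by (metis surj_pair)
    show ?case by (auto simp: slice_def lookup_single when_def)
  qed (simp_all add: lin_0[OF slice_lin] lin_add[OF slice_lin] lin_scale[OF slice_lin] lookup_add)
qed

text \<open>For each fixed label \<open>(m, r)\<close> the map \<open>Q\<close> is a copy of
  \<open>chain\<close>, so injectivity is tested slice by slice.\<close>

lemma Q_inj:
  assumes f: "f \<in> vecs SC" and "Q f = 0" shows "f = 0"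
proof (rule poly_mapping_eqI)
  fix b :: "nat \<times> nat \<times> nat \<times> nat"
  obtain m u k r where [simp]: "b = (m, (u, (k, r)))" by (metis surj_pair)
  have "coord (m, r) (Q f) = chain (slice m r f)"
  proof (rule lin_eqI[of f UNIV, OF _ lin_comp(2)[OF coord_lin Q_lin] lin_comp(2)[OF chain_lin slice_lin]])
    fix c :: "nat \<times> nat \<times> nat \<times> nat"
    obtain m' u' k' r' where [simp]: "c = (m', (u', (k', r')))" by (metis surj_pair)
    show "coord (m, r) (Q (ev c)) = chain (slice m r (ev c))"
      by (auto simp: Q_def slice_def coord_elem_tensor lin_0[OF chain_lin])
  qed simp
  then have "chain (slice m r f) = 0" using assms(2) by (simp add: lin_0[OF coord_lin])
  moreover have "slice m r f \<in> vecs blkset"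
    by (rule lin_vecs_image[OF f slice_lin])
      (auto simp: slice_def SC_def blkset_def nblk intro!: vecs_intros)
  ultimately have "slice m r f = 0" using chain_inj by blast
  then show "Poly_Mapping.lookup f b = Poly_Mapping.lookup 0 b"
    using lookup_slice[of m r f u k] by simp
qed

text \<open>The filtration by the exponent of \<open>x\<close> in the first factor, with respect to
  which \<open>x^r\<close> is triangular.\<close>

abbreviation lev :: "nat \<Rightarrow> ((nat \<times> nat) \<times> (nat \<times> nat)) set"
  where "lev r \<equiv> (UNIV \<times> {..<r}) \<times> UNIV"

lemma z_pow_ev: "m < s \<Longrightarrow> (zA ^^ m) (ev ((i, r), (j, 0))) = ev ((i, r), (j, m))"
  using tens_pow[OF lin_id(1) jx_lin, where n = m and f = "ev (i, r)" and g = "ev (j, 0)"] jx_pow_less[of m 0 s "{..<t}" \<beta> j]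
  by (simp add: zA_def id_pow)

lemma yA_ev: "yA (ev ((i, r), (j, m))) = scale (w * q ^ m) (elem_tensor (jx {..<p} s \<alpha> (ev (i, r))) (ev (j, m)))"
  by (simp add: yA_def jd_ev elem_tensor_scale del: scale_single)

lemma zA_ev: "zA (ev (a, b)) = elem_tensor (ev a) (jx {..<t} s \<beta> (ev b))"
  by (simp add: zA_def)

text \<open>Only \<open>y\<close> raises the first exponent, and by one; as exponents below
  \<open>r\<close> are smaller than \<open>s - 1\<close>, no wrap-around occurs in the first
  factor.\<close>

lemma xA_lev:
  assumes "r < s" "f \<in> vecs (lev r)" shows "xA f \<in> vecs (lev (Suc r))"
proof (rule lin_vecs_image[OF assms(2) xA_lin])
  fix b :: "(nat \<times> nat) \<times> (nat \<times> nat)" assume "b \<in> lev r"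
  then obtain i r' j m where [simp]: "b = ((i, r'), (j, m))" and r': "r' < r" by auto
  show "xA (ev b) \<in> vecs (lev (Suc r))"
    unfolding xA_eq using r' assms(1)
    by (auto simp: yA_ev zA_ev jx_ev simp del: elem_tensor_single
        intro!: vecs_add vecs_scale elem_tensor_in_vecs vecs_single)
qed

text \<open>Among the words in \<open>y\<close> and \<open>z\<close> that make up
  \<open>x^r\<close>, only \<open>y^r\<close> reaches first exponent \<open>r\<close>. Its scalar is
  \<open>w^r q^(m r)\<close>, since each \<open>y\<close> multiplies by \<open>w\<close> and by
  \<open>q\<close> to the power of the second exponent \<open>m\<close>.\<close>

lemma x_pow_ev:
  assumes "r < s"
  shows "(xA ^^ r) (ev ((i, 0), (j, m))) - scale (w ^ r * q ^ (m * r)) (ev ((i, r), (j, m))) \<in> vecs (lev r)"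
  using assms
proof (induction r)
  case (Suc r)
  let ?d = "(xA ^^ r) (ev ((i, 0), (j, m))) - scale (w ^ r * q ^ (m * r)) (ev ((i, r), (j, m)))"
  have "xA ?d \<in> vecs (lev (Suc r))" using Suc by (intro xA_lev) auto
  moreover have "xA (ev ((i, r), (j, m))) - scale (w * q ^ m) (ev ((i, Suc r), (j, m))) \<in> vecs (lev (Suc r))"
    using Suc(2) by (auto simp: xA_eq yA_ev zA_ev jx_ev intro!: elem_tensor_in_vecs vecs_single)
  ultimately have "xA ?d + scale (w ^ r * q ^ (m * r))
      (xA (ev ((i, r), (j, m))) - scale (w * q ^ m) (ev ((i, Suc r), (j, m)))) \<in> vecs (lev (Suc r))"
    by (intro vecs_add vecs_scale)
  then show ?case
    by (simp add: lin_diff[OF xA_lin] lin_scale[OF xA_lin] scale_diff_right power_add mult_ac del: scale_single)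
qed simp

text \<open>At the highest exponent \<open>K\<close> only leading terms are visible, and different
  labels \<open>(m, i, j)\<close> have different leading vectors: this is the diagonal of the
  triangular matrix.\<close>

lemma lookup_P1:
  assumes f: "f \<in> vecs {((m, r), (i, j)). m < s \<and> r \<le> K}" and K: "K < s"
  shows "Poly_Mapping.lookup (P1 f) ((i, K), (j, m)) = w ^ K * q ^ (m * K) * Poly_Mapping.lookup f ((m, K), (i, j))"
  using f
proof (induction rule: vecs_lin_induct)
  case (ev b)
  then obtain m' r' i' j' where [simp]: "b = ((m', r'), (i', j'))" and m': "m' < s" and r': "r' \<le> K" by auto
  have "Poly_Mapping.lookup ((xA ^^ r') (ev ((i', 0), (j', m'))) - scale (w ^ r' * q ^ (m' * r')) (ev ((i', r'), (j', m')))) ((i, K), (j, m)) = 0"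
    by (rule vecsD[OF x_pow_ev]) (use r' K in auto)
  then have "Poly_Mapping.lookup (P1 (ev b)) ((i, K), (j, m)) =
      w ^ r' * q ^ (m' * r') * Poly_Mapping.lookup (ev ((i', r'), (j', m'))) ((i, K), (j, m))"
    by (simp add: P1_def z_pow_ev[OF m'] lookup_minus del: scale_single)
  then show ?case by (auto simp: lookup_single when_def)
qed (simp_all add: lin_0[OF P1_lin] lin_add[OF P1_lin] lin_scale[OF P1_lin] lookup_add algebra_simps)

lemma P1_inj:
  assumes "f \<in> vecs S1" "P1 f = 0" shows "f = 0"
proof -
  have "K \<le> s \<Longrightarrow> f \<in> vecs {((m, r), (i, j)). m < s \<and> r < K} \<Longrightarrow> P1 f = 0 \<Longrightarrow> f = 0" for K f
  proof (induction K)
    case 0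
    then show ?case by (simp add: vecs_def)
  next
    case (Suc K)
    have f: "f \<in> vecs {((m, r), (i, j)). m < s \<and> r \<le> K}" using Suc(3) by (simp add: less_Suc_eq_le)
    \<comment> \<open>The diagonal entries \<open>w^K q^(m K)\<close> are nonzero, so the top layer
      of \<open>f\<close> vanishes and \<open>K\<close> can be lowered.\<close>
    have "q \<noteq> 0" using q(1) s by (auto simp: power_0_left)
    then have "Poly_Mapping.lookup f ((m, K), (i, j)) = 0" for m i j
      using lookup_P1[OF f, of i j m] Suc(2,4) w by simp
    then have "Poly_Mapping.lookup f b = 0" if "b \<notin> {((m, r), (i, j)). m < s \<and> r < K}" for b
      using that vecsD[OF f, of b] by (cases b rule: prod.exhaust; force simp: le_less)
    then have "f \<in> vecs {((m, r), (i, j)). m < s \<and> r < K}" by (intro vecsI) blast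
    then show ?case using Suc by simp
  qed
  moreover have "f \<in> vecs {((m, r), (i, j)). m < s \<and> r < s}"
    by (rule vecs_mono[OF assms(1)]) (auto simp: S1_def)
  ultimately show ?thesis using assms(2) by blast
qed

lemma sum_nblk: "(\<Sum>u = 1..min p t. nblk u) = p * t"
proof -
  \<comment> \<open>The sum of the first \<open>n\<close> odd numbers, each increased by
    \<open>d\<close>. For \<open>n = min p t\<close> and \<open>d = |p - t|\<close> the value is the
    product of minimum and maximum.\<close>
  have 1: "(\<Sum>u = 1..n. 2 * u - 1 + d) = n * (n + d)" for n d :: nat
    by (induction n) (auto simp: algebra_simps)
  show ?thesis unfolding nblk_def 1 by (cases "p \<le> t") (auto simp: min_def nat_diff_distrib)
qed

lemma card_eq: "card SC = card SA"
proof -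
  have "card SC = (\<Sum>m<s. \<Sum>u = 1..min p t. nblk u * s)"
    unfolding SC_def by (simp add: card_SigmaI card_cartesian_product)
  also have "\<dots> = s * ((\<Sum>u = 1..min p t. nblk u) * s)"
    by (simp add: sum_distrib_right)
  also have "\<dots> = card SA" unfolding sum_nblk SA_def by (simp add: card_cartesian_product)
  finally show ?thesis .
qed

lemma P_bij: "bij_betw P (vecs SC) (vecs SA)"
proof (rule lin_inj_imp_bij[OF P_lin _ _ card_eq])
  show "finite SC" "finite SA" by (simp_all add: SC_def SA_def)
  show "P (ev b) \<in> vecs SA" if "b \<in> SC" for b
    using that by (auto simp: SC_def P_ev intro!: funpow_vecs[OF xA_vecs] funpow_vecs[OF zA_vecs] \<iota>_vecs chain_RA)
  fix f assume f: "f \<in> vecs SC" and "P f = 0"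
  then have "P1 (Q f) = 0" by (simp add: P_factor)
  moreover have "Q f \<in> vecs S1"
  proof (rule lin_vecs_image[OF f Q_lin])
    fix b assume "b \<in> SC"
    then obtain m u k r where [simp]: "b = (m, (u, (k, r)))" and "u \<in> {1..min p t}" "m < s" "r < s"
      by (auto simp: SC_def)
    then show "Q (ev b) \<in> vecs S1"
      by (auto simp: Q_def S1_def chain_ev intro!: elem_tensor_in_vecs vecs_single chain_RA)
  qed
  ultimately have "Q f = 0" using P1_inj by blast
  then show "f = 0" by (rule Q_inj[OF f])
qed

end

text \<open>Powers of this bijection identify a Jordan block with its degree shifts.\<close>

lemma jx_bij:
  fixes \<gamma> :: "'k::field"
  assumes s: "s > 0" and \<gamma>: "\<gamma> \<noteq> 0"
  shows "bij_betw (jx {..<n} s \<gamma>) (vecs ({..<n} \<times> {..<s})) (vecs ({..<n} \<times> {..<s}))"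
proof (rule lin_inj_imp_bij[OF jx_lin])
  show "jx {..<n} s \<gamma> (ev b) \<in> vecs ({..<n} \<times> {..<s})" if "b \<in> {..<n} \<times> {..<s}" for b
    by (rule jx_in_vecs[OF s vecs_single[OF that]])
  fix f :: "nat \<times> nat \<Rightarrow>\<^sub>0 'k" assume f: "f \<in> vecs ({..<n} \<times> {..<s})" and 0: "jx {..<n} s \<gamma> f = 0"
  have Y0: "(jx {..<n} s \<gamma> ^^ s) f = 0"
    using s 0 lin_0[OF lin_funpow[OF jx_lin]] by (cases s) (auto simp only: funpow_Suc_right o_apply)
  \<comment> \<open>As \<open>x^s\<close> kills \<open>f\<close>, the vector \<open>f\<close> equals
    \<open>- \<gamma>^(-1) (x^s - \<gamma>) f\<close> and so lies one layer deeper; after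
    \<open>n\<close> layers nothing is left.\<close>
  have "f \<in> vecs ({k..<n} \<times> {..<s})" for k
  proof (induction k)
    case 0
    then show ?case using f by (simp add: atLeast0LessThan)
  next
    case (Suc k)
    let ?N = "\<lambda>f. (jx {..<n} s \<gamma> ^^ s) f - scale \<gamma> f"
    have "?N f \<in> vecs ({Suc k..<n} \<times> {..<s})"
    proof (rule lin_vecs_image[OF Suc])
      show "lin ?N" by (intro lin_minus lin_funpow jx_lin lin_scaleI lin_id)
    qed (auto simp: jx_pow_s simp del: scale_single intro!: vecs_single)
    then have "scale (- inverse \<gamma>) (?N f) \<in> vecs ({Suc k..<n} \<times> {..<s})" by (rule vecs_scale)
    then show ?case using \<gamma> by (simp add: Y0)
  qed
  from this[of n] show "f = 0" by (simp add: vecs_def)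
qed auto

section \<open>Twists by characters and the tensor product of Jordan modules\<close>

context group
begin

text \<open>A module isomorphism is controlled on its carrier only; its linear extension from basis
  vectors agrees with it there and is linear on the whole type, as \<open>gmod_cong\<close>
  requires.\<close>

lemma miso_intertwiner:
  fixes \<rho> :: "'a \<Rightarrow> ('u \<Rightarrow>\<^sub>0 'k::field) \<Rightarrow> ('u \<Rightarrow>\<^sub>0 'k)" and \<rho>' :: "'a \<Rightarrow> ('w \<Rightarrow>\<^sub>0 'k) \<Rightarrow> ('w \<Rightarrow>\<^sub>0 'k)"
  assumes m: "miso gA (cmod B \<rho>) (cmod B' \<rho>')" and r: "grep G B \<rho>" "grep G B' \<rho>'"
  obtains Q where "lin Q" "bij_betw Q (vecs B) (vecs B')"
    "\<And>g f. g \<in> carrier G \<Longrightarrow> f \<in> vecs B \<Longrightarrow> Q (\<rho> g f) = \<rho>' g (Q f)"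
proof -
  obtain \<phi> where h: "\<phi> \<in> module_hom gA (cmod B \<rho>) (cmod B' \<rho>')" and bij: "bij_betw \<phi> (vecs B) (vecs B')"
    using misoE[OF m] by auto
  have in': "\<phi> f \<in> vecs B'" if "f \<in> vecs B" for f using bij that by (auto simp: bij_betw_def)
  have add: "\<phi> (f + g) = \<phi> f + \<phi> g" if "f \<in> vecs B" "g \<in> vecs B" for f g
    using module_homD(2)[OF h] that by simp
  have single: "\<phi> (scale c (\<rho> g f)) = scale c (\<rho>' g (\<phi> f))" if "g \<in> carrier G" "f \<in> vecs B" for c g f
    using module_homD(3)[OF h gA_closed[OF that(1), of c]] that by simp
  have sc: "\<phi> (scale c f) = scale c (\<phi> f)" if "f \<in> vecs B" for c f
    using single[OF one_closed that] by (simp add: grepD(4)[OF r(1)] grepD(4)[OF r(2)] in' that)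
  define Q where "Q = lin_ext (\<lambda>b. \<phi> (ev b))"
  have lQ: "lin Q" by (simp add: Q_def lin_lin_ext)
  have eq: "Q f = \<phi> f" if "f \<in> vecs B" for f
    using that
  proof (induction rule: vecs_lin_induct)
    case zero
    then show ?case using sc[of 0 0] by (simp add: lin_0[OF lQ])
  next
    case (ev b)
    then show ?case by (simp add: Q_def)
  qed (simp_all add: lin_add[OF lQ] lin_scale[OF lQ] add sc)
  show ?thesis
  proof (rule that[OF lQ])
    show "bij_betw Q (vecs B) (vecs B')" using bij by (simp add: eq cong: bij_betw_cong)
    show "Q (\<rho> g f) = \<rho>' g (Q f)" if "g \<in> carrier G" "f \<in> vecs B" for g f
      using single[OF that, of 1] by (simp add: eq that grepD(2)[OF r(1)])
  qed
qed

lemma grep_sumop: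
  fixes \<rho> :: "'i \<Rightarrow> 'a \<Rightarrow> ('u \<Rightarrow>\<^sub>0 'k::field) \<Rightarrow> ('u \<Rightarrow>\<^sub>0 'k)"
  assumes r: "\<And>i. i \<in> I \<Longrightarrow> grep G (B i) (\<rho> i)"
  shows "grep G (Sigma I B) (sumop \<rho>)"
  unfolding grep_def
proof (intro conjI ballI)
  fix f :: "'i \<times> 'u \<Rightarrow>\<^sub>0 'k" assume f: "f \<in> vecs (Sigma I B)"
  show "sumop \<rho> g f \<in> vecs (Sigma I B)" if "g \<in> carrier G" for g
    by (rule sumop_in_vecs[OF f]) (use grepD(2)[OF r] that in auto)
  show "sumop \<rho> \<one> f = f"
    by (rule lin_eqI[OF f sumop_lin lin_id(1)]) (auto simp: grepD(4)[OF r] vecs_single)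
  fix g h assume g: "g \<in> carrier G" and h: "h \<in> carrier G"
  show "sumop \<rho> (g \<otimes> h) f = sumop \<rho> g (sumop \<rho> h f)"
  proof (rule lin_eqI[OF f sumop_lin lin_comp(2)[OF sumop_lin sumop_lin]])
    fix b assume "b \<in> Sigma I B"
    then obtain i u where [simp]: "b = (i, u)" and i: "i \<in> I" and u: "u \<in> B i" by auto
    have "sumop \<rho> g (elem_tensor (ev i) v) = elem_tensor (ev i) (\<rho> i g v)" for v
      by (rule lin_eqI[of v UNIV, OF _ lin_comp(2)[OF sumop_lin elem_tensor_lin(1)]
            lin_comp(2)[OF elem_tensor_lin(1) grepD(1)[OF r[OF i] g]]]) simp_all
    then show "sumop \<rho> (g \<otimes> h) (ev b) = sumop \<rho> g (sumop \<rho> h (ev b))"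
      by (simp add: grepD(3)[OF r[OF i] g h] vecs_single u)
  qed
qed (simp_all add: sumop_lin)

lemma scalar_action_transfer:
  fixes V :: "('a \<Rightarrow>\<^sub>0 'k::field, 'v) module" and B :: "'u set"
  assumes m: "miso gA V (cmod B \<rho>)" and r: "grep G B \<rho>" and g: "g \<in> carrier G"
    and act: "\<And>v. v \<in> carrier V \<Longrightarrow> ev g \<odot>\<^bsub>V\<^esub> v = scale c \<one>\<^bsub>gA\<^esub> \<odot>\<^bsub>V\<^esub> v" and f: "f \<in> vecs B"
  shows "\<rho> g f = scale c f"
proof -
  obtain \<phi> where h: "\<phi> \<in> module_hom gA V (cmod B \<rho>)" and bij: "bij_betw \<phi> (carrier V) (vecs B)"
    using misoE[OF m] by auto
  then have "f \<in> \<phi> ` carrier V" using f by (simp add: bij_betw_def)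
  then obtain v where v: "v \<in> carrier V" "\<phi> v = f" by blast
  have "\<rho> g f = \<phi> (ev g \<odot>\<^bsub>V\<^esub> v)"
    using module_homD(3)[OF h gA_closed[OF g] v(1), of 1] v(2) by simp
  also have "\<dots> = scale c (\<rho> \<one> f)"
    unfolding act[OF v(1)] using module_homD(3)[OF h gA_closed[OF one_closed] v(1), of c] v(2)
    by (simp add: group_algebra_simps del: single_one)
  finally show ?thesis by (simp add: grepD(4)[OF r f])
qed

end

context graded_setting
begin

abbreviation twist :: "nat \<Rightarrow> ('a \<Rightarrow> ('u \<Rightarrow>\<^sub>0 'k) \<Rightarrow> ('u \<Rightarrow>\<^sub>0 'k)) \<Rightarrow> 'a \<Rightarrow> ('u \<Rightarrow>\<^sub>0 'k) \<Rightarrow> ('u \<Rightarrow>\<^sub>0 'k)"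
  where "twist m \<rho> \<equiv> \<lambda>g f. scale (\<chi> g ^ m) (\<rho> g f)"

lemma grep_twist:
  fixes B :: "'u set"
  assumes "grep G B \<rho>" shows "grep G B (twist m \<rho>)"
proof -
  note r = grepD[OF assms]
  show ?thesis
    unfolding grep_def
    by (auto intro!: lin_scaleI vecs_scale r simp: \<chi>_one r lin_scale[OF r(1)] \<chi>_mult power_mult_distrib)
qed

lemma char_module_miso: "miso kG (char_module \<chi>) (cmod {()} (\<lambda>g f. scale (\<chi> g) f))"
  and grep_char: "grep G {()} (\<lambda>g f. scale (\<chi> g) f)"
proof -
  let ?M = "cmod {()} (\<lambda>g f. scale (\<chi> g) f) :: ('a \<Rightarrow>\<^sub>0 'k, unit \<Rightarrow>\<^sub>0 'k) module"
  show g: "grep G {()} (\<lambda>g f. scale (\<chi> g) f)"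
    unfolding grep_def by (auto intro!: linI vecs_scale simp: \<chi>_one \<chi>_mult scale_add_right mult.commute)
  have N: "left_module kG ?M" by (rule grep_left_module[OF g])
  let ?\<phi> = "\<lambda>v :: 'k. Poly_Mapping.single () v"
  have hom: "?\<phi> \<in> module_hom kG (char_module \<chi>) ?M"
  proof (rule module_homI)
    fix r :: "'a \<Rightarrow>\<^sub>0 'k" and v :: 'k
    show "?\<phi> (r \<odot>\<^bsub>char_module \<chi>\<^esub> v) = r \<odot>\<^bsub>?M\<^esub> ?\<phi> v"
      by (intro poly_mapping_eqI) (simp add: char_module_def lin_ext_def sum_distrib_right mult.assoc lookup_sum)
  qed (auto simp: char_module_def vecs_single single_add)
  have bij: "bij_betw ?\<phi> (carrier (char_module \<chi>)) (carrier ?M)"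
    by (rule bij_betw_byWitness[of _ "\<lambda>f. Poly_Mapping.lookup f ()"])
      (auto simp: char_module_def vecs_single intro!: poly_mapping_eqI)
  have "left_module kG (char_module \<chi> :: ('a \<Rightarrow>\<^sub>0 'k, 'k) module)"
    by (rule left_module_pullback[OF N hom bij]) (auto simp: char_module_def)
  then show "miso kG (char_module \<chi>) ?M" by (rule misoI[OF _ N hom bij])
qed

lemma char_module_tensor_miso:
  fixes V :: "('a \<Rightarrow>\<^sub>0 'k, 'v) module" and B :: "'u set"
  assumes V: "miso kG V (cmod B \<rho>)" and r: "grep G B \<rho>"
  shows "miso kG (module_tensor kG group_comult (char_module \<chi>) V) (cmod B (twist 1 \<rho>))"
proof -
  have "miso kG (module_tensor kG group_comult (char_module \<chi>) V)
      (cmod ({()} \<times> B) (\<lambda>g. tens (\<lambda>f. scale (\<chi> g) f) (\<rho> g)))"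
    by (rule group_tensor_miso[OF char_module_miso grep_char V r])
  also have "miso kG \<dots> (cmod B (twist 1 \<rho>))"
  proof (rule cmod_reindex[where h = snd])
    show "carrier kG = vecs (carrier G)" by (simp add: group_algebra_simps)
    show "left_module kG (cmod ({()} \<times> B) (\<lambda>g. tens (scale (\<chi> g)) (\<rho> g)))"
      by (intro grep_left_module grep_tens grep_char r)
    show "left_module kG (cmod B (twist 1 \<rho>))" by (intro grep_left_module grep_twist r)
    show "bij_betw snd ({()} \<times> B) B" by (rule bij_betwI[of _ _ _ "\<lambda>b. ((), b)"]) auto
    show "lin (twist 1 \<rho> g)" if "g \<in> carrier G" for g by (intro lin_scaleI grepD(1)[OF r that])
    fix g b assume "g \<in> carrier G" "b \<in> {()} \<times> B"
    then obtain b' where [simp]: "b = ((), b')" by auto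
    have "lin_ext (\<lambda>b. ev (snd b)) (elem_tensor (ev ()) v) = v" for v :: "'u \<Rightarrow>\<^sub>0 'k"
      by (rule lin_eqI[of v UNIV, OF _ lin_comp(2)[OF lin_lin_ext elem_tensor_lin(1)] lin_id(1)]) simp_all
    then show "twist 1 \<rho> g (ev (snd b)) = lin_ext (\<lambda>b. ev (snd b)) (tens (scale (\<chi> g)) (\<rho> g) (ev b))"
      by (simp add: elem_tensor_scale lin_scale[OF lin_lin_ext] del: scale_single)
  qed (rule lin_tens)
  finally show ?thesis .
qed

text \<open>All the modules \<open>V ((\<sigma> ^^ m) l)\<close> are described on the one basis
  \<open>B l\<close>, with the action of \<open>l\<close> multiplied by \<open>\<chi>^m\<close>;
  each application of \<open>\<sigma>\<close> adds one factor \<open>\<chi>\<close>.\<close>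

lemma simple_module_shift:
  fixes V :: "'i \<Rightarrow> ('a \<Rightarrow>\<^sub>0 'k, 'v) module" and B :: "'i \<Rightarrow> 'u set"
  assumes V: "\<And>l. l \<in> I \<Longrightarrow> miso kG (V l) (cmod (B l) (\<rho> l))" and r: "\<And>l. l \<in> I \<Longrightarrow> grep G (B l) (\<rho> l)"
    and \<sigma>: "\<And>l. l \<in> I \<Longrightarrow> \<sigma> l \<in> I"
    and shift: "\<And>l. l \<in> I \<Longrightarrow> module_iso kG (module_tensor kG group_comult (char_module \<chi>) (V l)) (V (\<sigma> l))"
    and l: "l \<in> I"
  shows "(\<sigma> ^^ m) l \<in> I \<and> miso kG (V ((\<sigma> ^^ m) l)) (cmod (B l) (twist m (\<rho> l)))"
proof (induction m)
  case 0
  then show ?case using V[OF l] l by simp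
next
  case (Suc m)
  let ?l = "(\<sigma> ^^ m) l"
  have l': "?l \<in> I" and m: "miso kG (V ?l) (cmod (B l) (twist m (\<rho> l)))" using Suc by auto
  note t = char_module_tensor_miso[OF m grep_twist[OF r[OF l]]]
  have "miso kG (module_tensor kG group_comult (char_module \<chi>) (V ?l)) (V (\<sigma> ?l))"
    using t V[OF \<sigma>[OF l']] shift[OF l'] by (simp add: miso_def)
  then have "miso kG (V (\<sigma> ?l)) (cmod (B l) (twist 1 (twist m (\<rho> l))))"
    by (rule miso_trans[OF miso_sym t])
  then show ?case using \<sigma>[OF l'] by simp
qed

text \<open>Multiplication by \<open>x^m\<close> shifts degrees by \<open>m\<close>; for
  \<open>\<gamma> \<noteq> 0\<close> it is invertible on the block and so absorbs the twist.\<close>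

lemma jordan_twist_miso:
  fixes B :: "'u set"
  assumes r: "grep G B \<rho>" and \<gamma>: "\<gamma> \<noteq> 0"
  shows "miso H (jordan n \<gamma> B (twist m \<rho>)) (jordan n \<gamma> B \<rho>)"
proof -
  let ?S = "{..<n} \<times> {..<s}" and ?Y = "jx {..<n} s \<gamma>"
  note d = gdata_jordan[OF s_pos, of "{..<n}" \<gamma>]
  \<comment> \<open>Scalars cross the tensor sign: twisting the representation by
    \<open>\<chi>^m\<close> is the same as shifting the grading of the block.\<close>
  have "tens (\<lambda>f. scale c (L f)) M = tens L (\<lambda>f. scale c (M f))"
    for c and L :: "(nat \<times> nat \<Rightarrow>\<^sub>0 'k) \<Rightarrow> (nat \<times> nat \<Rightarrow>\<^sub>0 'k)" and M :: "('u \<Rightarrow>\<^sub>0 'k) \<Rightarrow> ('u \<Rightarrow>\<^sub>0 'k)"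
    by (simp add: tens_def elem_tensor_scale)
  then have eq: "gmod ?S ?Y (\<lambda>c f. scale (c ^ m) (jd c f)) B \<rho> = jordan n \<gamma> B (twist m \<rho>)"
    by simp
  have "miso H (gmod ?S ?Y (\<lambda>c f. scale (c ^ m) (jd c f)) B \<rho>) (jordan n \<gamma> B \<rho>)"
  proof (rule gmod_cong[OF gdata_shift[OF d] d r r, where P = "?Y ^^ m" and Q = "\<lambda>f. f"])
    show "lin (?Y ^^ m)" by (intro lin_funpow jx_lin)
    show "bij_betw (?Y ^^ m) (vecs ?S) (vecs ?S)" by (intro bij_betw_funpow jx_bij s_pos \<gamma>)
    show "(?Y ^^ m) (?Y f) = ?Y ((?Y ^^ m) f)" for f by (simp add: funpow_swap1)
    fix c :: 'k and f :: "nat \<times> nat \<Rightarrow>\<^sub>0 'k" assume c: "c ^ s = 1" and f: "f \<in> vecs ?S"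
    have "jd c ((?Y ^^ m) f) = scale (c ^ m) ((?Y ^^ m) (jd c f))"
    proof (induction m)
      case (Suc m)
      then show ?case
        using gdataD(5)[OF d c funpow_vecs[OF gdataD(2)[OF d] f, where n = m]] by (simp add: lin_scale[OF jx_lin])
    qed simp
    then show "(?Y ^^ m) (scale (c ^ m) (jd c f)) = jd c ((?Y ^^ m) f)"
      by (simp add: lin_scale[OF lin_funpow[OF jx_lin]])
  qed (simp_all add: lin_id bij_betw_def)
  then show ?thesis unfolding eq .
qed

end

section \<open>Separating the Jordan blocks from the representations\<close>

text \<open>Exchanges the middle factors, so that the two blocks and the two representations come
  together and the decomposition problems for blocks and for \<open>kG\<close> become
  independent.\<close>

definition shuffle :: "(('i \<times> 'u) \<times> ('j \<times> 'w) \<Rightarrow>\<^sub>0 'k::field) \<Rightarrow> (('i \<times> 'j) \<times> ('u \<times> 'w) \<Rightarrow>\<^sub>0 'k)"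
  where "shuffle = lin_ext (\<lambda>((i, u), (j, w)). ev ((i, j), (u, w)))"

lemma shuffle_lin: "lin shuffle"
  by (simp add: shuffle_def lin_lin_ext)

lemma shuffle_elem_tensor:
  "shuffle (elem_tensor (elem_tensor f u) (elem_tensor g w)) = elem_tensor (elem_tensor f g) (elem_tensor u w)"
  (is "?L f g = ?R f g")
proof -
  have 1: "shuffle (elem_tensor (elem_tensor (ev i) u) (elem_tensor (ev j) w)) =
      elem_tensor (elem_tensor (ev i) (ev j)) (elem_tensor u w)" for i j
    by (rule bilin_eqI[of u UNIV w UNIV])
      (auto simp: shuffle_def intro!: linI simp: elem_tensor_add elem_tensor_scale lin_add[OF lin_lin_ext] lin_scale[OF lin_lin_ext])
  show ?thesis
    by (rule bilin_eqI[of f UNIV g UNIV])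
      (auto intro!: linI simp: 1 elem_tensor_add elem_tensor_scale lin_add[OF shuffle_lin] lin_scale[OF shuffle_lin]
        simp del: elem_tensor_single)
qed

lemma shuffle_tens:
  assumes "lin K" "lin L" "lin M" "lin N" and f: "f \<in> vecs ((S \<times> B) \<times> (S' \<times> B'))"
  shows "shuffle (tens (tens K L) (tens M N) f) = tens (tens K M) (tens L N) (shuffle f)"
proof (rule lin_eqI[OF f lin_comp(2)[OF shuffle_lin lin_tens] lin_comp(2)[OF lin_tens shuffle_lin]])
  fix b assume "b \<in> (S \<times> B) \<times> (S' \<times> B')"
  obtain i u j w where [simp]: "b = ((i, u), (j, w))" by (metis surj_pair)
  show "shuffle (tens (tens K L) (tens M N) (ev b)) = tens (tens K M) (tens L N) (shuffle (ev b))"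
    by (simp add: shuffle_elem_tensor) (simp add: shuffle_def)
qed

context graded_setting
begin

lemma jordan_tensor_miso:
  fixes V :: "('a \<Rightarrow>\<^sub>0 'k, 'v) module" and W :: "('a \<Rightarrow>\<^sub>0 'k, 'w) module"
    and B :: "'u set" and B' :: "'x set"
  assumes V: "miso kG V (cmod B \<rho>)" and r: "grep G B \<rho>"
    and W: "miso kG W (cmod B' \<rho>')" and r': "grep G B' \<rho>'"
    and a: "a \<in> group_center G" and act: "\<And>f. f \<in> vecs B' \<Longrightarrow> \<rho>' a f = scale w f"
  shows "miso H (module_tensor H (ore_comult G (\<lambda>g. inverse (\<chi> g)) a)
      (jordan_module G (\<lambda>g. inverse (\<chi> g)) s p V \<alpha>) (jordan_module G (\<lambda>g. inverse (\<chi> g)) s t W \<beta>))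
    (gmod (({..<p} \<times> {..<s}) \<times> ({..<t} \<times> {..<s})) (qsum w (\<chi> a) (jx {..<p} s \<alpha>) jd (jx {..<t} s \<beta>))
      (\<lambda>c. tens (jd c) (jd c)) (B \<times> B') (\<lambda>g. tens (\<rho> g) (\<rho>' g)))"
    (is "miso H ?T _")
proof -
  let ?S = "({..<p} \<times> {..<s}) \<times> ({..<t} \<times> {..<s})" and ?Y = "qsum w (\<chi> a) (jx {..<p} s \<alpha>) jd (jx {..<t} s \<beta>)"
  let ?D = "\<lambda>c. tens (jd c) (jd c) :: ((nat \<times> nat) \<times> (nat \<times> nat) \<Rightarrow>\<^sub>0 'k) \<Rightarrow> _"
    and ?B = "B \<times> B'" and ?\<rho> = "\<lambda>g. tens (\<rho> g) (\<rho>' g)"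
  let ?S1 = "{..<p} \<times> {..<s}" and ?S2 = "{..<t} \<times> {..<s}" and ?Y1 = "jx {..<p} s \<alpha>" and ?Y2 = "jx {..<t} s \<beta>"
  note d1 = gdata_jordan[OF s_pos, of "{..<p}" \<alpha>] and d2 = gdata_jordan[OF s_pos, of "{..<t}" \<beta>]
  have aG: "a \<in> carrier G" using a by (simp add: group_center_def)
  note h1 = hrep_gmod[OF d1 r] and h2 = hrep_gmod[OF d2 r']
  let ?BI = "(?S1 \<times> B) \<times> (?S2 \<times> B')"
  let ?\<rho>I = "\<lambda>g. tens (gact jd \<rho> g) (gact jd \<rho>' g)" and ?YI = "tvar a (gvar ?Y1) (gact jd \<rho>') (gvar ?Y2)"
  note h0 = hrep_tensor[OF h1 h2 a]
  have dT: "gdata s ?S ?Y ?D" by (rule gdata_tensor[OF d1 d2 \<chi>_pow[OF aG]])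
  have rT: "grep G ?B ?\<rho>" by (rule grep_tens[OF r r'])
  have "miso H ?T (hmod ?BI ?\<rho>I ?YI)"
    by (rule ore_tensor_miso[OF jordan_module_miso(1)[OF V r] h1 jordan_module_miso(1)[OF W r'] h2 a])
  also have "miso H (hmod ?BI ?\<rho>I ?YI) (gmod ?S ?Y ?D ?B ?\<rho>)"
  proof (rule cmod_reindex[where h = "\<lambda>((i, u), (j, w)). ((i, j), (u, w))"])
    show "carrier H = vecs (carrier G \<times> UNIV)" by (simp add: ore_algebra_simps)
    show "left_module H (hmod ?BI ?\<rho>I ?YI)" by (rule hrep_left_module[OF h0])
    show "left_module H (gmod ?S ?Y ?D ?B ?\<rho>)" by (rule gmod_left_module[OF dT rT])
    show "bij_betw (\<lambda>((i, u), (j, w)). ((i, j), (u, w))) ?BI (?S \<times> ?B)"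
      by (rule bij_betwI[of _ _ _ "\<lambda>((i, j), (u, w)). ((i, u), (j, w))"]) auto
    show "lin (hop ?\<rho>I ?YI b)" "lin (hop (gact ?D ?\<rho>) (gvar ?Y) b)" if "b \<in> carrier G \<times> UNIV" for b
      using hop_facts(1)[OF h0 that] hop_facts(1)[OF hrep_gmod[OF dT rT] that] by simp_all
    fix b :: "'a \<times> nat" and c assume b: "b \<in> carrier G \<times> UNIV" and c: "c \<in> ?BI"
    obtain g n where [simp]: "b = (g, n)" and g: "g \<in> carrier G" using b by auto
    obtain i u j w' where [simp]: "c = ((i, u), (j, w'))" and w': "w' \<in> B'" using c by auto
    have Y: "shuffle (?YI f) = gvar ?Y (shuffle f)" if f: "f \<in> vecs ?BI" for f
    proof -
      \<comment> \<open>On the second module \<open>a\<close> acts by \<open>\<chi>(a)^r\<close> in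
        degree \<open>r\<close> and by the scalar \<open>w\<close> on the representation; moving
        \<open>w\<close> to the block leaves the identity on the representation.\<close>
      have 1: "tens (gvar ?Y1) (gact jd \<rho>' a) f = tens (gvar ?Y1) (tens (\<lambda>f. scale w (jd (\<chi> a) f)) (\<lambda>x. x)) f"
      proof (rule tens_cong[OF f])
        fix b assume "b \<in> ?S2 \<times> B'"
        then obtain j v where [simp]: "b = (j, v)" and "v \<in> B'" by auto
        then show "gact jd \<rho>' a (ev b) = tens (\<lambda>f. scale w (jd (\<chi> a) f)) (\<lambda>x. x) (ev b)"
          by (simp add: act vecs_single elem_tensor_scale del: scale_single)
      qed simp
      have 2: "tens (\<lambda>x. x) (gvar ?Y2) f = tens (tens (\<lambda>x. x) (\<lambda>x. x)) (gvar ?Y2) f"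
        by (simp add: tens_id[abs_def])
      have 3: "tens (tens K M) (tens (\<lambda>x. x) (\<lambda>x. x)) e = tens (tens K M) (\<lambda>x. x) e"
        for K M and e :: "((nat \<times> nat) \<times> (nat \<times> nat)) \<times> ('u \<times> 'x) \<Rightarrow>\<^sub>0 'k"
        by (simp add: tens_id[abs_def])
      have 4: "gvar ?Y e = tens (tens ?Y1 (\<lambda>f. scale w (jd (\<chi> a) f))) (\<lambda>x. x) e + tens (tens (\<lambda>x. x) ?Y2) (\<lambda>x. x) e"
        for e :: "((nat \<times> nat) \<times> (nat \<times> nat)) \<times> ('u \<times> 'x) \<Rightarrow>\<^sub>0 'k"
        by (rule lin_eqI[of e UNIV, OF _ lin_tens lin_plus[OF lin_tens lin_tens]])
          (auto simp: qsum_def elem_tensor_add)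
      show ?thesis
        unfolding tvar_def 1 2 4 lin_add[OF shuffle_lin]
        by (simp add: shuffle_tens[OF _ _ _ _ f] jx_lin jd_lin lin_scaleI lin_id 3)
    qed
    have \<rho>: "shuffle (?\<rho>I g f) = gact ?D ?\<rho> g (shuffle f)" if f: "f \<in> vecs ?BI" for f
      by (rule shuffle_tens[OF jd_lin grepD(1)[OF r g] jd_lin grepD(1)[OF r' g] f])
    have "shuffle (hop ?\<rho>I ?YI (g, n) (ev c)) = hop (gact ?D ?\<rho>) (gvar ?Y) (g, n) (shuffle (ev c))"
      by (rule hop_intertwine[where B = ?BI, OF _ _ _ vecs_single[OF c]]) (simp_all add: hrepD(3)[OF h0] Y \<rho>)
    then show "hop (gact ?D ?\<rho>) (gvar ?Y) b (ev ((\<lambda>((i, u), (j, w)). ((i, j), (u, w))) c)) =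
        lin_ext (\<lambda>b. ev ((\<lambda>((i, u), (j, w)). ((i, j), (u, w))) b)) (hop ?\<rho>I ?YI b (ev c))"
      by (simp add: shuffle_def case_prod_unfold)
  qed
  finally show ?thesis .
qed

end

section \<open>From lists of summands to multiplicities\<close>

lemma suml_pow:
  assumes "\<And>i. lin (L i)"
  shows "(suml L ^^ n) (elem_tensor (ev i) f) = elem_tensor (ev i) ((L i ^^ n) f)"
  by (induction n) (simp_all add: suml_elem_tensor assms)

text \<open>A list of \<open>n\<close> simple summands with labels \<open>lc\<close> is renumbered
  by pairs of a label and a position among the \<open>N l\<close> copies carrying it.\<close>

lemma fibre_bij:
  assumes lc: "\<And>c. c < n \<Longrightarrow> lc c \<in> I" and N: "\<And>l. l \<in> I \<Longrightarrow> N l = card {c. c < n \<and> lc c = l}"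
  obtains \<iota> :: "nat \<Rightarrow> nat" where "bij_betw (\<lambda>c. (lc c, \<iota> c)) {..<n} (Sigma I (\<lambda>l. {..<N l}))"
proof -
  have "\<exists>h. bij_betw h {c. c < n \<and> lc c = l} {..<N l}" if "l \<in> I" for l
    by (rule finite_same_card_bij) (auto simp: N[OF that])
  then obtain h where h: "\<And>l. l \<in> I \<Longrightarrow> bij_betw (h l) {c. c < n \<and> lc c = l} {..<N l}" by metis
  have "bij_betw (\<lambda>c. (lc c, h (lc c) c)) {..<n} (Sigma I (\<lambda>l. {..<N l}))"
  proof (rule bij_betw_imageI)
    show "inj_on (\<lambda>c. (lc c, h (lc c) c)) {..<n}"
    proof (rule inj_onI)
      fix c d assume "c \<in> {..<n}" "d \<in> {..<n}" "(lc c, h (lc c) c) = (lc d, h (lc d) d)"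
      then show "c = d" using h[OF lc, of c] by (auto simp: bij_betw_def dest: inj_onD)
    qed
    show "(\<lambda>c. (lc c, h (lc c) c)) ` {..<n} = Sigma I (\<lambda>l. {..<N l})"
    proof (intro equalityI subsetI)
      fix x assume "x \<in> (\<lambda>c. (lc c, h (lc c) c)) ` {..<n}"
      then obtain c where c: "c < n" and x: "x = (lc c, h (lc c) c)" by auto
      have "h (lc c) c \<in> {..<N (lc c)}" by (rule bij_betwE[OF h[OF lc[OF c]], rule_format]) (simp add: c)
      then show "x \<in> Sigma I (\<lambda>l. {..<N l})" using lc[OF c] x by simp
    next
      fix x assume "x \<in> Sigma I (\<lambda>l. {..<N l})"
      then obtain l e where x: "x = (l, e)" and l: "l \<in> I" and "e \<in> {..<N l}" by auto
      then have "e \<in> h l ` {c. c < n \<and> lc c = l}" using h[OF l] by (simp add: bij_betw_def)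
      then obtain c where "c < n" "lc c = l" "h l c = e" by auto
      then show "x \<in> (\<lambda>c. (lc c, h (lc c) c)) ` {..<n}" unfolding x by (intro image_eqI[of _ _ c]) auto
    qed
  qed
  then show ?thesis by (rule that)
qed

context graded_setting
begin

text \<open>Both sides have the same basis up to the order of its indices. On the left the shift by
  \<open>m\<close> belongs to the grading of the block, on the right it is a twist of the
  representation; a scalar \<open>\<chi>(g)^m\<close> moved across the tensor sign accounts for the
  difference.\<close>

lemma jordan_sum_miso:
  fixes n :: nat and lc :: "nat \<Rightarrow> 'i" and B :: "'i \<Rightarrow> 'u set" and M :: "'i \<Rightarrow> nat \<Rightarrow> nat \<Rightarrow> ('a \<times> nat \<Rightarrow>\<^sub>0 'k, 'z) module"
  assumes lc: "\<And>c. c < n \<Longrightarrow> lc c \<in> I" and N: "\<And>l. l \<in> I \<Longrightarrow> N l = card {c. c < n \<and> lc c = l}"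
    and r: "\<And>l. l \<in> I \<Longrightarrow> grep G (B l) (\<rho> l)"
    and M: "\<And>l m u. l \<in> I \<Longrightarrow> m < s \<Longrightarrow> u \<in> K \<Longrightarrow> miso H (M l m u) (jordan (nb u) \<gamma> (B l) (twist m (\<rho> l)))"
  shows "miso H
    (gmod (Sigma {..<s} (\<lambda>m. Sigma K (\<lambda>u. {..<nb u} \<times> {..<s})))
      (suml (\<lambda>m. suml (\<lambda>u. jx {..<nb u} s \<gamma>)))
      (\<lambda>c. suml (\<lambda>m f. scale (c ^ m) (suml (\<lambda>u. jd c) f)))
      (Sigma {..<n} (\<lambda>c. B (lc c))) (sumop (\<lambda>c. \<rho> (lc c))))
    (direct_sum I (\<lambda>l. direct_sum {..<s} (\<lambda>m. direct_sum K (\<lambda>u. copies (N l) (M l m u)))))"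
    (is "miso H (gmod ?S ?Y ?D ?B ?\<rho>) ?R")
proof -
  let ?\<tau> = "\<lambda>g. inverse (\<chi> g)"
  let ?op = "\<lambda>l m u. hop (gact jd (twist m (\<rho> l))) (gvar (jx {..<nb u} s \<gamma>))"
  let ?C = "\<lambda>l u. ({..<nb u} \<times> {..<s}) \<times> B l"
  let ?Bas = "carrier G \<times> (UNIV :: nat set)"
  have H: "carrier H = vecs ?Bas" by (simp add: ore_algebra_simps)
  have h: "hrep G ?\<tau> (?C l u) (gact jd (twist m (\<rho> l))) (gvar (jx {..<nb u} s \<gamma>))" if "l \<in> I" for l m u
    by (intro hrep_gmod gdata_jordan s_pos grep_twist r that)
  have lin: "lin (?op l m u b)" if "l \<in> I" "b \<in> ?Bas" for l m u b
    using hop_facts(1)[OF h[OF that(1)] that(2)] .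
  have cl: "?op l m u b f \<in> vecs (?C l u)" if "l \<in> I" "b \<in> ?Bas" "f \<in> vecs (?C l u)" for l m u b f
    using hop_facts(2)[OF h[OF that(1)] that(2,3)] .
  define op1 where "op1 l m u = sumop (\<lambda>_ :: nat. ?op l m u)" for l m u
  define op2 where "op2 l m = sumop (\<lambda>u. op1 l m u)" for l m
  define op3 where "op3 l = sumop (\<lambda>m. op2 l m)" for l
  define C1 where "C1 l u = {..<N l} \<times> ?C l u" for l u
  define C2 where "C2 l = Sigma K (C1 l)" for l
  define C3 where "C3 l = {..<s} \<times> C2 l" for l
  have cl1: "op1 l m u b f \<in> vecs (C1 l u)" if "l \<in> I" "b \<in> ?Bas" "f \<in> vecs (C1 l u)" for l m u b f
    using that unfolding op1_def C1_def by (intro sumop_in_vecs) (simp_all add: cl)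
  have cl2: "op2 l m b f \<in> vecs (C2 l)" if "l \<in> I" "b \<in> ?Bas" "f \<in> vecs (C2 l)" for l m b f
    using that unfolding op2_def C2_def by (intro sumop_in_vecs cl1)
  have cl3: "op3 l b f \<in> vecs (C3 l)" if "l \<in> I" "b \<in> ?Bas" "f \<in> vecs (C3 l)" for l b f
    using that unfolding op3_def C3_def by (intro sumop_in_vecs cl2)
  have R1: "miso H (copies (N l) (M l m u)) (cmod (C1 l u) (op1 l m u))" if "l \<in> I" "m < s" "u \<in> K" for l m u
    unfolding copies_def C1_def op1_def
    by (rule direct_sum_miso[OF ring_H H M[OF that]]) (use lin cl that(1) in blast)+
  have R2: "miso H (direct_sum K (\<lambda>u. copies (N l) (M l m u))) (cmod (C2 l) (op2 l m))" if "l \<in> I" "m < s" for l m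
    unfolding C2_def op2_def
    by (rule direct_sum_miso[OF ring_H H R1[OF that]]) (use cl1 that(1) in \<open>simp_all add: op1_def sumop_lin\<close>)
  have R3: "miso H (direct_sum {..<s} (\<lambda>m. direct_sum K (\<lambda>u. copies (N l) (M l m u)))) (cmod (C3 l) (op3 l))" if "l \<in> I" for l
    unfolding C3_def op3_def
    by (rule direct_sum_miso[OF ring_H H]) (use R2 cl2 that in \<open>simp_all add: op2_def sumop_lin\<close>)
  have R4: "miso H ?R (cmod (Sigma I C3) (sumop op3))"
    by (rule direct_sum_miso[OF ring_H H]) (use R3 cl3 in \<open>simp_all add: op3_def sumop_lin\<close>)
  have d: "gdata s ?S ?Y ?D" by (intro gdata_sum gdata_shift gdata_jordan s_pos)
  have rB: "grep G ?B ?\<rho>" by (intro grep_sumop r lc) simp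
  obtain \<iota> where \<iota>: "bij_betw (\<lambda>c. (lc c, \<iota> c)) {..<n} (Sigma I (\<lambda>l. {..<N l}))" using fibre_bij[OF lc N] by blast
  \<comment> \<open>The position \<open>c\<close> in the list of simple summands is replaced by its
    label and copy number, and the label becomes the outermost index.\<close>
  let ?h = "\<lambda>((m, (u, y)), (c, b)). (lc c, (m, (u, (\<iota> c, (y, b)))))"
  have bij: "bij_betw ?h (?S \<times> ?B) (Sigma I C3)"
  proof (rule bij_betw_imageI)
    show "inj_on ?h (?S \<times> ?B)"
      using bij_betw_imp_inj_on[OF \<iota>] by (auto simp: inj_on_def)
    show "?h ` (?S \<times> ?B) = Sigma I C3"
    proof (intro equalityI subsetI)
      fix x assume "x \<in> ?h ` (?S \<times> ?B)"
      then obtain m u y c b where x: "x = (lc c, (m, (u, (\<iota> c, (y, b)))))" and c: "c < n"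
        and m: "m < s" "u \<in> K" "y \<in> {..<nb u} \<times> {..<s}" "b \<in> B (lc c)" by auto
      have "(lc c, \<iota> c) \<in> Sigma I (\<lambda>l. {..<N l})" using \<iota> c by (auto simp: bij_betw_def)
      then show "x \<in> Sigma I C3" using m by (simp add: x C3_def C2_def C1_def)
    next
      fix x assume "x \<in> Sigma I C3"
      then obtain l m u e y b where x: "x = (l, (m, (u, (e, (y, b)))))" and m: "m < s" "u \<in> K" "y \<in> {..<nb u} \<times> {..<s}" "b \<in> B l"
        and "l \<in> I" "e < N l" by (auto simp: C3_def C2_def C1_def)
      then have "(l, e) \<in> (\<lambda>c. (lc c, \<iota> c)) ` {..<n}" using \<iota> by (simp add: bij_betw_def)
      then obtain c where "c < n" "l = lc c" "e = \<iota> c" by auto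
      then show "x \<in> ?h ` (?S \<times> ?B)"
        using m by (intro image_eqI[of _ _ "((m, (u, y)), (c, b))"]) (auto simp: x)
    qed
  qed
  have "miso H (gmod ?S ?Y ?D ?B ?\<rho>) (cmod (Sigma I C3) (sumop op3))"
  proof (rule cmod_reindex[OF H _ _ bij])
    show "left_module H (gmod ?S ?Y ?D ?B ?\<rho>)" by (rule gmod_left_module[OF d rB])
    show "left_module H (cmod (Sigma I C3) (sumop op3))" using R4 by (simp add: miso_def)
    show "lin (hop (gact ?D ?\<rho>) (gvar ?Y) b)" if "b \<in> ?Bas" for b
      using hop_facts(1)[OF hrep_gmod[OF d rB] that] .
    fix b x assume b: "b \<in> ?Bas" and x: "x \<in> ?S \<times> ?B"
    obtain g k where [simp]: "b = (g, k)" and g: "g \<in> carrier G" using b by auto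
    obtain m u y c b' where [simp]: "x = ((m, (u, y)), (c, b'))" and c: "c < n" using x by auto
    note lr = grepD(1)[OF r[OF lc[OF c]] g]
    let ?v = "jd (\<chi> g) ((jx {..<nb u} s \<gamma> ^^ k) (ev y))" and ?w = "\<rho> (lc c) g (ev b')"
    let ?P = "lin_ext (\<lambda>z. ev (?h z))"
    have P: "?P (elem_tensor (elem_tensor (ev m) (elem_tensor (ev u) v)) (elem_tensor (ev c) w)) =
        elem_tensor (ev (lc c)) (elem_tensor (ev m) (elem_tensor (ev u) (elem_tensor (ev (\<iota> c)) (elem_tensor v w))))"
      for v and w :: "'u \<Rightarrow>\<^sub>0 'k"
      by (rule bilin_eqI[of v UNIV w UNIV])
        (auto intro!: linI simp: elem_tensor_add elem_tensor_scale lin_add[OF lin_lin_ext] lin_scale[OF lin_lin_ext])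
    have e3: "ev (m, (u, y)) = (elem_tensor (ev m) (elem_tensor (ev u) (ev y)) :: _ \<Rightarrow>\<^sub>0 'k)"
      and e1: "ev (y, b') = (elem_tensor (ev y) (ev b') :: _ \<Rightarrow>\<^sub>0 'k)"
      and e0: "ev x = (elem_tensor (ev (m, (u, y))) (ev (c, b')) :: _ \<Rightarrow>\<^sub>0 'k)" by simp_all
    have Yk: "(?Y ^^ k) (ev (m, (u, y))) = elem_tensor (ev m) (elem_tensor (ev u) ((jx {..<nb u} s \<gamma> ^^ k) (ev y)))"
      unfolding e3 by (simp add: suml_pow suml_lin jx_lin del: elem_tensor_single)
    \<comment> \<open>The factor \<open>\<chi> g ^ m\<close> comes out of the shifted grading and
      reappears on the other side in \<open>twist m\<close>.\<close>
    have Dg: "?D (\<chi> g) (elem_tensor (ev m) (elem_tensor (ev u) v)) = scale (\<chi> g ^ m) (elem_tensor (ev m) (elem_tensor (ev u) (jd (\<chi> g) v)))" for v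
      by (simp add: suml_elem_tensor suml_lin jd_lin lin_scaleI elem_tensor_scale)
    have "hop (gact ?D ?\<rho>) (gvar ?Y) b (ev x) = tens (?D (\<chi> g)) (?\<rho> g) (elem_tensor ((?Y ^^ k) (ev (m, (u, y)))) (ev (c, b')))"
      unfolding e0 by (simp add: hop_pair gvar_pow suml_lin del: elem_tensor_single)
    also have "\<dots> = elem_tensor (?D (\<chi> g) ((?Y ^^ k) (ev (m, (u, y))))) (?\<rho> g (ev (c, b')))"
      by (rule tens_elem_tensor[OF suml_lin sumop_lin])
    also have "\<dots> = scale (\<chi> g ^ m) (elem_tensor (elem_tensor (ev m) (elem_tensor (ev u) ?v)) (elem_tensor (ev c) ?w))"
      unfolding Yk Dg by (simp add: elem_tensor_scale)
    finally have 1: "?P (hop (gact ?D ?\<rho>) (gvar ?Y) b (ev x)) = scale (\<chi> g ^ m) (elem_tensor (ev (lc c)) (elem_tensor (ev m)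
        (elem_tensor (ev u) (elem_tensor (ev (\<iota> c)) (elem_tensor ?v ?w)))))"
      by (simp add: lin_scale[OF lin_lin_ext] P)
    have "?op (lc c) m u b (ev (y, b')) = scale (\<chi> g ^ m) (elem_tensor ?v ?w)"
      unfolding e1 by (simp add: hop_pair gvar_pow jx_lin tens_elem_tensor[OF jd_lin lin_scaleI[OF lr]] elem_tensor_scale
          del: elem_tensor_single)
    then show "sumop op3 b (ev (?h x)) = ?P (hop (gact ?D ?\<rho>) (gvar ?Y) b (ev x))"
      unfolding 1 by (simp add: op3_def op2_def op1_def elem_tensor_scale)
  qed (rule sumop_lin)
  also have "miso H \<dots> ?R" by (rule miso_sym[OF R4])
  finally show ?thesis .
qed

end

section \<open>Characters and the assembly of the decomposition\<close>

lemma units_group_group: "group (units_group :: 'k::field monoid)"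
proof (rule groupI)
  show "\<exists>y\<in>carrier units_group. y \<otimes>\<^bsub>units_group\<^esub> x = \<one>\<^bsub>units_group\<^esub>" if "x \<in> carrier units_group" for x :: 'k
    using that by (intro bexI[of _ "inverse x"]) (auto simp: units_group_def)
qed (auto simp: units_group_def mult.assoc)

lemma units_group_pow: "x [^]\<^bsub>units_group\<^esub> (n :: nat) = (x :: 'k::field) ^ n"
  by (induction n) (simp_all add: units_group_def Group.nat_pow_Suc nat_pow_0 mult.commute)

lemma character_facts:
  assumes "group G" and \<chi>: "\<chi> \<in> carrier (dual_group G)"
  shows "g \<in> carrier G \<Longrightarrow> h \<in> carrier G \<Longrightarrow> \<chi> (g \<otimes>\<^bsub>G\<^esub> h) = \<chi> g * \<chi> h" "g \<in> carrier G \<Longrightarrow> \<chi> g \<noteq> 0"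
    "\<chi> \<one>\<^bsub>G\<^esub> = 1" "\<chi> \<in> extensional (carrier G)"
proof -
  interpret group G by fact
  have h: "\<chi> \<in> hom G units_group" and e: "\<chi> \<in> extensional (carrier G)"
    using \<chi> by (auto simp: dual_group_def)
  show "\<chi> \<in> extensional (carrier G)" by (rule e)
  show m: "\<chi> (g \<otimes>\<^bsub>G\<^esub> h) = \<chi> g * \<chi> h" if "g \<in> carrier G" "h \<in> carrier G" for g h
    using hom_mult[OF h that] by (simp add: units_group_def)
  show nz: "\<chi> g \<noteq> 0" if "g \<in> carrier G" for g
    using hom_in_carrier[OF h that] by (simp add: units_group_def)
  show "\<chi> \<one>\<^bsub>G\<^esub> = 1" using m[OF one_closed one_closed] nz[OF one_closed] by simp
qed

lemma dual_group_group:
  assumes "group G" shows "group (dual_group G :: ('g \<Rightarrow> 'k::field) monoid)"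
proof -
  interpret group G by fact
  show ?thesis
  proof (rule groupI)
    fix x :: "'g \<Rightarrow> 'k" assume x: "x \<in> carrier (dual_group G)"
    note f = character_facts[OF assms x]
    show "\<one>\<^bsub>dual_group G\<^esub> \<otimes>\<^bsub>dual_group G\<^esub> x = x"
      using f(4) by (auto simp: dual_group_def extensional_def)
    show "\<exists>y\<in>carrier (dual_group G). y \<otimes>\<^bsub>dual_group G\<^esub> x = \<one>\<^bsub>dual_group G\<^esub>"
      by (rule bexI[of _ "\<lambda>g\<in>carrier G. inverse (x g)"])
        (auto simp: dual_group_def hom_def units_group_def f intro!: restrict_ext)
  next
    fix x y :: "'g \<Rightarrow> 'k" assume x: "x \<in> carrier (dual_group G)" and y: "y \<in> carrier (dual_group G)"
    show "x \<otimes>\<^bsub>dual_group G\<^esub> y \<in> carrier (dual_group G)"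
      using character_facts[OF assms x] character_facts[OF assms y]
      by (auto simp: dual_group_def hom_def units_group_def)
  qed (auto simp: dual_group_def hom_def units_group_def mult.assoc intro!: restrict_ext)
qed

lemma dual_group_pow:
  assumes "group G" "g \<in> carrier G"
  shows "(\<chi> [^]\<^bsub>dual_group G\<^esub> (n :: nat)) g = (\<chi> g :: 'k::field) ^ n"
  by (induction n) (use assms in \<open>simp_all add: dual_group_def Group.nat_pow_Suc nat_pow_0 mult.commute\<close>)

theorem proposition5p4:
  fixes G :: "'g monoid"
    and a :: 'g
    and \<chi> :: "'g \<Rightarrow> 'k :: {alg_closed_field, field_char_0}"
    and s :: nat
    and I :: "'i set"
    and V :: "'i \<Rightarrow> ('g \<Rightarrow>\<^sub>0 'k, 'v) module"
    and \<sigma> :: "'i \<Rightarrow> 'i"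
    and \<omega> :: "'i \<Rightarrow> 'k"
    and p t :: nat
    and i j :: 'i
    and \<alpha> \<beta> :: 'k
  defines "\<tau> \<equiv> \<lambda>g. inverse (\<chi> g)"
  defines "kG \<equiv> (group_algebra G :: ('g \<Rightarrow>\<^sub>0 'k) ring)"
  defines "H \<equiv> ore_algebra G \<tau>"
  defines "N \<equiv> \<lambda>i j l. simple_multiplicity kG (V l) (module_tensor kG group_comult (V i) (V j))"
  defines "Vt \<equiv> \<lambda>n l \<gamma>. jordan_module G \<tau> s n (V l) \<gamma>"
  assumes "group G" and "finite (carrier G)"
    and "a \<in> group_center G"
    and "\<chi> \<in> carrier (dual_group G)"
    and "\<chi> a \<noteq> 1"
    and "group.ord units_group (\<chi> a) = s"
    and "group.ord (dual_group G) \<chi> = s"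
    and "simple_representatives kG I V"
    and "bij_betw \<sigma> I I"
    and "\<And>l. l \<in> I \<Longrightarrow> module_iso kG (module_tensor kG group_comult (char_module \<chi>) (V l)) (V (\<sigma> l))"
    and "\<And>l. l \<in> I \<Longrightarrow> \<omega> l \<noteq> 0"
    and "\<And>l v. l \<in> I \<Longrightarrow> v \<in> carrier (V l) \<Longrightarrow>
           Poly_Mapping.single a 1 \<odot>\<^bsub>V l\<^esub> v = scale (\<omega> l) \<one>\<^bsub>kG\<^esub> \<odot>\<^bsub>V l\<^esub> v"
    and "p > 0" and "t > 0"
    and "i \<in> I" and "j \<in> I"
    and "\<alpha> \<noteq> 0" and "\<beta> \<noteq> 0"
  shows "module_iso H
           (module_tensor H (ore_comult G \<tau> a) (Vt p i \<alpha>) (Vt t j \<beta>))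
           (direct_sum I (\<lambda>l. direct_sum {0..s - 1} (\<lambda>m. direct_sum {1..min p t} (\<lambda>u.
              copies (N i j l)
                (Vt (2 * u - 1 + nat \<bar>int p - int t\<bar>) ((\<sigma> ^^ m) l) (\<omega> j ^ s * \<alpha> + \<beta>))))))
         \<and> (\<forall>l\<in>I. \<forall>m\<in>{0..s - 1}. \<forall>u\<in>{1..min p t}.
              (\<omega> j ^ s * \<alpha> + \<beta> = 0 \<longrightarrow>
                module_iso H
                  (Vt (2 * u - 1 + nat \<bar>int p - int t\<bar>) ((\<sigma> ^^ m) l) (\<omega> j ^ s * \<alpha> + \<beta>))
                  (nil_module G \<tau> (s * (2 * u - 1 + nat \<bar>int p - int t\<bar>)) (V ((\<sigma> ^^ m) l))))
            \<and> (\<omega> j ^ s * \<alpha> + \<beta> \<noteq> 0 \<longrightarrow>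
                module_iso H
                  (Vt (2 * u - 1 + nat \<bar>int p - int t\<bar>) ((\<sigma> ^^ m) l) (\<omega> j ^ s * \<alpha> + \<beta>))
                  (Vt (2 * u - 1 + nat \<bar>int p - int t\<bar>) l (\<omega> j ^ s * \<alpha> + \<beta>))))"
proof -
  interpret GG: group G by fact
  interpret U: group "units_group :: 'k monoid" by (rule units_group_group)
  interpret D: group "dual_group G :: ('g \<Rightarrow> 'k) monoid" by (rule dual_group_group) fact
  note \<chi> = character_facts[OF \<open>group G\<close> \<open>\<chi> \<in> carrier (dual_group G)\<close>]
  have aG: "a \<in> carrier G" using assms(8) by (simp add: group_center_def)
  \<comment> \<open>The two orders do different work: that of \<open>\<chi>\<close> makes degrees
    matter only modulo \<open>s\<close>, and that of \<open>\<chi> a\<close> makes \<open>q\<close>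
    a primitive \<open>s\<close>-th root of unity, as the \<open>q\<close>-binomial theorem
    demands.\<close>
  have \<chi>_pow: "\<chi> g ^ s = 1" if "g \<in> carrier G" for g
    using D.pow_ord_eq_1[OF assms(9)] that
    by (simp add: dual_group_pow[OF \<open>group G\<close> that, symmetric] assms(12)) (simp add: dual_group_def that)
  have aU: "\<chi> a \<in> carrier (units_group :: 'k monoid)" using \<chi>(2)[OF aG] by (simp add: units_group_def)
  have q: "\<chi> a ^ n = 1 \<longleftrightarrow> s dvd n" for n
    using U.pow_eq_id[OF aU, of n] by (simp add: units_group_pow assms(11)) (simp add: units_group_def)
  have "\<chi> (a [^]\<^bsub>G\<^esub> n) = \<chi> a ^ n" for n :: nat
    by (induction n) (simp_all add: \<chi> aG Group.nat_pow_Suc nat_pow_0 mult.commute)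
  then have "\<chi> a ^ Coset.order G = 1"
    using GG.pow_order_eq_1[OF aG] by (metis \<chi>(3))
  \<comment> \<open>The order 0 would mean infinite order; since \<open>\<chi> a\<close> to the
    power of the group order is 1, \<open>s\<close> divides a positive number.\<close>
  then have s: "s > 0" using GG.order_gt_0_iff_finite assms(7) q by (auto intro!: Nat.gr0I)
  interpret S: graded_setting G \<chi> s
    by unfold_locales (simp_all add: \<chi> \<chi>_pow s)
  have w: "\<omega> j \<noteq> 0" using assms by blast
  interpret J: jordan_tensor p t s "\<omega> j" "\<chi> a" \<alpha> \<beta>
    by unfold_locales (use w s q in \<open>auto dest: dvd_imp_le\<close>)
  have simple: "simple_module S.kG (V l)" if "l \<in> I" for l
    using assms(13) that by (simp add: simple_representatives_def kG_def)
  have "\<exists>B \<rho>. B \<subseteq> carrier G \<and> grep G B \<rho> \<and> miso S.kG (V l) (cmod B \<rho>)" if "l \<in> I" for l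
    using GG.simple_module_coordinates[OF assms(7) simple[OF that]] by metis
  then obtain B \<rho> where B: "\<And>l. l \<in> I \<Longrightarrow> B l \<subseteq> carrier G" and r: "\<And>l. l \<in> I \<Longrightarrow> grep G (B l) (\<rho> l)"
    and V: "\<And>l. l \<in> I \<Longrightarrow> miso S.kG (V l) (cmod (B l) (\<rho> l))" by metis
  have \<sigma>: "\<sigma> l \<in> I" if "l \<in> I" for l using assms(14) that by (auto simp: bij_betw_def)
  have shift: "miso S.kG (V ((\<sigma> ^^ m) l)) (cmod (B l) (S.twist m (\<rho> l)))" if "l \<in> I" for l m
    using S.simple_module_shift[where V = V and B = B and \<rho> = \<rho>, OF V r \<sigma> assms(15)[unfolded kG_def] that] by blast
  have J: "miso H (Vt n ((\<sigma> ^^ m) l) \<gamma>) (S.jordan n \<gamma> (B l) (S.twist m (\<rho> l)))" if "l \<in> I" for l m n \<gamma>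
    unfolding H_def Vt_def \<tau>_def by (rule S.jordan_module_miso(1)[OF shift[OF that] S.grep_twist[OF r[OF that]]])
  have act: "\<rho> j a f = scale (\<omega> j) f" if "f \<in> vecs (B j)" for f
    by (rule GG.scalar_action_transfer[OF V[OF assms(21)] r[OF assms(21)] aG assms(17)[unfolded kG_def, OF assms(21)] that])
  let ?B = "B i \<times> B j" and ?\<rho> = "\<lambda>g. tens (\<rho> i g) (\<rho> j g)"
  let ?W = "module_tensor S.kG group_comult (V i) (V j)"
  have rB: "grep G ?B ?\<rho>" by (intro GG.grep_tens r assms(20,21))
  have W: "miso S.kG ?W (cmod ?B ?\<rho>)" by (intro GG.group_tensor_miso V r assms(20,21))
  have finB: "finite ?B" using B[OF assms(20)] B[OF assms(21)] assms(7) by (auto intro: finite_subset)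
  obtain n :: nat and lc where lc: "\<And>c. c < n \<Longrightarrow> lc c \<in> I"
    and mult: "\<And>l. l \<in> I \<Longrightarrow> simple_multiplicity S.kG (V l) ?W = card {c. c < n \<and> lc c = l}"
    and dec: "miso S.kG ?W (direct_sum {..<n} (\<lambda>c. V (lc c)))"
    using GG.multiplicity_decomposition[OF assms(7) finB rB W assms(13)[unfolded kG_def], of thesis] by fast
  have N: "N i j l = card {c. c < n \<and> lc c = l}" if "l \<in> I" for l
    unfolding N_def kG_def by (rule mult[OF that])
  let ?BS = "Sigma {..<n} (\<lambda>c. B (lc c))" and ?\<rho>S = "sumop (\<lambda>c. \<rho> (lc c))"
  have rS: "grep G ?BS ?\<rho>S" by (intro GG.grep_sumop r lc) simp
  have "miso S.kG (direct_sum {..<n} (\<lambda>c. V (lc c))) (cmod ?BS ?\<rho>S)"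
    by (rule direct_sum_miso[OF GG.group_algebra_ring, where Bas = "carrier G"])
      (auto simp: group_algebra_simps intro!: V lc grepD[OF r])
  \<comment> \<open>Two coordinate descriptions of \<open>V i \<otimes> V j\<close>: as a tensor
    product and as the chosen sum of simple modules. An intertwiner between them serves as the
    second map in \<open>gmod_cong\<close>.\<close>
  then have e: "miso S.kG (cmod ?BS ?\<rho>S) (cmod ?B ?\<rho>)"
    using miso_trans[OF miso_sym[OF miso_trans[OF dec]] W] by blast
  obtain Q where Q: "lin Q" "bij_betw Q (vecs ?BS) (vecs ?B)"
    "\<And>g f. g \<in> carrier G \<Longrightarrow> f \<in> vecs ?BS \<Longrightarrow> Q (?\<rho>S g f) = ?\<rho> g (Q f)"
    using GG.miso_intertwiner[OF e rS rB, of thesis] by fast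
  \<comment> \<open>The truncated \<open>s - 1\<close> is harmless because
    \<open>s > 0\<close>.\<close>
  have I: "{0..s - 1} = {..<s}" using s by auto
  let ?\<gamma> = "\<omega> j ^ s * \<alpha> + \<beta>" and ?n = "\<lambda>u. 2 * u - 1 + nat \<bar>int p - int t\<bar>"
  have "miso H (module_tensor H (ore_comult G \<tau> a) (Vt p i \<alpha>) (Vt t j \<beta>)) (S.gmod J.SA J.xA J.DA ?B ?\<rho>)"
    unfolding H_def \<tau>_def Vt_def J.SA_def J.xA_def J.DA_def
    by (rule S.jordan_tensor_miso[OF V[OF assms(20)] r[OF assms(20)] V[OF assms(21)] r[OF assms(21)] assms(8) act])
  also have "miso H \<dots> (S.gmod J.SC J.YC J.DC ?BS ?\<rho>S)"
  proof (rule miso_sym)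
    show "miso H (S.gmod J.SC J.YC J.DC ?BS ?\<rho>S) (S.gmod J.SA J.xA J.DA ?B ?\<rho>)"
      unfolding H_def \<tau>_def
      by (rule S.gmod_cong[where P = J.P and Q = Q, OF J.gdata_C J.gdata_A rS rB J.P_lin J.P_bij _ _ Q(1,2)])
        (simp_all add: J.P_var J.P_grading Q(3))
  qed
  also have "miso H \<dots> (direct_sum I (\<lambda>l. direct_sum {..<s} (\<lambda>m. direct_sum {1..min p t} (\<lambda>u.
      copies (N i j l) (Vt (?n u) ((\<sigma> ^^ m) l) ?\<gamma>)))))"
    unfolding H_def \<tau>_def J.SC_def J.YC_def J.DC_def J.nblk_def J.\<gamma>_def
    by (rule S.jordan_sum_miso[OF lc N r J[unfolded H_def \<tau>_def]])
  finally have main: "module_iso H (module_tensor H (ore_comult G \<tau> a) (Vt p i \<alpha>) (Vt t j \<beta>))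
      (direct_sum I (\<lambda>l. direct_sum {..<s} (\<lambda>m. direct_sum {1..min p t} (\<lambda>u.
      copies (N i j l) (Vt (?n u) ((\<sigma> ^^ m) l) ?\<gamma>)))))"
    by (rule miso_iso)
  have zero: "module_iso H (Vt n ((\<sigma> ^^ m) l) ?\<gamma>) (nil_module G \<tau> (s * n) (V ((\<sigma> ^^ m) l)))"
    if "l \<in> I" "?\<gamma> = 0" for l m n
  proof -
    have "Vt n ((\<sigma> ^^ m) l) ?\<gamma> = nil_module G \<tau> (s * n) (V ((\<sigma> ^^ m) l))"
      unfolding Vt_def \<tau>_def
      by (rule S.jordan_module_miso(2)[OF shift[OF that(1)] S.grep_twist[OF r[OF that(1)]] that(2)])
    \<comment> \<open>Reflexivity, by passing to coordinates and back.\<close>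
    moreover have "module_iso H (Vt n ((\<sigma> ^^ m) l) ?\<gamma>) (Vt n ((\<sigma> ^^ m) l) ?\<gamma>)"
      by (rule miso_iso[OF miso_trans[OF J miso_sym[OF J]]]) fact+
    ultimately show ?thesis by simp
  qed
  have nonzero: "module_iso H (Vt n ((\<sigma> ^^ m) l) ?\<gamma>) (Vt n l ?\<gamma>)" if l: "l \<in> I" and "?\<gamma> \<noteq> 0" for l m n
  proof -
    have "miso H (S.jordan n ?\<gamma> (B l) (S.twist m (\<rho> l))) (S.jordan n ?\<gamma> (B l) (\<rho> l))"
      unfolding H_def \<tau>_def by (rule S.jordan_twist_miso[OF r[OF l]]) fact
    moreover have "miso H (Vt n l ?\<gamma>) (S.jordan n ?\<gamma> (B l) (\<rho> l))"
      unfolding H_def Vt_def \<tau>_def by (rule S.jordan_module_miso(1)[OF V[OF l] r[OF l]])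
    ultimately show ?thesis using miso_iso[OF miso_trans[OF J[OF l] miso_trans[OF _ miso_sym]]] by blast
  qed
  show ?thesis unfolding I using main zero nonzero by blast
qed

end
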